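(* Let $A$ be an associative $R$-algebra, let $C$ be a maximal commutative subalgebra of $A$ which is smooth over $R$, and let $M$ be an arbitrary $R$-symmetric $A$-bimodule. Then $\mathrm{Gr}^CA$ is a nonlinear involutive distribution on the scheme $\mathrm{Spec}\,C$ over $R$, and $\mathrm{Gr}^CM$ is a graded sheaf with a flat connection along $\mathrm{Gr}^CA$. That is: $\mathrm{Gr}^CA$ embeds, by a homomorphism of graded Poisson algebras that is the identity on $\mathrm{Gr}^C_0A=C$, as a graded Poisson subalgebra of $\mathrm{Sym}_C\Theta^{C/R}$; and $\mathrm{Gr}^C_0M\otimes_C\mathrm{Sym}_C\Theta^{C/R}$ has a structure of a graded Poisson module over $\mathrm{Gr}^CA$ for which there is an embedding of $\mathrm{Gr}^CM$ as a graded Poisson submodule.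
   Context: Conventions. $R$ is a noetherian commutative ring with $\mathbb{Q}\subset R$; all rings are unital, all (bi)modules unitary; an $A$-bimodule is $R$-symmetric if the left and right $R$-actions agree. Graded Poisson algebras and modules. A graded Poisson algebra is a commutative graded $R$-algebra $B=\bigoplus_{p\in\mathbb{Z}}B_p$, $B_p=0$ for $p\ll0$, with an $R$-linear Lie bracket $\{-,-\}:B\otimes_R B\to B$, $\{B_{p_0},B_{p_1}\}\subset B_{p_0+p_1-1}$, satisfying $\{b_0,b_1b_2\}=\{b_0,b_1\}b_2+b_1\{b_0,b_2\}$. A graded Poisson module over $B$ is a graded $B$-module $N$ (viewed as a symmetric bimodule), $N_p=0$ for $p\ll0$, with a right module structure $\{-,-\}:N\otimes_R B\to N$ over the Lie algebra $(B,\{-,-\})$, $\{N_{p_0},B_{p_1}\}\subset N_{p_0+p_1-1}$, such that $\{nb_1,b_2\}=\{n,b_2\}b_1+n\{b_1,b_2\}$ and $\{n,b_1b_2\}=\{n,b_1\}b_2+b_1\{n,b_2\}$. The filtration $F^C$. For $c\in C$, $m\in M$ put $\mathrm{ad}_c(m)=cm-mc$, $F^C_pM=\{m\in M\mid\forall c\in C:\ \mathrm{ad}_c^{p+1}(m)=0\}$ for $p\ge0$, $F^C_pM=0$ for $p<0$, and similarly for $A$ (the case $M=A$). Put $\mathrm{Gr}^C_p=F^C_p/F^C_{p-1}$, $\mathrm{Gr}^C=\bigoplus_p\mathrm{Gr}^C_p$. Since $C$ is maximal commutative, $F^C_0A=C$. One has $F^C_{p_0}M\cdot F^C_{p_1}A,\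 F^C_{p_1}A\cdot F^C_{p_0}M\subset F^C_{p_0+p_1}M$ and $[F^C_{p_0}M,F^C_{p_1}A]\subset F^C_{p_0+p_1-1}M$ (also for $M=A$), so $\mathrm{Gr}^CA$ is a graded Poisson algebra and $\mathrm{Gr}^CM$ a graded Poisson module over it, with brackets $\{a_0+F^C_{p_0-1}A,\ a_1+F^C_{p_1-1}A\}=[a_0,a_1]+F^C_{p_0+p_1-2}A$ and $\{m+F^C_{p_0-1}M,\ a_1+F^C_{p_1-1}A\}=[m,a_1]+F^C_{p_0+p_1-2}M$. The graded Poisson algebra $\mathrm{Sym}_C\Theta^{C/R}$. For $C$ smooth commutative over $R$, $\Theta^{C/R}=\mathrm{Hom}_C(\Omega^1_{C/R},C)$. Identify $\mathrm{Sym}^p_C\Theta^{C/R}$ with $\mathrm{Hom}_C(\mathrm{Sym}^p_C\Omega^1_{C/R},C)$, i.e. with symmetric $R$-multilinear $C$-valued $p$-forms on $C$ that are derivations in each argument. For $f_i$ of degree $p_i$, $i=0,1$: $$(f_0f_1)(c_1,\dots,c_{p_0+p_1})=\tfrac{1}{(p_0+p_1)!}\sum_{\sigma\in\mathfrak S_{p_0+p_1}}f_0(c_{\sigma(1)},\dots,c_{\sigma(p_0)})\,f_1(c_{\sigma(p_0+1)},\dots,c_{\sigma(p_0+p_1)}),$$ $$\{f_0,f_1\}(c_1,\dots,c_{p_0+p_1-1})=\tfrac{1}{(p_0+p_1-1)!}\sum_{\sigma\in\mathfrak S_{p_0+p_1-1}}\Big(p_0f_0\big(c_{\sigma(1)},\dots,c_{\sigma(p_0-1)},f_1(c_{\sigma(p_0)},\dots,c_{\sigma(p_0+p_1-1)})\big)-p_1f_1\big(c_{\sigma(1)},\dots,c_{\sigma(p_1-1)},f_0(c_{\sigma(p_1)},\dots,c_{\sigma(p_0+p_1-1)})\big)\Big).$$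 Definitions. A nonlinear involutive distribution on $\mathrm{Spec}\,C$ over $R$ is a graded Poisson subalgebra $B$ of $\mathrm{Sym}_C\Theta^{C/R}$ with $B_0=C$. A graded sheaf with a flat connection along $B$ is a graded Poisson module $N$ over $B$ together with a structure of a graded Poisson module over $B$ on $N_0\otimes_C\mathrm{Sym}_C\Theta^{C/R}$ (graded by the degree in $\mathrm{Sym}$, with underlying $B$-module structure the canonical one coming from $B\subset\mathrm{Sym}_C\Theta^{C/R}$) and an embedding of $N$ as a graded Poisson submodule of $N_0\otimes_C\mathrm{Sym}_C\Theta^{C/R}$. *)

theory Defs
  imports
    "HOL-Algebra.Algebra"
    "HOL-Combinatorics.Combinatorics"
begin

section \<open>Algebras, bimodules, smoothness\<close>

definition rat_ring :: "rat ring" where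
  "rat_ring = \<lparr>carrier = UNIV, monoid.mult = (*), one = 1, ring.zero = 0, add = (+)\<rparr>"

definition contains_rationals :: "'r ring \<Rightarrow> bool" where
  "contains_rationals R \<longleftrightarrow> (\<exists>h \<in> ring_hom rat_ring R. inj_on h (carrier rat_ring))"

text \<open>The locale \<^locale>\<open>algebra\<close> of the library is for commutative algebras only.\<close>

locale assoc_algebra = module R A + ring A for R and A (structure) +
  assumes smult_mult_left:
      "\<lbrakk>r \<in> carrier R; x \<in> carrier A; y \<in> carrier A\<rbrakk> \<Longrightarrow> (r \<odot> x) \<otimes> y = r \<odot> (x \<otimes> y)"
    and smult_mult_right:
      "\<lbrakk>r \<in> carrier R; x \<in> carrier A; y \<in> carrier A\<rbrakk> \<Longrightarrow> x \<otimes> (r \<odot> y) = r \<odot> (x \<otimes> y)"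

definition commutative_subalgebra :: "'r ring \<Rightarrow> ('r, 'a) module \<Rightarrow> 'a set \<Rightarrow> bool" where
  "commutative_subalgebra R A C \<longleftrightarrow>
     subcring C A \<and> (\<forall>r \<in> carrier R. \<forall>c \<in> C. r \<odot>\<^bsub>A\<^esub> c \<in> C)"

definition maximal_commutative_subalgebra :: "'r ring \<Rightarrow> ('r, 'a) module \<Rightarrow> 'a set \<Rightarrow> bool" where
  "maximal_commutative_subalgebra R A C \<longleftrightarrow>
     commutative_subalgebra R A C \<and> (\<forall>D. commutative_subalgebra R A D \<and> C \<subseteq> D \<longrightarrow> D = C)"

text \<open>As for \<^typ>\<open>('a, 'm) module\<close>, the multiplicative fields of the underlying ring record
  carry no meaning.\<close>

record ('a, 'm) bimodule = "('a, 'm) module" +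
  rsmult :: "'m \<Rightarrow> 'a \<Rightarrow> 'm"  (infixl \<open>\<odot>r\<index>\<close> 70)

locale bimodule = ring A + M?: abelian_group M
  for A :: "('r, 'a) module" and M :: "('a, 'm) bimodule" (structure) +
  assumes left_closed: "\<lbrakk>a \<in> carrier A; m \<in> carrier M\<rbrakk> \<Longrightarrow> a \<odot> m \<in> carrier M"
    and left_add: "\<lbrakk>a \<in> carrier A; b \<in> carrier A; m \<in> carrier M\<rbrakk>
          \<Longrightarrow> (a \<oplus>\<^bsub>A\<^esub> b) \<odot> m = a \<odot> m \<oplus> b \<odot> m"
    and left_distr: "\<lbrakk>a \<in> carrier A; m \<in> carrier M; n \<in> carrier M\<rbrakk>
          \<Longrightarrow> a \<odot> (m \<oplus> n) = a \<odot> m \<oplus> a \<odot> n"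
    and left_assoc: "\<lbrakk>a \<in> carrier A; b \<in> carrier A; m \<in> carrier M\<rbrakk>
          \<Longrightarrow> (a \<otimes>\<^bsub>A\<^esub> b) \<odot> m = a \<odot> (b \<odot> m)"
    and left_one: "m \<in> carrier M \<Longrightarrow> \<one>\<^bsub>A\<^esub> \<odot> m = m"
    and right_closed: "\<lbrakk>a \<in> carrier A; m \<in> carrier M\<rbrakk> \<Longrightarrow> m \<odot>r a \<in> carrier M"
    and right_add: "\<lbrakk>a \<in> carrier A; b \<in> carrier A; m \<in> carrier M\<rbrakk>
          \<Longrightarrow> m \<odot>r (a \<oplus>\<^bsub>A\<^esub> b) = m \<odot>r a \<oplus> m \<odot>r b"
    and right_distr: "\<lbrakk>a \<in> carrier A; m \<in> carrier M; n \<in> carrier M\<rbrakk>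
          \<Longrightarrow> (m \<oplus> n) \<odot>r a = m \<odot>r a \<oplus> n \<odot>r a"
    and right_assoc: "\<lbrakk>a \<in> carrier A; b \<in> carrier A; m \<in> carrier M\<rbrakk>
          \<Longrightarrow> m \<odot>r (a \<otimes>\<^bsub>A\<^esub> b) = (m \<odot>r a) \<odot>r b"
    and right_one: "m \<in> carrier M \<Longrightarrow> m \<odot>r \<one>\<^bsub>A\<^esub> = m"
    and left_right: "\<lbrakk>a \<in> carrier A; b \<in> carrier A; m \<in> carrier M\<rbrakk>
          \<Longrightarrow> (a \<odot> m) \<odot>r b = a \<odot> (m \<odot>r b)"

definition symmetric_over :: "'r ring \<Rightarrow> ('r, 'a) module \<Rightarrow> ('a, 'm) bimodule \<Rightarrow> bool" where
  "symmetric_over R A M \<longleftrightarrow>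
     (\<forall>r \<in> carrier R. \<forall>m \<in> carrier M. (r \<odot>\<^bsub>A\<^esub> \<one>\<^bsub>A\<^esub>) \<odot>\<^bsub>M\<^esub> m = m \<odot>r\<^bsub>M\<^esub> (r \<odot>\<^bsub>A\<^esub> \<one>\<^bsub>A\<^esub>))"

definition self_bimodule :: "('r, 'a) module \<Rightarrow> ('a, 'a) bimodule" where
  "self_bimodule A = \<lparr>carrier = carrier A, monoid.mult = monoid.mult A, one = one A,
     ring.zero = ring.zero A, add = add A, smult = monoid.mult A, rsmult = monoid.mult A\<rparr>"

definition finite_type :: "'r ring \<Rightarrow> ('r, 'c) module \<Rightarrow> bool" where
  "finite_type R S \<longleftrightarrow>
     (\<exists>U. finite U \<and> U \<subseteq> carrier S \<and>
        (\<forall>D. commutative_subalgebra R S D \<and> U \<subseteq> D \<longrightarrow> D = carrier S))"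

text \<open>Infinitesimal lifting: every homomorphism of \<open>R\<close>-algebras from \<open>S\<close> to \<open>E / I\<close> with
  \<open>I\<^sup>2 = 0\<close> lifts to \<open>E\<close>. The test algebras \<open>E\<close> have carriers in a given type.\<close>

definition formally_smooth :: "'t itself \<Rightarrow> 'r ring \<Rightarrow> ('r, 'c) module \<Rightarrow> bool" where
  "formally_smooth _ R S \<longleftrightarrow>
     (\<forall>(E :: ('r, 't) module) I g.
        algebra R E \<and> ideal I E \<and> (\<forall>x \<in> I. \<forall>y \<in> I. x \<otimes>\<^bsub>E\<^esub> y = \<zero>\<^bsub>E\<^esub>) \<and>
        g \<in> ring_hom S (E Quot I) \<and>
        (\<forall>r \<in> carrier R. g (r \<odot>\<^bsub>S\<^esub> \<one>\<^bsub>S\<^esub>) = I +>\<^bsub>E\<^esub> (r \<odot>\<^bsub>E\<^esub> \<one>\<^bsub>E\<^esub>)) \<longrightarrow>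
        (\<exists>h \<in> ring_hom S E.
           (\<forall>r \<in> carrier R. h (r \<odot>\<^bsub>S\<^esub> \<one>\<^bsub>S\<^esub>) = r \<odot>\<^bsub>E\<^esub> \<one>\<^bsub>E\<^esub>) \<and>
           (\<forall>c \<in> carrier S. I +>\<^bsub>E\<^esub> h c = g c)))"

text \<open>Smoothness over a noetherian base, where finite type and finite presentation agree.
  The type of test algebras accommodates \<open>P / J\<^sup>2\<close> for every presentation
  \<open>S = P / J\<close>, \<open>P = R[x\<^sub>1, \<dots>, x\<^sub>n]\<close> (elements of \<open>P\<close> being functions from monomials to
  coefficients). A lifting of the identity of \<open>S\<close> to \<open>P / J\<^sup>2\<close> yields liftings for test
  algebras of every other type, so nothing is lost by fixing the type.\<close>

definition smooth_algebra :: "'r ring \<Rightarrow> ('r, 'c) module \<Rightarrow> bool" where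
  "smooth_algebra R S \<longleftrightarrow>
     algebra R S \<and> finite_type R S \<and> formally_smooth TYPE((nat multiset \<Rightarrow> 'r) set) R S"

section \<open>Restriction of scalars and tensor products\<close>

definition with_smult :: "('k \<Rightarrow> 'v \<Rightarrow> 'v) \<Rightarrow> ('l, 'v, 'z) module_scheme \<Rightarrow> ('k, 'v) module" where
  "with_smult f V = \<lparr>carrier = carrier V, monoid.mult = monoid.mult V, one = one V,
     ring.zero = ring.zero V, add = add V, smult = f\<rparr>"

text \<open>An \<open>S\<close>-module regarded as a module over \<open>R\<close>, for an \<open>R\<close>-algebra \<open>S\<close>.\<close>

definition restrict_scalars ::
    "('r, 's) module \<Rightarrow> ('s, 'v, 'z) module_scheme \<Rightarrow> ('r, 'v) module" where
  "restrict_scalars S V = with_smult (\<lambda>r v. (r \<odot>\<^bsub>S\<^esub> \<one>\<^bsub>S\<^esub>) \<odot>\<^bsub>V\<^esub> v) V"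

text \<open>The tensor product over a commutative ring: the free abelian group on pairs modulo the
  subgroup generated by the bilinearity relations.\<close>

definition tensor_relations ::
    "'k set \<Rightarrow> ('k, 'n) module \<Rightarrow> ('k, 'v) module \<Rightarrow> ('n \<times> 'v \<Rightarrow>\<^sub>0 int) set" where
  "tensor_relations K N V = generate (free_Abelian_group (carrier N \<times> carrier V))
     ({frag_of (x \<oplus>\<^bsub>N\<^esub> y, v) - frag_of (x, v) - frag_of (y, v) | x y v.
         x \<in> carrier N \<and> y \<in> carrier N \<and> v \<in> carrier V} \<union>
      {frag_of (x, v \<oplus>\<^bsub>V\<^esub> w) - frag_of (x, v) - frag_of (x, w) | x v w.
         x \<in> carrier N \<and> v \<in> carrier V \<and> w \<in> carrier V} \<union>
      {frag_of (k \<odot>\<^bsub>N\<^esub> x, v) - frag_of (x, k \<odot>\<^bsub>V\<^esub> v) | k x v.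
         k \<in> K \<and> x \<in> carrier N \<and> v \<in> carrier V})"

definition tensor_coset ::
    "'k set \<Rightarrow> ('k, 'n) module \<Rightarrow> ('k, 'v) module \<Rightarrow>
     ('n \<times> 'v \<Rightarrow>\<^sub>0 int) \<Rightarrow> ('n \<times> 'v \<Rightarrow>\<^sub>0 int) set" where
  "tensor_coset K N V t =
     tensor_relations K N V #>\<^bsub>free_Abelian_group (carrier N \<times> carrier V)\<^esub> t"

definition tensor_product ::
    "'k set \<Rightarrow> ('k, 'n) module \<Rightarrow> ('k, 'v) module \<Rightarrow> ('k, ('n \<times> 'v \<Rightarrow>\<^sub>0 int) set) module" where
  "tensor_product K N V =
     (let Q = free_Abelian_group (carrier N \<times> carrier V) Mod tensor_relations K N V in
      \<lparr>carrier = carrier Q, monoid.mult = undefined, one = undefined,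
       ring.zero = \<one>\<^bsub>Q\<^esub>, add = monoid.mult Q,
       smult = (\<lambda>k U. \<Union>t \<in> U.
         tensor_coset K N V (frag_extend (\<lambda>(x, v). frag_of (k \<odot>\<^bsub>N\<^esub> x, v)) t))\<rparr>)"

definition pure_tensor ::
    "'k set \<Rightarrow> ('k, 'n) module \<Rightarrow> ('k, 'v) module \<Rightarrow> 'n \<Rightarrow> 'v \<Rightarrow> ('n \<times> 'v \<Rightarrow>\<^sub>0 int) set" where
  "pure_tensor K N V x v = tensor_coset K N V (frag_of (x, v))"

section \<open>Graded Poisson algebras and modules\<close>

text \<open>A graded object \<open>B = \<Oplus>\<^sub>p B\<^sub>p\<close> is given by its family of homogeneous components, all of them
  \<open>R\<close>-modules, and by its operations on homogeneous elements; the integer arguments of an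
  operation are the degrees of the elements it is applied to.\<close>

record ('r, 'b) graded_poisson =
  component :: "int \<Rightarrow> ('r, 'b) module"
  gmult :: "int \<Rightarrow> int \<Rightarrow> 'b \<Rightarrow> 'b \<Rightarrow> 'b"
  gone :: 'b
  gbracket :: "int \<Rightarrow> int \<Rightarrow> 'b \<Rightarrow> 'b \<Rightarrow> 'b"

abbreviation homog :: "('r, 'b) graded_poisson \<Rightarrow> int \<Rightarrow> 'b set" where
  "homog B p \<equiv> carrier (component B p)"

record ('r, 'b, 'n) graded_poisson_mod =
  mcomponent :: "int \<Rightarrow> ('r, 'n) module"
  mact :: "int \<Rightarrow> int \<Rightarrow> 'n \<Rightarrow> 'b \<Rightarrow> 'n"
  mbracket :: "int \<Rightarrow> int \<Rightarrow> 'n \<Rightarrow> 'b \<Rightarrow> 'n"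

abbreviation mhomog :: "('r, 'b, 'n) graded_poisson_mod \<Rightarrow> int \<Rightarrow> 'n set" where
  "mhomog N p \<equiv> carrier (mcomponent N p)"

definition bilinear_map ::
    "'r ring \<Rightarrow> ('r, 'u) module \<Rightarrow> ('r, 'v) module \<Rightarrow> ('r, 'w) module \<Rightarrow>
     ('u \<Rightarrow> 'v \<Rightarrow> 'w) \<Rightarrow> bool" where
  "bilinear_map R U V W f \<longleftrightarrow>
     (\<forall>x \<in> carrier U. \<forall>y \<in> carrier V. f x y \<in> carrier W) \<and>
     (\<forall>x \<in> carrier U. \<forall>x' \<in> carrier U. \<forall>y \<in> carrier V.
        f (x \<oplus>\<^bsub>U\<^esub> x') y = f x y \<oplus>\<^bsub>W\<^esub> f x' y) \<and>
     (\<forall>x \<in> carrier U. \<forall>y \<in> carrier V. \<forall>y' \<in> carrier V.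
        f x (y \<oplus>\<^bsub>V\<^esub> y') = f x y \<oplus>\<^bsub>W\<^esub> f x y') \<and>
     (\<forall>r \<in> carrier R. \<forall>x \<in> carrier U. \<forall>y \<in> carrier V.
        f (r \<odot>\<^bsub>U\<^esub> x) y = r \<odot>\<^bsub>W\<^esub> f x y \<and> f x (r \<odot>\<^bsub>V\<^esub> y) = r \<odot>\<^bsub>W\<^esub> f x y)"

locale graded_poisson_algebra =
  fixes R :: "'r ring" and B :: "('r, 'b) graded_poisson"
  assumes component_module: "module R (component B p)"
    and bounded_below: "\<exists>p0. \<forall>p < p0. homog B p = {\<zero>\<^bsub>component B p\<^esub>}"
    and gmult_bilinear:
      "bilinear_map R (component B p) (component B q) (component B (p + q)) (gmult B p q)"
    and gmult_comm: "\<lbrakk>x \<in> homog B p; y \<in> homog B q\<rbrakk> \<Longrightarrow> gmult B p q x y = gmult B q p y x"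
    and gmult_assoc: "\<lbrakk>x \<in> homog B p; y \<in> homog B q; z \<in> homog B s\<rbrakk>
      \<Longrightarrow> gmult B (p + q) s (gmult B p q x y) z = gmult B p (q + s) x (gmult B q s y z)"
    and gone_closed: "gone B \<in> homog B 0"
    and gmult_one: "x \<in> homog B p \<Longrightarrow> gmult B 0 p (gone B) x = x"
    and gbracket_bilinear:
      "bilinear_map R (component B p) (component B q) (component B (p + q - 1)) (gbracket B p q)"
    and gbracket_self: "x \<in> homog B p \<Longrightarrow> gbracket B p p x x = \<zero>\<^bsub>component B (p + p - 1)\<^esub>"
    and gbracket_antisym: "\<lbrakk>x \<in> homog B p; y \<in> homog B q\<rbrakk>
      \<Longrightarrow> gbracket B p q x y = \<ominus>\<^bsub>component B (p + q - 1)\<^esub> gbracket B q p y x"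
    and jacobi: "\<lbrakk>x \<in> homog B p; y \<in> homog B q; z \<in> homog B s\<rbrakk>
      \<Longrightarrow> gbracket B p (q + s - 1) x (gbracket B q s y z)
            \<oplus>\<^bsub>component B (p + q + s - 2)\<^esub> gbracket B q (s + p - 1) y (gbracket B s p z x)
            \<oplus>\<^bsub>component B (p + q + s - 2)\<^esub> gbracket B s (p + q - 1) z (gbracket B p q x y)
          = \<zero>\<^bsub>component B (p + q + s - 2)\<^esub>"
    and leibniz: "\<lbrakk>x \<in> homog B p; y \<in> homog B q; z \<in> homog B s\<rbrakk>
      \<Longrightarrow> gbracket B p (q + s) x (gmult B q s y z)
          = gmult B (p + q - 1) s (gbracket B p q x y) z
            \<oplus>\<^bsub>component B (p + q + s - 1)\<^esub> gmult B q (p + s - 1) y (gbracket B p s x z)"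

text \<open>Modules are symmetric bimodules, so that only one action is recorded.\<close>

locale graded_poisson_module = graded_poisson_algebra R B
  for R :: "'r ring" and B :: "('r, 'b) graded_poisson" +
  fixes N :: "('r, 'b, 'n) graded_poisson_mod"
  assumes mcomponent_module: "module R (mcomponent N p)"
    and m_bounded_below: "\<exists>p0. \<forall>p < p0. mhomog N p = {\<zero>\<^bsub>mcomponent N p\<^esub>}"
    and mact_bilinear:
      "bilinear_map R (mcomponent N p) (component B q) (mcomponent N (p + q)) (mact N p q)"
    and mact_assoc: "\<lbrakk>n \<in> mhomog N p; x \<in> homog B q; y \<in> homog B s\<rbrakk>
      \<Longrightarrow> mact N (p + q) s (mact N p q n x) y = mact N p (q + s) n (gmult B q s x y)"
    and mact_one: "n \<in> mhomog N p \<Longrightarrow> mact N p 0 n (gone B) = n"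
    and mbracket_bilinear:
      "bilinear_map R (mcomponent N p) (component B q) (mcomponent N (p + q - 1)) (mbracket N p q)"
    and mbracket_lie: "\<lbrakk>n \<in> mhomog N p; x \<in> homog B q; y \<in> homog B s\<rbrakk>
      \<Longrightarrow> mbracket N p (q + s - 1) n (gbracket B q s x y)
          = mbracket N (p + q - 1) s (mbracket N p q n x) y
            \<ominus>\<^bsub>mcomponent N (p + q + s - 2)\<^esub> mbracket N (p + s - 1) q (mbracket N p s n y) x"
    and mbracket_act: "\<lbrakk>n \<in> mhomog N p; x \<in> homog B q; y \<in> homog B s\<rbrakk>
      \<Longrightarrow> mbracket N (p + q) s (mact N p q n x) y
          = mact N (p + s - 1) q (mbracket N p s n y) x
            \<oplus>\<^bsub>mcomponent N (p + q + s - 1)\<^esub> mact N p (q + s - 1) n (gbracket B q s x y)"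
    and mbracket_mult: "\<lbrakk>n \<in> mhomog N p; x \<in> homog B q; y \<in> homog B s\<rbrakk>
      \<Longrightarrow> mbracket N p (q + s) n (gmult B q s x y)
          = mact N (p + q - 1) s (mbracket N p q n x) y
            \<oplus>\<^bsub>mcomponent N (p + q + s - 1)\<^esub> mact N (p + s - 1) q (mbracket N p s n y) x"

definition linear_injection ::
    "'r ring \<Rightarrow> ('r, 'u) module \<Rightarrow> ('r, 'v) module \<Rightarrow> ('u \<Rightarrow> 'v) \<Rightarrow> bool" where
  "linear_injection R U V f \<longleftrightarrow>
     f \<in> carrier U \<rightarrow> carrier V \<and> inj_on f (carrier U) \<and>
     (\<forall>x \<in> carrier U. \<forall>y \<in> carrier U. f (x \<oplus>\<^bsub>U\<^esub> y) = f x \<oplus>\<^bsub>V\<^esub> f y) \<and>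
     (\<forall>r \<in> carrier R. \<forall>x \<in> carrier U. f (r \<odot>\<^bsub>U\<^esub> x) = r \<odot>\<^bsub>V\<^esub> f x)"

definition graded_poisson_embedding ::
    "'r ring \<Rightarrow> ('r, 'b) graded_poisson \<Rightarrow> ('r, 'c) graded_poisson \<Rightarrow> (int \<Rightarrow> 'b \<Rightarrow> 'c) \<Rightarrow> bool" where
  "graded_poisson_embedding R B D f \<longleftrightarrow>
     graded_poisson_algebra R B \<and> graded_poisson_algebra R D \<and>
     (\<forall>p. linear_injection R (component B p) (component D p) (f p)) \<and>
     f 0 (gone B) = gone D \<and>
     (\<forall>p q. \<forall>x \<in> homog B p. \<forall>y \<in> homog B q.
        f (p + q) (gmult B p q x y) = gmult D p q (f p x) (f q y) \<and>
        f (p + q - 1) (gbracket B p q x y) = gbracket D p q (f p x) (f q y))"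

definition graded_poisson_module_embedding ::
    "'r ring \<Rightarrow> ('r, 'b) graded_poisson \<Rightarrow> ('r, 'b, 'n) graded_poisson_mod \<Rightarrow>
     ('r, 'b, 'l) graded_poisson_mod \<Rightarrow> (int \<Rightarrow> 'n \<Rightarrow> 'l) \<Rightarrow> bool" where
  "graded_poisson_module_embedding R B N L f \<longleftrightarrow>
     graded_poisson_module R B N \<and> graded_poisson_module R B L \<and>
     (\<forall>p. linear_injection R (mcomponent N p) (mcomponent L p) (f p)) \<and>
     (\<forall>p q. \<forall>n \<in> mhomog N p. \<forall>x \<in> homog B q.
        f (p + q) (mact N p q n x) = mact L p q (f p n) x \<and>
        f (p + q - 1) (mbracket N p q n x) = mbracket L p q (f p n) x)"

definition graded_poisson_subalgebra ::
    "'r ring \<Rightarrow> ('r, 'b) graded_poisson \<Rightarrow> (int \<Rightarrow> 'b set) \<Rightarrow> bool" where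
  "graded_poisson_subalgebra R D H \<longleftrightarrow>
     graded_poisson_algebra R D \<and>
     (\<forall>p. submodule (H p) R (component D p)) \<and> gone D \<in> H 0 \<and>
     (\<forall>p q. \<forall>x \<in> H p. \<forall>y \<in> H q. gmult D p q x y \<in> H (p + q) \<and> gbracket D p q x y \<in> H (p + q - 1))"

section \<open>The symmetric algebra of the module of derivations\<close>

text \<open>For a smooth commutative \<open>R\<close>-algebra \<open>S\<close>, the degree \<open>p\<close> part of the symmetric algebra of
  \<open>\<Theta>\<close> is the module of symmetric \<open>R\<close>-multilinear \<open>S\<close>-valued forms in \<open>p\<close> arguments
  that are derivations in each argument. The arguments form a list of length \<open>p\<close>.
  In negative degree \<open>args S p\<close> is empty and the module is zero.\<close>

definition args :: "('r, 'c) module \<Rightarrow> int \<Rightarrow> 'c list set" where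
  "args S p = {xs. int (length xs) = p \<and> set xs \<subseteq> carrier S}"

definition symmetric_multiderivations :: "'r ring \<Rightarrow> ('r, 'c) module \<Rightarrow> int \<Rightarrow> ('c list \<Rightarrow> 'c) set" where
  "symmetric_multiderivations R S p =
     {f \<in> args S p \<rightarrow>\<^sub>E carrier S.
        (\<forall>xs \<in> args S p. \<forall>ys \<in> args S p. mset xs = mset ys \<longrightarrow> f xs = f ys) \<and>
        (\<forall>xs ys. \<forall>x \<in> carrier S. \<forall>y \<in> carrier S. xs @ x # ys \<in> args S p \<longrightarrow>
           f (xs @ (x \<oplus>\<^bsub>S\<^esub> y) # ys) = f (xs @ x # ys) \<oplus>\<^bsub>S\<^esub> f (xs @ y # ys) \<and>
           (\<forall>r \<in> carrier R. f (xs @ (r \<odot>\<^bsub>S\<^esub> x) # ys) = r \<odot>\<^bsub>S\<^esub> f (xs @ x # ys)) \<and>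
           f (xs @ (x \<otimes>\<^bsub>S\<^esub> y) # ys) = x \<otimes>\<^bsub>S\<^esub> f (xs @ y # ys) \<oplus>\<^bsub>S\<^esub> y \<otimes>\<^bsub>S\<^esub> f (xs @ x # ys))}"

definition sym_component :: "'r ring \<Rightarrow> ('r, 'c) module \<Rightarrow> int \<Rightarrow> ('c, 'c list \<Rightarrow> 'c) module" where
  "sym_component R S p =
     \<lparr>carrier = symmetric_multiderivations R S p,
      monoid.mult = undefined, one = undefined,
      ring.zero = (\<lambda>xs \<in> args S p. \<zero>\<^bsub>S\<^esub>),
      add = (\<lambda>f g. \<lambda>xs \<in> args S p. f xs \<oplus>\<^bsub>S\<^esub> g xs),
      smult = (\<lambda>c f. \<lambda>xs \<in> args S p. c \<otimes>\<^bsub>S\<^esub> f xs)\<rparr>"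

definition sym_const :: "('r, 'c) module \<Rightarrow> 'c \<Rightarrow> 'c list \<Rightarrow> 'c" where
  "sym_const S c = (\<lambda>xs \<in> args S 0. c)"

definition symmetrize :: "('r, 'c) module \<Rightarrow> ('c list \<Rightarrow> 'c) \<Rightarrow> 'c list \<Rightarrow> 'c" where
  "symmetrize S f xs =
     inv\<^bsub>S\<^esub> (add_pow S (fact (length xs) :: nat) \<one>\<^bsub>S\<^esub>) \<otimes>\<^bsub>S\<^esub>
     (\<Oplus>\<^bsub>S\<^esub>\<sigma> \<in> {\<sigma>. \<sigma> permutes {..<length xs}}. f (permute_list \<sigma> xs))"

definition sym_mult ::
    "('r, 'c) module \<Rightarrow> int \<Rightarrow> int \<Rightarrow> ('c list \<Rightarrow> 'c) \<Rightarrow> ('c list \<Rightarrow> 'c) \<Rightarrow> 'c list \<Rightarrow> 'c" where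
  "sym_mult S p q f g =
     (\<lambda>xs \<in> args S (p + q).
        if p < 0 \<or> q < 0 then \<zero>\<^bsub>S\<^esub>
        else symmetrize S (\<lambda>ys. f (take (nat p) ys) \<otimes>\<^bsub>S\<^esub> g (drop (nat p) ys)) xs)"

text \<open>When \<open>p = 0\<close> the first summand, and when \<open>q = 0\<close> the second summand, is
  \<open>0\<close> times a meaningless element.\<close>

definition sym_bracket ::
    "('r, 'c) module \<Rightarrow> int \<Rightarrow> int \<Rightarrow> ('c list \<Rightarrow> 'c) \<Rightarrow> ('c list \<Rightarrow> 'c) \<Rightarrow> 'c list \<Rightarrow> 'c" where
  "sym_bracket S p q f g =
     (\<lambda>xs \<in> args S (p + q - 1).
        if p < 0 \<or> q < 0 then \<zero>\<^bsub>S\<^esub>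
        else symmetrize S (\<lambda>ys.
          add_pow S (nat p) (f (take (nat p - 1) ys @ [g (drop (nat p - 1) ys)])) \<ominus>\<^bsub>S\<^esub>
          add_pow S (nat q) (g (take (nat q - 1) ys @ [f (drop (nat q - 1) ys)]))) xs)"

definition sym_theta :: "'r ring \<Rightarrow> ('r, 'c) module \<Rightarrow> ('r, 'c list \<Rightarrow> 'c) graded_poisson" where
  "sym_theta R S =
     \<lparr>component = (\<lambda>p. restrict_scalars S (sym_component R S p)),
      gmult = sym_mult S, gone = sym_const S \<one>\<^bsub>S\<^esub>, gbracket = sym_bracket S\<rparr>"

section \<open>Involutive distributions and flat connections\<close>

definition nonlinear_involutive_distribution ::
    "'r ring \<Rightarrow> ('r, 'c) module \<Rightarrow> (int \<Rightarrow> ('c list \<Rightarrow> 'c) set) \<Rightarrow> bool" where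
  "nonlinear_involutive_distribution R S H \<longleftrightarrow>
     graded_poisson_subalgebra R (sym_theta R S) H \<and> H 0 = sym_const S ` carrier S"

text \<open>Below \<open>B\<close> is regarded as a subalgebra of the symmetric algebra through an embedding \<open>\<iota>\<close>
  with \<open>\<iota>(B\<^sub>0) = S\<close>. Then \<open>N\<^sub>0\<close> is an \<open>S\<close>-module because \<open>S\<close> is \<open>B\<^sub>0\<close>.\<close>

definition degree_zero_module ::
    "('r, 'c) module \<Rightarrow> ('r, 'b) graded_poisson \<Rightarrow> (int \<Rightarrow> 'b \<Rightarrow> 'c list \<Rightarrow> 'c) \<Rightarrow>
     ('r, 'b, 'n) graded_poisson_mod \<Rightarrow> ('c, 'n) module" where
  "degree_zero_module S B \<iota> N =
     with_smult (\<lambda>c n. mact N 0 0 n (the_inv_into (homog B 0) (\<iota> 0) (sym_const S c))) (mcomponent N 0)"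

text \<open>The module structure on \<open>L = N\<^sub>0 \<otimes> Sym \<Theta>\<close> is determined by its values
  \<open>(n \<otimes> f) b = n \<otimes> (f \<iota>(b))\<close> on pure tensors; its bracket is part of the data.\<close>

definition sheaf_with_flat_connection ::
    "'r ring \<Rightarrow> ('r, 'c) module \<Rightarrow> ('r, 'b) graded_poisson \<Rightarrow> (int \<Rightarrow> 'b \<Rightarrow> 'c list \<Rightarrow> 'c) \<Rightarrow>
     ('r, 'b, 'n) graded_poisson_mod \<Rightarrow>
     ('r, 'b, ('n \<times> ('c list \<Rightarrow> 'c) \<Rightarrow>\<^sub>0 int) set) graded_poisson_mod \<Rightarrow>
     (int \<Rightarrow> 'n \<Rightarrow> ('n \<times> ('c list \<Rightarrow> 'c) \<Rightarrow>\<^sub>0 int) set) \<Rightarrow> bool" where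
  "sheaf_with_flat_connection R S B \<iota> N L j \<longleftrightarrow>
     (let N0 = degree_zero_module S B \<iota> N in
      graded_poisson_module R B N \<and>
      graded_poisson_module R B L \<and>
      (\<forall>p. mcomponent L p =
         restrict_scalars S (tensor_product (carrier S) N0 (sym_component R S p))) \<and>
      (\<forall>p q. \<forall>n \<in> mhomog N 0. \<forall>f \<in> homog (sym_theta R S) p. \<forall>b \<in> homog B q.
         mact L p q (pure_tensor (carrier S) N0 (sym_component R S p) n f) b =
         pure_tensor (carrier S) N0 (sym_component R S (p + q)) n (sym_mult S p q f (\<iota> q b))) \<and>
      graded_poisson_module_embedding R B N L j)"

section \<open>The filtration by iterated commutators\<close>

definition ad :: "('a, 'm) bimodule \<Rightarrow> 'a \<Rightarrow> 'm \<Rightarrow> 'm" where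
  "ad M c m = c \<odot>\<^bsub>M\<^esub> m \<ominus>\<^bsub>M\<^esub> m \<odot>r\<^bsub>M\<^esub> c"

definition filtration :: "'a set \<Rightarrow> ('a, 'm) bimodule \<Rightarrow> int \<Rightarrow> 'm set" where
  "filtration C M p =
     (if p < 0 then {\<zero>\<^bsub>M\<^esub>}
      else {m \<in> carrier M. \<forall>c \<in> C. (ad M c ^^ (nat p + 1)) m = \<zero>\<^bsub>M\<^esub>})"

definition gr_class :: "'a set \<Rightarrow> ('a, 'm) bimodule \<Rightarrow> int \<Rightarrow> 'm \<Rightarrow> 'm set" where
  "gr_class C M p m = filtration C M (p - 1) +>\<^bsub>M\<^esub> m"

text \<open>Scalars of \<^term>\<open>gr_component C M p\<close> are the elements of \<open>C\<close>. The unions below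
  are over representatives; each of them is a single coset.\<close>

definition gr_component :: "'a set \<Rightarrow> ('a, 'm) bimodule \<Rightarrow> int \<Rightarrow> ('a, 'm set) module" where
  "gr_component C M p =
     \<lparr>carrier = gr_class C M p ` filtration C M p,
      monoid.mult = undefined, one = undefined,
      ring.zero = filtration C M (p - 1), add = set_add M,
      smult = (\<lambda>c U. \<Union>m \<in> U. gr_class C M p (c \<odot>\<^bsub>M\<^esub> m))\<rparr>"

definition gr_algebra :: "('r, 'a) module \<Rightarrow> 'a set \<Rightarrow> ('r, 'a set) graded_poisson" where
  "gr_algebra A C =
     \<lparr>component = (\<lambda>p. restrict_scalars A (gr_component C (self_bimodule A) p)),
      gmult = (\<lambda>p q U V. \<Union>x \<in> U. \<Union>y \<in> V. gr_class C (self_bimodule A) (p + q) (x \<otimes>\<^bsub>A\<^esub> y)),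
      gone = gr_class C (self_bimodule A) 0 \<one>\<^bsub>A\<^esub>,
      gbracket = (\<lambda>p q U V. \<Union>x \<in> U. \<Union>y \<in> V.
        gr_class C (self_bimodule A) (p + q - 1) (x \<otimes>\<^bsub>A\<^esub> y \<ominus>\<^bsub>A\<^esub> y \<otimes>\<^bsub>A\<^esub> x))\<rparr>"

definition gr_module ::
    "('r, 'a) module \<Rightarrow> 'a set \<Rightarrow> ('a, 'm) bimodule \<Rightarrow> ('r, 'a set, 'm set) graded_poisson_mod" where
  "gr_module A C M =
     \<lparr>mcomponent = (\<lambda>p. restrict_scalars A (gr_component C M p)),
      mact = (\<lambda>p q U V. \<Union>m \<in> U. \<Union>a \<in> V. gr_class C M (p + q) (m \<odot>r\<^bsub>M\<^esub> a)),
      mbracket = (\<lambda>p q U V. \<Union>m \<in> U. \<Union>a \<in> V.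
        gr_class C M (p + q - 1) (m \<odot>r\<^bsub>M\<^esub> a \<ominus>\<^bsub>M\<^esub> a \<odot>\<^bsub>M\<^esub> m))\<rparr>"

end

theory Submission
  imports Defs
begin

text \<open>Iterated commutators of \<open>a \<in> F\<^sub>p A\<close> with \<open>p\<close> elements of \<open>C\<close> lie in
  \<open>F\<^sub>0 A = C\<close>, and \<open>\<sigma>\<^sub>p(a)(c\<^sub>1, \<dots>, c\<^sub>p) = [\<dots>[a, c\<^sub>1], \<dots>, c\<^sub>p] / p!\<close> is a
  symmetric multiderivation which vanishes only if \<open>a \<in> F\<^sub>p\<^sub>-\<^sub>1 A\<close>. Products and brackets of forms are
  determined by their values on the diagonal (polarization), so the Poisson identities of the forms
  become identities between polynomial functions, and \<open>\<sigma>\<close> is a Poisson homomorphism by induction on the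
  degree: bracketing with constants determines a form of positive degree.

  A bimodule \<open>M\<close> is treated as an ideal of the square-zero extension \<open>A \<oplus> M\<close>, in which
  \<open>C \<oplus> F\<^sub>0 M\<close> is again its own centralizer. The symbols of elements of \<open>M\<close> are forms on
  \<open>C\<close> with values in \<open>N = F\<^sub>0 M\<close>, and brackets with symbols of elements of \<open>A\<close> preserve the
  set of all such forms. Since \<open>C\<close> is smooth there are finitely many \<open>u \<in> C\<close> and derivations
  \<open>d\<^sub>u\<close> with \<open>\<delta> = \<Sum> d\<^sub>u \<cdot> \<delta>(u)\<close> for every derivation \<open>\<delta>\<close> into a module; expanding forms
  accordingly identifies the \<open>N\<close>-valued forms with \<open>N \<otimes> Sym \<Theta>\<close>.\<close>

section \<open>Polarization\<close>

text \<open>The algebra C \<oplus> F_0 M is in general neither smooth nor finitely generated.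
  Therefore forms, their brackets and symbols are developed for an arbitrary commutative R-algebra,
  Sym \<Theta> being read throughout as the module of symmetric multiderivations; the same theory
  then serves once for C in A and once for \<open>C \<times> N\<close> in A \<oplus> M. Smoothness
  of C is spent in one place, on the dual basis. The bracket on N \<otimes> Sym \<Theta> is not
  given by a formula on tensors. It is the bracket of two forms on \<open>C \<times> N\<close>, one
  coming from the tensor product and one being the symbol of (a, 0). Hence all module axioms, for Gr
  M as well as for the tensor product, are instances of the axioms of a single Poisson algebra of
  forms. The price is that an element of A must keep its degree when it is also tested against N,
  and that the forms coming from the tensor product must be closed under this bracket.\<close>

definition tuples :: "('a, 'x) ring_scheme \<Rightarrow> nat \<Rightarrow> 'a list set" where
  "tuples S n = {xs. length xs = n \<and> set xs \<subseteq> carrier S}"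

text \<open>Additivity is the right generality because polarization only substitutes c + t d with
  natural t. The value group is kept apart from S: iterated commutators of elements of A take values
  in A.\<close>

definition multiadditive ::
    "('a, 'x) ring_scheme \<Rightarrow> ('b, 'y) ring_scheme \<Rightarrow> nat \<Rightarrow> ('a list \<Rightarrow> 'b) \<Rightarrow> bool" where
  "multiadditive S G n F \<longleftrightarrow>
     (\<forall>xs \<in> tuples S n. F xs \<in> carrier G) \<and>
     (\<forall>xs ys. \<forall>x \<in> carrier S. \<forall>y \<in> carrier S. xs @ x # ys \<in> tuples S n \<longrightarrow>
        F (xs @ (x \<oplus>\<^bsub>S\<^esub> y) # ys) = F (xs @ x # ys) \<oplus>\<^bsub>G\<^esub> F (xs @ y # ys))"

definition symmetric_form :: "('a, 'x) ring_scheme \<Rightarrow> nat \<Rightarrow> ('a list \<Rightarrow> 'b) \<Rightarrow> bool" where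
  "symmetric_form S n F \<longleftrightarrow> (\<forall>xs \<in> tuples S n. \<forall>ys \<in> tuples S n. mset xs = mset ys \<longrightarrow> F xs = F ys)"

lemma tuples_0 [simp]: "tuples S 0 = {[]}"
  by (auto simp: tuples_def)

lemma Cons_in_tuples [simp]: "x # xs \<in> tuples S (Suc n) \<longleftrightarrow> x \<in> carrier S \<and> xs \<in> tuples S n"
  by (auto simp: tuples_def)

lemma replicate_in_tuples [simp, intro]: "x \<in> carrier S \<Longrightarrow> replicate n x \<in> tuples S n"
  by (auto simp: tuples_def)

lemma tuples_SucE:
  assumes "xs \<in> tuples S (Suc n)"
  obtains y ys where "xs = y # ys" "y \<in> carrier S" "ys \<in> tuples S n"
  using assms by (cases xs) (auto simp: tuples_def)

lemma multiadditive_closed: "multiadditive S G n F \<Longrightarrow> xs \<in> tuples S n \<Longrightarrow> F xs \<in> carrier G"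
  by (auto simp: multiadditive_def)

lemma multiadditive_add:
  "\<lbrakk>multiadditive S G n F; x \<in> carrier S; y \<in> carrier S; xs @ x # ys \<in> tuples S n\<rbrakk>
    \<Longrightarrow> F (xs @ (x \<oplus>\<^bsub>S\<^esub> y) # ys) = F (xs @ x # ys) \<oplus>\<^bsub>G\<^esub> F (xs @ y # ys)"
  by (auto simp: multiadditive_def)

lemma multiadditive_Cons:
  assumes H: "multiadditive S G (Suc n) H" and d: "d \<in> carrier S"
  shows "multiadditive S G n (\<lambda>zs. H (d # zs))"
  unfolding multiadditive_def
proof (intro conjI ballI allI impI)
  show "H (d # xs) \<in> carrier G" if "xs \<in> tuples S n" for xs
    using that d by (intro multiadditive_closed[OF H]) simp
  show "H (d # xs @ (x \<oplus>\<^bsub>S\<^esub> y) # ys) = H (d # xs @ x # ys) \<oplus>\<^bsub>G\<^esub> H (d # xs @ y # ys)"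
    if "x \<in> carrier S" "y \<in> carrier S" "xs @ x # ys \<in> tuples S n" for xs ys x y
    using multiadditive_add[OF H, of x y "d # xs" ys] that d by simp
qed

lemma symmetric_formD:
  assumes "symmetric_form S n F" "xs \<in> tuples S n" "mset xs = mset ys"
  shows "F xs = F ys"
proof -
  have "ys \<in> tuples S n"
    using assms(2) mset_eq_length[OF assms(3)] mset_eq_setD[OF assms(3)] by (simp add: tuples_def)
  with assms show ?thesis unfolding symmetric_form_def by blast
qed

section \<open>Polynomial functions with values in a torsion-free group\<close>

lemma (in abelian_group) minus_eq_zero_iff:
  "\<lbrakk>x \<in> carrier G; y \<in> carrier G\<rbrakk> \<Longrightarrow> x \<ominus> y = \<zero> \<longleftrightarrow> x = y"
  by (metis a_minus_def minus_equality minus_minus a_inv_closed r_neg)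

text \<open>Elimination in the Vandermonde system at the nodes 2^s: the combination 2^(m+1) P(2^s) -
  P(2^(s+1)) has no term of degree m + 1, and its lower coefficients are the old ones times the
  positive integers 2^(m+1) - 2^j, which torsion-freeness cancels.\<close>

lemma (in abelian_group) vandermonde_vanish:
  assumes tf: "\<And>k g. \<lbrakk>0 < k; g \<in> carrier G; [(k::nat)] \<cdot>\<^bsub>G\<^esub> g = \<zero>\<rbrakk> \<Longrightarrow> g = \<zero>"
  shows "\<lbrakk>\<And>j. a j \<in> carrier G; \<And>s. (\<Oplus>j\<in>{..m}. [((2::nat) ^ (s * j))] \<cdot>\<^bsub>G\<^esub> a j) = \<zero>\<rbrakk>
    \<Longrightarrow> j \<le> m \<Longrightarrow> a j = \<zero>"
proof (induction m arbitrary: a j)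
  case 0
  then show ?case using "0.prems"(2)[of 0] by simp
next
  case (Suc m)
  note cl [simp] = Suc.prems(1)
  \<comment> \<open>The coefficients of the eliminated polynomial; for j \<le> m the natural
    subtraction does not truncate.\<close>
  define b where "b j = (if j \<le> m then [((2::nat) ^ Suc m - 2 ^ j)] \<cdot>\<^bsub>G\<^esub> a j else \<zero>)" for j
  have b0: "b j = \<zero>" if "j \<le> m" for j
  proof (rule Suc.IH[OF _ _ that])
    show "b j \<in> carrier G" for j by (simp add: b_def)
    fix s :: nat
    let ?X = "\<Oplus>j\<in>{..m}. [((2::nat) ^ (s * j))] \<cdot>\<^bsub>G\<^esub> b j"
    let ?Y = "\<Oplus>j\<in>{..m}. [((2::nat) ^ (Suc s * j))] \<cdot>\<^bsub>G\<^esub> a j"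
    let ?Z = "\<Oplus>j\<in>{..m}. [((2::nat) ^ Suc m)] \<cdot>\<^bsub>G\<^esub> ([((2::nat) ^ (s * j))] \<cdot>\<^bsub>G\<^esub> a j)"
    let ?t = "[((2::nat) ^ (Suc s * Suc m))] \<cdot>\<^bsub>G\<^esub> a (Suc m)"
    have bc: "b j \<in> carrier G" for j by (simp add: b_def)
    have Z: "?Z = [((2::nat) ^ Suc m)] \<cdot>\<^bsub>G\<^esub> (\<Oplus>j\<in>{..m}. [((2::nat) ^ (s * j))] \<cdot>\<^bsub>G\<^esub> a j)"
    proof -
      have "(\<Oplus>j\<in>{..n}. [(k::nat)] \<cdot>\<^bsub>G\<^esub> (f j)) = [k] \<cdot>\<^bsub>G\<^esub> (\<Oplus>j\<in>{..n}. f j)" if "\<And>j. f j \<in> carrier G"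
        for k n and f :: "nat \<Rightarrow> 'a"
        using that by (induction n) (simp_all add: add.nat_pow_distrib)
      then show ?thesis by simp
    qed
    have "?Z = (\<Oplus>j\<in>{..m}. [((2::nat) ^ (s * j))] \<cdot>\<^bsub>G\<^esub> b j \<oplus> [((2::nat) ^ (Suc s * j))] \<cdot>\<^bsub>G\<^esub> a j)"
    proof (rule add.finprod_cong')
      fix j assume "j \<in> {..m}"
      then have jm: "j \<le> m" by simp
      then have "(2::nat) ^ j \<le> 2 ^ Suc m" by (intro power_increasing) auto
      then have "(2::nat) ^ (s * j) * (2 ^ Suc m - 2 ^ j) + 2 ^ (Suc s * j) = 2 ^ (s * j) * 2 ^ Suc m"
        by (simp add: power_add algebra_simps diff_mult_distrib2)
      then show "[((2::nat) ^ Suc m)] \<cdot>\<^bsub>G\<^esub> ([((2::nat) ^ (s * j))] \<cdot>\<^bsub>G\<^esub> a j) =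
          [((2::nat) ^ (s * j))] \<cdot>\<^bsub>G\<^esub> b j \<oplus> [((2::nat) ^ (Suc s * j))] \<cdot>\<^bsub>G\<^esub> a j"
        using jm by (simp add: b_def add.nat_pow_pow add.nat_pow_mult mult.commute)
    qed (auto simp: bc)
    also have "\<dots> = ?X \<oplus> ?Y" by (rule add.finprod_multf) (auto simp: bc)
    finally have XYZ: "?Z = ?X \<oplus> ?Y" .
    have "(\<Oplus>j\<in>{..Suc m}. [((2::nat) ^ (Suc s * j))] \<cdot>\<^bsub>G\<^esub> a j) = \<zero>" by (rule Suc.prems)
    then have Y: "?t \<oplus> ?Y = \<zero>" by (subst (asm) atMost_Suc, subst (asm) add.finprod_insert) auto
    have "(\<Oplus>j\<in>{..Suc m}. [((2::nat) ^ (s * j))] \<cdot>\<^bsub>G\<^esub> a j) = \<zero>" by (rule Suc.prems)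
    then have "[((2::nat) ^ Suc m)] \<cdot>\<^bsub>G\<^esub> ([((2::nat) ^ (s * Suc m))] \<cdot>\<^bsub>G\<^esub> a (Suc m) \<oplus> (\<Oplus>j\<in>{..m}. [((2::nat) ^ (s * j))] \<cdot>\<^bsub>G\<^esub> a j)) = \<zero>"
      by simp
    then have "?t \<oplus> ?Z = \<zero>"
      unfolding Z by (subst (asm) add.nat_pow_distrib) (simp_all add: add.nat_pow_pow power_add mult_ac)
    with Y have "?t \<oplus> ?Z = ?t \<oplus> ?Y" by simp
    then have "?Z = ?Y" by (subst (asm) add.l_cancel) auto
    with XYZ have "?X \<oplus> ?Y = ?Y" by simp
    then show "?X = \<zero>" by (subst (asm) add.r_cancel_one) (auto simp: bc)
  qed
  have low: "a j = \<zero>" if "j \<le> m" for j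
  proof (rule tf)
    show "0 < (2::nat) ^ Suc m - 2 ^ j" using that power_strict_increasing[of j "Suc m" "2::nat"] by simp
    show "[((2::nat) ^ Suc m - 2 ^ j)] \<cdot>\<^bsub>G\<^esub> a j = \<zero>" using b0[OF that] that by (simp add: b_def)
  qed simp
  \<comment> \<open>At s = 0 all weights are 1, so once the lower coefficients vanish the equation
    says that the top one does.\<close>
  have "(\<Oplus>j\<in>{..m}. [((2::nat) ^ (0 * j))] \<cdot>\<^bsub>G\<^esub> a j) = \<zero>"
    by (rule add.finprod_one_eqI) (simp add: low)
  with Suc.prems(2)[of 0] have "a (Suc m) = \<zero>" by simp
  with low Suc.prems(3) show ?case by (cases "j = Suc m") auto
qed

text \<open>Torsion-freeness of the value group is the form in which the rationals in R enter
  polarization. The locale is used with values in S itself, for forms, and with values in A, for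
  iterated commutators.\<close>

locale form_groups = S: abelian_group S + G: abelian_group G
  for S :: "('a, 'x) ring_scheme" and G :: "('b, 'y) ring_scheme" (structure) +
  assumes torsion_free: "\<lbrakk>0 < k; g \<in> carrier G; [(k::nat)] \<cdot> g = \<zero>\<rbrakk> \<Longrightarrow> g = \<zero>"
begin

lemma torsion_free_cancel:
  assumes "0 < k" "g \<in> carrier G" "h \<in> carrier G" "[(k::nat)] \<cdot> g = [k] \<cdot> h"
  shows "g = h"
proof -
  have "[k] \<cdot> (g \<ominus> h) = [k] \<cdot> g \<ominus> [k] \<cdot> h"
    using assms by (simp add: a_minus_def G.add.nat_pow_distrib G.add.nat_pow_inv)
  then have "g \<ominus> h = \<zero>" using assms torsion_free[of k "g \<ominus> h"]
    by (simp add: G.r_neg a_minus_def)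
  then show ?thesis using assms by (simp add: G.minus_eq_zero_iff)
qed

lemma multiadditive_nat_multiple:
  assumes F: "multiadditive S G n F" and x: "x \<in> carrier S" and xs: "xs @ x # ys \<in> tuples S n"
  shows "F (xs @ ([(k::nat)] \<cdot>\<^bsub>S\<^esub> x) # ys) = [k] \<cdot> F (xs @ x # ys)"
proof -
  have cl: "xs @ y # ys \<in> tuples S n" if "y \<in> carrier S" for y
    using xs that by (auto simp: tuples_def)
  note c2 = multiadditive_closed[OF F cl]
  have "F (xs @ \<zero>\<^bsub>S\<^esub> # ys) = F (xs @ \<zero>\<^bsub>S\<^esub> # ys) \<oplus> F (xs @ \<zero>\<^bsub>S\<^esub> # ys)"
    using multiadditive_add[OF F S.zero_closed S.zero_closed cl[OF S.zero_closed]] by simp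
  then have "F (xs @ \<zero>\<^bsub>S\<^esub> # ys) = \<zero>"
    using c2[OF S.zero_closed] by (metis G.add.r_cancel_one')
  then show ?thesis
    by (induction k) (simp_all add: x cl c2 multiadditive_add[OF F])
qed

text \<open>Along the line c + t d a multiadditive map is polynomial in t. Only the coefficients of
  1 and t matter, so the others stay unspecified. The sum runs to n + 1 so that index 1 is present
  even for n = 0. The prefix \<open>pre\<close> collects the slots already decided as c or d, as the
  induction on n requires.\<close>

lemma multiadditive_expand:
  assumes F: "multiadditive S G N F" and c: "c \<in> carrier S" and d: "d \<in> carrier S"
  shows "length pre + n = N \<Longrightarrow> set pre \<subseteq> carrier S \<Longrightarrow>
    \<exists>a. (\<forall>j. a j \<in> carrier G) \<and> a 0 = F (pre @ replicate n c) \<and>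
      a 1 = (\<Oplus>i\<in>{..<n}. F (pre @ replicate i c @ d # replicate (n - Suc i) c)) \<and>
      (\<forall>t::nat. F (pre @ replicate n (c \<oplus>\<^bsub>S\<^esub> [t] \<cdot>\<^bsub>S\<^esub> d)) = (\<Oplus>j\<in>{..Suc n}. [(t ^ j)] \<cdot> a j))"
proof (induction n arbitrary: pre)
  case 0
  then have "F pre \<in> carrier G"
    by (intro multiadditive_closed[OF F]) (auto simp: tuples_def)
  then show ?case
    by (intro exI[of _ "\<lambda>j. if j = 0 then F pre else \<zero>"]) auto
next
  case (Suc n)
  have mem: "pre @ x # replicate n y \<in> tuples S N" if "x \<in> carrier S" "y \<in> carrier S" for x y
    using Suc.prems that by (auto simp: tuples_def)
  have l: "length (pre @ [x]) + n = N" "set (pre @ [x]) \<subseteq> carrier S" if "x \<in> carrier S" for x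
    using Suc.prems that by auto
  from Suc.IH[OF l[OF c], unfolded append_assoc append_Cons append_Nil] obtain a where
    a: "\<And>j. a j \<in> carrier G" "a 0 = F (pre @ c # replicate n c)"
      "a 1 = (\<Oplus>i\<in>{..<n}. F (pre @ c # replicate i c @ d # replicate (n - Suc i) c))"
      "\<And>t::nat. F (pre @ c # replicate n (c \<oplus>\<^bsub>S\<^esub> [t] \<cdot>\<^bsub>S\<^esub> d)) = (\<Oplus>j\<in>{..Suc n}. [(t ^ j)] \<cdot> a j)"
    by blast
  from Suc.IH[OF l[OF d], unfolded append_assoc append_Cons append_Nil] obtain b where
    b: "\<And>j. b j \<in> carrier G" "b 0 = F (pre @ d # replicate n c)"
      "\<And>t::nat. F (pre @ d # replicate n (c \<oplus>\<^bsub>S\<^esub> [t] \<cdot>\<^bsub>S\<^esub> d)) = (\<Oplus>j\<in>{..Suc n}. [(t ^ j)] \<cdot> b j)"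
    by blast
  \<comment> \<open>The next slot is split into c and t d; choosing t d shifts the degree by one.
    The cut-off discards values \<open>a j\<close> that the induction hypothesis does not relate to
    F.\<close>
  define e where "e j = (if j \<le> Suc n then a j else \<zero>) \<oplus> (case j of 0 \<Rightarrow> \<zero> | Suc i \<Rightarrow> b i)" for j
  have ec: "e j \<in> carrier G" for j by (auto simp: e_def a(1) b(1) split: nat.split)
  have Fc: "F (pre @ replicate i c @ d # replicate (n - i) c) \<in> carrier G" if "i \<le> n" for i
    using Suc.prems c d that by (intro multiadditive_closed[OF F]) (auto simp: tuples_def)
  \<comment> \<open>The term i = 0 has d in the slot just split and is b_0; the remaining positions
    make up a_1.\<close>
  have e1: "e 1 = (\<Oplus>i\<in>{..<Suc n}. F (pre @ replicate i c @ d # replicate (Suc n - Suc i) c))"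
  proof -
    have "(\<Oplus>i\<in>{..<Suc n}. F (pre @ replicate i c @ d # replicate (Suc n - Suc i) c)) =
      (\<Oplus>i\<in>insert 0 (Suc ` {..<n}). F (pre @ replicate i c @ d # replicate (n - i) c))"
      by (simp add: lessThan_Suc_eq_insert_0)
    also have "\<dots> = F (pre @ d # replicate n c) \<oplus>
      (\<Oplus>i\<in>Suc ` {..<n}. F (pre @ replicate i c @ d # replicate (n - i) c))"
      using Fc[of 0] by (subst G.add.finprod_insert) (auto intro!: Fc)
    also have "(\<Oplus>i\<in>Suc ` {..<n}. F (pre @ replicate i c @ d # replicate (n - i) c)) =
       (\<Oplus>i\<in>{..<n}. F (pre @ replicate (Suc i) c @ d # replicate (n - Suc i) c))"
      by (subst G.add.finprod_reindex) (auto intro!: Fc)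
    also have "\<dots> = a 1" using a(3) by simp
    finally show ?thesis using a(1)[of 1] b(1)[of 0] by (simp add: e_def b G.a_comm)
  qed
  have "F (pre @ replicate (Suc n) (c \<oplus>\<^bsub>S\<^esub> [t] \<cdot>\<^bsub>S\<^esub> d)) = (\<Oplus>j\<in>{..Suc (Suc n)}. [(t ^ j)] \<cdot> e j)" for t :: nat
  proof -
    let ?x = "c \<oplus>\<^bsub>S\<^esub> [t] \<cdot>\<^bsub>S\<^esub> d"
    let ?a = "\<lambda>j. if j \<le> Suc n then a j else \<zero>" and ?b = "\<lambda>j. case j of 0 \<Rightarrow> \<zero> | Suc i \<Rightarrow> b i"
    have x: "?x \<in> carrier S" using c d by simp
    have "F (pre @ replicate (Suc n) ?x) = F (pre @ c # replicate n ?x) \<oplus> F (pre @ ([t] \<cdot>\<^bsub>S\<^esub> d) # replicate n ?x)"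
      using multiadditive_add[OF F c, of "[t] \<cdot>\<^bsub>S\<^esub> d" pre "replicate n ?x"] mem[OF c x] d by simp
    also have "F (pre @ ([t] \<cdot>\<^bsub>S\<^esub> d) # replicate n ?x) = [t] \<cdot> F (pre @ d # replicate n ?x)"
      by (rule multiadditive_nat_multiple[OF F d mem[OF d x]])
    also have "F (pre @ d # replicate n ?x) = (\<Oplus>j\<in>{..Suc n}. [(t ^ j)] \<cdot> b j)" by (rule b)
    also have "[t] \<cdot> \<dots> = (\<Oplus>j\<in>{..Suc n}. [(t ^ Suc j)] \<cdot> b j)"
    proof -
      have "[t] \<cdot> (\<Oplus>j\<in>{..m}. [(t ^ j)] \<cdot> b j) = (\<Oplus>j\<in>{..m}. [(t ^ Suc j)] \<cdot> b j)" for m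
        by (induction m) (simp_all add: b(1) G.add.nat_pow_distrib G.add.nat_pow_pow mult.commute)
      then show ?thesis .
    qed
    also have "\<dots> = (\<Oplus>j\<in>Suc ` {..Suc n}. [(t ^ j)] \<cdot> ?b j)"
      by (subst G.add.finprod_reindex) (auto simp: b(1))
    also have "\<dots> = (\<Oplus>j\<in>insert 0 (Suc ` {..Suc n}). [(t ^ j)] \<cdot> ?b j)"
      by (subst G.add.finprod_insert) (auto simp: b(1) intro!: G.l_zero[symmetric] G.finsum_closed)
    also have "insert 0 (Suc ` {..Suc n}) = {..Suc (Suc n)}" by (simp add: atMost_Suc_eq_insert_0)
    also have "F (pre @ c # replicate n ?x) = (\<Oplus>j\<in>{..Suc n}. [(t ^ j)] \<cdot> ?a j)"
      unfolding a(4) by (rule G.add.finprod_cong') (auto simp: a(1))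
    also have "\<dots> = (\<Oplus>j\<in>{..Suc (Suc n)}. [(t ^ j)] \<cdot> ?a j)"
      by (subst (2) atMost_Suc) (subst G.add.finprod_insert; auto simp: a(1))
    also have "\<dots> \<oplus> (\<Oplus>j\<in>{..Suc (Suc n)}. [(t ^ j)] \<cdot> ?b j) =
      (\<Oplus>j\<in>{..Suc (Suc n)}. [(t ^ j)] \<cdot> ?a j \<oplus> [(t ^ j)] \<cdot> ?b j)"
      by (rule G.add.finprod_multf[symmetric]) (auto simp: a(1) b(1) split: nat.split)
    also have "\<dots> = (\<Oplus>j\<in>{..Suc (Suc n)}. [(t ^ j)] \<cdot> e j)"
      by (rule G.add.finprod_cong') (auto simp: e_def a(1) b(1) G.add.nat_pow_distrib split: nat.split)
    finally show ?thesis .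
  qed
  moreover have "e 0 = F (pre @ replicate (Suc n) c)"
    using a(1)[of 0] by (simp add: e_def a)
  ultimately show ?case using ec e1 by blast
qed

text \<open>Both sides are the coefficient of \<open>t\<close> in the common value at \<open>c + t d\<close>.\<close>

lemma diagonal_derivative:
  assumes F: "multiadditive S G n F" and H: "multiadditive S G n H"
    and eq: "\<And>c. c \<in> carrier S \<Longrightarrow> F (replicate n c) = H (replicate n c)"
    and c: "c \<in> carrier S" and d: "d \<in> carrier S"
  shows "(\<Oplus>i\<in>{..<n}. F (replicate i c @ d # replicate (n - Suc i) c)) =
    (\<Oplus>i\<in>{..<n}. H (replicate i c @ d # replicate (n - Suc i) c))"
proof -
  have l: "length ([]::'a list) + n = n" "set [] \<subseteq> carrier S" by simp_all
  from multiadditive_expand[OF F c d l, unfolded append_Nil] obtain a where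
    a: "\<And>j. a j \<in> carrier G"
      "a 1 = (\<Oplus>i\<in>{..<n}. F (replicate i c @ d # replicate (n - Suc i) c))"
      "\<And>t::nat. F (replicate n (c \<oplus>\<^bsub>S\<^esub> [t] \<cdot>\<^bsub>S\<^esub> d)) = (\<Oplus>j\<in>{..Suc n}. [(t ^ j)] \<cdot> a j)"
    by blast
  from multiadditive_expand[OF H c d l, unfolded append_Nil] obtain b where
    b: "\<And>j. b j \<in> carrier G"
      "b 1 = (\<Oplus>i\<in>{..<n}. H (replicate i c @ d # replicate (n - Suc i) c))"
      "\<And>t::nat. H (replicate n (c \<oplus>\<^bsub>S\<^esub> [t] \<cdot>\<^bsub>S\<^esub> d)) = (\<Oplus>j\<in>{..Suc n}. [(t ^ j)] \<cdot> b j)"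
    by blast
  \<comment> \<open>The difference of the two polynomials vanishes at every natural t; the powers of
    two suffice.\<close>
  have "a 1 \<ominus> b 1 = \<zero>"
  proof (rule G.vandermonde_vanish[where a = "\<lambda>j. a j \<ominus> b j" and m = "Suc n"])
    show "g = \<zero>" if "0 < k" "g \<in> carrier G" "[(k::nat)] \<cdot> g = \<zero>" for k g
      by (rule torsion_free[OF that])
    fix s :: nat
    let ?t = "(2::nat) ^ s"
    have "(\<Oplus>j\<in>{..m}. [((2::nat) ^ (s * j))] \<cdot> (a j \<ominus> b j)) =
      (\<Oplus>j\<in>{..m}. [(?t ^ j)] \<cdot> a j) \<ominus> (\<Oplus>j\<in>{..m}. [(?t ^ j)] \<cdot> b j)" for m
    proof (induction m)
      case 0
      then show ?case using a(1) b(1) by simp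
    next
      case (Suc m)
      have AB: "(\<Oplus>j\<in>{..m}. [(?t ^ j)] \<cdot> a j) \<in> carrier G" "(\<Oplus>j\<in>{..m}. [(?t ^ j)] \<cdot> b j) \<in> carrier G"
        using a(1) b(1) by (auto intro!: G.finsum_closed)
      from Suc a(1) b(1) AB show ?case
        by (simp add: power_mult[symmetric] a_minus_def G.add.nat_pow_distrib G.add.nat_pow_inv G.minus_add G.a_ac)
    qed
    also have "\<dots> (Suc n) = \<zero>"
      unfolding a(3)[symmetric] b(3)[symmetric] using eq[of "c \<oplus>\<^bsub>S\<^esub> [(?t)] \<cdot>\<^bsub>S\<^esub> d"] c d
        multiadditive_closed[OF H, of "replicate n (c \<oplus>\<^bsub>S\<^esub> [(?t)] \<cdot>\<^bsub>S\<^esub> d)"]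
      by (simp add: G.r_neg a_minus_def)
    finally show "(\<Oplus>j\<in>{..Suc n}. [((2::nat) ^ (s * j))] \<cdot> (a j \<ominus> b j)) = \<zero>" .
  qed (auto simp: a b)
  then show ?thesis using a b by (metis G.minus_eq_zero_iff)
qed

text \<open>By symmetry the n + 1 positions of d give the same value. So the derivative of the
  diagonal knows H(d, c, ..., c) up to the factor n + 1.\<close>

lemma symmetric_insert_sum:
  assumes H: "multiadditive S G (Suc n) H" "symmetric_form S (Suc n) H"
    and c: "c \<in> carrier S" and d: "d \<in> carrier S"
  shows "(\<Oplus>i\<in>{..<Suc n}. H (replicate i c @ d # replicate (Suc n - Suc i) c)) =
    [(Suc n)] \<cdot> H (d # replicate n c)"
proof -
  have Hc: "H (d # replicate n c) \<in> carrier G"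
    using c d by (intro multiadditive_closed[OF H(1)]) auto
  have "(\<Oplus>i\<in>{..<Suc n}. H (replicate i c @ d # replicate (Suc n - Suc i) c)) =
    (\<Oplus>i\<in>{..<Suc n}. H (d # replicate n c))"
  proof (rule G.add.finprod_cong')
    fix i assume i: "i \<in> {..<Suc n}"
    then have "replicate_mset i c + replicate_mset (n - i) c = replicate_mset n c"
      by (intro multiset_eqI) auto
    then show "H (replicate i c @ d # replicate (Suc n - Suc i) c) = H (d # replicate n c)"
      using i c d by (intro symmetric_formD[OF H(2)]) (auto simp: tuples_def)
  qed (auto simp: Hc)
  also have "\<dots> = [(Suc n)] \<cdot> H (d # replicate n c)"
    using Hc by (simp del: G.add.nat_pow_Suc add: G.add.finprod_const)
  finally show ?thesis .
qed

text \<open>Polarization by induction: the derivative of the zero function gives (n + 1) H(d, c,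
  ..., c) = 0, so the contraction H(d, -) again vanishes on the diagonal.\<close>

lemma diagonal_zero:
  "\<lbrakk>multiadditive S G n H; symmetric_form S n H; \<And>c. c \<in> carrier S \<Longrightarrow> H (replicate n c) = \<zero>;
    xs \<in> tuples S n\<rbrakk> \<Longrightarrow> H xs = \<zero>"
proof (induction n arbitrary: H xs)
  case 0
  from 0(3)[of "\<zero>\<^bsub>S\<^esub>"] 0(4) show ?case by simp
next
  case (Suc n)
  obtain d ys where xs: "xs = d # ys" and d: "d \<in> carrier S" and ys: "ys \<in> tuples S n"
    using Suc.prems(4) by (rule tuples_SucE)
  have 0: "multiadditive S G (Suc n) (\<lambda>_. \<zero>)"
    by (simp add: multiadditive_def)
  have "H (d # replicate n c) = \<zero>" if c: "c \<in> carrier S" for c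
  proof (rule torsion_free[of "Suc n"])
    show "H (d # replicate n c) \<in> carrier G"
      using c d by (intro multiadditive_closed[OF Suc.prems(1)]) auto
    have "[(Suc n)] \<cdot> H (d # replicate n c) = (\<Oplus>i\<in>{..<Suc n}. \<zero>)"
      unfolding symmetric_insert_sum[OF Suc.prems(1,2) c d, symmetric]
      by (rule diagonal_derivative[OF Suc.prems(1) 0 Suc.prems(3) c d])
    then show "[(Suc n)] \<cdot> H (d # replicate n c) = \<zero>" by simp
  qed simp
  moreover have "multiadditive S G n (\<lambda>zs. H (d # zs))"
    by (rule multiadditive_Cons[OF Suc.prems(1) d])
  moreover have "symmetric_form S n (\<lambda>zs. H (d # zs))"
    using Suc.prems(2) d unfolding symmetric_form_def by simp
  ultimately show ?case unfolding xs using Suc.IH[of "\<lambda>zs. H (d # zs)" ys] ys by blast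
qed

lemma multiadditive_diff:
  assumes F: "multiadditive S G n F" and H: "multiadditive S G n H"
  shows "multiadditive S G n (\<lambda>xs. F xs \<ominus> H xs)"
  unfolding multiadditive_def
proof (intro conjI ballI allI impI)
  fix xs assume "xs \<in> tuples S n"
  then show "F xs \<ominus> H xs \<in> carrier G"
    using F H by (simp add: multiadditive_closed)
next
  fix xs ys x y assume *: "x \<in> carrier S" "y \<in> carrier S" "xs @ x # ys \<in> tuples S n"
  then have "xs @ y # ys \<in> tuples S n" by (auto simp: tuples_def)
  with * show "F (xs @ (x \<oplus>\<^bsub>S\<^esub> y) # ys) \<ominus> H (xs @ (x \<oplus>\<^bsub>S\<^esub> y) # ys) =
    (F (xs @ x # ys) \<ominus> H (xs @ x # ys)) \<oplus> (F (xs @ y # ys) \<ominus> H (xs @ y # ys))"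
    using multiadditive_closed[OF F] multiadditive_closed[OF H]
    by (simp add: multiadditive_add[OF F] multiadditive_add[OF H] a_minus_def G.minus_add G.a_ac)
qed

text \<open>The principle behind the later identities between forms: two symmetric forms need to be
  compared only at equal arguments.\<close>

lemma diagonal_determines:
  assumes F: "multiadditive S G n F" "symmetric_form S n F"
    and H: "multiadditive S G n H" "symmetric_form S n H"
    and eq: "\<And>c. c \<in> carrier S \<Longrightarrow> F (replicate n c) = H (replicate n c)"
    and xs: "xs \<in> tuples S n"
  shows "F xs = H xs"
proof -
  have "F xs \<ominus> H xs = \<zero>"
  proof (rule diagonal_zero[OF multiadditive_diff[OF F(1) H(1)] _ _ xs])
    show "symmetric_form S n (\<lambda>xs. F xs \<ominus> H xs)"
      unfolding symmetric_form_def
    proof (intro ballI impI)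
      fix xs ys assume "xs \<in> tuples S n" "mset xs = mset ys"
      then show "F xs \<ominus> H xs = F ys \<ominus> H ys"
        using symmetric_formD[OF F(2)] symmetric_formD[OF H(2)] by simp
    qed
    show "F (replicate n c) \<ominus> H (replicate n c) = \<zero>" if "c \<in> carrier S" for c
      using eq[OF that] multiadditive_closed[OF H(1)] that by (simp add: a_minus_def G.r_neg)
  qed
  then show ?thesis using multiadditive_closed[OF F(1) xs] multiadditive_closed[OF H(1) xs]
    by (simp add: G.minus_eq_zero_iff)
qed

end


section \<open>Symmetrization\<close>

lemma (in module) nat_multiple_smult:
  "v \<in> carrier M \<Longrightarrow> [(n::nat)] \<cdot>\<^bsub>M\<^esub> v = ([n] \<cdot>\<^bsub>R\<^esub> \<one>) \<odot>\<^bsub>M\<^esub> v"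
  by (induction n) (simp_all add: smult_l_distr)

text \<open>The image of 1/n serves, since a unital homomorphism sends the rational number n to n
  times one.\<close>

lemma contains_rationals_inverse:
  assumes "cring R" and "contains_rationals R" and n: "0 < (n::nat)"
  shows "\<exists>r \<in> carrier R. r \<otimes>\<^bsub>R\<^esub> ([n] \<cdot>\<^bsub>R\<^esub> \<one>\<^bsub>R\<^esub>) = \<one>\<^bsub>R\<^esub>"
proof -
  interpret cring R by fact
  obtain h where h: "h \<in> ring_hom rat_ring R"
    using assms(2) by (auto simp: contains_rationals_def)
  have add: "h (x + y) = h x \<oplus>\<^bsub>R\<^esub> h y" and mul: "h (x * y) = h x \<otimes>\<^bsub>R\<^esub> h y"
    and one: "h 1 = \<one>\<^bsub>R\<^esub>" and cl: "h x \<in> carrier R" for x y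
    using ring_hom_add[OF h, of x y] ring_hom_mult[OF h, of x y] ring_hom_one[OF h]
      ring_hom_closed[OF h, of x] by (simp_all add: rat_ring_def)
  have zero: "h 0 = \<zero>\<^bsub>R\<^esub>" using add[of 0 0] cl[of 0] by (metis add.r_cancel_one' add_0)
  have "h (of_nat n) = [n] \<cdot>\<^bsub>R\<^esub> \<one>\<^bsub>R\<^esub>" for n :: nat
    by (induction n) (simp_all add: zero one add a_comm)
  then have "h (1 / of_nat n) \<otimes>\<^bsub>R\<^esub> ([n] \<cdot>\<^bsub>R\<^esub> \<one>\<^bsub>R\<^esub>) = h (1 / of_nat n * of_nat n)"
    by (simp add: mul del: times_divide_eq_left)
  also have "\<dots> = \<one>\<^bsub>R\<^esub>" using n by (simp add: one)
  finally show ?thesis using cl by blast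
qed

lemma nat_multiple_inverse:
  assumes "module R M" and "contains_rationals R" and "0 < (n::nat)"
  shows "\<exists>r \<in> carrier R. \<forall>v \<in> carrier M. r \<odot>\<^bsub>M\<^esub> ([n] \<cdot>\<^bsub>M\<^esub> v) = v"
proof -
  interpret module R M by fact
  obtain r where r: "r \<in> carrier R" "r \<otimes>\<^bsub>R\<^esub> ([n] \<cdot>\<^bsub>R\<^esub> \<one>\<^bsub>R\<^esub>) = \<one>\<^bsub>R\<^esub>"
    using contains_rationals_inverse[OF R.is_cring assms(2,3)] by blast
  then have "r \<odot>\<^bsub>M\<^esub> ([n] \<cdot>\<^bsub>M\<^esub> v) = v" if "v \<in> carrier M" for v
    using that by (simp add: nat_multiple_smult smult_assoc1[symmetric])
  with r show ?thesis by blast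
qed

lemma rational_torsion_free:
  assumes "module R M" and "contains_rationals R" and "0 < (n::nat)"
    and "v \<in> carrier M" and "[n] \<cdot>\<^bsub>M\<^esub> v = \<zero>\<^bsub>M\<^esub>"
  shows "v = \<zero>\<^bsub>M\<^esub>"
proof -
  interpret module R M by fact
  show ?thesis using nat_multiple_inverse[OF assms(1-3)] assms(4,5) by force
qed

locale rational_algebra = algebra R S for R :: "'r ring" and S :: "('r, 'c) module" (structure) +
  assumes rationals: "contains_rationals R"

sublocale rational_algebra \<subseteq> form_groups S S
  using rational_torsion_free[OF module rationals] by unfold_locales

text \<open>The place to which a permutation moves the distinguished entry depends on \<sigma>
  alone, and the other entries do not see x. This makes each summand of a symmetrization additive in
  a chosen slot.\<close>

lemma permute_list_slot:
  assumes \<sigma>: "\<sigma> permutes {..<Suc (length xs + length ys)}"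
  shows "\<exists>as bs. \<forall>x. permute_list \<sigma> (xs @ x # ys) = as @ x # bs"
proof -
  let ?n = "Suc (length xs + length ys)"
  define j where "j = inv_into UNIV \<sigma> (length xs)"
  have j: "\<sigma> j = length xs" unfolding j_def using permutes_surj[OF \<sigma>] by (rule surj_f_inv_f)
  have jn: "j < ?n" using permutes_in_image[OF \<sigma>, of j] j by simp
  \<comment> \<open>Away from position j the entry is independent of x, so \<open>undefined\<close>
    may stand for x there; this produces surrounding lists that do not mention x.\<close>
  define el where "el x i = (xs @ x # ys) ! (\<sigma> i)" for x i
  have *: "el x i = el undefined i" if "i \<noteq> j" for x i
  proof -
    have "\<sigma> i \<noteq> length xs" using that j permutes_inj[OF \<sigma>] by (metis injD)
    then show ?thesis by (auto simp: el_def nth_append nth_Cons' )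
  qed
  have "permute_list \<sigma> (xs @ x # ys) =
    map (el undefined) [0..<j] @ x # map (el undefined) [Suc j..<?n]" for x
  proof -
    have "[0..<?n] = [0..<j] @ j # [Suc j..<?n]"
      using jn using upt_add_eq_append[of 0 j "?n - j"] by (simp add: upt_conv_Cons)
    then have "permute_list \<sigma> (xs @ x # ys) = map (el x) ([0..<j] @ j # [Suc j..<?n])"
      unfolding permute_list_def el_def by (metis add_Suc_right length_append list.size(4) add_0_right)
    also have "\<dots> = map (el x) [0..<j] @ el x j # map (el x) [Suc j..<?n]" by simp
    also have "el x j = x" by (simp add: el_def j)
    also have "map (el x) [0..<j] = map (el undefined) [0..<j]" by (intro map_cong refl *) auto
    also have "map (el x) [Suc j..<?n] = map (el undefined) [Suc j..<?n]" by (intro map_cong refl *) auto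
    finally show ?thesis .
  qed
  then show ?thesis by blast
qed

section \<open>Averaging multiadditive maps over permutations\<close>

lemma permute_list_in_tuples:
  "xs \<in> tuples S n \<Longrightarrow> \<sigma> permutes {..<n} \<Longrightarrow> permute_list \<sigma> xs \<in> tuples S n"
  by (auto simp: tuples_def)

context rational_algebra
begin

abbreviation "cS \<equiv> carrier S"
abbreviation "Form \<equiv> sym_component R S"

text \<open>Justifies the division in \<open>symmetrize\<close>: the inverse of n! in S comes from
  the action of 1/n! through R.\<close>

lemma fact_unit: "[(fact n :: nat)] \<cdot> \<one> \<in> Units S"
proof -
  obtain r where r: "r \<in> carrier R" "\<And>v. v \<in> cS \<Longrightarrow> r \<odot> ([(fact n::nat)] \<cdot> v) = v"
    using nat_multiple_inverse[OF module rationals, of "fact n"] by auto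
  have "(r \<odot> \<one>) \<otimes> ([(fact n :: nat)] \<cdot> \<one>) = \<one>"
    using r by (simp add: smult_assoc2)
  moreover from this have "([(fact n :: nat)] \<cdot> \<one>) \<otimes> (r \<odot> \<one>) = \<one>"
    using r(1) by (simp add: m_comm)
  ultimately show ?thesis using r(1) unfolding Units_def
    by (auto intro!: bexI[of _ "r \<odot> \<one>"])
qed

lemma symmetrize_closed:
  assumes "multiadditive S S n F" "xs \<in> tuples S n"
  shows "symmetrize S F xs \<in> cS"
proof -
  have "length xs = n" using assms(2) by (simp add: tuples_def)
  then show ?thesis unfolding symmetrize_def
    using assms multiadditive_closed[OF assms(1) permute_list_in_tuples[OF assms(2)]]
      Units_inv_closed[OF fact_unit]
    by (auto intro!: m_closed M.finsum_closed)
qed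

text \<open>All n! permutations fix a constant list. Hence products and brackets can be read off on
  the diagonal from their unsymmetrized formulas.\<close>

lemma symmetrize_diagonal:
  assumes F: "multiadditive S S n F" and c: "c \<in> cS"
  shows "symmetrize S F (replicate n c) = F (replicate n c)"
proof -
  let ?x = "F (replicate n c)"
  have x: "?x \<in> cS" using F c by (auto intro: multiadditive_closed)
  have "permute_list \<sigma> (replicate n c) = replicate n c" if "\<sigma> permutes {..<n}" for \<sigma>
    using set_permute_list[of \<sigma> "replicate n c"] that
    by (intro replicate_eqI) (auto split: if_splits)
  then have "(\<Oplus>\<sigma> \<in> {\<sigma>. \<sigma> permutes {..<n}}. F (permute_list \<sigma> (replicate n c))) =
    (\<Oplus>\<sigma> \<in> {\<sigma>. \<sigma> permutes {..<n}}. ?x)"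
    using x by (intro M.add.finprod_cong') auto
  also have "\<dots> = [(fact n :: nat)] \<cdot> ?x"
    using x by (simp add: M.add.finprod_const card_permutations)
  also have "\<dots> = ([(fact n :: nat)] \<cdot> \<one>) \<otimes> ?x"
    using x by (simp add: add_pow_ldistr)
  finally show ?thesis
    using x fact_unit[of n] by (simp add: symmetrize_def m_assoc[symmetric])
qed

text \<open>Rearranging the arguments by \<pi> only reindexes the sum over permutations by
  composition with \<pi>.\<close>

lemma symmetrize_symmetric:
  assumes F: "multiadditive S S n F"
  shows "symmetric_form S n (symmetrize S F)"
  unfolding symmetric_form_def
proof (intro ballI impI)
  fix xs ys assume xs: "xs \<in> tuples S n" and ys: "ys \<in> tuples S n" and eq: "mset xs = mset ys"
  obtain \<pi> where \<pi>: "\<pi> permutes {..<length ys}" "permute_list \<pi> ys = xs"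
    by (rule mset_eq_permutation[OF eq])
  have len: "length xs = n" "length ys = n" using xs ys by (auto simp: tuples_def)
  let ?P = "{\<sigma>. \<sigma> permutes {..<n}}"
  have "(\<Oplus>\<sigma> \<in> ?P. F (permute_list \<sigma> xs)) = (\<Oplus>\<sigma> \<in> ?P. F (permute_list (\<pi> \<circ> \<sigma>) ys))"
  proof (rule M.add.finprod_cong')
    show "F (permute_list \<sigma> xs) = F (permute_list (\<pi> \<circ> \<sigma>) ys)" if "\<sigma> \<in> ?P" for \<sigma>
      using that \<pi>(2) len by (simp add: permute_list_compose)
    show "(\<lambda>\<sigma>. F (permute_list (\<pi> \<circ> \<sigma>) ys)) \<in> ?P \<rightarrow> cS"
      using multiadditive_closed[OF F permute_list_in_tuples[OF ys]] \<pi>(1) len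
      by (auto intro: permutes_compose)
  qed simp
  also have "\<dots> = (\<Oplus>\<sigma> \<in> (\<lambda>\<sigma>. \<pi> \<circ> \<sigma>) ` ?P. F (permute_list \<sigma> ys))"
  proof (rule M.add.finprod_reindex[symmetric])
    show "(\<lambda>\<sigma>. F (permute_list \<sigma> ys)) \<in> (\<lambda>\<sigma>. \<pi> \<circ> \<sigma>) ` ?P \<rightarrow> cS"
      using multiadditive_closed[OF F permute_list_in_tuples[OF ys]] \<pi> len by (auto intro: permutes_compose)
    show "inj_on (\<lambda>\<sigma>. \<pi> \<circ> \<sigma>) ?P"
      using permutes_inj[OF \<pi>(1)] by (auto simp: inj_on_def fun_eq_iff dest: injD)
  qed
  also have "(\<lambda>\<sigma>. \<pi> \<circ> \<sigma>) ` ?P = ?P"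
    using image_compose_permutations_left[of \<pi> "{..<n}"] \<pi> len by (simp add: image_def) blast
  finally show "symmetrize S F xs = symmetrize S F ys" by (simp add: symmetrize_def len)
qed

lemma symmetrize_multiadditive:
  assumes F: "multiadditive S S n F"
  shows "multiadditive S S n (symmetrize S F)"
  unfolding multiadditive_def
proof (intro conjI ballI allI impI)
  show "symmetrize S F xs \<in> cS" if "xs \<in> tuples S n" for xs
    by (rule symmetrize_closed[OF F that])
next
  fix xs ys x y assume x: "x \<in> cS" and y: "y \<in> cS" and mem: "xs @ x # ys \<in> tuples S n"
  have n: "n = Suc (length xs + length ys)" using mem by (simp add: tuples_def)
  have mem': "xs @ z # ys \<in> tuples S n" if "z \<in> cS" for z using mem that by (auto simp: tuples_def)
  let ?P = "{\<sigma>. \<sigma> permutes {..<n}}"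
  have cl: "F (permute_list \<sigma> (xs @ z # ys)) \<in> cS" if "\<sigma> \<in> ?P" "z \<in> cS" for \<sigma> z
    using that by (auto intro!: multiadditive_closed[OF F] permute_list_in_tuples mem')
  have "(\<Oplus>\<sigma> \<in> ?P. F (permute_list \<sigma> (xs @ (x \<oplus> y) # ys))) =
    (\<Oplus>\<sigma> \<in> ?P. F (permute_list \<sigma> (xs @ x # ys)) \<oplus> F (permute_list \<sigma> (xs @ y # ys)))"
  proof (rule M.add.finprod_cong')
    fix \<sigma> assume \<sigma>: "\<sigma> \<in> ?P"
    then obtain as bs where ab: "\<And>z. permute_list \<sigma> (xs @ z # ys) = as @ z # bs"
      using permute_list_slot[of \<sigma> xs ys] n by auto
    have "as @ x # bs \<in> tuples S n"
      using permute_list_in_tuples[OF mem'[OF x], of \<sigma>] \<sigma> unfolding ab by simp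
    then show "F (permute_list \<sigma> (xs @ (x \<oplus> y) # ys)) =
        F (permute_list \<sigma> (xs @ x # ys)) \<oplus> F (permute_list \<sigma> (xs @ y # ys))"
      unfolding ab by (rule multiadditive_add[OF F x y])
  qed (use cl x y in auto)
  also have "\<dots> = (\<Oplus>\<sigma> \<in> ?P. F (permute_list \<sigma> (xs @ x # ys))) \<oplus>
    (\<Oplus>\<sigma> \<in> ?P. F (permute_list \<sigma> (xs @ y # ys)))"
    using cl x y by (intro M.add.finprod_multf) auto
  finally show "symmetrize S F (xs @ (x \<oplus> y) # ys) =
      symmetrize S F (xs @ x # ys) \<oplus> symmetrize S F (xs @ y # ys)"
    using cl x y Units_inv_closed[OF fact_unit]
    by (simp add: symmetrize_def n[symmetric] r_distr[OF M.finsum_closed M.finsum_closed])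
qed

end

section \<open>Symmetric multiderivations\<close>

definition derivation_on :: "'r ring \<Rightarrow> ('r, 'c) module \<Rightarrow> ('c \<Rightarrow> 'c) \<Rightarrow> bool" where
  "derivation_on R S \<delta> \<longleftrightarrow> (\<forall>x \<in> carrier S. \<delta> x \<in> carrier S \<and> (\<forall>r \<in> carrier R. \<delta> (r \<odot>\<^bsub>S\<^esub> x) = r \<odot>\<^bsub>S\<^esub> \<delta> x) \<and>
     (\<forall>y \<in> carrier S. \<delta> (x \<oplus>\<^bsub>S\<^esub> y) = \<delta> x \<oplus>\<^bsub>S\<^esub> \<delta> y \<and>
        \<delta> (x \<otimes>\<^bsub>S\<^esub> y) = x \<otimes>\<^bsub>S\<^esub> \<delta> y \<oplus>\<^bsub>S\<^esub> y \<otimes>\<^bsub>S\<^esub> \<delta> x))"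

lemma args_int [simp]: "args S (int n) = tuples S n"
  by (simp add: args_def tuples_def)

lemma args_nonneg: "0 \<le> p \<Longrightarrow> args S p = tuples S (nat p)"
  by (auto simp: args_def tuples_def)

lemma args_neg: "p < 0 \<Longrightarrow> args S p = {}"
  by (auto simp: args_def)

text \<open>By symmetry the derivation property has to be checked in the first slot only.\<close>

lemma multiderivationI:
  assumes ext: "f \<in> tuples S n \<rightarrow>\<^sub>E carrier S" and sym: "symmetric_form S n f"
    and der: "\<And>m zs. \<lbrakk>n = Suc m; zs \<in> tuples S m\<rbrakk> \<Longrightarrow> derivation_on R S (\<lambda>x. f (x # zs))"
  shows "f \<in> symmetric_multiderivations R S (int n)"
proof -
  have *: "f (xs @ z # ys) = f (z # xs @ ys)" if "xs @ x # ys \<in> tuples S n" "z \<in> carrier S" for xs ys x z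
    using that by (intro symmetric_formD[OF sym]) (auto simp: tuples_def)
  have "f (xs @ (x \<oplus>\<^bsub>S\<^esub> y) # ys) = f (xs @ x # ys) \<oplus>\<^bsub>S\<^esub> f (xs @ y # ys) \<and>
     (\<forall>r \<in> carrier R. f (xs @ (r \<odot>\<^bsub>S\<^esub> x) # ys) = r \<odot>\<^bsub>S\<^esub> f (xs @ x # ys)) \<and>
     f (xs @ (x \<otimes>\<^bsub>S\<^esub> y) # ys) = x \<otimes>\<^bsub>S\<^esub> f (xs @ y # ys) \<oplus>\<^bsub>S\<^esub> y \<otimes>\<^bsub>S\<^esub> f (xs @ x # ys)"
    if x: "x \<in> carrier S" and y: "y \<in> carrier S" and mem: "xs @ x # ys \<in> tuples S n" for x y xs ys
  proof -
    have n: "n = Suc (length xs + length ys)" and m: "xs @ ys \<in> tuples S (length xs + length ys)"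
      using mem by (auto simp: tuples_def)
    note d = der[OF n m]
    \<comment> \<open>The equation is needed for sums, products and multiples of arguments too, and
      nothing assumed here keeps these in the carrier. Outside it both sides are
      \<open>undefined\<close>, as f is extensional.\<close>
    have cyc: "f (xs @ z # ys) = f (z # xs @ ys)" for z
    proof (cases "z \<in> carrier S")
      case False
      then have "xs @ z # ys \<notin> tuples S n" "z # xs @ ys \<notin> tuples S n" by (auto simp: tuples_def)
      then show ?thesis using PiE_arb[OF ext] by metis
    qed (rule *[OF mem])
    show ?thesis unfolding cyc using d x y unfolding derivation_on_def by blast
  qed
  then show ?thesis using ext sym
    unfolding symmetric_multiderivations_def symmetric_form_def args_int by blast
qed

lemma multiderivationD:
  assumes f: "f \<in> symmetric_multiderivations R S (int n)"
  shows "f \<in> tuples S n \<rightarrow>\<^sub>E carrier S" and "multiadditive S S n f" and "symmetric_form S n f"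
    and "\<And>m zs. \<lbrakk>n = Suc m; zs \<in> tuples S m\<rbrakk> \<Longrightarrow> derivation_on R S (\<lambda>x. f (x # zs))"
proof -
  show 1: "f \<in> tuples S n \<rightarrow>\<^sub>E carrier S" and "symmetric_form S n f"
    using f unfolding symmetric_multiderivations_def symmetric_form_def args_int by blast+
  show "multiadditive S S n f"
    using f unfolding symmetric_multiderivations_def multiadditive_def args_int by blast
  show "derivation_on R S (\<lambda>x. f (x # zs))" if n: "n = Suc m" and zs: "zs \<in> tuples S m" for m zs
    unfolding derivation_on_def
  proof (intro ballI conjI)
    fix x y assume x: "x \<in> carrier S" and y: "y \<in> carrier S"
    have mem: "[] @ x # zs \<in> args S (int n)" using n x zs by (simp only: args_int append_Nil Cons_in_tuples)
    have "\<forall>xs ys. \<forall>x \<in> carrier S. \<forall>y \<in> carrier S. xs @ x # ys \<in> args S (int n) \<longrightarrow>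
           f (xs @ (x \<oplus>\<^bsub>S\<^esub> y) # ys) = f (xs @ x # ys) \<oplus>\<^bsub>S\<^esub> f (xs @ y # ys) \<and>
           (\<forall>r \<in> carrier R. f (xs @ (r \<odot>\<^bsub>S\<^esub> x) # ys) = r \<odot>\<^bsub>S\<^esub> f (xs @ x # ys)) \<and>
           f (xs @ (x \<otimes>\<^bsub>S\<^esub> y) # ys) = x \<otimes>\<^bsub>S\<^esub> f (xs @ y # ys) \<oplus>\<^bsub>S\<^esub> y \<otimes>\<^bsub>S\<^esub> f (xs @ x # ys)"
      using f unfolding symmetric_multiderivations_def by blast
    from this[rule_format, OF x y mem]
    show "f ((x \<oplus>\<^bsub>S\<^esub> y) # zs) = f (x # zs) \<oplus>\<^bsub>S\<^esub> f (y # zs)"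
      and "f ((x \<otimes>\<^bsub>S\<^esub> y) # zs) = x \<otimes>\<^bsub>S\<^esub> f (y # zs) \<oplus>\<^bsub>S\<^esub> y \<otimes>\<^bsub>S\<^esub> f (x # zs)"
      and "\<And>r. r \<in> carrier R \<Longrightarrow> f ((r \<odot>\<^bsub>S\<^esub> x) # zs) = r \<odot>\<^bsub>S\<^esub> f (x # zs)"
      by (simp_all only: append_Nil)
  next
    fix x assume "x \<in> carrier S"
    then show "f (x # zs) \<in> carrier S" using 1 n zs by auto
  qed
qed

lemma derivation_onD:
  assumes "derivation_on R S \<delta>" and "x \<in> carrier S"
  shows "\<delta> x \<in> carrier S" and "r \<in> carrier R \<Longrightarrow> \<delta> (r \<odot>\<^bsub>S\<^esub> x) = r \<odot>\<^bsub>S\<^esub> \<delta> x"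
    and "y \<in> carrier S \<Longrightarrow> \<delta> (x \<oplus>\<^bsub>S\<^esub> y) = \<delta> x \<oplus>\<^bsub>S\<^esub> \<delta> y"
    and "y \<in> carrier S \<Longrightarrow> \<delta> (x \<otimes>\<^bsub>S\<^esub> y) = x \<otimes>\<^bsub>S\<^esub> \<delta> y \<oplus>\<^bsub>S\<^esub> y \<otimes>\<^bsub>S\<^esub> \<delta> x"
  using assms unfolding derivation_on_def by blast+

context rational_algebra
begin

lemma multiadditive_scale:
  "\<lbrakk>multiadditive S S n F; s \<in> cS\<rbrakk> \<Longrightarrow> multiadditive S S n (\<lambda>xs. s \<otimes> F xs)"
  unfolding multiadditive_def by (auto simp: r_distr tuples_def)

lemma multiadditive_sum:
  assumes "multiadditive S S n F" "multiadditive S S n H"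
  shows "multiadditive S S n (\<lambda>xs. F xs \<oplus> H xs)"
proof -
  have "xs @ y # ys \<in> tuples S n" if "xs @ x # ys \<in> tuples S n" "y \<in> cS" for xs ys x y
    using that by (auto simp: tuples_def)
  then show ?thesis using assms unfolding multiadditive_def by (simp add: M.a_ac)
qed

lemma smult_eq_mult: "\<lbrakk>r \<in> carrier R; x \<in> cS\<rbrakk> \<Longrightarrow> r \<odot> x = (r \<odot> \<one>) \<otimes> x"
  by (simp add: smult_assoc2)

text \<open>The criterion by which products and brackets are seen to be derivations in each argument:
  the derivative of the diagonal has to be a derivation.\<close>

lemma symmetrize_multiderivation:
  assumes F: "multiadditive S S n F"
    and K: "\<And>c d. \<lbrakk>c \<in> cS; d \<in> cS\<rbrakk> \<Longrightarrow>
      (\<Oplus>i\<in>{..<n}. F (replicate i c @ d # replicate (n - Suc i) c)) = K c d"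
    and der: "\<And>c. c \<in> cS \<Longrightarrow> derivation_on R S (K c)"
  shows "restrict (symmetrize S F) (tuples S n) \<in> symmetric_multiderivations R S (int n)"
    and "\<And>c. c \<in> cS \<Longrightarrow> symmetrize S F (replicate n c) = F (replicate n c)"
    and "\<And>m c d. \<lbrakk>n = Suc m; c \<in> cS; d \<in> cS\<rbrakk>
      \<Longrightarrow> [n] \<cdot> symmetrize S F (d # replicate m c) = K c d"
proof -
  let ?H = "symmetrize S F"
  note H = symmetrize_multiadditive[OF F] symmetrize_symmetric[OF F]
  show diag: "\<And>c. c \<in> cS \<Longrightarrow> symmetrize S F (replicate n c) = F (replicate n c)"
    by (rule symmetrize_diagonal[OF F])
  show KH: "[n] \<cdot> ?H (d # replicate m c) = K c d"
    if n: "n = Suc m" and c: "c \<in> cS" and d: "d \<in> cS" for m c d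
    using symmetric_insert_sum[OF H[unfolded n] c d] diagonal_derivative[OF H(1) F diag c d] K[OF c d]
    by (simp add: n del: M.add.nat_pow_Suc)
  have "derivation_on R S (\<lambda>x. ?H (x # zs))" if n: "n = Suc m" and zs: "zs \<in> tuples S m" for m zs
  proof -
    have ma: "multiadditive S S m (\<lambda>zs. ?H (x # zs))" if "x \<in> cS" for x
      using multiadditive_Cons[OF H(1)[unfolded n] that] .
    have sy: "symmetric_form S m (\<lambda>zs. ?H (x # zs))" if "x \<in> cS" for x
      using H(2) that unfolding symmetric_form_def n by simp
    have cl: "?H (x # replicate m c) \<in> cS" if "x \<in> cS" "c \<in> cS" for x c
      using multiadditive_closed[OF ma[OF that(1)]] that by auto
    have cancel: "g = h" if "[n] \<cdot> g = [n] \<cdot> h" "g \<in> cS" "h \<in> cS" for g h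
      using torsion_free_cancel[of n g h] that n by simp
    show ?thesis unfolding derivation_on_def
    proof (intro ballI conjI)
      fix x assume x: "x \<in> cS"
      show "?H (x # zs) \<in> cS" using multiadditive_closed[OF ma[OF x] zs] .
      { fix r assume r: "r \<in> carrier R"
        have rx: "r \<odot> x \<in> cS" and r1: "r \<odot> \<one> \<in> cS" using r x by simp_all
        \<comment> \<open>Both sides are symmetric forms in \<open>zs\<close>, so \<open>zs\<close>
          may be taken constant. There n times the values of the symmetrization are values of K, for
          which the derivation property is assumed, and n is cancelled. The product rule below is
          obtained in the same way.\<close>
        have "?H ((r \<odot> x) # zs) = (r \<odot> \<one>) \<otimes> ?H (x # zs)"
        proof (rule diagonal_determines[OF ma[OF rx] sy[OF rx] multiadditive_scale[OF ma[OF x] r1] _ _ zs])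
          show "symmetric_form S m (\<lambda>zs. (r \<odot> \<one>) \<otimes> ?H (x # zs))"
            using sy[OF x] unfolding symmetric_form_def by metis
          fix c assume c: "c \<in> cS"
          show "?H ((r \<odot> x) # replicate m c) = (r \<odot> \<one>) \<otimes> ?H (x # replicate m c)"
          proof (rule cancel)
            have "[n] \<cdot> ((r \<odot> \<one>) \<otimes> ?H (x # replicate m c)) =
              (r \<odot> \<one>) \<otimes> ([n] \<cdot> ?H (x # replicate m c))"
              using r1 cl[OF x c] by (simp add: add_pow_rdistr)
            also have "\<dots> = K c (r \<odot> x)"
              using derivation_onD(1,2)[OF der[OF c] x] r by (simp add: KH[OF n c x] smult_eq_mult[symmetric])
            finally show "[n] \<cdot> ?H ((r \<odot> x) # replicate m c) =
              [n] \<cdot> ((r \<odot> \<one>) \<otimes> ?H (x # replicate m c))" by (simp add: KH[OF n c rx])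
          qed (use cl[OF rx c] cl[OF x c] r1 in simp_all)
        qed
        then show "?H ((r \<odot> x) # zs) = r \<odot> ?H (x # zs)"
          using r multiadditive_closed[OF ma[OF x] zs] by (simp add: smult_eq_mult[symmetric]) }
      fix y assume y: "y \<in> cS"
      show "?H ((x \<oplus> y) # zs) = ?H (x # zs) \<oplus> ?H (y # zs)"
        using multiadditive_add[OF H(1) x y, of "[]" zs] x zs n by simp
      have xy: "x \<otimes> y \<in> cS" using x y by simp
      show "?H ((x \<otimes> y) # zs) = x \<otimes> ?H (y # zs) \<oplus> y \<otimes> ?H (x # zs)"
      proof (rule diagonal_determines[OF ma[OF xy] sy[OF xy]
            multiadditive_sum[OF multiadditive_scale[OF ma[OF y] x] multiadditive_scale[OF ma[OF x] y]] _ _ zs])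
        show "symmetric_form S m (\<lambda>zs. x \<otimes> ?H (y # zs) \<oplus> y \<otimes> ?H (x # zs))"
          using sy[OF x] sy[OF y] unfolding symmetric_form_def by metis
        fix c assume c: "c \<in> cS"
        show "?H ((x \<otimes> y) # replicate m c) = x \<otimes> ?H (y # replicate m c) \<oplus> y \<otimes> ?H (x # replicate m c)"
        proof (rule cancel)
          have "[n] \<cdot> (x \<otimes> ?H (y # replicate m c) \<oplus> y \<otimes> ?H (x # replicate m c)) =
            x \<otimes> ([n] \<cdot> ?H (y # replicate m c)) \<oplus> y \<otimes> ([n] \<cdot> ?H (x # replicate m c))"
            using x y cl[OF x c] cl[OF y c] by (simp add: add_pow_rdistr M.add.nat_pow_distrib)
          also have "\<dots> = K c (x \<otimes> y)"
            using derivation_onD(4)[OF der[OF c] x y] by (simp add: KH[OF n c x] KH[OF n c y])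
          finally show "[n] \<cdot> ?H ((x \<otimes> y) # replicate m c) = [n] \<cdot>
              (x \<otimes> ?H (y # replicate m c) \<oplus> y \<otimes> ?H (x # replicate m c))" by (simp add: KH[OF n c xy])
        qed (use cl[OF xy c] cl[OF x c] cl[OF y c] x y in simp_all)
      qed
    qed
  qed
  moreover have "symmetric_form S n (restrict ?H (tuples S n))"
    unfolding symmetric_form_def
  proof (intro ballI impI)
    fix xs ys assume "xs \<in> tuples S n" "ys \<in> tuples S n" "mset xs = mset ys"
    then show "restrict ?H (tuples S n) xs = restrict ?H (tuples S n) ys"
      using symmetric_formD[OF H(2), of xs ys] by simp
  qed
  moreover have "derivation_on R S (\<lambda>x. restrict ?H (tuples S n) (x # zs)) = derivation_on R S (\<lambda>x. ?H (x # zs))"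
    if "n = Suc m" "zs \<in> tuples S m" for m zs
    using that by (simp add: derivation_on_def)
  ultimately show "restrict ?H (tuples S n) \<in> symmetric_multiderivations R S (int n)"
    using multiadditive_closed[OF H(1)] by (intro multiderivationI) auto
qed

end


section \<open>Products and brackets on the diagonal\<close>

text \<open>The polynomial function \<open>c \<mapsto> f(c, \<dots>, c)\<close> of a form and its first two derivatives.\<close>

definition diag :: "('r, 'c) module \<Rightarrow> int \<Rightarrow> ('c list \<Rightarrow> 'c) \<Rightarrow> 'c \<Rightarrow> 'c" where
  "diag S p f c = (if p < 0 then \<zero>\<^bsub>S\<^esub> else f (replicate (nat p) c))"

definition diag_deriv :: "('r, 'c) module \<Rightarrow> int \<Rightarrow> ('c list \<Rightarrow> 'c) \<Rightarrow> 'c \<Rightarrow> 'c \<Rightarrow> 'c" where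
  "diag_deriv S p f c d =
     (if p < 1 then \<zero>\<^bsub>S\<^esub> else [(nat p)] \<cdot>\<^bsub>S\<^esub> f (d # replicate (nat p - 1) c))"

definition diag_deriv2 :: "('r, 'c) module \<Rightarrow> int \<Rightarrow> ('c list \<Rightarrow> 'c) \<Rightarrow> 'c \<Rightarrow> 'c \<Rightarrow> 'c \<Rightarrow> 'c" where
  "diag_deriv2 S p f c d e =
     (if p < 2 then \<zero>\<^bsub>S\<^esub> else [(nat p * (nat p - 1))] \<cdot>\<^bsub>S\<^esub> f (d # e # replicate (nat p - 2) c))"

lemma (in abelian_monoid) finsum_lessThan_add:
  assumes "f \<in> {..<m + n} \<rightarrow> carrier G"
  shows "(\<Oplus>i\<in>{..<m + n}. f i) = (\<Oplus>i\<in>{..<m}. f i) \<oplus> (\<Oplus>i\<in>{..<n}. f (m + i :: nat))"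
proof -
  have "{..<m + n} = {..<m} \<union> (+) m ` {..<n}"
    using lessThan_atLeast0 ivl_disj_un_two(3)[of 0 m "m + n"] by (auto simp: image_iff)
  moreover have "(\<Oplus>i\<in>{..<m} \<union> (+) m ` {..<n}. f i) = (\<Oplus>i\<in>{..<m}. f i) \<oplus> (\<Oplus>i\<in>(+) m ` {..<n}. f i)"
    using assms by (intro finsum_Un_disjoint) auto
  moreover have "(\<Oplus>i\<in>(+) m ` {..<n}. f i) = (\<Oplus>i\<in>{..<n}. f (m + i))"
    using assms by (intro finsum_reindex) auto
  ultimately show ?thesis by simp
qed

context rational_algebra
begin

section \<open>Derivations, and diagonals of forms with their derivatives\<close>

abbreviation Der :: "int \<Rightarrow> ('c list \<Rightarrow> 'c) set" where
  "Der \<equiv> symmetric_multiderivations R S"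

lemma derivation_on_zero: "derivation_on R S (\<lambda>_. \<zero>)"
  by (simp add: derivation_on_def)

lemma derivation_on_add:
  assumes "derivation_on R S \<delta>" "derivation_on R S \<epsilon>"
  shows "derivation_on R S (\<lambda>x. \<delta> x \<oplus> \<epsilon> x)"
  unfolding derivation_on_def
proof (intro ballI conjI)
  fix x y assume x: "x \<in> cS" and y: "y \<in> cS"
  note cl = derivation_onD(1)[OF assms(1)] derivation_onD(1)[OF assms(2)]
  show "\<delta> (x \<oplus> y) \<oplus> \<epsilon> (x \<oplus> y) = \<delta> x \<oplus> \<epsilon> x \<oplus> (\<delta> y \<oplus> \<epsilon> y)"
    using x y by (simp add: cl derivation_onD(3)[OF assms(1)] derivation_onD(3)[OF assms(2)] M.a_ac)
  show "\<delta> (x \<otimes> y) \<oplus> \<epsilon> (x \<otimes> y) = x \<otimes> (\<delta> y \<oplus> \<epsilon> y) \<oplus> y \<otimes> (\<delta> x \<oplus> \<epsilon> x)"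
    using x y by (simp add: cl derivation_onD(4)[OF assms(1)] derivation_onD(4)[OF assms(2)] M.a_ac r_distr)
qed (use assms in \<open>simp_all add: derivation_onD smult_r_distr\<close>)

lemma derivation_on_scale:
  assumes "derivation_on R S \<delta>" "s \<in> cS"
  shows "derivation_on R S (\<lambda>x. s \<otimes> \<delta> x)"
  unfolding derivation_on_def
proof (intro ballI conjI)
  fix x assume x: "x \<in> cS"
  note d = derivation_onD[OF assms(1) x]
  show "s \<otimes> \<delta> x \<in> cS" using d assms by simp
  show "s \<otimes> \<delta> (r \<odot> x) = r \<odot> (s \<otimes> \<delta> x)" if "r \<in> carrier R" for r
    using d assms that by (metis m_comm smult_assoc2 smult_closed)
  fix y assume y: "y \<in> cS"
  note dy = derivation_onD[OF assms(1) y]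
  show "s \<otimes> \<delta> (x \<oplus> y) = s \<otimes> \<delta> x \<oplus> s \<otimes> \<delta> y"
    using d dy assms y by (simp add: r_distr)
  show "s \<otimes> \<delta> (x \<otimes> y) = x \<otimes> (s \<otimes> \<delta> y) \<oplus> y \<otimes> (s \<otimes> \<delta> x)"
    using d(1,4) dy(1) assms(2) x y by (simp add: r_distr m_lcomm)
qed

lemma derivation_on_nat_multiple:
  "derivation_on R S \<delta> \<Longrightarrow> derivation_on R S (\<lambda>x. [(k::nat)] \<cdot> \<delta> x)"
  by (induction k) (simp_all add: derivation_on_zero derivation_on_add)

lemma derivation_on_uminus:
  assumes "derivation_on R S \<delta>" shows "derivation_on R S (\<lambda>x. \<ominus> \<delta> x)"
proof -
  have "derivation_on R S (\<lambda>x. (\<ominus> \<one>) \<otimes> \<delta> x)"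
    by (rule derivation_on_scale[OF assms]) simp
  moreover have "derivation_on R S (\<lambda>x. (\<ominus> \<one>) \<otimes> \<delta> x) = derivation_on R S (\<lambda>x. \<ominus> \<delta> x)"
    unfolding derivation_on_def using derivation_onD(1)[OF assms]
    by (intro ball_cong refl conj_cong) (simp_all add: l_minus)
  ultimately show ?thesis by simp
qed

lemma derivation_on_arith:
  assumes "derivation_on R S \<delta>"
  shows "\<delta> \<zero> = \<zero>" and "x \<in> cS \<Longrightarrow> \<delta> (\<ominus> x) = \<ominus> \<delta> x"
    and "\<lbrakk>x \<in> cS; y \<in> cS\<rbrakk> \<Longrightarrow> \<delta> (x \<ominus> y) = \<delta> x \<ominus> \<delta> y"
    and "x \<in> cS \<Longrightarrow> \<delta> ([(k::nat)] \<cdot> x) = [k] \<cdot> \<delta> x"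
proof -
  note d = derivation_onD[OF assms]
  show z: "\<delta> \<zero> = \<zero>"
    using d(3)[of "\<zero>" "\<zero>"] d(1)[of "\<zero>"] by (metis M.add.r_cancel_one' M.l_zero M.zero_closed)
  show m: "\<delta> (\<ominus> x) = \<ominus> \<delta> x" if "x \<in> cS" for x
    using d(3)[of "\<ominus> x" x] d(1)[of x] d(1)[of "\<ominus> x"] that z
    by (metis M.a_inv_closed M.l_neg M.minus_equality)
  show "\<delta> (x \<ominus> y) = \<delta> x \<ominus> \<delta> y" if "x \<in> cS" "y \<in> cS"
    using that d(3)[of x "\<ominus> y"] by (simp add: a_minus_def m)
  show "\<delta> ([(k::nat)] \<cdot> x) = [k] \<cdot> \<delta> x" if "x \<in> cS"
    by (induction k) (simp_all add: z d that)
qed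

text \<open>The mixed terms \<delta>(x) \<epsilon>(y) cancel. This is needed for the derivative of a
  bracket of forms, where two composites of derivations occur whose difference, but in general
  neither of them, is a derivation.\<close>

lemma derivation_on_commutator:
  assumes d: "derivation_on R S \<delta>" and e: "derivation_on R S \<epsilon>"
  shows "derivation_on R S (\<lambda>x. \<delta> (\<epsilon> x) \<ominus> \<epsilon> (\<delta> x))"
  unfolding derivation_on_def
proof (intro ballI conjI)
  fix x assume x: "x \<in> cS"
  note cl = derivation_onD(1)[OF d] derivation_onD(1)[OF e]
  show "\<delta> (\<epsilon> x) \<ominus> \<epsilon> (\<delta> x) \<in> cS" using x by (simp add: cl)
  show "\<delta> (\<epsilon> (r \<odot> x)) \<ominus> \<epsilon> (\<delta> (r \<odot> x)) = r \<odot> (\<delta> (\<epsilon> x) \<ominus> \<epsilon> (\<delta> x))" if "r \<in> carrier R" for r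
    using x that by (simp add: cl derivation_onD(2)[OF d] derivation_onD(2)[OF e] a_minus_def smult_r_distr smult_r_minus)
  fix y assume y: "y \<in> cS"
  show "\<delta> (\<epsilon> (x \<oplus> y)) \<ominus> \<epsilon> (\<delta> (x \<oplus> y)) =
      (\<delta> (\<epsilon> x) \<ominus> \<epsilon> (\<delta> x)) \<oplus> (\<delta> (\<epsilon> y) \<ominus> \<epsilon> (\<delta> y))"
    using x y by (simp add: cl derivation_onD(3)[OF d] derivation_onD(3)[OF e] a_minus_def M.minus_add M.a_ac)
  have "\<delta> (\<epsilon> (x \<otimes> y)) = x \<otimes> \<delta> (\<epsilon> y) \<oplus> \<epsilon> y \<otimes> \<delta> x \<oplus> (y \<otimes> \<delta> (\<epsilon> x) \<oplus> \<epsilon> x \<otimes> \<delta> y)"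
    using x y by (simp add: cl derivation_onD(3,4)[OF d] derivation_onD(4)[OF e])
  moreover have "\<epsilon> (\<delta> (x \<otimes> y)) = x \<otimes> \<epsilon> (\<delta> y) \<oplus> \<delta> y \<otimes> \<epsilon> x \<oplus> (y \<otimes> \<epsilon> (\<delta> x) \<oplus> \<delta> x \<otimes> \<epsilon> y)"
    using x y by (simp add: cl derivation_onD(3,4)[OF e] derivation_onD(4)[OF d])
  moreover have "a \<oplus> u \<otimes> v \<oplus> (b \<oplus> s \<otimes> t) \<ominus> (a' \<oplus> t \<otimes> s \<oplus> (b' \<oplus> v \<otimes> u)) =
      (a \<ominus> a') \<oplus> (b \<ominus> b')"
    if "a \<in> cS" "a' \<in> cS" "b \<in> cS" "b' \<in> cS" "u \<in> cS" "v \<in> cS"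
      "s \<in> cS" "t \<in> cS" for a a' b b' u v s t
    using that by algebra
  ultimately show "\<delta> (\<epsilon> (x \<otimes> y)) \<ominus> \<epsilon> (\<delta> (x \<otimes> y)) =
      x \<otimes> (\<delta> (\<epsilon> y) \<ominus> \<epsilon> (\<delta> y)) \<oplus> y \<otimes> (\<delta> (\<epsilon> x) \<ominus> \<epsilon> (\<delta> x))"
    using x y by (simp add: cl a_minus_def r_distr r_minus)
qed

lemma diag_closed: "\<lbrakk>f \<in> Der p; c \<in> cS\<rbrakk> \<Longrightarrow> diag S p f c \<in> cS"
  using multiderivationD(2)[of f R S "nat p"]
  by (auto simp: diag_def intro!: multiadditive_closed)

lemma diag_deriv_derivation:
  assumes f: "f \<in> Der p" and c: "c \<in> cS"
  shows "derivation_on R S (diag_deriv S p f c)"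
proof (cases "p < 1")
  case True
  then show ?thesis by (simp add: diag_deriv_def[abs_def] derivation_on_zero)
next
  case False
  then have "nat p = Suc (nat p - 1)" "f \<in> Der (int (nat p))" using f by auto
  from multiderivationD(4)[OF this(2,1), of "replicate (nat p - 1) c"] c False show ?thesis
    by (simp add: diag_deriv_def[abs_def] derivation_on_nat_multiple del: One_nat_def)
qed

lemma diag_deriv2_commute:
  assumes f: "f \<in> Der p" and "c \<in> cS" "d \<in> cS" "e \<in> cS"
  shows "diag_deriv2 S p f c d e = diag_deriv2 S p f c e d"
proof (cases "p < 2")
  case False
  then have p: "nat p = Suc (Suc (nat p - 2))" "f \<in> Der (int (nat p))" using f by auto
  have "d # e # replicate (nat p - 2) c \<in> tuples S (nat p)"
    by (subst p(1)) (simp add: assms)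
  then have "f (d # e # replicate (nat p - 2) c) = f (e # d # replicate (nat p - 2) c)"
    by (rule symmetric_formD[OF multiderivationD(3)[OF p(2)]]) simp
  then show ?thesis by (simp add: diag_deriv2_def)
qed (simp add: diag_deriv2_def)

lemma diag_deriv2_derivation:
  assumes f: "f \<in> Der p" and c: "c \<in> cS" and d: "d \<in> cS"
  shows "derivation_on R S (diag_deriv2 S p f c d)" and "derivation_on R S (\<lambda>e. diag_deriv2 S p f c e d)"
proof -
  show "derivation_on R S (\<lambda>e. diag_deriv2 S p f c e d)"
  proof (cases "p < 2")
    case True
    then show ?thesis by (simp add: diag_deriv2_def derivation_on_zero)
  next
    case False
    then have p: "nat p = Suc (Suc (nat p - 2))" and f': "f \<in> Der (int (nat p))" using f by auto
    have "d # replicate (nat p - 2) c \<in> tuples S (Suc (nat p - 2))" using c d by simp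
    from derivation_on_nat_multiple[OF multiderivationD(4)[OF f' p this]] False show ?thesis
      by (simp add: diag_deriv2_def)
  qed
  moreover have "derivation_on R S (\<lambda>e. diag_deriv2 S p f c e d) = derivation_on R S (diag_deriv2 S p f c d)"
    unfolding derivation_on_def by (intro ball_cong refl) (simp add: diag_deriv2_commute[OF f c d])
  ultimately show "derivation_on R S (diag_deriv2 S p f c d)" by simp
qed

text \<open>Polarization for forms of any integer degree. In negative degree there are no arguments,
  and two extensional functions on the empty set agree.\<close>

lemma diag_eqI:
  assumes f: "f \<in> Der p" and g: "g \<in> Der p" and eq: "\<And>c. c \<in> cS \<Longrightarrow> diag S p f c = diag S p g c"
  shows "f = g"
proof (cases "p < 0")
  case True
  have "f \<in> args S p \<rightarrow>\<^sub>E cS" "g \<in> args S p \<rightarrow>\<^sub>E cS"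
    using f g by (auto simp: symmetric_multiderivations_def)
  then show ?thesis using True by (auto simp: args_neg)
next
  case False
  then have f': "f \<in> Der (int (nat p))" and g': "g \<in> Der (int (nat p))" using f g by auto
  show ?thesis
  proof (rule PiE_ext[OF multiderivationD(1)[OF f'] multiderivationD(1)[OF g']])
    fix xs assume xs: "xs \<in> tuples S (nat p)"
    show "f xs = g xs"
    proof (rule diagonal_determines[OF multiderivationD(2,3)[OF f'] multiderivationD(2,3)[OF g'] _ xs])
      show "f (replicate (nat p) c) = g (replicate (nat p) c)" if "c \<in> cS" for c
        using eq[OF that] False by (simp add: diag_def)
    qed
  qed
qed

text \<open>Interface of the symmetrization criterion: whatever the unsymmetrized formula, the
  resulting form is known through its diagonal and the derivative of its diagonal.\<close>

lemma symmetrize_Der: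
  assumes F: "multiadditive S S n F" and p: "p = int n"
    and K: "\<And>c d. \<lbrakk>c \<in> cS; d \<in> cS\<rbrakk> \<Longrightarrow>
      (\<Oplus>i\<in>{..<n}. F (replicate i c @ d # replicate (n - Suc i) c)) = K c d"
    and der: "\<And>c. c \<in> cS \<Longrightarrow> derivation_on R S (K c)"
  shows "restrict (symmetrize S F) (tuples S n) \<in> Der p"
    and "\<And>c. c \<in> cS \<Longrightarrow> diag S p (restrict (symmetrize S F) (tuples S n)) c = F (replicate n c)"
    and "\<And>c d. \<lbrakk>c \<in> cS; d \<in> cS\<rbrakk>
      \<Longrightarrow> diag_deriv S p (restrict (symmetrize S F) (tuples S n)) c d = K c d"
proof -
  note * = symmetrize_multiderivation[OF F K der]
  show "restrict (symmetrize S F) (tuples S n) \<in> Der p" unfolding p by (rule *(1))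
  show "diag S p (restrict (symmetrize S F) (tuples S n)) c = F (replicate n c)" if "c \<in> cS" for c
    using *(2) that by (simp add: diag_def p)
  show "diag_deriv S p (restrict (symmetrize S F) (tuples S n)) c d = K c d"
    if c: "c \<in> cS" and d: "d \<in> cS" for c d
  proof (cases n)
    case 0
    then show ?thesis using K[OF c d] by (simp add: diag_deriv_def p)
  next
    case (Suc m)
    then have "[n] \<cdot> symmetrize S F (d # replicate m c) = K c d" using *(3) c d by blast
    moreover have "diag_deriv S p h c d = [n] \<cdot> h (d # replicate m c)" for h
      unfolding diag_deriv_def p nat_int by (simp add: Suc del: M.add.nat_pow_Suc)
    ultimately show ?thesis using c d by (simp add: Suc del: M.add.nat_pow_Suc)
  qed
qed

lemma zero_form:
  "(\<lambda>xs \<in> args S p. \<zero>) \<in> Der p"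
  "diag S p (\<lambda>xs \<in> args S p. \<zero>) c = \<zero> \<or> c \<notin> cS"
  "diag_deriv S p (\<lambda>xs \<in> args S p. \<zero>) c d = \<zero> \<or> c \<notin> cS \<or> d \<notin> cS"
proof -
  have "xs @ y # ys \<in> args S p" if "xs @ x # ys \<in> args S p" "y \<in> cS" for xs ys x y
    using that by (auto simp: args_def)
  then show "(\<lambda>xs \<in> args S p. \<zero>) \<in> Der p"
    by (simp add: symmetric_multiderivations_def)
  show "diag S p (\<lambda>xs \<in> args S p. \<zero>) c = \<zero> \<or> c \<notin> cS"
    by (auto simp: diag_def args_nonneg)
  have "d # replicate (nat p - 1) c \<in> tuples S (nat p)" if "\<not> p < 1" "c \<in> cS" "d \<in> cS"
    using that by (auto simp: tuples_def)
  then show "diag_deriv S p (\<lambda>xs \<in> args S p. \<zero>) c d = \<zero> \<or> c \<notin> cS \<or> d \<notin> cS"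
    by (auto simp: diag_deriv_def args_nonneg)
qed

section \<open>The product of two forms\<close>

lemma sym_mult_nat:
  assumes f: "f \<in> Der (int p)" and g: "g \<in> Der (int q)"
  shows "sym_mult S (int p) (int q) f g \<in> Der (int p + int q)"
    and "\<And>c. c \<in> cS \<Longrightarrow> diag S (int p + int q) (sym_mult S (int p) (int q) f g) c =
      diag S (int p) f c \<otimes> diag S (int q) g c"
    and "\<And>c d. \<lbrakk>c \<in> cS; d \<in> cS\<rbrakk> \<Longrightarrow> diag_deriv S (int p + int q) (sym_mult S (int p) (int q) f g) c d =
      diag_deriv S (int p) f c d \<otimes> diag S (int q) g c \<oplus> diag S (int p) f c \<otimes> diag_deriv S (int q) g c d"
proof -
  let ?F = "\<lambda>ys. f (take p ys) \<otimes> g (drop p ys)"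
  note f' = multiderivationD[OF f] and g' = multiderivationD[OF g]
  have td: "take p xs \<in> tuples S p" "drop p xs \<in> tuples S q" if "xs \<in> tuples S (p + q)" for xs
    using that set_take_subset[of p xs] set_drop_subset[of p xs] by (auto simp: tuples_def)
  have fc: "f xs \<in> cS" if "xs \<in> tuples S p" for xs using multiadditive_closed[OF f'(2) that] .
  have gc: "g xs \<in> cS" if "xs \<in> tuples S q" for xs using multiadditive_closed[OF g'(2) that] .
  have F: "multiadditive S S (p + q) ?F"
    unfolding multiadditive_def
  proof (intro conjI ballI allI impI)
    show "?F xs \<in> cS" if "xs \<in> tuples S (p + q)" for xs using td[OF that] fc gc by simp
    fix xs ys x y assume x: "x \<in> cS" and y: "y \<in> cS" and mem: "xs @ x # ys \<in> tuples S (p + q)"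
    then have mem': "xs @ y # ys \<in> tuples S (p + q)" by (auto simp: tuples_def)
    show "?F (xs @ (x \<oplus> y) # ys) = ?F (xs @ x # ys) \<oplus> ?F (xs @ y # ys)"
    proof (cases "length xs < p")
      case True
      then obtain k where "p = length xs + Suc k" by (metis add_Suc_right less_imp_Suc_add)
      then have "take p (xs @ z # ys) = xs @ z # take k ys" "drop p (xs @ z # ys) = drop k ys" for z
        by simp_all
      then show ?thesis using td[OF mem] td[OF mem'] fc gc multiadditive_add[OF f'(2) x y]
        by (simp add: l_distr)
    next
      case False
      then have "take p (xs @ z # ys) = take p xs" "drop p (xs @ z # ys) = drop p xs @ z # ys" for z
        by simp_all
      then show ?thesis using td[OF mem] td[OF mem'] fc gc multiadditive_add[OF g'(2) x y]
        by (simp add: r_distr)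
    qed
  qed
  let ?K = "\<lambda>c d. diag_deriv S (int p) f c d \<otimes> diag S (int q) g c \<oplus> diag S (int p) f c \<otimes> diag_deriv S (int q) g c d"
  \<comment> \<open>The argument d sits either among the p arguments of f or among the q arguments
    of g; this is the product rule for the two diagonals.\<close>
  have K: "(\<Oplus>i\<in>{..<p + q}. ?F (replicate i c @ d # replicate (p + q - Suc i) c)) = ?K c d"
    if c: "c \<in> cS" and d: "d \<in> cS" for c d
  proof -
    have mem: "replicate i c @ d # replicate (n - Suc i) c \<in> tuples S n" if "i < n" for i n
      using c d that by (auto simp: tuples_def)
    have df: "(\<Oplus>i\<in>{..<n}. h (replicate i c @ d # replicate (n - Suc i) c)) = diag_deriv S (int n) h c d"
      if h: "h \<in> Der (int n)" for n h
    proof (cases n)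
      case (Suc m)
      have "diag_deriv S (int n) h c d = [n] \<cdot> h (d # replicate m c)"
        unfolding diag_deriv_def nat_int by (simp add: Suc del: M.add.nat_pow_Suc)
      then show ?thesis
        using symmetric_insert_sum[OF multiderivationD(2,3)[OF h, unfolded Suc] c d]
        by (simp add: Suc del: M.add.nat_pow_Suc)
    qed (simp add: diag_deriv_def)
    have 1: "(\<Oplus>i\<in>{..<p}. ?F (replicate i c @ d # replicate (p + q - Suc i) c)) =
      (\<Oplus>i\<in>{..<p}. f (replicate i c @ d # replicate (p - Suc i) c) \<otimes> g (replicate q c))"
    proof (rule M.add.finprod_cong')
      fix i assume i: "i \<in> {..<p}"
      then have "replicate i c @ d # replicate (p + q - Suc i) c =
          (replicate i c @ d # replicate (p - Suc i) c) @ replicate q c"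
        using i by (simp add: replicate_add[symmetric])
      moreover have l: "length (replicate i c @ d # replicate (p - Suc i) c) = p" using i by auto
      ultimately show "?F (replicate i c @ d # replicate (p + q - Suc i) c) =
          f (replicate i c @ d # replicate (p - Suc i) c) \<otimes> g (replicate q c)"
        by (metis append_eq_conv_conj)
    qed (use c fc gc mem in auto)
    have 2: "(\<Oplus>j\<in>{..<q}. ?F (replicate (p + j) c @ d # replicate (p + q - Suc (p + j)) c)) =
      (\<Oplus>j\<in>{..<q}. f (replicate p c) \<otimes> g (replicate j c @ d # replicate (q - Suc j) c))"
      using c fc gc mem by (intro M.add.finprod_cong') (auto simp: replicate_add)
    have "(\<Oplus>i\<in>{..<p + q}. ?F (replicate i c @ d # replicate (p + q - Suc i) c)) =
      (\<Oplus>i\<in>{..<p}. ?F (replicate i c @ d # replicate (p + q - Suc i) c)) \<oplus>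
      (\<Oplus>j\<in>{..<q}. ?F (replicate (p + j) c @ d # replicate (p + q - Suc (p + j)) c))"
      using multiadditive_closed[OF F mem] by (intro M.finsum_lessThan_add) auto
    also have "\<dots> = (\<Oplus>i\<in>{..<p}. f (replicate i c @ d # replicate (p - Suc i) c)) \<otimes> g (replicate q c) \<oplus>
        f (replicate p c) \<otimes> (\<Oplus>j\<in>{..<q}. g (replicate j c @ d # replicate (q - Suc j) c))"
      unfolding 1 2 using c fc gc mem by (subst finsum_ldistr) (auto simp: finsum_rdistr)
    finally show ?thesis unfolding df[OF f] df[OF g] by (simp add: diag_def)
  qed
  have der: "derivation_on R S (?K c)" if c: "c \<in> cS" for c
  proof -
    note D = diag_deriv_derivation[OF f c] diag_deriv_derivation[OF g c]
    have "derivation_on R S (\<lambda>d. diag S (int q) g c \<otimes> diag_deriv S (int p) f c d \<oplus> diag S (int p) f c \<otimes> diag_deriv S (int q) g c d)"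
      by (intro derivation_on_add derivation_on_scale D diag_closed f g c)
    moreover have "derivation_on R S (?K c) = derivation_on R S (\<lambda>d. diag S (int q) g c \<otimes> diag_deriv S (int p) f c d \<oplus> diag S (int p) f c \<otimes> diag_deriv S (int q) g c d)"
      unfolding derivation_on_def using derivation_onD(1)[OF D(1)] diag_closed[OF g c]
      by (intro ball_cong refl) (simp add: m_comm)
    ultimately show ?thesis by simp
  qed
  have eq: "sym_mult S (int p) (int q) f g = restrict (symmetrize S ?F) (tuples S (p + q))"
    unfolding sym_mult_def of_nat_add[symmetric] args_int by (simp add: restrict_def)
  show "sym_mult S (int p) (int q) f g \<in> Der (int p + int q)"
    unfolding eq by (rule symmetrize_Der(1)[where K = ?K, OF F of_nat_add[symmetric]]) (rule K der, assumption+)+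
  show "diag S (int p + int q) (sym_mult S (int p) (int q) f g) c = diag S (int p) f c \<otimes> diag S (int q) g c"
    if "c \<in> cS" for c
  proof -
    have "diag S (int p + int q) (sym_mult S (int p) (int q) f g) c = ?F (replicate (p + q) c)"
      unfolding eq by (rule symmetrize_Der(2)[where K = ?K, OF F of_nat_add[symmetric] _ _ that]) (rule K der, assumption+)+
    then show ?thesis by (simp add: diag_def)
  qed
  show "diag_deriv S (int p + int q) (sym_mult S (int p) (int q) f g) c d = ?K c d"
    if "c \<in> cS" "d \<in> cS" for c d
    unfolding eq by (rule symmetrize_Der(3)[where K = ?K, OF F of_nat_add[symmetric] _ _ that]) (rule K der, assumption+)+
qed

end


section \<open>The bracket of two forms\<close>

lemma (in abelian_group) finsum_diff:
  assumes "f \<in> A \<rightarrow> carrier G" "g \<in> A \<rightarrow> carrier G"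
  shows "(\<Oplus>i\<in>A. f i \<ominus> g i) = (\<Oplus>i\<in>A. f i) \<ominus> (\<Oplus>i\<in>A. g i)"
proof -
  have cl: "(\<Oplus>i\<in>A. g i) \<in> carrier G" "(\<Oplus>i\<in>A. f i \<ominus> g i) \<in> carrier G" "(\<Oplus>i\<in>A. f i) \<in> carrier G"
    using assms by (auto intro!: finsum_closed simp: Pi_def)
  have "(\<Oplus>i\<in>A. f i) = (\<Oplus>i\<in>A. (f i \<ominus> g i) \<oplus> g i)"
    using assms by (intro finsum_cong') (auto simp: a_minus_def a_assoc l_neg Pi_def)
  also have "\<dots> = (\<Oplus>i\<in>A. f i \<ominus> g i) \<oplus> (\<Oplus>i\<in>A. g i)"
    using assms by (intro finsum_addf) auto
  finally show ?thesis using cl by (simp add: a_minus_def a_assoc r_neg)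
qed

context rational_algebra
begin

lemma derivation_on_cong:
  assumes "\<And>x. x \<in> cS \<Longrightarrow> \<delta> x = \<epsilon> x"
  shows "derivation_on R S \<delta> \<longleftrightarrow> derivation_on R S \<epsilon>"
  unfolding derivation_on_def by (intro ball_cong refl) (simp add: assms)

text \<open>One of the two terms of the bracket: f with g inserted into its last slot. Its
  derivative in direction d has two contributions. With d in one of the p - 1 free slots of f it is
  a second derivative of f; with d inside g it is the first derivative of f in the direction of the
  derivative of g.\<close>

lemma bracket_half:
  fixes p q n :: nat and f g :: "'c list \<Rightarrow> 'c"
  defines "T \<equiv> (\<lambda>ys. [p] \<cdot> f (take (p - 1) ys @ [g (drop (p - 1) ys)]))"
  assumes f: "f \<in> Der (int p)" and g: "g \<in> Der (int q)" and n: "p + q = Suc n"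
  shows "multiadditive S S n T"
    and "\<And>c. c \<in> cS \<Longrightarrow> T (replicate n c) = diag_deriv S (int p) f c (diag S (int q) g c)"
    and "\<And>c d. \<lbrakk>c \<in> cS; d \<in> cS\<rbrakk> \<Longrightarrow>
      (\<Oplus>i\<in>{..<n}. T (replicate i c @ d # replicate (n - Suc i) c)) =
        diag_deriv2 S (int p) f c (diag S (int q) g c) d \<oplus> diag_deriv S (int p) f c (diag_deriv S (int q) g c d)"
proof -
  have "multiadditive S S n T \<and>
    (\<forall>c \<in> carrier S. T (replicate n c) = diag_deriv S (int p) f c (diag S (int q) g c)) \<and>
    (\<forall>c \<in> carrier S. \<forall>d \<in> carrier S.
      (\<Oplus>i\<in>{..<n}. T (replicate i c @ d # replicate (n - Suc i) c)) =
        diag_deriv2 S (int p) f c (diag S (int q) g c) d \<oplus> diag_deriv S (int p) f c (diag_deriv S (int q) g c d))"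
  proof (cases p)
    \<comment> \<open>The inserted value is meaningless for p = 0, but it is multiplied by
      0.\<close>
    case 0
    then have "T = (\<lambda>_. \<zero>)" by (simp add: T_def)
    then show ?thesis by (simp add: multiadditive_def diag_deriv_def diag_deriv2_def 0)
  next
    case (Suc k)
    note f' = multiderivationD[OF f, unfolded Suc] and g' = multiderivationD[OF g]
    have nk: "n = k + q" using n Suc by simp
    let ?B = "\<lambda>ys. f (take k ys @ [g (drop k ys)])"
    have T: "T = (\<lambda>ys. [(Suc k)] \<cdot> ?B ys)" by (simp add: T_def Suc del: M.add.nat_pow_Suc)
    have td: "take k xs \<in> tuples S k" "drop k xs \<in> tuples S q" if "xs \<in> tuples S n" for xs
      using that set_take_subset[of k xs] set_drop_subset[of k xs] by (auto simp: tuples_def nk)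
    have fc: "f xs \<in> cS" if "xs \<in> tuples S (Suc k)" for xs using multiadditive_closed[OF f'(2) that] .
    have gc: "g xs \<in> cS" if "xs \<in> tuples S q" for xs using multiadditive_closed[OF g'(2) that] .
    have snoc: "xs @ [z] \<in> tuples S (Suc k)" if "xs \<in> tuples S k" "z \<in> cS" for xs z
      using that by (auto simp: tuples_def)
    have Bc: "?B xs \<in> cS" if "xs \<in> tuples S n" for xs
      using td[OF that] by (intro fc snoc gc)
    have Badd: "?B (xs @ (x \<oplus> y) # ys) = ?B (xs @ x # ys) \<oplus> ?B (xs @ y # ys)"
      if x: "x \<in> cS" and y: "y \<in> cS" and mem: "xs @ x # ys \<in> tuples S n" for xs ys x y
    proof -
      have mem': "xs @ y # ys \<in> tuples S n" using mem y by (auto simp: tuples_def)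
      show ?thesis
      proof (cases "length xs < k")
        case True
        then obtain l where "k = length xs + Suc l" by (metis add_Suc_right less_imp_Suc_add)
        then have e: "take k (xs @ z # ys) = xs @ z # take l ys" "drop k (xs @ z # ys) = drop l ys" for z
          by simp_all
        have "xs @ x # take l ys @ [g (drop l ys)] \<in> tuples S (Suc k)"
          using snoc[OF td(1)[OF mem] gc[OF td(2)[OF mem]]] unfolding e by simp
        from multiadditive_add[OF f'(2) x y this] show ?thesis unfolding e by simp
      next
        case False
        then have e: "take k (xs @ z # ys) = take k xs" "drop k (xs @ z # ys) = drop k xs @ z # ys" for z
          by simp_all
        have a: "g (drop k xs @ (x \<oplus> y) # ys) = g (drop k xs @ x # ys) \<oplus> g (drop k xs @ y # ys)"
          using multiadditive_add[OF g'(2) x y] td(2)[OF mem] unfolding e by blast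
        have c: "g (drop k xs @ x # ys) \<in> cS" "g (drop k xs @ y # ys) \<in> cS"
          using gc td(2)[OF mem] td(2)[OF mem'] unfolding e by blast+
        have "take k xs @ [g (drop k xs @ x # ys)] \<in> tuples S (Suc k)"
          using snoc[OF td(1)[OF mem] gc[OF td(2)[OF mem]]] unfolding e .
        from multiadditive_add[OF f'(2) c this] show ?thesis unfolding e a .
      qed
    qed
    have ma: "multiadditive S S n T"
      unfolding multiadditive_def T
    proof (intro conjI ballI allI impI)
      show "[(Suc k)] \<cdot> ?B xs \<in> cS" if "xs \<in> tuples S n" for xs
        using Bc[OF that] by (simp del: M.add.nat_pow_Suc)
      fix xs ys x y assume x: "x \<in> cS" and y: "y \<in> cS" and mem: "xs @ x # ys \<in> tuples S n"
      then have mem': "xs @ y # ys \<in> tuples S n" by (auto simp: tuples_def)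
      show "[(Suc k)] \<cdot> ?B (xs @ (x \<oplus> y) # ys) =
          [(Suc k)] \<cdot> ?B (xs @ x # ys) \<oplus> [(Suc k)] \<cdot> ?B (xs @ y # ys)"
        unfolding Badd[OF x y mem] by (rule M.add.nat_pow_distrib[OF Bc[OF mem] Bc[OF mem']])
    qed
    have rot: "f (xs @ [z]) = f (z # xs)" if "xs \<in> tuples S k" "z \<in> cS" for xs z
      by (rule symmetric_formD[OF f'(3) snoc[OF that]]) simp
    have df: "diag_deriv S (int p) f c z = [(Suc k)] \<cdot> f (z # replicate k c)" for c z
      unfolding diag_deriv_def nat_int by (simp add: Suc del: M.add.nat_pow_Suc)
    have "T (replicate n c) = diag_deriv S (int p) f c (diag S (int q) g c)" if c: "c \<in> cS" for c
      unfolding T df using c gc rot by (simp add: nk diag_def del: M.add.nat_pow_Suc)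
    moreover have "(\<Oplus>i\<in>{..<n}. T (replicate i c @ d # replicate (n - Suc i) c)) =
        diag_deriv2 S (int p) f c (diag S (int q) g c) d \<oplus> diag_deriv S (int p) f c (diag_deriv S (int q) g c d)"
      if c: "c \<in> cS" and d: "d \<in> cS" for c d
    proof -
      have mem: "replicate i c @ d # replicate (m - Suc i) c \<in> tuples S m" if "i < m" for i m
        using c d that by (auto simp: tuples_def)
      have perm: "mset (replicate i c @ d # replicate (m - i) c) = mset (d # replicate m c)" if "i \<le> m" for i m
        using that by (intro multiset_eqI) auto
      let ?G = "g (replicate q c)"
      have G: "?G \<in> cS" using c gc by simp
      \<comment> \<open>The k free slots and the factor p = k + 1 make up p (p - 1), the factor in
        \<open>diag_deriv2\<close>; for k = 0 both sides are zero.\<close>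
      have d2: "[k] \<cdot> ([(Suc k)] \<cdot> f (d # ?G # replicate (k - 1) c)) = diag_deriv2 S (int p) f c (diag S (int q) g c) d"
      proof (cases k)
        case 0
        then show ?thesis by (simp add: diag_deriv2_def Suc)
      next
        case (Suc l)
        have "f (d # ?G # replicate (k - 1) c) \<in> cS" using c d G by (intro fc) (simp add: Suc)
        then have "[k] \<cdot> ([(Suc k)] \<cdot> f (d # ?G # replicate (k - 1) c)) =
          [(Suc k * k)] \<cdot> f (d # ?G # replicate (k - 1) c)"
          by (simp only: M.add.nat_pow_pow)
        also have "\<dots> = diag_deriv2 S (int p) f c d (diag S (int q) g c)"
          unfolding diag_deriv2_def \<open>p = Suc k\<close> nat_int by (simp add: Suc diag_def del: M.add.nat_pow_Suc mult_Suc mult_Suc_right)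
        also have "\<dots> = diag_deriv2 S (int p) f c (diag S (int q) g c) d"
          by (rule diag_deriv2_commute[OF f c d diag_closed[OF g c]])
        finally show ?thesis .
      qed
      have 1: "(\<Oplus>i\<in>{..<k}. T (replicate i c @ d # replicate (n - Suc i) c)) =
        (\<Oplus>i\<in>{..<k}. [(Suc k)] \<cdot> f (d # ?G # replicate (k - 1) c))"
      proof (rule M.add.finprod_cong')
        fix i assume i: "i \<in> {..<k}"
        then have "replicate (n - Suc i) c = replicate (k - Suc i) c @ replicate q c"
          unfolding replicate_add[symmetric] nk by auto
        then have "replicate i c @ d # replicate (n - Suc i) c = (replicate i c @ d # replicate (k - Suc i) c) @ replicate q c"
          by simp
        moreover have l: "length (replicate i c @ d # replicate (k - Suc i) c) = k" using i by auto
        ultimately have "T (replicate i c @ d # replicate (n - Suc i) c) =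
          [(Suc k)] \<cdot> f ((replicate i c @ d # replicate (k - Suc i) c) @ [?G])"
          unfolding T by (metis append_eq_conv_conj)
        also have "f ((replicate i c @ d # replicate (k - Suc i) c) @ [?G]) = f (d # ?G # replicate (k - 1) c)"
          using i by (intro symmetric_formD[OF f'(3) snoc[OF mem G]]) (auto intro!: multiset_eqI)
        finally show "T (replicate i c @ d # replicate (n - Suc i) c) =
          [(Suc k)] \<cdot> f (d # ?G # replicate (k - 1) c)" .
      next
        show "(\<lambda>i. [(Suc k)] \<cdot> f (d # ?G # replicate (k - 1) c)) \<in> {..<k} \<rightarrow> cS"
          using c d G by (cases k) (auto intro!: fc M.add.nat_pow_closed simp del: M.add.nat_pow_Suc)
      qed simp
      have fd: "derivation_on R S (\<lambda>z. f (z # replicate k c))"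
        using f'(4)[OF refl] c by blast
      \<comment> \<open>By symmetry of g the position of d inside g does not matter, so all q
        summands agree.\<close>
      have 2: "(\<Oplus>j\<in>{..<q}. T (replicate (k + j) c @ d # replicate (n - Suc (k + j)) c)) =
        (\<Oplus>j\<in>{..<q}. [(Suc k)] \<cdot> f (g (d # replicate (q - 1) c) # replicate k c))"
      proof (rule M.add.finprod_cong')
        fix j assume j: "j \<in> {..<q}"
        then have q1: "q - Suc j = q - 1 - j" "j \<le> q - 1" "q = Suc (q - 1)" by auto
        have gm: "g (replicate j c @ d # replicate (q - Suc j) c) = g (d # replicate (q - 1) c)"
          using symmetric_formD[OF g'(3) mem, of j] j perm[OF q1(2)] unfolding q1(1) by blast
        have "T (replicate (k + j) c @ d # replicate (n - Suc (k + j)) c) =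
          [(Suc k)] \<cdot> f (replicate k c @ [g (replicate j c @ d # replicate (q - Suc j) c)])"
          unfolding T by (simp add: replicate_add nk del: M.add.nat_pow_Suc)
        also have "\<dots> = [(Suc k)] \<cdot> f (g (d # replicate (q - 1) c) # replicate k c)"
          unfolding gm using c d j gc rot[of "replicate k c" "g (d # replicate (q - 1) c)"]
          by (metis Cons_in_tuples q1(3) replicate_in_tuples)
        finally show "T (replicate (k + j) c @ d # replicate (n - Suc (k + j)) c) =
          [(Suc k)] \<cdot> f (g (d # replicate (q - 1) c) # replicate k c)" .
      next
        show "(\<lambda>j. [(Suc k)] \<cdot> f (g (d # replicate (q - 1) c) # replicate k c)) \<in> {..<q} \<rightarrow> cS"
          using c d by (cases q) (auto intro!: fc gc M.add.nat_pow_closed simp del: M.add.nat_pow_Suc)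
      qed simp
      have "(\<Oplus>i\<in>{..<n}. T (replicate i c @ d # replicate (n - Suc i) c)) =
        (\<Oplus>i\<in>{..<k}. T (replicate i c @ d # replicate (n - Suc i) c)) \<oplus>
        (\<Oplus>j\<in>{..<q}. T (replicate (k + j) c @ d # replicate (n - Suc (k + j)) c))"
        unfolding nk using multiadditive_closed[OF ma mem] nk by (intro M.finsum_lessThan_add) auto
      also have "(\<Oplus>i\<in>{..<k}. T (replicate i c @ d # replicate (n - Suc i) c)) =
        diag_deriv2 S (int p) f c (diag S (int q) g c) d"
      proof (cases k)
        case 0
        then show ?thesis unfolding d2[symmetric] by simp
      next
        case (Suc l)
        have "f (d # ?G # replicate (k - 1) c) \<in> cS" using c d G by (intro fc) (simp add: Suc)
        then show ?thesis unfolding 1 d2[symmetric] by (simp add: M.add.finprod_const del: M.add.nat_pow_Suc)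
      qed
      also have "(\<Oplus>j\<in>{..<q}. T (replicate (k + j) c @ d # replicate (n - Suc (k + j)) c)) =
        diag_deriv S (int p) f c (diag_deriv S (int q) g c d)"
      proof (cases q)
        case 0
        have "f (\<zero> # replicate k c) = \<zero>" using derivation_on_arith(1)[OF fd] .
        then show ?thesis unfolding df by (simp add: 0 diag_deriv_def del: M.add.nat_pow_Suc)
      next
        case (Suc m)
        let ?z = "g (d # replicate (q - 1) c)"
        have z: "?z \<in> cS" using c d by (intro gc) (simp add: Suc)
        have fz: "f (?z # replicate k c) \<in> cS" using derivation_onD(1)[OF fd z] .
        have dg: "diag_deriv S (int q) g c d = [q] \<cdot> ?z"
          unfolding diag_deriv_def nat_int by (simp add: Suc del: M.add.nat_pow_Suc)
        have "(\<Oplus>j\<in>{..<q}. [(Suc k)] \<cdot> f (?z # replicate k c)) = [q] \<cdot> ([(Suc k)] \<cdot> f (?z # replicate k c))"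
          using fz by (simp add: M.add.finprod_const del: M.add.nat_pow_Suc)
        also have "\<dots> = [(Suc k)] \<cdot> ([q] \<cdot> f (?z # replicate k c))"
          using fz by (simp only: M.add.nat_pow_pow mult.commute)
        finally show ?thesis unfolding 2 df dg derivation_on_arith(4)[OF fd z] .
      qed
      finally show ?thesis .
    qed
    ultimately show ?thesis using ma by blast
  qed
  then show "multiadditive S S n T"
    and "\<And>c. c \<in> cS \<Longrightarrow> T (replicate n c) = diag_deriv S (int p) f c (diag S (int q) g c)"
    and "\<And>c d. \<lbrakk>c \<in> cS; d \<in> cS\<rbrakk> \<Longrightarrow>
      (\<Oplus>i\<in>{..<n}. T (replicate i c @ d # replicate (n - Suc i) c)) =
        diag_deriv2 S (int p) f c (diag S (int q) g c) d \<oplus> diag_deriv S (int p) f c (diag_deriv S (int q) g c d)"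
    by blast+
qed

lemma sym_bracket_nat:
  assumes f: "f \<in> Der (int p)" and g: "g \<in> Der (int q)" and n: "p + q = Suc n"
  shows "sym_bracket S (int p) (int q) f g \<in> Der (int n)"
    and "\<And>c. c \<in> cS \<Longrightarrow> diag S (int n) (sym_bracket S (int p) (int q) f g) c =
      diag_deriv S (int p) f c (diag S (int q) g c) \<ominus> diag_deriv S (int q) g c (diag S (int p) f c)"
    and "\<And>c d. \<lbrakk>c \<in> cS; d \<in> cS\<rbrakk> \<Longrightarrow> diag_deriv S (int n) (sym_bracket S (int p) (int q) f g) c d =
      (diag_deriv2 S (int p) f c (diag S (int q) g c) d \<oplus> diag_deriv S (int p) f c (diag_deriv S (int q) g c d)) \<ominus>
      (diag_deriv2 S (int q) g c (diag S (int p) f c) d \<oplus> diag_deriv S (int q) g c (diag_deriv S (int p) f c d))"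
proof -
  let ?T = "\<lambda>ys. [p] \<cdot> f (take (p - 1) ys @ [g (drop (p - 1) ys)])"
  let ?U = "\<lambda>ys. [q] \<cdot> g (take (q - 1) ys @ [f (drop (q - 1) ys)])"
  let ?F = "\<lambda>ys. ?T ys \<ominus> ?U ys"
  let ?K = "\<lambda>c d. (diag_deriv2 S (int p) f c (diag S (int q) g c) d \<oplus> diag_deriv S (int p) f c (diag_deriv S (int q) g c d)) \<ominus>
      (diag_deriv2 S (int q) g c (diag S (int p) f c) d \<oplus> diag_deriv S (int q) g c (diag_deriv S (int p) f c d))"
  note T = bracket_half[OF f g n]
  note U = bracket_half[OF g f, of n] 
  have n': "q + p = Suc n" using n by simp
  have F: "multiadditive S S n ?F" by (rule multiadditive_diff[OF T(1) U(1)[OF n']])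
  have K: "(\<Oplus>i\<in>{..<n}. ?F (replicate i c @ d # replicate (n - Suc i) c)) = ?K c d"
    if c: "c \<in> cS" and d: "d \<in> cS" for c d
  proof -
    have mem: "replicate i c @ d # replicate (n - Suc i) c \<in> tuples S n" if "i < n" for i
      using c d that by (auto simp: tuples_def)
    show ?thesis
      unfolding T(3)[OF c d, symmetric] U(3)[OF n' c d, symmetric]
    proof (rule M.finsum_diff)
      show "(\<lambda>i. ?T (replicate i c @ d # replicate (n - Suc i) c)) \<in> {..<n} \<rightarrow> cS"
        by (rule Pi_I, rule multiadditive_closed[OF T(1)], rule mem) simp
      show "(\<lambda>i. ?U (replicate i c @ d # replicate (n - Suc i) c)) \<in> {..<n} \<rightarrow> cS"
        by (rule Pi_I, rule multiadditive_closed[OF U(1)[OF n']], rule mem) simp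
    qed
  qed
  have der: "derivation_on R S (?K c)" if c: "c \<in> cS" for c
  proof -
    note D = diag_deriv_derivation[OF f c] diag_deriv_derivation[OF g c]
    note D2 = diag_deriv2_derivation(1)[OF f c diag_closed[OF g c]] diag_deriv2_derivation(1)[OF g c diag_closed[OF f c]]
    \<comment> \<open>Regrouped so that each part is visibly a derivation in d: the second
      derivatives singly, the two composites of first derivatives only as a commutator.\<close>
    let ?L = "\<lambda>d. (diag_deriv2 S (int p) f c (diag S (int q) g c) d \<oplus>
        (\<ominus> diag_deriv2 S (int q) g c (diag S (int p) f c) d)) \<oplus>
      (diag_deriv S (int p) f c (diag_deriv S (int q) g c d) \<ominus> diag_deriv S (int q) g c (diag_deriv S (int p) f c d))"
    have L: "derivation_on R S ?L"
      by (rule derivation_on_add[OF derivation_on_add[OF D2(1) derivation_on_uminus[OF D2(2)]] derivation_on_commutator[OF D]])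
    have "?K c d = ?L d" if d: "d \<in> cS" for d
    proof -
      have "(a \<oplus> b) \<ominus> (a' \<oplus> b') = (a \<oplus> \<ominus> a') \<oplus> (b \<ominus> b')"
        if "a \<in> cS" "a' \<in> cS" "b \<in> cS" "b' \<in> cS" for a b a' b'
        using that by (simp add: a_minus_def M.minus_add M.a_ac)
      then show ?thesis using derivation_onD(1)[OF D(1)] derivation_onD(1)[OF D(2)] derivation_onD(1)[OF D2(1)] derivation_onD(1)[OF D2(2)] d
        by simp
    qed
    then show ?thesis by (rule derivation_on_cong[THEN iffD2, OF _ L])
  qed
  have eq: "sym_bracket S (int p) (int q) f g = restrict (symmetrize S ?F) (tuples S n)"
  proof -
    have "int p + int q - 1 = int n" using n by linarith
    then show ?thesis unfolding sym_bracket_def by (simp add: restrict_def)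
  qed
  show "sym_bracket S (int p) (int q) f g \<in> Der (int n)"
    unfolding eq by (rule symmetrize_Der(1)[where K = ?K, OF F refl]) (rule K der, assumption+)+
  show "diag S (int n) (sym_bracket S (int p) (int q) f g) c =
      diag_deriv S (int p) f c (diag S (int q) g c) \<ominus> diag_deriv S (int q) g c (diag S (int p) f c)"
    if c: "c \<in> cS" for c
  proof -
    have "diag S (int n) (sym_bracket S (int p) (int q) f g) c = ?F (replicate n c)"
      unfolding eq by (rule symmetrize_Der(2)[where K = ?K, OF F refl _ _ c]) (rule K der, assumption+)+
    then show ?thesis unfolding T(2)[OF c] U(2)[OF n' c] .
  qed
  show "diag_deriv S (int n) (sym_bracket S (int p) (int q) f g) c d = ?K c d"
    if "c \<in> cS" "d \<in> cS" for c d
    unfolding eq by (rule symmetrize_Der(3)[where K = ?K, OF F refl _ _ that]) (rule K der, assumption+)+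
qed

text \<open>Extends the rules to all integer degrees; a factor of negative degree gives the zero
  form. The degree n of the result is a variable with an equation, so that differently arranged sums
  of degrees can be matched.\<close>

lemma sym_mult_facts:
  assumes f: "f \<in> Der p" and g: "g \<in> Der q" and n: "n = p + q"
  shows "sym_mult S p q f g \<in> Der n"
    and "\<And>c. c \<in> cS \<Longrightarrow> diag S n (sym_mult S p q f g) c = diag S p f c \<otimes> diag S q g c"
    and "\<And>c d. \<lbrakk>c \<in> cS; d \<in> cS\<rbrakk> \<Longrightarrow> diag_deriv S n (sym_mult S p q f g) c d =
      diag_deriv S p f c d \<otimes> diag S q g c \<oplus> diag S p f c \<otimes> diag_deriv S q g c d"
proof -
  have "sym_mult S p q f g \<in> Der n \<and>
    (\<forall>c \<in> carrier S. diag S n (sym_mult S p q f g) c = diag S p f c \<otimes> diag S q g c) \<and>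
    (\<forall>c \<in> carrier S. \<forall>d \<in> carrier S. diag_deriv S n (sym_mult S p q f g) c d =
      diag_deriv S p f c d \<otimes> diag S q g c \<oplus> diag S p f c \<otimes> diag_deriv S q g c d)"
  proof (cases "p < 0 \<or> q < 0")
    case True
    then have "sym_mult S p q f g = (\<lambda>xs \<in> args S n. \<zero>)" by (simp add: sym_mult_def n restrict_def)
    moreover have "diag S p f c \<otimes> diag S q g c = \<zero>" if "c \<in> cS" for c
      using True diag_closed[OF f that] diag_closed[OF g that] by (auto simp: diag_def)
    moreover have "diag_deriv S p f c d \<otimes> diag S q g c \<oplus> diag S p f c \<otimes> diag_deriv S q g c d = \<zero>"
      if c: "c \<in> cS" and d: "d \<in> cS" for c d
      using True diag_closed[OF f c] diag_closed[OF g c]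
        derivation_onD(1)[OF diag_deriv_derivation[OF f c] d] derivation_onD(1)[OF diag_deriv_derivation[OF g c] d]
      by (auto simp: diag_def diag_deriv_def)
    ultimately show ?thesis using zero_form[of n] by metis
  next
    case False
    then show ?thesis using sym_mult_nat[of f "nat p" g "nat q"] f g n by simp
  qed
  then show "sym_mult S p q f g \<in> Der n"
    and "\<And>c. c \<in> cS \<Longrightarrow> diag S n (sym_mult S p q f g) c = diag S p f c \<otimes> diag S q g c"
    and "\<And>c d. \<lbrakk>c \<in> cS; d \<in> cS\<rbrakk> \<Longrightarrow> diag_deriv S n (sym_mult S p q f g) c d =
      diag_deriv S p f c d \<otimes> diag S q g c \<oplus> diag S p f c \<otimes> diag_deriv S q g c d" by blast+
qed

lemma diag_deriv2_zero_degree: "p < 2 \<Longrightarrow> diag_deriv2 S p f c d e = \<zero>"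
  by (simp add: diag_deriv2_def)

lemma sym_bracket_facts:
  assumes f: "f \<in> Der p" and g: "g \<in> Der q" and n: "n = p + q - 1"
  shows "sym_bracket S p q f g \<in> Der n"
    and "\<And>c. c \<in> cS \<Longrightarrow> diag S n (sym_bracket S p q f g) c =
      diag_deriv S p f c (diag S q g c) \<ominus> diag_deriv S q g c (diag S p f c)"
    and "\<And>c d. \<lbrakk>c \<in> cS; d \<in> cS\<rbrakk> \<Longrightarrow> diag_deriv S n (sym_bracket S p q f g) c d =
      (diag_deriv2 S p f c (diag S q g c) d \<oplus> diag_deriv S p f c (diag_deriv S q g c d)) \<ominus>
      (diag_deriv2 S q g c (diag S p f c) d \<oplus> diag_deriv S q g c (diag_deriv S p f c d))"
proof -
  have "sym_bracket S p q f g \<in> Der n \<and>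
    (\<forall>c \<in> carrier S. diag S n (sym_bracket S p q f g) c =
      diag_deriv S p f c (diag S q g c) \<ominus> diag_deriv S q g c (diag S p f c)) \<and>
    (\<forall>c \<in> carrier S. \<forall>d \<in> carrier S. diag_deriv S n (sym_bracket S p q f g) c d =
      (diag_deriv2 S p f c (diag S q g c) d \<oplus> diag_deriv S p f c (diag_deriv S q g c d)) \<ominus>
      (diag_deriv2 S q g c (diag S p f c) d \<oplus> diag_deriv S q g c (diag_deriv S p f c d)))"
  \<comment> \<open>In degrees (0, 0) the result has degree -1, where the zero form is the only one;
    so this case goes with the negative degrees.\<close>
  proof (cases "p < 0 \<or> q < 0 \<or> (p = 0 \<and> q = 0)")
    case True
    then have "sym_bracket S p q f g = (\<lambda>xs \<in> args S n. \<zero>)"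
      by (auto simp: sym_bracket_def n args_neg restrict_def)
    moreover have "diag_deriv S p f c (diag S q g c) \<ominus> diag_deriv S q g c (diag S p f c) = \<zero>"
      if c: "c \<in> cS" for c
      using True derivation_on_arith(1)[OF diag_deriv_derivation[OF f c]] derivation_on_arith(1)[OF diag_deriv_derivation[OF g c]]
      by (auto simp: diag_def diag_deriv_def a_minus_def)
    moreover have "(diag_deriv2 S p f c (diag S q g c) d \<oplus> diag_deriv S p f c (diag_deriv S q g c d)) \<ominus>
      (diag_deriv2 S q g c (diag S p f c) d \<oplus> diag_deriv S q g c (diag_deriv S p f c d)) = \<zero>"
      if c: "c \<in> cS" and d: "d \<in> cS" for c d
      using True derivation_on_arith(1)[OF diag_deriv_derivation[OF f c]] derivation_on_arith(1)[OF diag_deriv_derivation[OF g c]]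
        derivation_on_arith(1)[OF diag_deriv2_derivation(2)[OF f c d]] derivation_on_arith(1)[OF diag_deriv2_derivation(2)[OF g c d]]
      by (auto simp: diag_def diag_deriv_def diag_deriv2_zero_degree a_minus_def)
    ultimately show ?thesis using zero_form[of n] by metis
  next
    case False
    then obtain m where "nat p + nat q = Suc m" by (cases "nat p + nat q") auto
    moreover from this False have "n = int m" using n by linarith
    ultimately show ?thesis using sym_bracket_nat[of f "nat p" g "nat q" m] f g False by simp
  qed
  then show "sym_bracket S p q f g \<in> Der n"
    and "\<And>c. c \<in> cS \<Longrightarrow> diag S n (sym_bracket S p q f g) c =
      diag_deriv S p f c (diag S q g c) \<ominus> diag_deriv S q g c (diag S p f c)"
    and "\<And>c d. \<lbrakk>c \<in> cS; d \<in> cS\<rbrakk> \<Longrightarrow> diag_deriv S n (sym_bracket S p q f g) c d =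
      (diag_deriv2 S p f c (diag S q g c) d \<oplus> diag_deriv S p f c (diag_deriv S q g c d)) \<ominus>
      (diag_deriv2 S q g c (diag S p f c) d \<oplus> diag_deriv S q g c (diag_deriv S p f c d))" by blast+
qed

end


section \<open>The graded Poisson algebra of symmetric multiderivations\<close>

lemma restrict_scalars_simps [simp]:
  "carrier (restrict_scalars S V) = carrier V"
  "ring.zero (restrict_scalars S V) = ring.zero V"
  "add (restrict_scalars S V) = add V"
  "smult (restrict_scalars S V) r v = smult V (r \<odot>\<^bsub>S\<^esub> \<one>\<^bsub>S\<^esub>) v"
  by (simp_all add: restrict_scalars_def with_smult_def)

lemma abelian_group_cong:
  assumes "abelian_group V" "carrier W = carrier V" "ring.zero W = ring.zero V" "add W = add V"
  shows "abelian_group W"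
proof -
  interpret abelian_group V by fact
  show ?thesis
  proof (rule abelian_groupI)
    show "\<exists>y\<in>carrier W. y \<oplus>\<^bsub>W\<^esub> x = \<zero>\<^bsub>W\<^esub>" if "x \<in> carrier W" for x
      using that assms l_neg a_inv_closed by metis
  qed (simp_all add: assms a_ac)
qed

lemma module_restrict_scalars:
  assumes "algebra R S" "module S V"
  shows "module R (restrict_scalars S V)"
proof -
  interpret algebra R S by fact
  interpret V: module S V by fact
  have "abelian_group (restrict_scalars S V)"
    by (rule abelian_group_cong[OF V.M.abelian_group_axioms]) simp_all
  then show ?thesis
    by (intro moduleI)
      (simp_all add: R_cring V.smult_l_distr V.smult_r_distr V.smult_assoc1[symmetric] smult_l_distr smult_assoc1 smult_assoc2)
qed

lemma sym_component_simps [simp]: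
  "carrier (sym_component R S p) = symmetric_multiderivations R S p"
  "ring.zero (sym_component R S p) = (\<lambda>xs \<in> args S p. \<zero>\<^bsub>S\<^esub>)"
  "add (sym_component R S p) f g = (\<lambda>xs \<in> args S p. f xs \<oplus>\<^bsub>S\<^esub> g xs)"
  "smult (sym_component R S p) c f = (\<lambda>xs \<in> args S p. c \<otimes>\<^bsub>S\<^esub> f xs)"
  by (simp_all add: sym_component_def)

lemma sym_theta_simps [simp]:
  "component (sym_theta R S) p = restrict_scalars S (sym_component R S p)"
  "gmult (sym_theta R S) = sym_mult S" "gone (sym_theta R S) = sym_const S \<one>\<^bsub>S\<^esub>"
  "gbracket (sym_theta R S) = sym_bracket S"
  by (simp_all add: sym_theta_def)

context rational_algebra
begin

lemma Der_negative: "p < 0 \<Longrightarrow> Der p = {\<lambda>_. undefined}"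
proof -
  assume p: "p < 0"
  have "Der p \<subseteq> args S p \<rightarrow>\<^sub>E cS" unfolding symmetric_multiderivations_def by blast
  then have "Der p \<subseteq> {\<lambda>_. undefined}" using p by (simp add: args_neg)
  moreover have "(\<lambda>_. undefined) \<in> Der p" using zero_form(1)[of p] p by (simp add: args_neg restrict_def)
  ultimately show ?thesis by blast
qed

lemma Der_PiE: "f \<in> Der p \<Longrightarrow> f \<in> args S p \<rightarrow>\<^sub>E cS"
  unfolding symmetric_multiderivations_def by blast

lemma Der_value_closed: "f \<in> Der p \<Longrightarrow> xs \<in> args S p \<Longrightarrow> f xs \<in> cS"
  using Der_PiE by (rule PiE_mem)

lemma Der_restrict_eq:
  assumes "f \<in> Der p" and "\<And>xs. xs \<in> args S p \<Longrightarrow> h xs = f xs"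
  shows "(\<lambda>xs \<in> args S p. h xs) = f"
proof
  show "(\<lambda>xs \<in> args S p. h xs) x = f x" for x
    using PiE_arb[OF Der_PiE[OF assms(1)], of x] assms(2) by (cases "x \<in> args S p") simp_all
qed

lemma symmetric_form_restrict:
  assumes "symmetric_form S n h" shows "symmetric_form S n (restrict h (tuples S n))"
  unfolding symmetric_form_def
proof (intro ballI impI)
  fix xs ys assume "xs \<in> tuples S n" "ys \<in> tuples S n" "mset xs = mset ys"
  then show "restrict h (tuples S n) xs = restrict h (tuples S n) ys"
    using symmetric_formD[OF assms, of xs ys] by simp
qed

text \<open>For forms given by a formula h on all lists. In positive degree the derivation property
  already controls the values, so closure is asked in degree 0 alone.\<close>

lemma restricted_form_Der:
  assumes sym: "\<And>n. p = int n \<Longrightarrow> symmetric_form S n h"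
    and der: "\<And>m zs. \<lbrakk>p = int (Suc m); zs \<in> tuples S m\<rbrakk> \<Longrightarrow> derivation_on R S (\<lambda>x. h (x # zs))"
    and const: "p = 0 \<Longrightarrow> h [] \<in> cS"
  shows "(\<lambda>xs \<in> args S p. h xs) \<in> Der p"
proof (cases "p < 0")
  case True
  then show ?thesis by (simp add: Der_negative args_neg restrict_def)
next
  case False
  define n where "n = nat p"
  with False have p: "p = int n" by simp
  let ?h = "restrict h (tuples S n)"
  have "h xs \<in> cS" if "xs \<in> tuples S n" for xs
  proof (cases n)
    case 0
    then show ?thesis using that const p by simp
  next
    case (Suc m)
    with that obtain y ys where "xs = y # ys" "y \<in> cS" "ys \<in> tuples S m"
      by (auto elim: tuples_SucE)
    then show ?thesis using derivation_onD(1)[OF der[of m ys]] p Suc by simp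
  qed
  moreover have "symmetric_form S n ?h"
    using sym[OF p] by (rule symmetric_form_restrict)
  moreover have "derivation_on R S (\<lambda>x. ?h (x # zs))" if "n = Suc m" "zs \<in> tuples S m" for m zs
    by (rule derivation_on_cong[THEN iffD2, OF _ der[of m zs]]) (use that p in simp_all)
  ultimately show ?thesis unfolding p args_int by (intro multiderivationI) auto
qed

lemma Der_symmetric: "f \<in> Der (int n) \<Longrightarrow> symmetric_form S n f"
  by (rule multiderivationD(3))

lemma Der_derivation: "\<lbrakk>f \<in> Der p; p = int (Suc m); zs \<in> tuples S m\<rbrakk> \<Longrightarrow> derivation_on R S (\<lambda>x. f (x # zs))"
  using multiderivationD(4)[of f R S "Suc m"] by simp

lemma add_form_Der:
  assumes "f \<in> Der p" "g \<in> Der p"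
  shows "(\<lambda>xs \<in> args S p. f xs \<oplus> g xs) \<in> Der p"
proof (rule restricted_form_Der)
  show "symmetric_form S n (\<lambda>xs. f xs \<oplus> g xs)" if "p = int n" for n
    using Der_symmetric[of f n] Der_symmetric[of g n] assms that unfolding symmetric_form_def by metis
  show "f [] \<oplus> g [] \<in> cS" if "p = 0"
    using assms Der_value_closed[of _ p "[]"] that by (simp add: args_def)
qed (intro derivation_on_add Der_derivation[OF assms(1)] Der_derivation[OF assms(2)])

lemma scale_form_Der:
  assumes "f \<in> Der p" "c \<in> cS"
  shows "(\<lambda>xs \<in> args S p. c \<otimes> f xs) \<in> Der p"
proof (rule restricted_form_Der)
  show "symmetric_form S n (\<lambda>xs. c \<otimes> f xs)" if "p = int n" for n
    using Der_symmetric[of f n] assms that unfolding symmetric_form_def by metis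
  show "c \<otimes> f [] \<in> cS" if "p = 0"
    using assms Der_value_closed[of _ p "[]"] that by (simp add: args_def)
qed (intro derivation_on_scale assms(2) Der_derivation[OF assms(1)])

lemma const_form_Der: "c \<in> cS \<Longrightarrow> sym_const S c \<in> Der 0"
  unfolding sym_const_def by (rule restricted_form_Der) (auto simp: symmetric_form_def)

lemma module_sym_component: "module S (Form p)"
proof (rule moduleI)
  show "cring S" by (rule M_cring)
  note v = Der_value_closed
  show "abelian_group (Form p)"
  proof (rule abelian_groupI)
    fix x assume x: "x \<in> carrier (Form p)"
    then have "(\<lambda>xs \<in> args S p. (\<ominus> \<one>) \<otimes> x xs) \<in> Der p"
      by (intro scale_form_Der) simp_all
    moreover have "(\<lambda>xs \<in> args S p. (\<lambda>xs \<in> args S p. (\<ominus> \<one>) \<otimes> x xs) xs \<oplus> x xs) = (\<lambda>xs \<in> args S p. \<zero>)"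
      using x v[of x p] by (intro restrict_ext) (simp add: l_minus M.l_neg)
    ultimately show "\<exists>y \<in> carrier (Form p). y \<oplus>\<^bsub>Form p\<^esub> x = \<zero>\<^bsub>Form p\<^esub>"
      by (intro bexI[of _ "\<lambda>xs \<in> args S p. (\<ominus> \<one>) \<otimes> x xs"]) simp_all
    show "\<zero>\<^bsub>Form p\<^esub> \<oplus>\<^bsub>Form p\<^esub> x = x"
      using x v[of x p] by (simp add: Der_restrict_eq)
  qed (auto simp: add_form_Der zero_form v M.a_ac intro!: restrict_ext)
next
  fix x assume "x \<in> carrier (Form p)"
  then show "\<one> \<odot>\<^bsub>Form p\<^esub> x = x"
    using Der_value_closed[of x p] by (simp add: Der_restrict_eq)
qed (auto simp: scale_form_Der Der_value_closed l_distr r_distr m_assoc intro!: restrict_ext)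

lemma module_sym_theta: "module R (restrict_scalars S (Form p))"
  by (rule module_restrict_scalars[OF algebra_axioms module_sym_component])

lemma diag_add:
  "\<lbrakk>f \<in> Der p; g \<in> Der p; c \<in> cS\<rbrakk> \<Longrightarrow>
    diag S p (f \<oplus>\<^bsub>Form p\<^esub> g) c = diag S p f c \<oplus> diag S p g c"
  by (simp add: diag_def args_nonneg)

lemma diag_scale:
  "\<lbrakk>f \<in> Der p; s \<in> cS; c \<in> cS\<rbrakk> \<Longrightarrow>
    diag S p (s \<odot>\<^bsub>Form p\<^esub> f) c = s \<otimes> diag S p f c"
  by (simp add: diag_def args_nonneg)

lemma diag_deriv_add:
  assumes "f \<in> Der p" "g \<in> Der p" "c \<in> cS" "d \<in> cS"
  shows "diag_deriv S p (f \<oplus>\<^bsub>Form p\<^esub> g) c d = diag_deriv S p f c d \<oplus> diag_deriv S p g c d"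
proof (cases "p < 1")
  case False
  have "d # replicate (nat p - 1) c \<in> args S p" using False assms by (auto simp: args_def)
  then show ?thesis using False assms Der_value_closed
    by (simp add: diag_deriv_def M.add.nat_pow_distrib del: One_nat_def)
qed (simp add: diag_deriv_def)

lemma diag_deriv_scale:
  assumes "f \<in> Der p" "s \<in> cS" "c \<in> cS" "d \<in> cS"
  shows "diag_deriv S p (s \<odot>\<^bsub>Form p\<^esub> f) c d = s \<otimes> diag_deriv S p f c d"
proof (cases "p < 1")
  case False
  have "d # replicate (nat p - 1) c \<in> args S p" using False assms by (auto simp: args_def)
  then show ?thesis using False assms Der_value_closed
    by (simp add: diag_deriv_def add_pow_rdistr del: One_nat_def)
qed (simp add: diag_deriv_def assms)

lemma diag_zero: "c \<in> cS \<Longrightarrow> diag S p \<zero>\<^bsub>Form p\<^esub> c = \<zero>"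
  using zero_form(2)[of p c] by simp

lemma diag_uminus:
  assumes f: "f \<in> Der p" and c: "c \<in> cS"
  shows "\<ominus>\<^bsub>restrict_scalars S (Form p)\<^esub> f \<in> Der p"
    and "diag S p (\<ominus>\<^bsub>restrict_scalars S (Form p)\<^esub> f) c = \<ominus> diag S p f c"
proof -
  interpret C: module R "restrict_scalars S (Form p)" by (rule module_sym_theta)
  let ?g = "\<ominus>\<^bsub>restrict_scalars S (Form p)\<^esub> f"
  show g: "?g \<in> Der p" using C.M.a_inv_closed[of f] f by simp
  have "?g \<oplus>\<^bsub>Form p\<^esub> f = \<zero>\<^bsub>Form p\<^esub>" using C.M.l_neg[of f] f by simp
  then have "diag S p ?g c \<oplus> diag S p f c = \<zero>"
    using diag_add[OF g f c] diag_zero[OF c, of p] by simp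
  then show "diag S p ?g c = \<ominus> diag S p f c"
    using M.minus_equality diag_closed[OF g c] diag_closed[OF f c] by metis
qed

lemma diag_sym_const: "c \<in> cS \<Longrightarrow> diag S 0 (sym_const S s) c = s"
  by (simp add: diag_def sym_const_def args_def)

text \<open>Both sides of each identity are determined by their diagonals. There the product is the
  pointwise product of polynomial maps from S to S, and the bracket f'(g) - g'(f) is, up to sign,
  the commutator of polynomial vector fields on S. So the Jacobi identity is that of vector
  fields.\<close>

lemma sym_theta_graded_poisson_algebra: "graded_poisson_algebra R (sym_theta R S)"
proof (rule graded_poisson_algebra.intro)
  note [simp del] = sym_component_simps(2-4)
  note mem = sym_mult_facts(1) sym_bracket_facts(1) add_form_Der[folded sym_component_simps(3)[of R]]
    scale_form_Der[folded sym_component_simps(4)[of R]] zero_form(1)[folded sym_component_simps(2)[of R]]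
  note D = diag_closed derivation_onD(1)[OF diag_deriv_derivation]
  note vals = sym_mult_facts(2) sym_bracket_facts(2) diag_add diag_scale diag_zero
  note deriv = sym_mult_facts(3) sym_bracket_facts(3) diag_deriv_add diag_deriv_scale
  note lin = derivation_onD(3,4)[OF diag_deriv_derivation] derivation_on_arith(2,3)[OF diag_deriv_derivation]
  show "module R (component (sym_theta R S) p)" for p by (simp add: module_sym_theta)
  show "\<exists>p0. \<forall>p<p0. homog (sym_theta R S) p = {\<zero>\<^bsub>component (sym_theta R S) p\<^esub>}"
    by (rule exI[of _ 0]) (simp add: Der_negative sym_component_simps args_neg restrict_def)
  show "gone (sym_theta R S) \<in> homog (sym_theta R S) 0" by (simp add: const_form_Der)
  show "bilinear_map R (component (sym_theta R S) p) (component (sym_theta R S) q)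
      (component (sym_theta R S) (p + q)) (gmult (sym_theta R S) p q)" for p q
    unfolding bilinear_map_def
    by (auto intro!: diag_eqI[of _ "p + q"] simp: mem vals D l_distr r_distr m_ac)
  show "gmult (sym_theta R S) p q x y = gmult (sym_theta R S) q p y x"
    if "x \<in> homog (sym_theta R S) p" "y \<in> homog (sym_theta R S) q" for x y p q
    using that by (auto intro!: diag_eqI[of _ "p + q"] simp: mem vals D m_comm)
  show "gmult (sym_theta R S) (p + q) s (gmult (sym_theta R S) p q x y) z =
      gmult (sym_theta R S) p (q + s) x (gmult (sym_theta R S) q s y z)"
    if "x \<in> homog (sym_theta R S) p" "y \<in> homog (sym_theta R S) q" "z \<in> homog (sym_theta R S) s" for x y z p q s
    using that by (auto intro!: diag_eqI[of _ "p + q + s"] simp: mem vals D m_assoc)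
  show "gmult (sym_theta R S) 0 p (gone (sym_theta R S)) x = x" if "x \<in> homog (sym_theta R S) p" for x p
    using that by (auto intro!: diag_eqI[of _ "p"] simp: mem vals D const_form_Der diag_sym_const)
  show "bilinear_map R (component (sym_theta R S) p) (component (sym_theta R S) q)
      (component (sym_theta R S) (p + q - 1)) (gbracket (sym_theta R S) p q)" for p q
    unfolding bilinear_map_def
  proof (intro conjI ballI)
    fix x y assume "x \<in> carrier (component (sym_theta R S) p)" "y \<in> carrier (component (sym_theta R S) q)"
    then have x: "x \<in> Der p" and y: "y \<in> Der q" by simp_all
    show "gbracket (sym_theta R S) p q x y \<in> carrier (component (sym_theta R S) (p + q - 1))"
      using x y by (simp add: mem)
    \<comment> \<open>The derivative of a form is linear in its direction over R only, so the scalar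
      that is moved out must come from R.\<close>
    have lin0: "\<delta> (s \<otimes> u) = s \<otimes> \<delta> u" if "r \<in> carrier R" "s = r \<odot> \<one>" "u \<in> cS" "derivation_on R S \<delta>" for r s u \<delta>
      using that derivation_onD(1,2)[of R S \<delta> u] by (simp add: smult_eq_mult[symmetric])
    fix r assume r: "r \<in> carrier R"
    have r1: "r \<odot> \<one> \<in> cS" using r by simp
    show "gbracket (sym_theta R S) p q (r \<odot>\<^bsub>component (sym_theta R S) p\<^esub> x) y =
        r \<odot>\<^bsub>component (sym_theta R S) (p + q - 1)\<^esub> gbracket (sym_theta R S) p q x y"
      using x y r1 by (auto intro!: diag_eqI[of _ "p + q - 1"] simp: mem vals deriv D
        lin0[OF r refl _ diag_deriv_derivation] a_minus_def r_distr r_minus)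
    show "gbracket (sym_theta R S) p q x (r \<odot>\<^bsub>component (sym_theta R S) q\<^esub> y) =
        r \<odot>\<^bsub>component (sym_theta R S) (p + q - 1)\<^esub> gbracket (sym_theta R S) p q x y"
      using x y r1 by (auto intro!: diag_eqI[of _ "p + q - 1"] simp: mem vals deriv D
        lin0[OF r refl _ diag_deriv_derivation] a_minus_def r_distr r_minus)
  next
    fix x x' y assume "x \<in> carrier (component (sym_theta R S) p)" "x' \<in> carrier (component (sym_theta R S) p)"
      "y \<in> carrier (component (sym_theta R S) q)"
    then show "gbracket (sym_theta R S) p q (x \<oplus>\<^bsub>component (sym_theta R S) p\<^esub> x') y =
       gbracket (sym_theta R S) p q x y \<oplus>\<^bsub>component (sym_theta R S) (p + q - 1)\<^esub> gbracket (sym_theta R S) p q x' y"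
      by (auto intro!: diag_eqI[of _ "p + q - 1"] simp: mem vals deriv D lin a_minus_def M.minus_add M.a_ac)
  next
    fix x y y' assume "x \<in> carrier (component (sym_theta R S) p)" "y \<in> carrier (component (sym_theta R S) q)"
      "y' \<in> carrier (component (sym_theta R S) q)"
    then show "gbracket (sym_theta R S) p q x (y \<oplus>\<^bsub>component (sym_theta R S) q\<^esub> y') =
       gbracket (sym_theta R S) p q x y \<oplus>\<^bsub>component (sym_theta R S) (p + q - 1)\<^esub> gbracket (sym_theta R S) p q x y'"
      by (auto intro!: diag_eqI[of _ "p + q - 1"] simp: mem vals deriv D lin a_minus_def M.minus_add M.a_ac)
  qed
  show "gbracket (sym_theta R S) p p x x = \<zero>\<^bsub>component (sym_theta R S) (p + p - 1)\<^esub>"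
    if "x \<in> homog (sym_theta R S) p" for x p
    using that by (auto intro!: diag_eqI[of _ "p + p - 1"] simp: mem vals D a_minus_def M.r_neg)
  show "gbracket (sym_theta R S) p q x y = \<ominus>\<^bsub>component (sym_theta R S) (p + q - 1)\<^esub> gbracket (sym_theta R S) q p y x"
    if "x \<in> homog (sym_theta R S) p" "y \<in> homog (sym_theta R S) q" for x y p q
    using that by (auto intro!: diag_eqI[of _ "p + q - 1"] diag_uminus(1) simp: mem vals diag_uminus(2) D a_minus_def M.minus_add M.a_ac)
  show "gbracket (sym_theta R S) p (q + s - 1) x (gbracket (sym_theta R S) q s y z) \<oplus>\<^bsub>component (sym_theta R S) (p + q + s - 2)\<^esub>
      gbracket (sym_theta R S) q (s + p - 1) y (gbracket (sym_theta R S) s p z x) \<oplus>\<^bsub>component (sym_theta R S) (p + q + s - 2)\<^esub>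
      gbracket (sym_theta R S) s (p + q - 1) z (gbracket (sym_theta R S) p q x y) = \<zero>\<^bsub>component (sym_theta R S) (p + q + s - 2)\<^esub>"
    if "x \<in> homog (sym_theta R S) p" "y \<in> homog (sym_theta R S) q" "z \<in> homog (sym_theta R S) s" for x y z p q s
  proof -
    have x: "x \<in> Der p" and y: "y \<in> Der q" and z: "z \<in> Der s" using that by simp_all
    note b = sym_bracket_facts(1)[OF y z refl] sym_bracket_facts(1)[OF z x refl] sym_bracket_facts(1)[OF x y refl]
    have deg: "p + q + s - 2 = p + (q + s - 1) - 1" "p + q + s - 2 = q + (s + p - 1) - 1" "p + q + s - 2 = s + (p + q - 1) - 1"
      by simp_all
    note bb = sym_bracket_facts(1)[OF x b(1) deg(1)] sym_bracket_facts(1)[OF y b(2) deg(2)] sym_bracket_facts(1)[OF z b(3) deg(3)]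
    show ?thesis
      unfolding sym_theta_simps restrict_scalars_simps
    proof (rule diag_eqI[of _ "p + q + s - 2"])
      fix c assume c: "c \<in> cS"
      define X' Y Z where X: "X' = diag S p x c" and Y: "Y = diag S q y c" and Z: "Z = diag S s z c"
      have cl: "X' \<in> cS" "Y \<in> cS" "Z \<in> cS"
        using diag_closed x y z c by (simp_all add: X Y Z)
      note dx = diag_deriv_derivation[OF x c] and dy = diag_deriv_derivation[OF y c] and dz = diag_deriv_derivation[OF z c]
      note cld = derivation_onD(1)[OF dx] derivation_onD(1)[OF dy] derivation_onD(1)[OF dz]
      note m = derivation_on_arith(3)[OF dx] derivation_on_arith(3)[OF dy] derivation_on_arith(3)[OF dz]
      note cl2 = derivation_onD(1)[OF diag_deriv2_derivation(1)[OF x c]] derivation_onD(1)[OF diag_deriv2_derivation(1)[OF y c]]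
        derivation_onD(1)[OF diag_deriv2_derivation(1)[OF z c]]
      have s1: "diag_deriv2 S p x c Z Y = diag_deriv2 S p x c Y Z" by (rule diag_deriv2_commute[OF x c cl(3,2)])
      have s2: "diag_deriv2 S q y c Z X' = diag_deriv2 S q y c X' Z" by (rule diag_deriv2_commute[OF y c cl(3,1)])
      have s3: "diag_deriv2 S s z c Y X' = diag_deriv2 S s z c X' Y" by (rule diag_deriv2_commute[OF z c cl(2,1)])
      \<comment> \<open>What is left of Jacobi once the derivatives are named. Composites of first
        derivatives cancel in pairs; the second derivatives a, b, e cancel because \<open>s1\<close>
        to \<open>s3\<close> have put their arguments into a common order.\<close>
      have jac: "(x1 \<ominus> x2 \<ominus> ((a \<oplus> y1) \<ominus> (b \<oplus> z1))) \<oplus>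
          (y1 \<ominus> y2 \<ominus> ((b \<oplus> z2) \<ominus> (e \<oplus> x2))) \<oplus>
          (z2 \<ominus> z1 \<ominus> ((e \<oplus> x1) \<ominus> (a \<oplus> y2))) = \<zero>"
        if "x1 \<in> cS" "x2 \<in> cS" "y1 \<in> cS" "y2 \<in> cS" "z1 \<in> cS" "z2 \<in> cS"
          "a \<in> cS" "b \<in> cS" "e \<in> cS" for x1 x2 y1 y2 z1 z2 a b e
      proof -
        have 1: "u \<ominus> v \<ominus> (w \<ominus> t) = (u \<oplus> t) \<ominus> (v \<oplus> w)"
          if "u \<in> cS" "v \<in> cS" "w \<in> cS" "t \<in> cS" for u v w t
          using that by (simp add: a_minus_def M.minus_add M.a_ac)
        have 2: "(u \<ominus> u') \<oplus> (v \<ominus> v') \<oplus> (w \<ominus> w') = (u \<oplus> v \<oplus> w) \<ominus> (u' \<oplus> v' \<oplus> w')"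
          if "u \<in> cS" "v \<in> cS" "w \<in> cS" "u' \<in> cS" "v' \<in> cS" "w' \<in> cS" for u v w u' v' w'
          using that by (simp add: a_minus_def M.minus_add M.a_ac)
        show ?thesis using that by (simp add: 1 2 M.minus_eq_zero_iff) (simp add: M.a_ac)
      qed
      show "diag S (p + q + s - 2) (sym_bracket S p (q + s - 1) x (sym_bracket S q s y z) \<oplus>\<^bsub>Form (p + q + s - 2)\<^esub>
          sym_bracket S q (s + p - 1) y (sym_bracket S s p z x) \<oplus>\<^bsub>Form (p + q + s - 2)\<^esub>
          sym_bracket S s (p + q - 1) z (sym_bracket S p q x y)) c = diag S (p + q + s - 2) \<zero>\<^bsub>Form (p + q + s - 2)\<^esub> c"
        unfolding diag_add[OF mem(3)[OF bb(1,2)] bb(3) c] diag_add[OF bb(1,2) c] diag_zero[OF c]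
          sym_bracket_facts(2)[OF x b(1) deg(1) c] sym_bracket_facts(2)[OF y b(2) deg(2) c] sym_bracket_facts(2)[OF z b(3) deg(3) c]
          sym_bracket_facts(2)[OF y z refl c] sym_bracket_facts(2)[OF z x refl c] sym_bracket_facts(2)[OF x y refl c]
          sym_bracket_facts(3)[OF y z refl c cl(1)] sym_bracket_facts(3)[OF z x refl c cl(2)]
          sym_bracket_facts(3)[OF x y refl c cl(3)] X[symmetric] Y[symmetric] Z[symmetric]
          m(1)[OF cld(2)[OF cl(3)] cld(3)[OF cl(2)]] m(2)[OF cld(3)[OF cl(1)] cld(1)[OF cl(3)]] m(3)[OF cld(1)[OF cl(2)] cld(2)[OF cl(1)]]
          s1 s2 s3
        by (rule jac) (simp_all add: cl cld cl2)
    qed (simp_all add: mem bb)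
  qed
  show "gbracket (sym_theta R S) p (q + s) x (gmult (sym_theta R S) q s y z) =
      gmult (sym_theta R S) (p + q - 1) s (gbracket (sym_theta R S) p q x y) z
      \<oplus>\<^bsub>component (sym_theta R S) (p + q + s - 1)\<^esub> gmult (sym_theta R S) q (p + s - 1) y (gbracket (sym_theta R S) p s x z)"
    if "x \<in> homog (sym_theta R S) p" "y \<in> homog (sym_theta R S) q" "z \<in> homog (sym_theta R S) s" for x y z p q s
  proof -
    have x: "x \<in> Der p" and y: "y \<in> Der q" and z: "z \<in> Der s" using that by simp_all
    have deg: "p + q + s - 1 = p + (q + s) - 1" "p + q + s - 1 = (p + q - 1) + s" "p + q + s - 1 = q + (p + s - 1)"
      by simp_all
    note yz = sym_mult_facts(1)[OF y z refl] and xy = sym_bracket_facts(1)[OF x y refl] and xz = sym_bracket_facts(1)[OF x z refl]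
    note l = sym_bracket_facts(1)[OF x yz deg(1)] and r1 = sym_mult_facts(1)[OF xy z deg(2)] and r2 = sym_mult_facts(1)[OF y xz deg(3)]
    show ?thesis unfolding sym_theta_simps restrict_scalars_simps
    proof (rule diag_eqI[OF l mem(3)[OF r1 r2]])
      fix c assume c: "c \<in> cS"
      note cl = diag_closed[OF x c] diag_closed[OF y c] diag_closed[OF z c]
      note cld = derivation_onD(1)[OF diag_deriv_derivation[OF x c]] derivation_onD(1)[OF diag_deriv_derivation[OF y c]]
        derivation_onD(1)[OF diag_deriv_derivation[OF z c]]
      \<comment> \<open>On the diagonal, x' in the direction y z is expanded because x' is a
        derivation, and (y z)' by the product rule.\<close>
      have id: "(Y \<otimes> a \<oplus> Z \<otimes> b) \<ominus> (u \<otimes> Z \<oplus> Y \<otimes> v) =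
        (b \<ominus> u) \<otimes> Z \<oplus> Y \<otimes> (a \<ominus> v)"
        if "Y \<in> cS" "Z \<in> cS" "a \<in> cS" "b \<in> cS" "u \<in> cS" "v \<in> cS" for Y Z a b u v
        using that by algebra
      show "diag S (p + q + s - 1) (sym_bracket S p (q + s) x (sym_mult S q s y z)) c =
        diag S (p + q + s - 1) (sym_mult S (p + q - 1) s (sym_bracket S p q x y) z \<oplus>\<^bsub>Form (p + q + s - 1)\<^esub>
          sym_mult S q (p + s - 1) y (sym_bracket S p s x z)) c"
        unfolding diag_add[OF r1 r2 c] sym_bracket_facts(2)[OF x yz deg(1) c] sym_mult_facts(2)[OF xy z deg(2) c]
          sym_mult_facts(2)[OF y xz deg(3) c] sym_mult_facts(2)[OF y z refl c] sym_mult_facts(3)[OF y z refl c cl(1)]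
          sym_bracket_facts(2)[OF x y refl c] sym_bracket_facts(2)[OF x z refl c]
          derivation_onD(4)[OF diag_deriv_derivation[OF x c] cl(2) cl(3)]
        by (rule id) (simp_all add: cl cld)
    qed
  qed
qed

end


section \<open>Transport of structure\<close>

text \<open>An injective map compatible with the operations reflects the axioms. Negatives are
  supplied by the scalar -1.\<close>

lemma module_pullback:
  assumes W: "module R W" and f: "f \<in> carrier V \<rightarrow> carrier W" and inj: "inj_on f (carrier V)"
    and zero: "\<zero>\<^bsub>V\<^esub> \<in> carrier V" "f \<zero>\<^bsub>V\<^esub> = \<zero>\<^bsub>W\<^esub>"
    and add: "\<And>x y. \<lbrakk>x \<in> carrier V; y \<in> carrier V\<rbrakk> \<Longrightarrow> x \<oplus>\<^bsub>V\<^esub> y \<in> carrier V \<and> f (x \<oplus>\<^bsub>V\<^esub> y) = f x \<oplus>\<^bsub>W\<^esub> f y"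
    and smult: "\<And>r x. \<lbrakk>r \<in> carrier R; x \<in> carrier V\<rbrakk> \<Longrightarrow> r \<odot>\<^bsub>V\<^esub> x \<in> carrier V \<and> f (r \<odot>\<^bsub>V\<^esub> x) = r \<odot>\<^bsub>W\<^esub> f x"
  shows "module R V"
proof -
  interpret W: module R W by fact
  have fW: "f x \<in> carrier W" if "x \<in> carrier V" for x using f that by auto
  note i = inj_onD[OF inj]
  have "abelian_group V"
  proof (rule abelian_groupI)
    fix x assume x: "x \<in> carrier V"
    have "(\<ominus>\<^bsub>R\<^esub> \<one>\<^bsub>R\<^esub>) \<odot>\<^bsub>V\<^esub> x \<oplus>\<^bsub>V\<^esub> x = \<zero>\<^bsub>V\<^esub>"
      using x fW[OF x] by (intro i) (simp_all add: add smult zero W.smult_l_minus W.M.l_neg)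
    then show "\<exists>y \<in> carrier V. y \<oplus>\<^bsub>V\<^esub> x = \<zero>\<^bsub>V\<^esub>"
      using x smult by (intro bexI[of _ "(\<ominus>\<^bsub>R\<^esub> \<one>\<^bsub>R\<^esub>) \<odot>\<^bsub>V\<^esub> x"]) simp_all
    show "\<zero>\<^bsub>V\<^esub> \<oplus>\<^bsub>V\<^esub> x = x" using x fW by (intro i) (simp_all add: add zero)
  next
    fix x y z assume xyz: "x \<in> carrier V" "y \<in> carrier V" "z \<in> carrier V"
    show "x \<oplus>\<^bsub>V\<^esub> y \<oplus>\<^bsub>V\<^esub> z = x \<oplus>\<^bsub>V\<^esub> (y \<oplus>\<^bsub>V\<^esub> z)"
      using xyz fW by (intro i) (simp_all add: add W.M.a_assoc)
  next
    fix x y assume xy: "x \<in> carrier V" "y \<in> carrier V"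
    show "x \<oplus>\<^bsub>V\<^esub> y = y \<oplus>\<^bsub>V\<^esub> x"
      using xy fW by (intro i) (simp_all add: add W.M.a_comm)
  qed (simp_all add: zero add)
  then show ?thesis
    by (intro moduleI W.R.is_cring)
      (auto simp: add smult fW W.smult_l_distr W.smult_r_distr W.smult_assoc1 intro!: i)
qed

lemma linear_injectionD:
  assumes "linear_injection R U V f"
  shows "x \<in> carrier U \<Longrightarrow> f x \<in> carrier V" and "inj_on f (carrier U)"
    and "\<lbrakk>x \<in> carrier U; y \<in> carrier U\<rbrakk> \<Longrightarrow> f (x \<oplus>\<^bsub>U\<^esub> y) = f x \<oplus>\<^bsub>V\<^esub> f y"
    and "\<lbrakk>r \<in> carrier R; x \<in> carrier U\<rbrakk> \<Longrightarrow> f (r \<odot>\<^bsub>U\<^esub> x) = r \<odot>\<^bsub>V\<^esub> f x"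
  using assms unfolding linear_injection_def by blast+

lemma additive_zero_minus:
  assumes "abelian_group U" "abelian_group V" and f: "\<And>x. x \<in> carrier U \<Longrightarrow> f x \<in> carrier V"
    and add: "\<And>x y. \<lbrakk>x \<in> carrier U; y \<in> carrier U\<rbrakk> \<Longrightarrow> f (x \<oplus>\<^bsub>U\<^esub> y) = f x \<oplus>\<^bsub>V\<^esub> f y"
  shows "f \<zero>\<^bsub>U\<^esub> = \<zero>\<^bsub>V\<^esub>" and "x \<in> carrier U \<Longrightarrow> f (\<ominus>\<^bsub>U\<^esub> x) = \<ominus>\<^bsub>V\<^esub> f x"
    and "\<lbrakk>x \<in> carrier U; y \<in> carrier U\<rbrakk> \<Longrightarrow> f (x \<ominus>\<^bsub>U\<^esub> y) = f x \<ominus>\<^bsub>V\<^esub> f y"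
proof -
  interpret U: abelian_group U by fact
  interpret V: abelian_group V by fact
  show z: "f \<zero>\<^bsub>U\<^esub> = \<zero>\<^bsub>V\<^esub>"
    using add[of "\<zero>\<^bsub>U\<^esub>" "\<zero>\<^bsub>U\<^esub>"] f[of "\<zero>\<^bsub>U\<^esub>"] by (metis U.l_zero U.zero_closed V.add.r_cancel_one')
  show m: "f (\<ominus>\<^bsub>U\<^esub> x) = \<ominus>\<^bsub>V\<^esub> f x" if "x \<in> carrier U" for x
    using add[of "\<ominus>\<^bsub>U\<^esub> x" x] f[of x] f[of "\<ominus>\<^bsub>U\<^esub> x"] that z
    by (metis U.a_inv_closed U.l_neg V.minus_equality)
  show "f (x \<ominus>\<^bsub>U\<^esub> y) = f x \<ominus>\<^bsub>V\<^esub> f y" if "x \<in> carrier U" "y \<in> carrier U"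
    using that by (simp add: a_minus_def add m)
qed

lemma bilinear_mapD:
  assumes "bilinear_map R U V W f"
  shows "\<lbrakk>x \<in> carrier U; y \<in> carrier V\<rbrakk> \<Longrightarrow> f x y \<in> carrier W"
    and "\<lbrakk>x \<in> carrier U; x' \<in> carrier U; y \<in> carrier V\<rbrakk> \<Longrightarrow> f (x \<oplus>\<^bsub>U\<^esub> x') y = f x y \<oplus>\<^bsub>W\<^esub> f x' y"
    and "\<lbrakk>x \<in> carrier U; y \<in> carrier V; y' \<in> carrier V\<rbrakk> \<Longrightarrow> f x (y \<oplus>\<^bsub>V\<^esub> y') = f x y \<oplus>\<^bsub>W\<^esub> f x y'"
    and "\<lbrakk>r \<in> carrier R; x \<in> carrier U; y \<in> carrier V\<rbrakk> \<Longrightarrow> f (r \<odot>\<^bsub>U\<^esub> x) y = r \<odot>\<^bsub>W\<^esub> f x y"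
    and "\<lbrakk>r \<in> carrier R; x \<in> carrier U; y \<in> carrier V\<rbrakk> \<Longrightarrow> f x (r \<odot>\<^bsub>V\<^esub> y) = r \<odot>\<^bsub>W\<^esub> f x y"
  using assms unfolding bilinear_map_def by blast+

lemma bilinear_pullback:
  assumes "module R U'" "module R V'" "module R W'" and b: "bilinear_map R U' V' W' b"
    and c: "\<And>x y. \<lbrakk>x \<in> carrier U; y \<in> carrier V\<rbrakk> \<Longrightarrow> a x y \<in> carrier W"
    and f: "\<And>x. x \<in> carrier U \<Longrightarrow> f x \<in> carrier U'" "\<And>x y. \<lbrakk>x \<in> carrier U; y \<in> carrier U\<rbrakk> \<Longrightarrow> f (x \<oplus>\<^bsub>U\<^esub> y) = f x \<oplus>\<^bsub>U'\<^esub> f y"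
      "\<And>r x. \<lbrakk>r \<in> carrier R; x \<in> carrier U\<rbrakk> \<Longrightarrow> f (r \<odot>\<^bsub>U\<^esub> x) = r \<odot>\<^bsub>U'\<^esub> f x"
    and g: "\<And>x. x \<in> carrier V \<Longrightarrow> g x \<in> carrier V'" "\<And>x y. \<lbrakk>x \<in> carrier V; y \<in> carrier V\<rbrakk> \<Longrightarrow> g (x \<oplus>\<^bsub>V\<^esub> y) = g x \<oplus>\<^bsub>V'\<^esub> g y"
      "\<And>r x. \<lbrakk>r \<in> carrier R; x \<in> carrier V\<rbrakk> \<Longrightarrow> g (r \<odot>\<^bsub>V\<^esub> x) = r \<odot>\<^bsub>V'\<^esub> g x"
    and h: "linear_injection R W W' h"
    and eq: "\<And>x y. \<lbrakk>x \<in> carrier U; y \<in> carrier V\<rbrakk> \<Longrightarrow> h (a x y) = b (f x) (g y)"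
    and U: "module R U" and V: "module R V" and W: "module R W"
  shows "bilinear_map R U V W a"
proof -
  interpret U: module R U by fact
  interpret V: module R V by fact
  interpret W: module R W by fact
  note i = inj_onD[OF linear_injectionD(2)[OF h]]
  show ?thesis unfolding bilinear_map_def
    by (auto intro!: i simp: c eq f g bilinear_mapD[OF b] linear_injectionD(3,4)[OF h])
qed

context graded_poisson_algebra
begin

lemma component_group: "abelian_group (component B p)"
  using component_module[of p] by (simp add: module_def)

lemma gmult_closed: "\<lbrakk>x \<in> homog B p; y \<in> homog B q; n = p + q\<rbrakk> \<Longrightarrow> gmult B p q x y \<in> homog B n"
  using bilinear_mapD(1)[OF gmult_bilinear] by blast

lemma gbracket_closed: "\<lbrakk>x \<in> homog B p; y \<in> homog B q; n = p + q - 1\<rbrakk> \<Longrightarrow> gbracket B p q x y \<in> homog B n"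
  using bilinear_mapD(1)[OF gbracket_bilinear] by blast

lemma gbracket_uminus_right:
  assumes "x \<in> homog B p" "y \<in> homog B q" "n = p + q - 1"
  shows "gbracket B p q x (\<ominus>\<^bsub>component B q\<^esub> y) = \<ominus>\<^bsub>component B n\<^esub> gbracket B p q x y"
  using assms(1,2) unfolding assms(3)
  by (intro additive_zero_minus(2)[OF component_group component_group, where f = "gbracket B p q x"]
      bilinear_mapD[OF gbracket_bilinear]) simp_all

lemma gmult_uminus_left:
  assumes "x \<in> homog B p" "y \<in> homog B q" "n = p + q"
  shows "gmult B p q (\<ominus>\<^bsub>component B p\<^esub> x) y = \<ominus>\<^bsub>component B n\<^esub> gmult B p q x y"
  using assms(1,2) unfolding assms(3)
  by (intro additive_zero_minus(2)[OF component_group component_group, where f = "\<lambda>x. gmult B p q x y"]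
      bilinear_mapD[OF gmult_bilinear]) simp_all

lemma antisym: "\<lbrakk>x \<in> homog B p; y \<in> homog B q; n = p + q - 1\<rbrakk>
    \<Longrightarrow> gbracket B p q x y = \<ominus>\<^bsub>component B n\<^esub> gbracket B q p y x"
  using gbracket_antisym by blast

text \<open>The Jacobi identity in the form required of a right Lie module. This and the next two
  lemmas are the module axioms for the algebra acting on itself; they pass to every module realized
  inside a Poisson algebra.\<close>

lemma bracket_bracket:
  assumes n: "n \<in> homog B p" and x: "x \<in> homog B q" and y: "y \<in> homog B s"
  shows "gbracket B p (q + s - 1) n (gbracket B q s x y) =
    gbracket B (p + q - 1) s (gbracket B p q n x) y
      \<ominus>\<^bsub>component B (p + q + s - 2)\<^esub> gbracket B (p + s - 1) q (gbracket B p s n y) x"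
proof -
  let ?d = "p + q + s - 2"
  interpret G: abelian_group "component B ?d" by (rule component_group)
  have d: "?d = s + (p + q - 1) - 1" "?d = q + (p + s - 1) - 1" "?d = p + (q + s - 1) - 1"
    "?d = (p + q - 1) + s - 1" "?d = (p + s - 1) + q - 1" and sp: "s + p - 1 = p + s - 1" by simp_all
  note nx = gbracket_closed[OF n x refl] and ny = gbracket_closed[OF n y refl] and xy = gbracket_closed[OF x y refl]
  let ?u = "gbracket B p (q + s - 1) n (gbracket B q s x y)"
  let ?v = "gbracket B (p + q - 1) s (gbracket B p q n x) y"
  let ?w = "gbracket B (p + s - 1) q (gbracket B p s n y) x"
  have cl: "?u \<in> homog B ?d" "?v \<in> homog B ?d" "?w \<in> homog B ?d"
    using gbracket_closed[OF n xy d(3)] gbracket_closed[OF nx y d(4)] gbracket_closed[OF ny x d(5)] by auto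
  have 1: "gbracket B s (p + q - 1) y (gbracket B p q n x) = \<ominus>\<^bsub>component B ?d\<^esub> ?v"
    by (rule antisym[OF y nx d(1)])
  have "gbracket B q (s + p - 1) x (gbracket B s p y n) =
    gbracket B q (p + s - 1) x (\<ominus>\<^bsub>component B (p + s - 1)\<^esub> gbracket B p s n y)"
    using antisym[OF y n refl] unfolding sp by simp
  also have "\<dots> = \<ominus>\<^bsub>component B ?d\<^esub> gbracket B q (p + s - 1) x (gbracket B p s n y)"
    by (rule gbracket_uminus_right[OF x ny d(2)])
  also have "gbracket B q (p + s - 1) x (gbracket B p s n y) = \<ominus>\<^bsub>component B ?d\<^esub> ?w"
    by (rule antisym[OF x ny d(2)])
  finally have 2: "gbracket B q (s + p - 1) x (gbracket B s p y n) = ?w" using cl by simp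
  have "?u \<oplus>\<^bsub>component B ?d\<^esub> ?w \<oplus>\<^bsub>component B ?d\<^esub> \<ominus>\<^bsub>component B ?d\<^esub> ?v = \<zero>\<^bsub>component B ?d\<^esub>"
    using jacobi[OF n x y] unfolding 1 2 .
  then have "?u \<oplus>\<^bsub>component B ?d\<^esub> ?w = ?v"
    using G.minus_eq_zero_iff[of "?u \<oplus>\<^bsub>component B ?d\<^esub> ?w" ?v] cl by (simp add: a_minus_def)
  then show ?thesis using cl by (metis G.a_assoc G.a_inv_closed G.r_neg G.r_zero a_minus_def)
qed

lemma bracket_mult_left:
  assumes n: "n \<in> homog B p" and x: "x \<in> homog B q" and y: "y \<in> homog B s"
  shows "gbracket B (p + q) s (gmult B p q n x) y =
    gmult B (p + s - 1) q (gbracket B p s n y) x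
      \<oplus>\<^bsub>component B (p + q + s - 1)\<^esub> gmult B p (q + s - 1) n (gbracket B q s x y)"
proof -
  let ?d = "p + q + s - 1"
  interpret G: abelian_group "component B ?d" by (rule component_group)
  have d: "?d = s + (p + q) - 1" "?d = (p + q) + s - 1" "?d = (p + s - 1) + q" "?d = p + (q + s - 1)"
    "s + p + q - 1 = ?d" and sp: "s + p - 1 = p + s - 1" "s + q - 1 = q + s - 1" by simp_all
  note nx = gmult_closed[OF n x refl] and ny = gbracket_closed[OF n y refl] and xy = gbracket_closed[OF x y refl]
  have "gbracket B (p + q) s (gmult B p q n x) y = \<ominus>\<^bsub>component B ?d\<^esub> gbracket B s (p + q) y (gmult B p q n x)"
    by (rule antisym[OF nx y d(2)])
  also have "gbracket B s (p + q) y (gmult B p q n x) =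
    gmult B (p + s - 1) q (gbracket B s p y n) x \<oplus>\<^bsub>component B ?d\<^esub> gmult B p (q + s - 1) n (gbracket B s q y x)"
    using leibniz[OF y n x] unfolding sp d(5) .
  also have "gbracket B s p y n = \<ominus>\<^bsub>component B (p + s - 1)\<^esub> gbracket B p s n y"
    by (rule antisym[OF y n]) simp
  also have "gmult B (p + s - 1) q (\<ominus>\<^bsub>component B (p + s - 1)\<^esub> gbracket B p s n y) x =
    \<ominus>\<^bsub>component B ?d\<^esub> gmult B (p + s - 1) q (gbracket B p s n y) x"
    by (rule gmult_uminus_left[OF ny x d(3)])
  also have "gbracket B s q y x = \<ominus>\<^bsub>component B (q + s - 1)\<^esub> gbracket B q s x y"
    by (rule antisym[OF y x]) simp
  also have "gmult B p (q + s - 1) n (\<ominus>\<^bsub>component B (q + s - 1)\<^esub> gbracket B q s x y) =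
    gmult B (q + s - 1) p (\<ominus>\<^bsub>component B (q + s - 1)\<^esub> gbracket B q s x y) n"
    by (rule gmult_comm[OF n abelian_group.a_inv_closed[OF component_group xy]])
  also have "\<dots> = \<ominus>\<^bsub>component B ?d\<^esub> gmult B (q + s - 1) p (gbracket B q s x y) n"
    by (rule gmult_uminus_left[OF xy n]) simp
  also have "gmult B (q + s - 1) p (gbracket B q s x y) n = gmult B p (q + s - 1) n (gbracket B q s x y)"
    by (rule gmult_comm[OF xy n])
  finally show ?thesis
    using gmult_closed[OF ny x d(3)] gmult_closed[OF n xy d(4)] by (simp add: G.minus_add)
qed

lemma bracket_mult_right:
  assumes n: "n \<in> homog B p" and x: "x \<in> homog B q" and y: "y \<in> homog B s"
  shows "gbracket B p (q + s) n (gmult B q s x y) =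
    gmult B (p + q - 1) s (gbracket B p q n x) y
      \<oplus>\<^bsub>component B (p + q + s - 1)\<^esub> gmult B (p + s - 1) q (gbracket B p s n y) x"
  using leibniz[OF n x y] gmult_comm[OF x gbracket_closed[OF n y refl]] by simp

end

text \<open>Injective maps reflect identities, so the axioms never have to be checked on cosets
  modulo the filtration.\<close>

lemma graded_poisson_algebra_pullback:
  assumes D: "graded_poisson_algebra R D" and B: "\<And>p. module R (component B p)"
    and bdd: "\<exists>p0. \<forall>p < p0. homog B p = {\<zero>\<^bsub>component B p\<^esub>}"
    and f: "\<And>p. linear_injection R (component B p) (component D p) (f p)"
    and one: "gone B \<in> homog B 0" "f 0 (gone B) = gone D"
    and mult: "\<And>p q x y. \<lbrakk>x \<in> homog B p; y \<in> homog B q\<rbrakk> \<Longrightarrow>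
      gmult B p q x y \<in> homog B (p + q) \<and> f (p + q) (gmult B p q x y) = gmult D p q (f p x) (f q y)"
    and bracket: "\<And>p q x y. \<lbrakk>x \<in> homog B p; y \<in> homog B q\<rbrakk> \<Longrightarrow>
      gbracket B p q x y \<in> homog B (p + q - 1) \<and>
      f (p + q - 1) (gbracket B p q x y) = gbracket D p q (f p x) (f q y)"
  shows "graded_poisson_algebra R B"
proof -
  interpret D: graded_poisson_algebra R D by fact
  have i: "x = y" if "f p x = f p y" "x \<in> homog B p" "y \<in> homog B p" for p x y
    using inj_onD[OF linear_injectionD(2)[OF f]] that by blast
  note fD = linear_injectionD(1)[OF f] and fadd = linear_injectionD(3)[OF f]
  have G: "abelian_group (component B p)" for p using B[of p] by (simp add: module_def)
  have f0: "f p \<zero>\<^bsub>component B p\<^esub> = \<zero>\<^bsub>component D p\<^esub>"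
    "x \<in> homog B p \<Longrightarrow> f p (\<ominus>\<^bsub>component B p\<^esub> x) = \<ominus>\<^bsub>component D p\<^esub> f p x" for p x
    by (rule additive_zero_minus[OF G D.component_group, where f = "f p"]; use fD fadd in blast)+
  note cl = mult[THEN conjunct1] bracket[THEN conjunct1]
  have mult': "gmult B p q x y \<in> homog B n \<and> f n (gmult B p q x y) = gmult D p q (f p x) (f q y)"
    if "n = p + q" "x \<in> homog B p" "y \<in> homog B q" for n p q x y
    using mult that by blast
  have bracket': "gbracket B p q x y \<in> homog B n \<and> f n (gbracket B p q x y) = gbracket D p q (f p x) (f q y)"
    if "n = p + q - 1" "x \<in> homog B p" "y \<in> homog B q" for n p q x y
    using bracket that by blast
  note addc = abelian_monoid.a_closed[OF abelian_group.axioms(1)[OF G]]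
  note zeroc = abelian_monoid.zero_closed[OF abelian_group.axioms(1)[OF G]]
  show ?thesis
  proof (rule graded_poisson_algebra.intro)
    show "bilinear_map R (component B p) (component B q) (component B (p + q)) (gmult B p q)" for p q
      by (rule bilinear_pullback[OF D.component_module D.component_module D.component_module D.gmult_bilinear _ _ _ _ _ _ _ f])
        (simp_all add: mult B linear_injectionD(1,3,4)[OF f])
    show "bilinear_map R (component B p) (component B q) (component B (p + q - 1)) (gbracket B p q)" for p q
      by (rule bilinear_pullback[OF D.component_module D.component_module D.component_module D.gbracket_bilinear _ _ _ _ _ _ _ f])
        (simp_all add: bracket B linear_injectionD(1,3,4)[OF f])
    show "gmult B p q x y = gmult B q p y x" if "x \<in> homog B p" "y \<in> homog B q" for p q x y
      by (rule i[of "p + q"]) (use that in \<open>simp_all add: mult' D.gmult_comm fD\<close>)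
    show "gmult B (p + q) s (gmult B p q x y) z = gmult B p (q + s) x (gmult B q s y z)"
      if "x \<in> homog B p" "y \<in> homog B q" "z \<in> homog B s" for p q s x y z
      by (rule i[of "p + q + s"]) (use that in \<open>simp_all add: mult' D.gmult_assoc fD\<close>)
    show "gmult B 0 p (gone B) x = x" if "x \<in> homog B p" for p x
      by (rule i[of p]) (use that in \<open>simp_all add: mult' D.gmult_one fD one\<close>)
    show "gbracket B p p x x = \<zero>\<^bsub>component B (p + p - 1)\<^esub>" if "x \<in> homog B p" for p x
      by (rule i[of "p + p - 1"]) (use that in \<open>simp_all add: bracket' D.gbracket_self fD f0 zeroc\<close>)
    show "gbracket B p q x y = \<ominus>\<^bsub>component B (p + q - 1)\<^esub> gbracket B q p y x"
      if "x \<in> homog B p" "y \<in> homog B q" for p q x y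
    proof (rule i[of "p + q - 1"])
      have b: "gbracket B q p y x \<in> homog B (p + q - 1)" "f (p + q - 1) (gbracket B q p y x) = gbracket D q p (f q y) (f p x)"
        using bracket'[of "p + q - 1" q p y x] that by auto
      show "f (p + q - 1) (gbracket B p q x y) = f (p + q - 1) (\<ominus>\<^bsub>component B (p + q - 1)\<^esub> gbracket B q p y x)"
        using that bracket[of x p y q] f0(2)[OF b(1)] D.gbracket_antisym[of "f p x" p "f q y" q] fD by (simp add: b)
      show "\<ominus>\<^bsub>component B (p + q - 1)\<^esub> gbracket B q p y x \<in> homog B (p + q - 1)"
        by (rule abelian_group.a_inv_closed[OF G b(1)])
    qed (use that cl in blast)
    show "gbracket B p (q + s - 1) x (gbracket B q s y z) \<oplus>\<^bsub>component B (p + q + s - 2)\<^esub>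
        gbracket B q (s + p - 1) y (gbracket B s p z x) \<oplus>\<^bsub>component B (p + q + s - 2)\<^esub>
        gbracket B s (p + q - 1) z (gbracket B p q x y) = \<zero>\<^bsub>component B (p + q + s - 2)\<^esub>"
      if "x \<in> homog B p" "y \<in> homog B q" "z \<in> homog B s" for p q s x y z
      by (rule i[of "p + q + s - 2"])
        (use that in \<open>simp_all add: bracket' fadd addc zeroc f0 D.jacobi fD\<close>)
    show "gbracket B p (q + s) x (gmult B q s y z) = gmult B (p + q - 1) s (gbracket B p q x y) z
        \<oplus>\<^bsub>component B (p + q + s - 1)\<^esub> gmult B q (p + s - 1) y (gbracket B p s x z)"
      if "x \<in> homog B p" "y \<in> homog B q" "z \<in> homog B s" for p q s x y z
      by (rule i[of "p + q + s - 1"])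
        (use that in \<open>simp_all add: bracket' mult' fadd addc D.leibniz fD\<close>)
  qed (use B bdd one in auto)
qed

text \<open>N is realized inside a Poisson algebra D by an injection j, B is mapped to D by
  \<kappa>, and B acts on N through product and bracket of D; the axioms become those of D acting on
  itself. It serves for \<open>gr_module\<close> and for the tensor product, both inside the forms
  on \<open>C \<times> N\<close>.\<close>

lemma graded_poisson_module_pullback:
  assumes B: "graded_poisson_algebra R B" and D: "graded_poisson_algebra R D"
    and N: "\<And>p. module R (mcomponent N p)" and bdd: "\<exists>p0. \<forall>p < p0. mhomog N p = {\<zero>\<^bsub>mcomponent N p\<^esub>}"
    and k: "\<And>p x. x \<in> homog B p \<Longrightarrow> \<kappa> p x \<in> homog D p"
      "\<And>p x y. \<lbrakk>x \<in> homog B p; y \<in> homog B p\<rbrakk> \<Longrightarrow> \<kappa> p (x \<oplus>\<^bsub>component B p\<^esub> y) = \<kappa> p x \<oplus>\<^bsub>component D p\<^esub> \<kappa> p y"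
      "\<And>p r x. \<lbrakk>r \<in> carrier R; x \<in> homog B p\<rbrakk> \<Longrightarrow> \<kappa> p (r \<odot>\<^bsub>component B p\<^esub> x) = r \<odot>\<^bsub>component D p\<^esub> \<kappa> p x"
      "\<kappa> 0 (gone B) = gone D"
      "\<And>p q x y. \<lbrakk>x \<in> homog B p; y \<in> homog B q\<rbrakk> \<Longrightarrow> \<kappa> (p + q) (gmult B p q x y) = gmult D p q (\<kappa> p x) (\<kappa> q y)"
      "\<And>p q x y. \<lbrakk>x \<in> homog B p; y \<in> homog B q\<rbrakk> \<Longrightarrow> \<kappa> (p + q - 1) (gbracket B p q x y) = gbracket D p q (\<kappa> p x) (\<kappa> q y)"
    and j: "\<And>p. linear_injection R (mcomponent N p) (component D p) (j p)"
    and act: "\<And>p q n x. \<lbrakk>n \<in> mhomog N p; x \<in> homog B q\<rbrakk> \<Longrightarrow>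
      mact N p q n x \<in> mhomog N (p + q) \<and> j (p + q) (mact N p q n x) = gmult D p q (j p n) (\<kappa> q x)"
    and bracket: "\<And>p q n x. \<lbrakk>n \<in> mhomog N p; x \<in> homog B q\<rbrakk> \<Longrightarrow>
      mbracket N p q n x \<in> mhomog N (p + q - 1) \<and>
      j (p + q - 1) (mbracket N p q n x) = gbracket D p q (j p n) (\<kappa> q x)"
  shows "graded_poisson_module R B N"
proof -
  interpret B: graded_poisson_algebra R B by fact
  interpret D: graded_poisson_algebra R D by fact
  have i: "x = y" if "j p x = j p y" "x \<in> mhomog N p" "y \<in> mhomog N p" for p x y
    using inj_onD[OF linear_injectionD(2)[OF j]] that by blast
  note jD = linear_injectionD(1)[OF j] and jadd = linear_injectionD(3)[OF j]
  have G: "abelian_group (mcomponent N p)" for p using N[of p] by (simp add: module_def)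
  have j0: "j p (x \<ominus>\<^bsub>mcomponent N p\<^esub> y) = j p x \<ominus>\<^bsub>component D p\<^esub> j p y"
    if "x \<in> mhomog N p" "y \<in> mhomog N p" for p x y
    by (rule additive_zero_minus(3)[OF G D.component_group, where f = "j p"]; use jD jadd that in blast)
  have act': "mact N p q x y \<in> mhomog N n \<and> j n (mact N p q x y) = gmult D p q (j p x) (\<kappa> q y)"
    if "n = p + q" "x \<in> mhomog N p" "y \<in> homog B q" for n p q x y
    using act that by blast
  have bracket': "mbracket N p q x y \<in> mhomog N n \<and> j n (mbracket N p q x y) = gbracket D p q (j p x) (\<kappa> q y)"
    if "n = p + q - 1" "x \<in> mhomog N p" "y \<in> homog B q" for n p q x y
    using bracket that by blast
  have km: "gmult B p q x y \<in> homog B n \<and> \<kappa> n (gmult B p q x y) = gmult D p q (\<kappa> p x) (\<kappa> q y)"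
    if "n = p + q" "x \<in> homog B p" "y \<in> homog B q" for n p q x y
    using k(5) B.gmult_closed that by blast
  have kb: "gbracket B p q x y \<in> homog B n \<and> \<kappa> n (gbracket B p q x y) = gbracket D p q (\<kappa> p x) (\<kappa> q y)"
    if "n = p + q - 1" "x \<in> homog B p" "y \<in> homog B q" for n p q x y
    using k(6) B.gbracket_closed that by blast
  note addc = abelian_monoid.a_closed[OF abelian_group.axioms(1)[OF G]]
  note minusc = abelian_group.minus_closed[OF G]
  show ?thesis
  proof (rule graded_poisson_module.intro[OF B graded_poisson_module_axioms.intro])
    show "bilinear_map R (mcomponent N p) (component B q) (mcomponent N (p + q)) (mact N p q)" for p q
      by (rule bilinear_pullback[OF D.component_module D.component_module D.component_module D.gmult_bilinear _ _ _ _ _ _ _ j])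
        (simp_all add: act N B.component_module k linear_injectionD(1,3,4)[OF j])
    show "bilinear_map R (mcomponent N p) (component B q) (mcomponent N (p + q - 1)) (mbracket N p q)" for p q
      by (rule bilinear_pullback[OF D.component_module D.component_module D.component_module D.gbracket_bilinear _ _ _ _ _ _ _ j])
        (simp_all add: bracket N B.component_module k linear_injectionD(1,3,4)[OF j])
    show "mact N (p + q) s (mact N p q n x) y = mact N p (q + s) n (gmult B q s x y)"
      if "n \<in> mhomog N p" "x \<in> homog B q" "y \<in> homog B s" for p q s n x y
      by (rule i[of "p + q + s"]) (use that in \<open>simp_all add: act' km D.gmult_assoc jD k(1)\<close>)
    show "mact N p 0 n (gone B) = n" if "n \<in> mhomog N p" for p n
      by (rule i[of p]) (use that D.gmult_comm[OF jD[OF that] D.gone_closed] in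
        \<open>simp_all add: act' B.gone_closed k(4) D.gmult_one jD\<close>)
    show "mbracket N p (q + s - 1) n (gbracket B q s x y) = mbracket N (p + q - 1) s (mbracket N p q n x) y
            \<ominus>\<^bsub>mcomponent N (p + q + s - 2)\<^esub> mbracket N (p + s - 1) q (mbracket N p s n y) x"
      if "n \<in> mhomog N p" "x \<in> homog B q" "y \<in> homog B s" for p q s n x y
      by (rule i[of "p + q + s - 2"])
        (use that in \<open>simp_all add: bracket' kb j0 minusc D.bracket_bracket jD k(1)\<close>)
    show "mbracket N (p + q) s (mact N p q n x) y = mact N (p + s - 1) q (mbracket N p s n y) x
            \<oplus>\<^bsub>mcomponent N (p + q + s - 1)\<^esub> mact N p (q + s - 1) n (gbracket B q s x y)"
      if "n \<in> mhomog N p" "x \<in> homog B q" "y \<in> homog B s" for p q s n x y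
      by (rule i[of "p + q + s - 1"])
        (use that in \<open>simp_all add: bracket' act' kb jadd addc D.bracket_mult_left jD k(1)\<close>)
    show "mbracket N p (q + s) n (gmult B q s x y) = mact N (p + q - 1) s (mbracket N p q n x) y
            \<oplus>\<^bsub>mcomponent N (p + q + s - 1)\<^esub> mact N (p + s - 1) q (mbracket N p s n y) x"
      if "n \<in> mhomog N p" "x \<in> homog B q" "y \<in> homog B s" for p q s n x y
      by (rule i[of "p + q + s - 1"])
        (use that in \<open>simp_all add: bracket' act' km jadd addc D.bracket_mult_right jD k(1)\<close>)
  qed (use N bdd in auto)
qed


section \<open>The symbol map\<close>

text \<open>Let Y be C together with a. Its double centralizer Z(Z(Y)) contains Y; it is commutative
  because Y lies in its own centralizer, so that Z(Z(Y)) lies in Z(Y). Maximality gives Z(Z(Y)) = C.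
  This avoids describing the subalgebra generated by C and a.\<close>

lemma maximal_commutative_centralizer:
  fixes A (structure)
  assumes A: "assoc_algebra R A" and C: "maximal_commutative_subalgebra R A C"
    and a: "a \<in> carrier A" and comm: "\<And>c. c \<in> C \<Longrightarrow> a \<otimes> c = c \<otimes> a"
  shows "a \<in> C"
proof -
  interpret assoc_algebra R A by fact
  define Z where "Z Y = {z \<in> carrier A. \<forall>x \<in> Y. z \<otimes> x = x \<otimes> z}" for Y
  let ?Y = "insert a C"
  have CA: "C \<subseteq> carrier A" and Cc: "\<And>x y. \<lbrakk>x \<in> C; y \<in> C\<rbrakk> \<Longrightarrow> x \<otimes> y = y \<otimes> x"
    using C subcring.sub_m_comm[of C A] subring.axioms subcring.axioms(1)[of C A] subringE(1)
    unfolding maximal_commutative_subalgebra_def commutative_subalgebra_def by blast+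
  have "?Y \<subseteq> Z ?Y" using a CA Cc comm by (auto simp: Z_def)
  then have D1: "Z (Z ?Y) \<subseteq> Z ?Y" and D2: "?Y \<subseteq> Z (Z ?Y)"
    using CA a by (auto simp: Z_def)
  have sub: "subring (Z Y) A" if "Y \<subseteq> carrier A" for Y
  proof (rule subringI)
    show "\<ominus> h \<in> Z Y" if "h \<in> Z Y" for h
      using that \<open>Y \<subseteq> carrier A\<close> by (auto simp: Z_def l_minus r_minus)
    show "h1 \<otimes> h2 \<in> Z Y" if "h1 \<in> Z Y" "h2 \<in> Z Y" for h1 h2
    proof -
      have "h1 \<otimes> h2 \<otimes> y = y \<otimes> (h1 \<otimes> h2)" if y: "y \<in> Y" for y
      proof -
        have c: "h1 \<in> carrier A" "h2 \<in> carrier A" "y \<in> carrier A" "h1 \<otimes> y = y \<otimes> h1" "h2 \<otimes> y = y \<otimes> h2"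
          using y \<open>h1 \<in> Z Y\<close> \<open>h2 \<in> Z Y\<close> \<open>Y \<subseteq> carrier A\<close> by (auto simp: Z_def)
        have "h1 \<otimes> h2 \<otimes> y = h1 \<otimes> (y \<otimes> h2)" using c by (simp add: m_assoc)
        also have "\<dots> = y \<otimes> (h1 \<otimes> h2)" using c by (simp add: m_assoc[symmetric])
        finally show ?thesis .
      qed
      then show ?thesis using that by (auto simp: Z_def)
    qed
    show "h1 \<oplus> h2 \<in> Z Y" if "h1 \<in> Z Y" "h2 \<in> Z Y" for h1 h2
      using that \<open>Y \<subseteq> carrier A\<close> by (auto simp: Z_def l_distr r_distr subset_iff)
  qed (use that in \<open>auto simp: Z_def\<close>)
  have ZA: "Z ?Y \<subseteq> carrier A" by (auto simp: Z_def)
  have "commutative_subalgebra R A (Z (Z ?Y))"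
    unfolding commutative_subalgebra_def
  proof (intro conjI ballI subcringI)
    show "subring (Z (Z ?Y)) A" by (rule sub[OF ZA])
    show "x \<otimes> y = y \<otimes> x" if "x \<in> Z (Z ?Y)" "y \<in> Z (Z ?Y)" for x y
      using that D1 by (auto simp: Z_def)
    show "r \<odot>\<^bsub>A\<^esub> c \<in> Z (Z ?Y)" if "r \<in> carrier R" "c \<in> Z (Z ?Y)" for r c
      using that ZA by (auto simp: Z_def smult_mult_left smult_mult_right)
  qed
  then have "Z (Z ?Y) = C"
    using C D2 unfolding maximal_commutative_subalgebra_def by blast
  then show ?thesis using D2 by blast
qed

lemma a_inv_cong:
  assumes "carrier G = carrier H" "ring.zero G = ring.zero H" "add G = add H"
  shows "a_inv G = a_inv H" "a_minus G = a_minus H"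
  using assms by (auto simp: a_inv_def m_inv_def a_minus_def fun_eq_iff)

context rational_algebra
begin

text \<open>Bracketing with a constant s is differentiation in the direction s, because a constant
  has derivative zero.\<close>

lemma diag_bracket_const:
  assumes f: "f \<in> Der n" and s: "s \<in> carrier S" and c: "c \<in> carrier S"
  shows "diag S (n - 1) (sym_bracket S n 0 f (sym_const S s)) c = diag_deriv S n f c s"
proof -
  note D = derivation_onD(1)[OF diag_deriv_derivation[OF f c]]
  have "diag S (n - 1) (sym_bracket S n 0 f (sym_const S s)) c = diag_deriv S n f c s \<ominus>\<^bsub>S\<^esub> \<zero>\<^bsub>S\<^esub>"
    using sym_bracket_facts(2)[OF f const_form_Der[OF s], of "n - 1" c] c s
    by (simp add: diag_sym_const diag_deriv_def)
  then show ?thesis using D[OF s] by (simp add: a_minus_def)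
qed

text \<open>In the direction s = c the derivative of the diagonal is n times the diagonal (Euler's
  relation), and n can be cancelled.\<close>

lemma contraction_eqI:
  assumes f: "f \<in> Der n" and g: "g \<in> Der n" and n: "1 \<le> n"
    and eq: "\<And>s. s \<in> carrier S \<Longrightarrow> sym_bracket S n 0 f (sym_const S s) = sym_bracket S n 0 g (sym_const S s)"
  shows "f = g"
proof (rule diag_eqI[OF f g])
  fix c assume c: "c \<in> carrier S"
  have Suc: "replicate (nat n) c = c # replicate (nat n - 1) c" using n by (cases "nat n") auto
  have "diag_deriv S n f c c = diag_deriv S n g c c"
    using diag_bracket_const[OF f c c] diag_bracket_const[OF g c c] eq[OF c] by simp
  then have "[(nat n)] \<cdot>\<^bsub>S\<^esub> diag S n f c = [(nat n)] \<cdot>\<^bsub>S\<^esub> diag S n g c"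
    using n by (simp add: diag_deriv_def diag_def Suc)
  then show "diag S n f c = diag S n g c"
    by (rule torsion_free_cancel[of "nat n", rotated 3]) (use n diag_closed[OF f c] diag_closed[OF g c] in simp_all)
qed

end

text \<open>The condition on the centralizer stands in for maximality: it is what the computation of
  F_0 uses, and it is readily verified for \<open>C \<times> N\<close> in the square-zero
  extension.\<close>

locale self_centralizing = assoc_algebra R A
  for R :: "'r ring" and A :: "('r, 'a) module" (structure) +
  fixes C :: "'a set"
  assumes subalgebra: "commutative_subalgebra R A C"
    and centralizer: "\<lbrakk>a \<in> carrier A; \<And>c. c \<in> C \<Longrightarrow> a \<otimes> c = c \<otimes> a\<rbrakk> \<Longrightarrow> a \<in> C"
    and rationals: "contains_rationals R"
begin

definition S :: "('r, 'a) module" where "S = A\<lparr>carrier := C\<rparr>"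

lemma S_simps [simp]:
  "carrier S = C" "monoid.mult S = monoid.mult A" "one S = \<one>" "ring.zero S = \<zero>" "add S = add A"
  "smult S = smult A"
  by (simp_all add: S_def)

lemma C_closed [simp]:
  "c \<in> C \<Longrightarrow> c \<in> carrier A" "\<one> \<in> C" "\<zero> \<in> C" "\<lbrakk>c \<in> C; d \<in> C\<rbrakk> \<Longrightarrow> c \<oplus> d \<in> C" "c \<in> C \<Longrightarrow> \<ominus> c \<in> C"
  "\<lbrakk>c \<in> C; d \<in> C\<rbrakk> \<Longrightarrow> c \<otimes> d \<in> C" "\<lbrakk>r \<in> carrier R; c \<in> C\<rbrakk> \<Longrightarrow> r \<odot>\<^bsub>A\<^esub> c \<in> C"
proof -
  have s: "subcring C A" using subalgebra by (simp add: commutative_subalgebra_def)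
  note r = subringE[OF subcring.axioms(1)[OF s]]
  show "c \<in> C \<Longrightarrow> c \<in> carrier A" "\<one> \<in> C" "\<zero> \<in> C" "\<lbrakk>c \<in> C; d \<in> C\<rbrakk> \<Longrightarrow> c \<oplus> d \<in> C" "c \<in> C \<Longrightarrow> \<ominus> c \<in> C"
    "\<lbrakk>c \<in> C; d \<in> C\<rbrakk> \<Longrightarrow> c \<otimes> d \<in> C" using r by auto
  show "\<lbrakk>r \<in> carrier R; c \<in> C\<rbrakk> \<Longrightarrow> r \<odot>\<^bsub>A\<^esub> c \<in> C"
    using subalgebra by (simp add: commutative_subalgebra_def)
qed

lemma C_comm: "\<lbrakk>c \<in> C; d \<in> C\<rbrakk> \<Longrightarrow> c \<otimes> d = d \<otimes> c"
  using subalgebra subcring.sub_m_comm[of C A] by (simp add: commutative_subalgebra_def)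

lemma algebra_S: "algebra R S"
proof (rule algebraI)
  have "subcring C A" using subalgebra by (simp add: commutative_subalgebra_def)
  moreover have "C \<subseteq> carrier A" by auto
  ultimately show "cring S" using subcring_iff[of C] by (simp add: S_def)
  show "cring R" by (rule R.is_cring)
qed (simp_all add: smult_l_distr smult_r_distr smult_assoc1 smult_mult_left)

sublocale S: rational_algebra R S
  by (intro rational_algebra.intro algebra_S rational_algebra_axioms.intro rationals)

sublocale SA: form_groups S A
proof
  show "g = \<zero>" if "0 < k" "g \<in> carrier A" "[(k::nat)] \<cdot> g = \<zero>" for k g
    using rational_torsion_free[OF module_axioms rationals that] .
qed

section \<open>Iterated commutators with elements of C\<close>

definition comm :: "'a \<Rightarrow> 'a \<Rightarrow> 'a" where "comm a b = a \<otimes> b \<ominus> b \<otimes> a"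

text \<open>The last entry of the list is bracketed first, so that a new argument at the head is one
  more outer commutator. For entries in C the order is immaterial.\<close>

abbreviation ders :: "'a list \<Rightarrow> 'a \<Rightarrow> 'a" where "ders xs a \<equiv> foldr (\<lambda>x b. comm b x) xs a"

lemma comm_closed [simp]: "\<lbrakk>a \<in> carrier A; b \<in> carrier A\<rbrakk> \<Longrightarrow> comm a b \<in> carrier A"
  by (simp add: comm_def)

lemma comm_C: "\<lbrakk>c \<in> C; d \<in> C\<rbrakk> \<Longrightarrow> comm c d = \<zero>"
  using C_comm[of c d] by (simp add: comm_def a_minus_def r_neg)

lemma comm_zero [simp]: "a \<in> carrier A \<Longrightarrow> comm a \<zero> = \<zero>" "a \<in> carrier A \<Longrightarrow> comm \<zero> a = \<zero>"
  by (simp_all add: comm_def a_minus_def)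

lemma comm_add_left: "\<lbrakk>a \<in> carrier A; b \<in> carrier A; x \<in> carrier A\<rbrakk> \<Longrightarrow> comm (a \<oplus> b) x = comm a x \<oplus> comm b x"
  unfolding comm_def by algebra

lemma comm_add_right: "\<lbrakk>a \<in> carrier A; x \<in> carrier A; y \<in> carrier A\<rbrakk> \<Longrightarrow> comm a (x \<oplus> y) = comm a x \<oplus> comm a y"
  unfolding comm_def by algebra

lemma comm_swap: "\<lbrakk>a \<in> carrier A; b \<in> carrier A\<rbrakk> \<Longrightarrow> comm b a = \<ominus> comm a b"
  unfolding comm_def by algebra

lemma comm_mult_left: "\<lbrakk>a \<in> carrier A; b \<in> carrier A; x \<in> carrier A\<rbrakk> \<Longrightarrow> comm (a \<otimes> b) x = comm a x \<otimes> b \<oplus> a \<otimes> comm b x"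
  unfolding comm_def by algebra

lemma comm_mult_right: "\<lbrakk>a \<in> carrier A; y \<in> carrier A; x \<in> carrier A\<rbrakk> \<Longrightarrow> comm a (x \<otimes> y) = x \<otimes> comm a y \<oplus> comm a x \<otimes> y"
  unfolding comm_def by algebra

lemma comm_comm: "\<lbrakk>a \<in> carrier A; b \<in> carrier A; x \<in> carrier A\<rbrakk> \<Longrightarrow> comm (comm a b) x = comm (comm a x) b \<oplus> comm a (comm b x)"
  unfolding comm_def by algebra

lemma comm_minus_left: "\<lbrakk>a \<in> carrier A; x \<in> carrier A\<rbrakk> \<Longrightarrow> comm (\<ominus> a) x = \<ominus> comm a x"
  unfolding comm_def by algebra

lemma comm_smult:
  assumes "r \<in> carrier R" "a \<in> carrier A" "b \<in> carrier A"
  shows "comm (r \<odot>\<^bsub>A\<^esub> a) b = r \<odot>\<^bsub>A\<^esub> comm a b" "comm a (r \<odot>\<^bsub>A\<^esub> b) = r \<odot>\<^bsub>A\<^esub> comm a b"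
  using assms by (simp_all add: comm_def smult_mult_left smult_mult_right a_minus_def smult_r_distr smult_r_minus)

lemma comm_scale: "\<lbrakk>a \<in> carrier A; c \<in> C; x \<in> C\<rbrakk> \<Longrightarrow> comm (c \<otimes> a) x = c \<otimes> comm a x"
  by (simp add: comm_mult_left comm_C)

lemma ders_closed [simp]: "\<lbrakk>set xs \<subseteq> carrier A; a \<in> carrier A\<rbrakk> \<Longrightarrow> ders xs a \<in> carrier A"
  by (induction xs) auto

lemma tuples_S: "xs \<in> tuples S n \<Longrightarrow> set xs \<subseteq> C \<and> set xs \<subseteq> carrier A \<and> length xs = n"
  using C_closed(1) by (auto simp: tuples_def)

lemma ders_add: "\<lbrakk>set xs \<subseteq> carrier A; a \<in> carrier A; b \<in> carrier A\<rbrakk> \<Longrightarrow> ders xs (a \<oplus> b) = ders xs a \<oplus> ders xs b"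
  by (induction xs) (auto simp: comm_add_left)

lemma ders_zero [simp]: "set xs \<subseteq> carrier A \<Longrightarrow> ders xs \<zero> = \<zero>"
  by (induction xs) auto

lemma ders_minus: "\<lbrakk>set xs \<subseteq> carrier A; a \<in> carrier A\<rbrakk> \<Longrightarrow> ders xs (\<ominus> a) = \<ominus> ders xs a"
  by (induction xs) (auto simp: comm_minus_left)

text \<open>Elements of C commute with each other, so by Jacobi the operators [-, x] with x in C
  commute.\<close>

lemma ders_move:
  "\<lbrakk>set xs \<subseteq> C; x \<in> C; a \<in> carrier A\<rbrakk> \<Longrightarrow> ders xs (comm a x) = comm (ders xs a) x"
proof (induction xs)
  case (Cons y ys)
  then have "set ys \<subseteq> carrier A" by auto
  with Cons show ?case
    using comm_comm[of "ders ys a" x y] by (simp add: comm_C)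
qed simp

lemma ders_mset:
  "\<lbrakk>mset xs = mset ys; set xs \<subseteq> C; a \<in> carrier A\<rbrakk> \<Longrightarrow> ders xs a = ders ys a"
proof (induction xs arbitrary: ys)
  case (Cons x xs)
  then have "x \<in> set ys" by (metis list.set_intros(1) mset_eq_setD)
  then obtain us vs where ys: "ys = us @ x # vs" by (meson split_list)
  then have m: "mset xs = mset (us @ vs)" using Cons.prems(1) by simp
  have C: "set (us @ vs) \<subseteq> C" "x \<in> C" using mset_eq_setD[OF m] Cons.prems(2) by auto
  then have "set vs \<subseteq> carrier A" by auto
  then have "ders ys a = comm (ders (us @ vs) a) x"
    using C Cons.prems(3) by (simp add: ys ders_move)
  then show ?case using Cons.IH[OF m] Cons.prems by simp
qed simp

lemma ders_multiadditive:
  assumes a: "a \<in> carrier A" shows "multiadditive S A n (\<lambda>xs. ders xs a)"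
  unfolding multiadditive_def
proof (intro conjI ballI allI impI)
  show "ders xs a \<in> carrier A" if "xs \<in> tuples S n" for xs
    using tuples_S[OF that] a by simp
  fix xs ys x y assume x: "x \<in> carrier S" and y: "y \<in> carrier S" and m: "xs @ x # ys \<in> tuples S n"
  from tuples_S[OF m] have "set xs \<subseteq> carrier A" "set ys \<subseteq> carrier A" by auto
  then show "ders (xs @ (x \<oplus>\<^bsub>S\<^esub> y) # ys) a = ders (xs @ x # ys) a \<oplus> ders (xs @ y # ys) a"
    using a x y by (simp add: comm_add_right ders_add)
qed

lemma ders_symmetric:
  assumes a: "a \<in> carrier A" shows "symmetric_form S n (\<lambda>xs. ders xs a)"
  unfolding symmetric_form_def
proof (intro ballI impI)
  fix xs ys assume "xs \<in> tuples S n" "mset xs = mset ys"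
  then show "ders xs a = ders ys a" using tuples_S[of xs n] a by (intro ders_mset) auto
qed

section \<open>The filtration in terms of mixed commutators\<close>

abbreviation F :: "int \<Rightarrow> 'a set" where "F \<equiv> filtration C (self_bimodule A)"

lemma self_bimodule_simps [simp]:
  "carrier (self_bimodule A) = carrier A" "ring.zero (self_bimodule A) = \<zero>" "add (self_bimodule A) = add A"
  "smult (self_bimodule A) = monoid.mult A" "rsmult (self_bimodule A) = monoid.mult A"
  by (simp_all add: self_bimodule_def)

lemma ad_self: "ad (self_bimodule A) c a = comm c a"
  by (simp add: ad_def comm_def a_inv_cong(2)[of "self_bimodule A" A])

text \<open>The commutators in \<open>ad\<close> and in \<open>ders\<close> are taken in opposite
  order, so the iterates agree up to sign; for vanishing this is enough.\<close>

lemma ad_power_zero: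
  assumes c: "c \<in> C" and a: "a \<in> carrier A"
  shows "(ad (self_bimodule A) c ^^ n) a = \<zero> \<longleftrightarrow> ders (replicate n c) a = \<zero>"
proof -
  have cl: "ders (replicate n c) a \<in> carrier A" for n using c a by (intro ders_closed) auto
  have "(ad (self_bimodule A) c ^^ n) a = ders (replicate n c) a \<or>
      (ad (self_bimodule A) c ^^ n) a = \<ominus> ders (replicate n c) a"
  proof (induction n)
    case (Suc n)
    then show ?case
      using c cl[of n] comm_swap[of "ders (replicate n c) a" c] comm_swap[of "\<ominus> ders (replicate n c) a" c]
      by (auto simp: ad_self comm_minus_left)
  qed simp
  then show ?thesis using cl[of n] by (metis minus_minus minus_zero)
qed

text \<open>The definition tests powers of a single ad c; polarization extends the vanishing to
  commutators with p + 1 different elements of C. The truncation in \<open>nat (p + 1)\<close>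
  covers negative p: no commutator is taken and a itself must vanish.\<close>

lemma F_iff: "a \<in> F p \<longleftrightarrow> a \<in> carrier A \<and> (\<forall>xs \<in> tuples S (nat (p + 1)). ders xs a = \<zero>)"
proof (cases "p < 0")
  case True
  then have "nat (p + 1) = 0" by simp
  then show ?thesis using True by (auto simp: filtration_def)
next
  case False
  then have n: "nat (p + 1) = nat p + 1" by simp
  have "(\<forall>c \<in> C. ders (replicate (nat p + 1) c) a = \<zero>) \<longleftrightarrow> (\<forall>xs \<in> tuples S (nat p + 1). ders xs a = \<zero>)"
    if a: "a \<in> carrier A"
  proof
    assume "\<forall>c \<in> C. ders (replicate (nat p + 1) c) a = \<zero>"
    then have "ders (replicate (nat p + 1) c) a = \<zero>" if "c \<in> carrier S" for c
      using that unfolding S_simps(1) by blast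
    then show "\<forall>xs \<in> tuples S (nat p + 1). ders xs a = \<zero>"
      by (intro ballI) (rule SA.diagonal_zero[OF ders_multiadditive[OF a] ders_symmetric[OF a]])
  next
    assume *: "\<forall>xs \<in> tuples S (nat p + 1). ders xs a = \<zero>"
    show "\<forall>c \<in> C. ders (replicate (nat p + 1) c) a = \<zero>"
    proof
      fix c assume "c \<in> C"
      then have "replicate (nat p + 1) c \<in> tuples S (nat p + 1)" by (intro replicate_in_tuples) simp
      with * show "ders (replicate (nat p + 1) c) a = \<zero>" by blast
    qed
  qed
  then show ?thesis unfolding n filtration_def using False by (auto simp: ad_power_zero simp del: funpow.simps)
qed

lemma F_carrier: "a \<in> F p \<Longrightarrow> a \<in> carrier A" by (simp add: F_iff)

lemma F_neg: "p < 0 \<Longrightarrow> F p = {\<zero>}" by (simp add: filtration_def)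

lemma F_zero [simp]: "\<zero> \<in> F p" using tuples_S by (auto simp: F_iff)

lemma F_add: "\<lbrakk>a \<in> F p; b \<in> F p\<rbrakk> \<Longrightarrow> a \<oplus> b \<in> F p"
  using tuples_S by (auto simp: F_iff ders_add)

lemma F_minus: "a \<in> F p \<Longrightarrow> \<ominus> a \<in> F p"
  using tuples_S by (auto simp: F_iff ders_minus)

lemma F_der:
  assumes a: "a \<in> F p" and x: "x \<in> C" shows "comm a x \<in> F (p - 1)"
proof (cases "p < 0")
  case True
  then show ?thesis using a x by (simp add: F_neg)
next
  case False
  then have n: "nat (p + 1) = Suc (nat p)" by simp
  have "ders xs (comm a x) = \<zero>" if xs: "xs \<in> tuples S (nat p)" for xs
  proof -
    have "xs @ [x] \<in> tuples S (nat (p + 1))" using xs x unfolding n by (auto simp: tuples_def)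
    then have "ders (xs @ [x]) a = \<zero>" using a unfolding F_iff by blast
    then show ?thesis by simp
  qed
  then show ?thesis using a x by (simp add: F_iff)
qed

text \<open>Converse of \<open>F_der\<close>. Together they describe the filtration recursively,
  starting from zero in negative degree, and carry the later inductions on the degree.\<close>

lemma F_intro:
  assumes p: "0 \<le> p" and a: "a \<in> carrier A" and der: "\<And>x. x \<in> C \<Longrightarrow> comm a x \<in> F (p - 1)"
  shows "a \<in> F p"
  unfolding F_iff
proof (intro conjI a ballI)
  fix xs assume xs: "xs \<in> tuples S (nat (p + 1))"
  have n: "nat (p + 1) = Suc (nat p)" using p by simp
  obtain x ys where e: "xs = x # ys" and "x \<in> carrier S" and ys: "ys \<in> tuples S (nat p)"
    using xs unfolding n by (rule tuples_SucE)
  then have x: "x \<in> C" by simp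
  have "ders xs a = ders ys (comm a x)" unfolding e using ders_move[of ys x a] tuples_S[OF ys] x a by simp
  also have "\<dots> = \<zero>" using der[OF x] ys unfolding F_iff by simp
  finally show "ders xs a = \<zero>" .
qed

end


lemma (in abelian_group) add_minus_cancel:
  "\<lbrakk>a \<in> carrier G; b \<in> carrier G\<rbrakk> \<Longrightarrow> a \<oplus> (b \<ominus> a) = b"
  by (simp add: a_minus_def a_comm[of b] r_neg2)

context self_centralizing
begin

text \<open>An element of F_0 commutes with all of C, since its commutators lie in F_{-1} = 0; so it
  lies in C, which is its own centralizer.\<close>

lemma F_0: "F 0 = C"
proof
  show "C \<subseteq> F 0"
  proof
    show "c \<in> F 0" if "c \<in> C" for c
      by (rule F_intro) (use that in \<open>simp_all add: comm_C\<close>)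
  qed
  show "F 0 \<subseteq> C"
  proof
    fix a assume a: "a \<in> F 0"
    have aA: "a \<in> carrier A" by (rule F_carrier[OF a])
    show "a \<in> C"
    proof (rule centralizer[OF aA])
      fix c assume c: "c \<in> C"
      have "comm a c = \<zero>" using F_der[OF a c] by (simp add: F_neg)
      then show "a \<otimes> c = c \<otimes> a" using aA c unfolding comm_def by (simp add: minus_eq_zero_iff)
    qed
  qed
qed

lemma F_mono: "F (p - 1) \<subseteq> F p"
proof (cases "p < 0")
  case False
  show ?thesis
  proof
    fix a assume a: "a \<in> F (p - 1)"
    show "a \<in> F p"
      unfolding F_iff
    proof (intro conjI ballI F_carrier[OF a])
      fix xs assume xs: "xs \<in> tuples S (nat (p + 1))"
      have n: "nat (p + 1) = Suc (nat p)" using False by simp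
      obtain x ys where "xs = x # ys" "x \<in> carrier S" "ys \<in> tuples S (nat p)"
        using xs unfolding n by (rule tuples_SucE)
      with a show "ders xs a = \<zero>" by (simp add: F_iff)
    qed
  qed
qed (simp add: F_neg)

lemma F_ders: "\<lbrakk>a \<in> F p; set xs \<subseteq> C\<rbrakk> \<Longrightarrow> ders xs a \<in> F (p - int (length xs))"
proof (induction xs)
  case (Cons x xs)
  then show ?case using F_der[of "ders xs a" "p - int (length xs)" x] by (simp add: algebra_simps)
qed simp

section \<open>The symbol as a symmetric multiderivation\<close>

definition inverse_fact :: "nat \<Rightarrow> 'a" where
  "inverse_fact n = inv\<^bsub>S\<^esub> ([(fact n :: nat)] \<cdot>\<^bsub>S\<^esub> \<one>\<^bsub>S\<^esub>)"

lemma add_pow_S [simp]: "[(n::nat)] \<cdot>\<^bsub>S\<^esub> x = [n] \<cdot> x"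
  by (simp add: add_pow_def nat_pow_def)

lemma inverse_fact_C [simp]: "inverse_fact n \<in> C"
  using S.Units_inv_closed[OF S.fact_unit[of n]] by (simp add: inverse_fact_def)

lemma fact_inverse_fact: "[(fact n :: nat)] \<cdot> inverse_fact n = \<one>"
proof -
  have "inverse_fact n \<otimes> ([(fact n :: nat)] \<cdot> \<one>) = \<one>"
    using S.Units_l_inv[OF S.fact_unit[of n]] by (simp add: inverse_fact_def)
  then show ?thesis by (simp add: add_pow_rdistr)
qed

lemma inverse_fact_0: "inverse_fact 0 = \<one>"
  using fact_inverse_fact[of 0] by simp

lemma inverse_fact_Suc: "[(Suc n)] \<cdot> inverse_fact (Suc n) = inverse_fact n"
proof (rule SA.torsion_free_cancel)
  have "[(fact n :: nat)] \<cdot> ([(Suc n)] \<cdot> inverse_fact (Suc n)) = [(Suc n * fact n)] \<cdot> inverse_fact (Suc n)"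
    by (simp only: add.nat_pow_pow C_closed(1)[OF inverse_fact_C])
  also have "Suc n * fact n = (fact (Suc n) :: nat)" by simp
  finally show "[(fact n :: nat)] \<cdot> ([(Suc n)] \<cdot> inverse_fact (Suc n)) = [(fact n :: nat)] \<cdot> inverse_fact n"
    by (simp only: fact_inverse_fact)
qed (simp_all del: add.nat_pow_Suc)

lemma inverse_fact_cancel:
  assumes v: "v \<in> carrier A" and z: "inverse_fact n \<otimes> v = \<zero>" shows "v = \<zero>"
proof -
  have "v = ([(fact n :: nat)] \<cdot> inverse_fact n) \<otimes> v" using v by (simp add: fact_inverse_fact)
  also have "\<dots> = [(fact n :: nat)] \<cdot> (inverse_fact n \<otimes> v)" using v by (simp add: add_pow_ldistr)
  finally show ?thesis by (simp add: z)
qed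

text \<open>The factor 1/p! makes symbols multiplicative: when p + q commutators with c are applied
  to a b, only the binomial term with p of them on a and q on b survives, and its coefficient is (p
  + q)! / (p! q!).\<close>

definition symbol :: "int \<Rightarrow> 'a \<Rightarrow> 'a list \<Rightarrow> 'a" where
  "symbol p a = (\<lambda>xs \<in> args S p. inverse_fact (nat p) \<otimes> ders xs a)"

lemma symbol_Der:
  assumes a: "a \<in> F p" shows "symbol p a \<in> S.Der p"
  unfolding symbol_def
proof (rule S.restricted_form_Der)
  have aA: "a \<in> carrier A" by (rule F_carrier[OF a])
  show "symmetric_form S n (\<lambda>xs. inverse_fact (nat p) \<otimes> ders xs a)" for n
    using ders_symmetric[OF aA] unfolding symmetric_form_def by metis
  show "inverse_fact (nat p) \<otimes> ders [] a \<in> carrier S" if "p = 0"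
    using a that by (simp add: F_0)
  fix m zs assume p: "p = int (Suc m)" and zs: "zs \<in> tuples S m"
  let ?u = "inverse_fact (nat p)"
  let ?b = "ders zs a"
  \<comment> \<open>After all but one commutator the result lies in F_1. A further commutator with x
    then lands in C and commutes with the other factors, which turns the noncommutative product rule
    into that of a derivation.\<close>
  have b: "?b \<in> F 1" using F_ders[OF a, of zs] tuples_S[OF zs] p by simp
  have bA: "?b \<in> carrier A" by (rule F_carrier[OF b])
  have bC: "comm ?b x \<in> C" if "x \<in> C" for x using F_der[OF b that] by (simp add: F_0)
  show "derivation_on R S (\<lambda>x. ?u \<otimes> ders (x # zs) a)"
    unfolding derivation_on_def
  proof (intro ballI conjI)
    fix x assume x: "x \<in> carrier S"
    show "?u \<otimes> ders (x # zs) a \<in> carrier S" using x bC by simp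
    show "?u \<otimes> ders ((r \<odot>\<^bsub>S\<^esub> x) # zs) a = r \<odot>\<^bsub>S\<^esub> (?u \<otimes> ders (x # zs) a)" if "r \<in> carrier R" for r
      using x bA that by (simp add: comm_smult smult_mult_right)
    fix y assume y: "y \<in> carrier S"
    show "?u \<otimes> ders ((x \<oplus>\<^bsub>S\<^esub> y) # zs) a = ?u \<otimes> ders (x # zs) a \<oplus>\<^bsub>S\<^esub> ?u \<otimes> ders (y # zs) a"
      using x y bA by (simp add: comm_add_right r_distr)
    have "?u \<otimes> ders ((x \<otimes> y) # zs) a = ?u \<otimes> (x \<otimes> comm ?b y) \<oplus> ?u \<otimes> (comm ?b x \<otimes> y)"
      using x y bA by (simp add: comm_mult_right r_distr)
    also have "?u \<otimes> (x \<otimes> comm ?b y) = x \<otimes> (?u \<otimes> comm ?b y)"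
      using x y bC C_comm[of ?u x] by (simp add: m_assoc[symmetric])
    also have "?u \<otimes> (comm ?b x \<otimes> y) = y \<otimes> (?u \<otimes> comm ?b x)"
      using x y bC C_comm[of "?u \<otimes> comm ?b x" y] by (simp add: m_assoc)
    finally show "?u \<otimes> ders ((x \<otimes>\<^bsub>S\<^esub> y) # zs) a = x \<otimes>\<^bsub>S\<^esub> (?u \<otimes> ders (y # zs) a) \<oplus>\<^bsub>S\<^esub> y \<otimes>\<^bsub>S\<^esub> (?u \<otimes> ders (x # zs) a)"
      by simp
  qed
qed

lemma args_S: "xs \<in> args S p \<Longrightarrow> set xs \<subseteq> carrier A \<and> xs \<in> tuples S (nat p)"
  using C_closed(1) by (auto simp: args_def tuples_def)

lemma symbol_add:
  "\<lbrakk>a \<in> F p; b \<in> F p\<rbrakk> \<Longrightarrow> symbol p (a \<oplus> b) = symbol p a \<oplus>\<^bsub>S.Form p\<^esub> symbol p b"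
  using args_S[of _ p] F_carrier[of _ p]
  by (auto simp: symbol_def ders_add r_distr intro!: restrict_ext)

lemma symbol_zero: "symbol p \<zero> = \<zero>\<^bsub>S.Form p\<^esub>"
  using args_S[of _ p] by (auto simp: symbol_def intro!: restrict_ext)

lemma symbol_minus:
  assumes a: "a \<in> F p"
  shows "symbol p (\<ominus> a) = \<ominus>\<^bsub>restrict_scalars S (S.Form p)\<^esub> symbol p a"
proof -
  interpret N: module R "restrict_scalars S (S.Form p)" by (rule S.module_sym_theta)
  have "symbol p (\<ominus> a) \<oplus>\<^bsub>S.Form p\<^esub> symbol p a = symbol p (\<ominus> a \<oplus> a)"
    by (rule symbol_add[OF F_minus[OF a] a, symmetric])
  then have "symbol p (\<ominus> a) \<oplus>\<^bsub>restrict_scalars S (S.Form p)\<^esub> symbol p a =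
      \<zero>\<^bsub>restrict_scalars S (S.Form p)\<^esub>"
    using F_carrier[OF a] by (simp add: l_neg symbol_zero del: sym_component_simps)
  then show ?thesis using symbol_Der[OF a] symbol_Der[OF F_minus[OF a]] by (intro N.M.minus_equality[symmetric]) simp_all
qed

lemma symbol_const: "c \<in> C \<Longrightarrow> symbol 0 c = sym_const S c"
  by (auto simp: symbol_def sym_const_def inverse_fact_0 args_def intro!: restrict_ext)

text \<open>As 1/p! is cancellable, a vanishing symbol means that all p-fold commutators vanish.
  With \<open>symbol_lower\<close>, the kernel of the symbol is exactly the next lower step.\<close>

lemma symbol_eq_zero:
  assumes a: "a \<in> F p" and z: "symbol p a = \<zero>\<^bsub>S.Form p\<^esub>"
  shows "a \<in> F (p - 1)"
proof (cases "p < 0")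
  case False
  have "ders xs a = \<zero>" if xs: "xs \<in> tuples S (nat p)" for xs
  proof (rule inverse_fact_cancel)
    show "ders xs a \<in> carrier A" using tuples_S[OF xs] F_carrier[OF a] by simp
    have "xs \<in> args S p" using xs False by (simp add: args_nonneg)
    then show "inverse_fact (nat p) \<otimes> ders xs a = \<zero>" using fun_cong[OF z, of xs] by (simp add: symbol_def)
  qed
  then show ?thesis using F_carrier[OF a] by (simp add: F_iff)
qed (use a in \<open>simp add: F_neg\<close>)

lemma symbol_lower:
  assumes a: "a \<in> F (p - 1)" shows "symbol p a = \<zero>\<^bsub>S.Form p\<^esub>"
proof (cases "p < 0")
  case False
  then have "ders xs a = \<zero>" if "xs \<in> args S p" for xs
    using a args_S[OF that] by (simp add: F_iff)
  then show ?thesis by (auto simp: symbol_def intro!: restrict_ext)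
qed (use a in \<open>simp add: F_neg symbol_zero\<close>)

text \<open>Differentiating the diagonal produces the factor p, which turns 1/p! into 1/(p - 1)!;
  the commutator with s may be moved to the innermost place.\<close>

lemma symbol_bracket_const:
  assumes a: "a \<in> F p" and s: "s \<in> C"
  shows "sym_bracket S p 0 (symbol p a) (sym_const S s) = symbol (p - 1) (comm a s)"
proof (rule S.diag_eqI[of _ "p - 1"])
  have sS: "s \<in> carrier S" using s by simp
  show "sym_bracket S p 0 (symbol p a) (sym_const S s) \<in> S.Der (p - 1)"
    by (rule S.sym_bracket_facts(1)[OF symbol_Der[OF a] S.const_form_Der[OF sS]]) simp
  show "symbol (p - 1) (comm a s) \<in> S.Der (p - 1)" by (rule symbol_Der[OF F_der[OF a s]])
  fix c assume c: "c \<in> carrier S"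
  show "diag S (p - 1) (sym_bracket S p 0 (symbol p a) (sym_const S s)) c = diag S (p - 1) (symbol (p - 1) (comm a s)) c"
    unfolding S.diag_bracket_const[OF symbol_Der[OF a] sS c]
  proof (cases "p < 1")
    case False
    define m where "m = nat p - 1"
    have p: "p = int (Suc m)" using False by (simp add: m_def)
    have aA: "a \<in> carrier A" by (rule F_carrier[OF a])
    have "set (replicate m c) \<subseteq> C" using c by auto
    from ders_move[OF this s aA] have v: "ders (replicate m c) (comm a s) = ders (s # replicate m c) a" by simp
    have vA: "ders (s # replicate m c) a \<in> carrier A" using c s aA by (intro ders_closed) auto
    have mem: "s # replicate m c \<in> args S p" unfolding p args_int using s c by simp
    have "diag_deriv S p (symbol p a) c s = [(Suc m)] \<cdot> (inverse_fact (Suc m) \<otimes> ders (s # replicate m c) a)"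
      using mem by (simp add: diag_deriv_def symbol_def p nat_add_distrib del: add.nat_pow_Suc)
    also have "\<dots> = inverse_fact m \<otimes> ders (s # replicate m c) a"
      using vA by (simp only: add_pow_ldistr[symmetric] C_closed(1)[OF inverse_fact_C] inverse_fact_Suc)
    also have "\<dots> = diag S (p - 1) (symbol (p - 1) (comm a s)) c"
      using c unfolding v[symmetric] by (simp add: diag_def symbol_def p)
    finally show "diag_deriv S p (symbol p a) c s = diag S (p - 1) (symbol (p - 1) (comm a s)) c" .
  qed (simp add: diag_deriv_def diag_def)
qed

text \<open>Bracketing with constants reduces the assertion to lower degrees.\<close>

theorem symbol_hom:
  "\<lbrakk>a \<in> F p; b \<in> F q\<rbrakk> \<Longrightarrow> a \<otimes> b \<in> F (p + q) \<and> comm a b \<in> F (p + q - 1) \<and>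
    symbol (p + q) (a \<otimes> b) = sym_mult S p q (symbol p a) (symbol q b) \<and>
    symbol (p + q - 1) (comm a b) = sym_bracket S p q (symbol p a) (symbol q b)"
\<comment> \<open>All negative degrees count as 0, so lowering a nonnegative degree by one decreases
  the measure.\<close>
proof (induction "nat (p + 1) + nat (q + 1)" arbitrary: p q a b rule: less_induct)
  case less
  note a = less.prems(1) and b = less.prems(2)
  have aA: "a \<in> carrier A" and bA: "b \<in> carrier A" using F_carrier a b by auto
  interpret P: graded_poisson_algebra R "sym_theta R S" by (rule S.sym_theta_graded_poisson_algebra)
  show ?case
  proof (cases "p < 0 \<or> q < 0")
    case True
    then have "a = \<zero> \<or> b = \<zero>" using a b by (auto simp: F_neg)
    then have "a \<otimes> b = \<zero>" "comm a b = \<zero>" using aA bA by auto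
    then show ?thesis using True symbol_zero[of "p + q"] symbol_zero[of "p + q - 1"]
      by (simp add: sym_mult_def sym_bracket_def)
  next
    case False
    then have p: "0 \<le> p" and q: "0 \<le> q" by auto
    have IH1: "comm a c \<otimes> b \<in> F (p + q - 1) \<and> comm (comm a c) b \<in> F (p + q - 2) \<and>
        symbol (p + q - 1) (comm a c \<otimes> b) = sym_mult S (p - 1) q (symbol (p - 1) (comm a c)) (symbol q b) \<and>
        symbol (p + q - 2) (comm (comm a c) b) = sym_bracket S (p - 1) q (symbol (p - 1) (comm a c)) (symbol q b)"
      if c: "c \<in> C" for c
      using less.hyps[OF _ F_der[OF a c] b] p by (simp add: algebra_simps)
    have IH2: "a \<otimes> comm b c \<in> F (p + q - 1) \<and> comm a (comm b c) \<in> F (p + q - 2) \<and>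
        symbol (p + q - 1) (a \<otimes> comm b c) = sym_mult S p (q - 1) (symbol p a) (symbol (q - 1) (comm b c)) \<and>
        symbol (p + q - 2) (comm a (comm b c)) = sym_bracket S p (q - 1) (symbol p a) (symbol (q - 1) (comm b c))"
      if c: "c \<in> C" for c
      using less.hyps[OF _ a F_der[OF b c]] q by (simp add: algebra_simps)
    have ab: "a \<otimes> b \<in> F (p + q)"
    proof (rule F_intro)
      show "comm (a \<otimes> b) c \<in> F (p + q - 1)" if "c \<in> C" for c
        using IH1[OF that] IH2[OF that] aA bA that by (simp add: comm_mult_left F_add)
    qed (use p q aA bA in auto)
    have cab: "comm a b \<in> F (p + q - 1)"
    \<comment> \<open>Here the asserted degree is -1, out of reach of \<open>F_intro\<close>; the
      commutator vanishes because a and b lie in C.\<close>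
    proof (cases "p + q = 0")
      case True
      then have "p = 0" "q = 0" using p q by auto
      then show ?thesis using a b by (simp add: F_0 comm_C)
    next
      case False
      show ?thesis
      proof (rule F_intro)
        show "comm (comm a b) c \<in> F (p + q - 1 - 1)" if "c \<in> C" for c
          using IH1[OF that] IH2[OF that] aA bA that comm_comm[of a b c] by (simp add: F_add)
      qed (use p q aA bA False in auto)
    qed
    have sa: "symbol p a \<in> homog (sym_theta R S) p" and sb: "symbol q b \<in> homog (sym_theta R S) q"
      using symbol_Der a b by simp_all
    have sc: "sym_const S c \<in> homog (sym_theta R S) 0" if "c \<in> C" for c
      using S.const_form_Der that by simp
    have mult: "symbol (p + q) (a \<otimes> b) = sym_mult S p q (symbol p a) (symbol q b)"
    proof (cases "p + q = 0")
      case True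
      then have 0: "p = 0" "q = 0" using p q by auto
      then have C: "a \<in> C" "b \<in> C" using a b by (simp_all add: F_0)
      show ?thesis
      proof (rule S.diag_eqI[of _ "p + q"])
        show "symbol (p + q) (a \<otimes> b) \<in> S.Der (p + q)" by (rule symbol_Der[OF ab])
        show "sym_mult S p q (symbol p a) (symbol q b) \<in> S.Der (p + q)"
          by (rule S.sym_mult_facts(1)[OF symbol_Der[OF a] symbol_Der[OF b] refl])
        show "diag S (p + q) (symbol (p + q) (a \<otimes> b)) c = diag S (p + q) (sym_mult S p q (symbol p a) (symbol q b)) c"
          if "c \<in> carrier S" for c
          unfolding S.sym_mult_facts(2)[OF symbol_Der[OF a] symbol_Der[OF b] refl that]
          using C that by (simp add: 0 symbol_const S.diag_sym_const)
      qed
    next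
      case False
      show ?thesis
      \<comment> \<open>Both sides are contracted with a constant c. On the left this gives the
        symbol of [a b, c] = [a, c] b + a [b, c], on the right the Leibniz rule for forms; the terms
        agree by the induction hypotheses.\<close>
      proof (rule S.contraction_eqI[OF symbol_Der[OF ab]])
        show "sym_mult S p q (symbol p a) (symbol q b) \<in> S.Der (p + q)"
          by (rule S.sym_mult_facts(1)[OF symbol_Der[OF a] symbol_Der[OF b] refl])
        show "1 \<le> p + q" using False p q by linarith
        fix c assume "c \<in> carrier S"
        then have c: "c \<in> C" by simp
        have "sym_bracket S (p + q) 0 (symbol (p + q) (a \<otimes> b)) (sym_const S c) =
          symbol (p + q - 1) (comm a c \<otimes> b \<oplus> a \<otimes> comm b c)"
          using symbol_bracket_const[OF ab c] aA bA c by (simp add: comm_mult_left)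
        also have "\<dots> = sym_mult S (p - 1) q (symbol (p - 1) (comm a c)) (symbol q b) \<oplus>\<^bsub>S.Form (p + q - 1)\<^esub>
          sym_mult S p (q - 1) (symbol p a) (symbol (q - 1) (comm b c))"
          using IH1[OF c] IH2[OF c] by (simp add: symbol_add del: sym_component_simps)
        also have "\<dots> = sym_bracket S (p + q) 0 (sym_mult S p q (symbol p a) (symbol q b)) (sym_const S c)"
          using P.bracket_mult_left[OF sa sb sc[OF c]]
          by (simp add: symbol_bracket_const[OF a c] symbol_bracket_const[OF b c] del: sym_component_simps)
        finally show "sym_bracket S (p + q) 0 (symbol (p + q) (a \<otimes> b)) (sym_const S c) =
          sym_bracket S (p + q) 0 (sym_mult S p q (symbol p a) (symbol q b)) (sym_const S c)" .
      qed
    qed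
    have bracket: "symbol (p + q - 1) (comm a b) = sym_bracket S p q (symbol p a) (symbol q b)"
    proof -
      \<comment> \<open>If a or b is a constant, the bracket is a contraction and already known.
        Otherwise it has degree at least 1, as \<open>contraction_eqI\<close> demands.\<close>
      consider "q = 0" | "p = 0" | "1 \<le> p" "1 \<le> q" using p q by linarith
      then show ?thesis
      proof cases
        case 1
        then show ?thesis using symbol_bracket_const[OF a, of b] b by (simp add: F_0 symbol_const)
      next
        case 2
        then have aC: "a \<in> C" using a by (simp add: F_0)
        have "sym_bracket S p q (symbol p a) (symbol q b) =
          \<ominus>\<^bsub>component (sym_theta R S) (p + q - 1)\<^esub> sym_bracket S q p (symbol q b) (symbol p a)"
          using P.gbracket_antisym[OF sa sb] by simp
        also have "\<dots> = \<ominus>\<^bsub>restrict_scalars S (S.Form (q - 1))\<^esub> symbol (q - 1) (comm b a)"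
          using symbol_bracket_const[OF b aC] 2 aC by (simp add: symbol_const)
        also have "\<dots> = symbol (q - 1) (comm a b)"
          using symbol_minus[OF F_der[OF b aC]] comm_swap[OF bA aA] by simp
        finally show ?thesis using 2 by simp
      next
        case 3
        show ?thesis
        proof (rule S.contraction_eqI[OF symbol_Der[OF cab]])
          show sab: "sym_bracket S p q (symbol p a) (symbol q b) \<in> S.Der (p + q - 1)"
            by (rule S.sym_bracket_facts(1)[OF symbol_Der[OF a] symbol_Der[OF b] refl])
          show "1 \<le> p + q - 1" using 3 by linarith
          fix c assume "c \<in> carrier S"
          then have c: "c \<in> C" by simp
          interpret G: abelian_group "component (sym_theta R S) (p + q - 2)" by (rule P.component_group)
          let ?u = "sym_bracket S (p - 1) q (symbol (p - 1) (comm a c)) (symbol q b)"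
          let ?v = "sym_bracket S p (q - 1) (symbol p a) (symbol (q - 1) (comm b c))"
          let ?w = "sym_bracket S (p + q - 1) 0 (sym_bracket S p q (symbol p a) (symbol q b)) (sym_const S c)"
          have u: "?u \<in> homog (sym_theta R S) (p + q - 2)"
            using S.sym_bracket_facts(1)[OF symbol_Der[OF F_der[OF a c]] symbol_Der[OF b], of "p + q - 2"] by simp
          have v: "?v \<in> homog (sym_theta R S) (p + q - 2)"
            using S.sym_bracket_facts(1)[OF symbol_Der[OF a] symbol_Der[OF F_der[OF b c]], of "p + q - 2"] by simp
          have w: "?w \<in> homog (sym_theta R S) (p + q - 2)"
            using S.sym_bracket_facts(1)[OF sab S.const_form_Der[of c], of "p + q - 2"] c by simp
          \<comment> \<open>Jacobi for [[a, b], c] in A is compared with Jacobi for forms, which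
            presents the second summand as a difference.\<close>
          have "sym_bracket S (p + q - 1) 0 (symbol (p + q - 1) (comm a b)) (sym_const S c) =
            symbol (p + q - 2) (comm (comm a c) b \<oplus> comm a (comm b c))"
            using symbol_bracket_const[OF cab c] comm_comm[of a b c] aA bA c by (simp add: algebra_simps)
          also have "\<dots> = ?u \<oplus>\<^bsub>component (sym_theta R S) (p + q - 2)\<^esub> ?v"
            using IH1[OF c] IH2[OF c] by (simp add: symbol_add del: sym_component_simps)
          also have "?v = ?w \<ominus>\<^bsub>component (sym_theta R S) (p + q - 2)\<^esub> ?u"
            using P.bracket_bracket[OF sa sb sc[OF c]]
            by (simp add: symbol_bracket_const[OF a c] symbol_bracket_const[OF b c] del: sym_component_simps)
          also have "?u \<oplus>\<^bsub>component (sym_theta R S) (p + q - 2)\<^esub> (?w \<ominus>\<^bsub>component (sym_theta R S) (p + q - 2)\<^esub> ?u) = ?w"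
            by (rule G.add_minus_cancel[OF u w])
          finally show "sym_bracket S (p + q - 1) 0 (symbol (p + q - 1) (comm a b)) (sym_const S c) = ?w" .
        qed
      qed
    qed
    show ?thesis using ab cab mult bracket by blast
  qed
qed

end


section \<open>The associated graded algebra\<close>

text \<open>The symbol map turns classes modulo the next lower step of the filtration into fibres.\<close>

locale filtered_symbol =
  fixes C :: "'a set" and M :: "('a, 'm) bimodule" and W :: "int \<Rightarrow> ('k, 'w) module"
    and \<sigma> :: "int \<Rightarrow> 'm \<Rightarrow> 'w"
  assumes group_M: "abelian_group M" and group_W: "abelian_group (W p)"
    and sub: "filtration C M p \<subseteq> carrier M"
    and add_closed: "\<lbrakk>m \<in> filtration C M p; n \<in> filtration C M p\<rbrakk> \<Longrightarrow> m \<oplus>\<^bsub>M\<^esub> n \<in> filtration C M p"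
    and minus_closed: "m \<in> filtration C M p \<Longrightarrow> \<ominus>\<^bsub>M\<^esub> m \<in> filtration C M p"
    and zero_in: "\<zero>\<^bsub>M\<^esub> \<in> filtration C M p"
    and lower: "filtration C M (p - 1) \<subseteq> filtration C M p"
    and sigma_closed: "m \<in> filtration C M p \<Longrightarrow> \<sigma> p m \<in> carrier (W p)"
    and sigma_add: "\<lbrakk>m \<in> filtration C M p; n \<in> filtration C M p\<rbrakk> \<Longrightarrow> \<sigma> p (m \<oplus>\<^bsub>M\<^esub> n) = \<sigma> p m \<oplus>\<^bsub>W p\<^esub> \<sigma> p n"
    and sigma_kernel: "m \<in> filtration C M p \<Longrightarrow> \<sigma> p m = \<zero>\<^bsub>W p\<^esub> \<longleftrightarrow> m \<in> filtration C M (p - 1)"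
begin

abbreviation "FM \<equiv> filtration C M"
abbreviation "cls \<equiv> gr_class C M"

lemma class_eq:
  assumes m: "m \<in> FM p"
  shows "cls p m = {x \<in> FM p. \<sigma> p x = \<sigma> p m}"
proof -
  interpret M: abelian_group M by (rule group_M)
  interpret W: abelian_group "W p" by (rule group_W)
  have mM: "m \<in> carrier M" using m sub by blast
  have "x \<in> cls p m \<longleftrightarrow> x \<in> FM p \<and> \<sigma> p x = \<sigma> p m" for x
  proof
    assume "x \<in> cls p m"
    then obtain h where h: "h \<in> FM (p - 1)" "x = h \<oplus>\<^bsub>M\<^esub> m"
      unfolding gr_class_def a_r_coset_def' by blast
    moreover have hp: "h \<in> FM p" using h lower by blast
    ultimately show "x \<in> FM p \<and> \<sigma> p x = \<sigma> p m"
      using m sigma_kernel[OF hp] sigma_closed[OF m] by (simp add: add_closed sigma_add)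
  next
    assume x: "x \<in> FM p \<and> \<sigma> p x = \<sigma> p m"
    then have xM: "x \<in> carrier M" using sub by blast
    let ?h = "x \<oplus>\<^bsub>M\<^esub> (\<ominus>\<^bsub>M\<^esub> m)"
    have h: "?h \<in> FM p" using x m by (simp add: add_closed minus_closed)
    have "?h \<oplus>\<^bsub>M\<^esub> m = x" using xM mM by (simp add: M.a_assoc M.l_neg)
    then have "\<sigma> p ?h \<oplus>\<^bsub>W p\<^esub> \<sigma> p m = \<sigma> p m" using sigma_add[OF h m] x by simp
    then have "\<sigma> p ?h = \<zero>\<^bsub>W p\<^esub>" using sigma_closed[OF h] sigma_closed[OF m]
      by (metis W.add.r_cancel_one)
    then have "?h \<in> FM (p - 1)" using sigma_kernel[OF h] by simp
    then show "x \<in> cls p m" unfolding gr_class_def a_r_coset_def'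
      using \<open>?h \<oplus>\<^bsub>M\<^esub> m = x\<close> by blast
  qed
  then show ?thesis by blast
qed

lemma class_eq_iff: "\<lbrakk>m \<in> FM p; n \<in> FM p\<rbrakk> \<Longrightarrow> cls p m = cls p n \<longleftrightarrow> \<sigma> p m = \<sigma> p n"
  by (auto simp: class_eq)

definition gr_map :: "int \<Rightarrow> 'm set \<Rightarrow> 'w" where "gr_map p U = \<sigma> p (SOME m. m \<in> U)"

lemma gr_map_class:
  assumes m: "m \<in> FM p" shows "gr_map p (cls p m) = \<sigma> p m"
proof -
  have "m \<in> cls p m" using m by (simp add: class_eq)
  then have "(SOME x. x \<in> cls p m) \<in> cls p m" by (rule someI)
  then show ?thesis unfolding gr_map_def using class_eq[OF m] by blast
qed

lemma gr_carrier: "carrier (gr_component C M p) = cls p ` FM p"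
  by (simp add: gr_component_def)

lemma gr_zero: "\<zero>\<^bsub>gr_component C M p\<^esub> = cls p \<zero>\<^bsub>M\<^esub>"
proof -
  interpret M: abelian_group M by (rule group_M)
  interpret W: abelian_group "W p" by (rule group_W)
  have "\<sigma> p \<zero>\<^bsub>M\<^esub> = \<zero>\<^bsub>W p\<^esub>" using sigma_kernel[OF zero_in] zero_in by simp
  moreover have "FM (p - 1) = {x \<in> FM p. \<sigma> p x = \<zero>\<^bsub>W p\<^esub>}" using sigma_kernel lower by blast
  ultimately show ?thesis using class_eq[OF zero_in, of p] by (simp add: gr_component_def)
qed

lemma gr_add:
  assumes m: "m \<in> FM p" and n: "n \<in> FM p"
  shows "cls p m \<oplus>\<^bsub>gr_component C M p\<^esub> cls p n = cls p (m \<oplus>\<^bsub>M\<^esub> n)"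
proof -
  interpret M: abelian_group M by (rule group_M)
  interpret W: abelian_group "W p" by (rule group_W)
  have mn: "m \<in> carrier M" "n \<in> carrier M" using m n sub by blast+
  have "x \<in> cls p m <+>\<^bsub>M\<^esub> cls p n \<longleftrightarrow> x \<in> cls p (m \<oplus>\<^bsub>M\<^esub> n)" for x
  proof
    assume "x \<in> cls p m <+>\<^bsub>M\<^esub> cls p n"
    then show "x \<in> cls p (m \<oplus>\<^bsub>M\<^esub> n)"
      unfolding set_add_def' class_eq[OF m] class_eq[OF n] class_eq[OF add_closed[OF m n]]
      using m n by (auto simp: add_closed sigma_add)
  next
    assume "x \<in> cls p (m \<oplus>\<^bsub>M\<^esub> n)"
    then have x: "x \<in> FM p" "\<sigma> p x = \<sigma> p m \<oplus>\<^bsub>W p\<^esub> \<sigma> p n"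
      unfolding class_eq[OF add_closed[OF m n]] using m n by (simp_all add: sigma_add)
    then have xM: "x \<in> carrier M" using sub by blast
    let ?y = "\<ominus>\<^bsub>M\<^esub> m \<oplus>\<^bsub>M\<^esub> x"
    have y: "?y \<in> FM p" using x m by (simp add: add_closed minus_closed)
    have e: "m \<oplus>\<^bsub>M\<^esub> ?y = x" using xM mn by (simp add: M.r_neg2)
    then have "\<sigma> p m \<oplus>\<^bsub>W p\<^esub> \<sigma> p ?y = \<sigma> p m \<oplus>\<^bsub>W p\<^esub> \<sigma> p n" using sigma_add[OF m y] x by simp
    then have "\<sigma> p ?y = \<sigma> p n" using sigma_closed m n y by simp
    then show "x \<in> cls p m <+>\<^bsub>M\<^esub> cls p n"
      unfolding set_add_def' class_eq[OF m] class_eq[OF n] using e m y by blast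
  qed
  then show ?thesis by (auto simp: gr_component_def)
qed

text \<open>The unions over representatives in the operations of the associated graded objects
  collapse as soon as the result depends only on the symbol of the representative.\<close>

lemma UN_class:
  assumes m: "m \<in> FM p" and "\<And>x. \<lbrakk>x \<in> FM p; \<sigma> p x = \<sigma> p m\<rbrakk> \<Longrightarrow> h x = h m"
  shows "(\<Union>x \<in> cls p m. h x) = h m"
proof -
  have "m \<in> cls p m" using m by (simp add: class_eq)
  moreover have "h x = h m" if "x \<in> cls p m" for x
    using assms(2)[of x] that unfolding class_eq[OF m] by blast
  ultimately show ?thesis by blast
qed

text \<open>Scalars of R act through r 1. The targets W are left general because the lemma serves
  the algebra, with forms on C, and the bimodule, with forms on \<open>C \<times> N\<close>.\<close>

lemma gr_linear:
  fixes R :: "'k ring" and A :: "('k, 'a) module"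
  assumes W: "\<And>p. module R (W p)"
    and scal: "\<And>r m p. \<lbrakk>r \<in> carrier R; m \<in> FM p\<rbrakk> \<Longrightarrow>
      (r \<odot>\<^bsub>A\<^esub> \<one>\<^bsub>A\<^esub>) \<odot>\<^bsub>M\<^esub> m \<in> FM p \<and> \<sigma> p ((r \<odot>\<^bsub>A\<^esub> \<one>\<^bsub>A\<^esub>) \<odot>\<^bsub>M\<^esub> m) = r \<odot>\<^bsub>W p\<^esub> \<sigma> p m"
  shows "linear_injection R (restrict_scalars A (gr_component C M p)) (W p) (gr_map p)"
    and "module R (restrict_scalars A (gr_component C M p))"
proof -
  let ?G = "restrict_scalars A (gr_component C M p)"
  have smult: "r \<odot>\<^bsub>?G\<^esub> cls p m = cls p ((r \<odot>\<^bsub>A\<^esub> \<one>\<^bsub>A\<^esub>) \<odot>\<^bsub>M\<^esub> m)"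
    if r: "r \<in> carrier R" and m: "m \<in> FM p" for r m
  proof -
    have "r \<odot>\<^bsub>?G\<^esub> cls p m = (\<Union>x \<in> cls p m. cls p ((r \<odot>\<^bsub>A\<^esub> \<one>\<^bsub>A\<^esub>) \<odot>\<^bsub>M\<^esub> x))"
      by (simp add: gr_component_def)
    also have "\<dots> = cls p ((r \<odot>\<^bsub>A\<^esub> \<one>\<^bsub>A\<^esub>) \<odot>\<^bsub>M\<^esub> m)"
      using scal r m by (intro UN_class) (simp_all add: class_eq_iff)
    finally show ?thesis .
  qed
  have inj: "inj_on (gr_map p) (carrier ?G)"
  proof (rule inj_onI)
    fix U V assume "U \<in> carrier ?G" "V \<in> carrier ?G" and eq: "gr_map p U = gr_map p V"
    then obtain m n where "U = cls p m" "m \<in> FM p" "V = cls p n" "n \<in> FM p"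
      by (auto simp: gr_carrier)
    with eq show "U = V" by (simp add: gr_map_class class_eq_iff)
  qed
  have zero: "\<zero>\<^bsub>?G\<^esub> = cls p \<zero>\<^bsub>M\<^esub>" by (simp add: gr_zero)
  have s0: "\<sigma> p \<zero>\<^bsub>M\<^esub> = \<zero>\<^bsub>W p\<^esub>" using sigma_kernel[OF zero_in] zero_in by simp
  show "linear_injection R ?G (W p) (gr_map p)"
    unfolding linear_injection_def
    by (auto simp: inj[unfolded restrict_scalars_simps gr_carrier] gr_carrier gr_map_class sigma_closed gr_add add_closed sigma_add smult[simplified] scal)
  show "module R ?G"
    by (rule module_pullback[OF W _ inj])
      (auto simp: zero[simplified] gr_carrier gr_map_class sigma_closed gr_add add_closed sigma_add smult[simplified] scal zero_in s0)
qed

end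

lemma linear_injection_submodule:
  assumes U: "module R U" and V: "module R V" and f: "linear_injection R U V f"
  shows "submodule (f ` carrier U) R V"
proof -
  interpret U: module R U by fact
  interpret V: module R V by fact
  note f' = linear_injectionD[OF f]
  have m: "\<ominus>\<^bsub>V\<^esub> f x = f (\<ominus>\<^bsub>U\<^esub> x)" if "x \<in> carrier U" for x
    by (rule additive_zero_minus(2)[OF U.M.abelian_group_axioms V.M.abelian_group_axioms f'(1,3) that, symmetric])
  have "subgroup (f ` carrier U) (add_monoid V)"
  proof (rule V.M.add.subgroupI)
    show "f ` carrier U \<noteq> {}" using U.M.zero_closed by blast
    fix a b assume "a \<in> f ` carrier U" "b \<in> f ` carrier U"
    then show "\<ominus>\<^bsub>V\<^esub> a \<in> f ` carrier U" "a \<oplus>\<^bsub>V\<^esub> b \<in> f ` carrier U"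
      using f'(3)[symmetric] m by auto
  qed (use f'(1) in auto)
  then show ?thesis
    using f'(4)[symmetric] U.smult_closed by (intro submodule.intro submodule_axioms.intro) (auto simp: )
qed

context self_centralizing
begin

abbreviation "GA \<equiv> gr_algebra A C"

sublocale gr: filtered_symbol C "self_bimodule A" "\<lambda>p. component (sym_theta R S) p" symbol
proof (rule filtered_symbol.intro)
  show "abelian_group (self_bimodule A)"
    by (rule abelian_group_cong[OF abelian_group_axioms]) simp_all
  show "abelian_group (component (sym_theta R S) p)" for p
    using S.sym_theta_graded_poisson_algebra by (rule graded_poisson_algebra.component_group)
  show "F p \<subseteq> carrier (self_bimodule A)" for p using F_carrier by auto
  show "\<ominus>\<^bsub>self_bimodule A\<^esub> m \<in> F p" if "m \<in> F p" for m p
    using F_minus[OF that] by (simp add: a_inv_cong(1)[of "self_bimodule A" A])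
  show "symbol p m = \<zero>\<^bsub>component (sym_theta R S) p\<^esub> \<longleftrightarrow> m \<in> F (p - 1)" if "m \<in> F p" for m p
    using symbol_eq_zero[OF that] symbol_lower[of m p] by (auto simp del: sym_component_simps)
qed (use F_mono in \<open>auto simp: F_add symbol_Der symbol_add simp del: sym_component_simps(2-4)\<close>)

definition \<iota> :: "int \<Rightarrow> 'a set \<Rightarrow> 'a list \<Rightarrow> 'a" where "\<iota> = gr.gr_map"

lemma iota_class: "a \<in> F p \<Longrightarrow> \<iota> p (gr.cls p a) = symbol p a"
  by (simp add: \<iota>_def gr.gr_map_class)

lemma gr_algebra_simps [simp]:
  "component GA p = restrict_scalars A (gr_component C (self_bimodule A) p)"
  "gone GA = gr.cls 0 \<one>"
  by (simp_all add: gr_algebra_def)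

lemma homog_gr: "homog GA p = gr.cls p ` F p"
  by (simp add: gr.gr_carrier)

text \<open>Independence of the representatives comes from \<open>symbol_hom\<close>: the symbol of
  a product depends only on the symbols of the factors.\<close>

lemma gr_mult:
  assumes a: "a \<in> F p" and b: "b \<in> F q"
  shows "gmult GA p q (gr.cls p a) (gr.cls q b) = gr.cls (p + q) (a \<otimes> b)"
proof -
  have "gmult GA p q (gr.cls p a) (gr.cls q b) =
    (\<Union>x \<in> gr.cls p a. \<Union>y \<in> gr.cls q b. gr.cls (p + q) (x \<otimes> y))" by (simp add: gr_algebra_def)
  also have "\<dots> = (\<Union>x \<in> gr.cls p a. gr.cls (p + q) (x \<otimes> b))"
    by (intro SUP_cong refl gr.UN_class[OF b])
      (use symbol_hom b in \<open>auto simp: gr.class_eq[OF a] gr.class_eq_iff\<close>)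
  also have "\<dots> = gr.cls (p + q) (a \<otimes> b)"
    by (rule gr.UN_class[OF a]) (use symbol_hom a b in \<open>auto simp: gr.class_eq_iff\<close>)
  finally show ?thesis .
qed

lemma gr_bracket:
  assumes a: "a \<in> F p" and b: "b \<in> F q"
  shows "gbracket GA p q (gr.cls p a) (gr.cls q b) = gr.cls (p + q - 1) (comm a b)"
proof -
  have "gbracket GA p q (gr.cls p a) (gr.cls q b) =
    (\<Union>x \<in> gr.cls p a. \<Union>y \<in> gr.cls q b. gr.cls (p + q - 1) (comm x y))" by (simp add: gr_algebra_def comm_def)
  also have "\<dots> = (\<Union>x \<in> gr.cls p a. gr.cls (p + q - 1) (comm x b))"
    by (intro SUP_cong refl gr.UN_class[OF b])
      (use symbol_hom b in \<open>auto simp: gr.class_eq[OF a] gr.class_eq_iff\<close>)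
  also have "\<dots> = gr.cls (p + q - 1) (comm a b)"
    by (rule gr.UN_class[OF a]) (use symbol_hom a b in \<open>auto simp: gr.class_eq_iff\<close>)
  finally show ?thesis .
qed

text \<open>The scalar r 1 lies in C = F_0, which gives closure; commutators with elements of C are
  linear over C, which gives the symbol.\<close>

lemma F_smult:
  assumes r: "r \<in> carrier R" and a: "a \<in> F p"
  shows "(r \<odot>\<^bsub>A\<^esub> \<one>) \<otimes> a \<in> F p" "symbol p ((r \<odot>\<^bsub>A\<^esub> \<one>) \<otimes> a) = (r \<odot>\<^bsub>A\<^esub> \<one>) \<odot>\<^bsub>S.Form p\<^esub> symbol p a"
proof -
  have c: "r \<odot>\<^bsub>A\<^esub> \<one> \<in> C" using r by simp
  then show "(r \<odot>\<^bsub>A\<^esub> \<one>) \<otimes> a \<in> F p" using symbol_hom[of "r \<odot>\<^bsub>A\<^esub> \<one>" 0 a p] a by (simp add: F_0)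
  have "ders xs ((r \<odot>\<^bsub>A\<^esub> \<one>) \<otimes> a) = (r \<odot>\<^bsub>A\<^esub> \<one>) \<otimes> ders xs a" if "set xs \<subseteq> C" for xs
    using that
  proof (induction xs)
    case (Cons x xs)
    then have "ders xs a \<in> carrier A" using F_carrier[OF a] by (intro ders_closed) auto
    with Cons c show ?case by (simp add: comm_scale)
  qed simp
  moreover have "ders xs a \<in> carrier A" if "set xs \<subseteq> C" for xs
    using that F_carrier[OF a] by (intro ders_closed) auto
  ultimately show "symbol p ((r \<odot>\<^bsub>A\<^esub> \<one>) \<otimes> a) = (r \<odot>\<^bsub>A\<^esub> \<one>) \<odot>\<^bsub>S.Form p\<^esub> symbol p a"
    using r args_def[of S p] F_carrier[OF a]
    by (auto simp: symbol_def smult_mult_left smult_mult_right intro!: restrict_ext)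
qed

lemma gr_component_linear:
  "linear_injection R (component GA p) (component (sym_theta R S) p) (\<iota> p)"
  "module R (component GA p)"
proof -
  have "linear_injection R (restrict_scalars A (gr_component C (self_bimodule A) p)) (component (sym_theta R S) p) (gr.gr_map p)
    \<and> module R (restrict_scalars A (gr_component C (self_bimodule A) p))"
  proof (intro conjI gr.gr_linear)
    show "module R (component (sym_theta R S) p)" for p by (simp add: S.module_sym_theta)
  qed (simp_all add: F_smult S.module_sym_theta del: sym_component_simps)
  then show "linear_injection R (component GA p) (component (sym_theta R S) p) (\<iota> p)"
    "module R (component GA p)" by (simp_all add: \<iota>_def)
qed

text \<open>The symbol induces an injection that respects all operations. So the axioms are pulled
  back from the forms, and the image is closed under product and bracket.\<close>

theorem gr_algebra_embedding:
  shows "graded_poisson_algebra R GA"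
    and "graded_poisson_embedding R GA (sym_theta R S) \<iota>"
    and "\<And>c. c \<in> C \<Longrightarrow> \<iota> 0 (gr.cls 0 c) = sym_const S c"
    and "nonlinear_involutive_distribution R S (\<lambda>p. \<iota> p ` homog GA p)"
proof -
  note D = S.sym_theta_graded_poisson_algebra
  have mult: "gmult GA p q x y \<in> homog GA (p + q) \<and>
      \<iota> (p + q) (gmult GA p q x y) = gmult (sym_theta R S) p q (\<iota> p x) (\<iota> q y)"
    if "x \<in> homog GA p" "y \<in> homog GA q" for p q x y
    using that symbol_hom unfolding homog_gr by (auto simp: gr_mult iota_class)
  have bracket: "gbracket GA p q x y \<in> homog GA (p + q - 1) \<and>
      \<iota> (p + q - 1) (gbracket GA p q x y) = gbracket (sym_theta R S) p q (\<iota> p x) (\<iota> q y)"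
    if "x \<in> homog GA p" "y \<in> homog GA q" for p q x y
    using that symbol_hom unfolding homog_gr by (auto simp: gr_bracket iota_class)
  show c: "\<iota> 0 (gr.cls 0 c) = sym_const S c" if "c \<in> C" for c
    using that by (simp add: iota_class F_0 symbol_const)
  have one: "gone GA \<in> homog GA 0" "\<iota> 0 (gone GA) = gone (sym_theta R S)"
    using F_0 c[of \<one>] by (simp_all add: gr.gr_carrier)
  show G: "graded_poisson_algebra R GA"
  proof (rule graded_poisson_algebra_pullback[OF D gr_component_linear(2) _ gr_component_linear(1) one mult bracket])
    show "\<exists>p0. \<forall>p<p0. homog GA p = {\<zero>\<^bsub>component GA p\<^esub>}"
      unfolding homog_gr by (rule exI[of _ 0]) (simp add: F_neg gr.gr_zero)
  qed
  show "graded_poisson_embedding R GA (sym_theta R S) \<iota>"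
    unfolding graded_poisson_embedding_def
    using G D gr_component_linear(1) one mult bracket by blast
  show "nonlinear_involutive_distribution R S (\<lambda>p. \<iota> p ` homog GA p)"
    unfolding nonlinear_involutive_distribution_def graded_poisson_subalgebra_def
  proof (intro conjI allI ballI D)
    show "submodule (\<iota> p ` homog GA p) R (component (sym_theta R S) p)" for p
      by (rule linear_injection_submodule[OF gr_component_linear(2) graded_poisson_algebra.component_module[OF D] gr_component_linear(1)])
    show "gone (sym_theta R S) \<in> \<iota> 0 ` homog GA 0" using one by (metis imageI)
    fix p q x y assume "x \<in> \<iota> p ` homog GA p" "y \<in> \<iota> q ` homog GA q"
    then obtain u v where "u \<in> homog GA p" "v \<in> homog GA q" "x = \<iota> p u" "y = \<iota> q v" by blast
    then show "gmult (sym_theta R S) p q x y \<in> \<iota> (p + q) ` homog GA (p + q)"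
      "gbracket (sym_theta R S) p q x y \<in> \<iota> (p + q - 1) ` homog GA (p + q - 1)"
      using mult bracket by (metis imageI)+
  next
    show "\<iota> 0 ` homog GA 0 = sym_const S ` carrier S"
      unfolding homog_gr F_0 S_simps(1) image_image by (rule image_cong[OF refl c])
  qed
qed

end


section \<open>Square-zero extensions\<close>

text \<open>Scalars of R act on M from the left through r 1. The construction is used twice: for A
  and M, and for a commutative algebra with a free module, where multiplicative sections encode
  families of derivations.\<close>

definition square_zero_extension :: "('r, 'a) module \<Rightarrow> ('a, 'm) bimodule \<Rightarrow> ('r, 'a \<times> 'm) module" where
  "square_zero_extension A M =
     \<lparr>carrier = carrier A \<times> carrier M,
      monoid.mult = (\<lambda>x y. (fst x \<otimes>\<^bsub>A\<^esub> fst y, fst x \<odot>\<^bsub>M\<^esub> snd y \<oplus>\<^bsub>M\<^esub> snd x \<odot>r\<^bsub>M\<^esub> fst y)),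
      one = (\<one>\<^bsub>A\<^esub>, \<zero>\<^bsub>M\<^esub>), ring.zero = (\<zero>\<^bsub>A\<^esub>, \<zero>\<^bsub>M\<^esub>),
      add = (\<lambda>x y. (fst x \<oplus>\<^bsub>A\<^esub> fst y, snd x \<oplus>\<^bsub>M\<^esub> snd y)),
      smult = (\<lambda>r x. (r \<odot>\<^bsub>A\<^esub> fst x, (r \<odot>\<^bsub>A\<^esub> \<one>\<^bsub>A\<^esub>) \<odot>\<^bsub>M\<^esub> snd x))\<rparr>"

lemma square_zero_simps [simp]:
  "carrier (square_zero_extension A M) = carrier A \<times> carrier M"
  "monoid.mult (square_zero_extension A M) (a, m) (b, n) = (a \<otimes>\<^bsub>A\<^esub> b, a \<odot>\<^bsub>M\<^esub> n \<oplus>\<^bsub>M\<^esub> m \<odot>r\<^bsub>M\<^esub> b)"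
  "one (square_zero_extension A M) = (\<one>\<^bsub>A\<^esub>, \<zero>\<^bsub>M\<^esub>)"
  "ring.zero (square_zero_extension A M) = (\<zero>\<^bsub>A\<^esub>, \<zero>\<^bsub>M\<^esub>)"
  "add (square_zero_extension A M) (a, m) (b, n) = (a \<oplus>\<^bsub>A\<^esub> b, m \<oplus>\<^bsub>M\<^esub> n)"
  "smult (square_zero_extension A M) r (a, m) = (r \<odot>\<^bsub>A\<^esub> a, (r \<odot>\<^bsub>A\<^esub> \<one>\<^bsub>A\<^esub>) \<odot>\<^bsub>M\<^esub> m)"
  by (simp_all add: square_zero_extension_def)

context bimodule
begin

lemma left_zero [simp]: "a \<in> carrier A \<Longrightarrow> a \<odot> \<zero> = \<zero>" "m \<in> carrier M \<Longrightarrow> \<zero>\<^bsub>A\<^esub> \<odot> m = \<zero>"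
proof -
  show "a \<odot> \<zero> = \<zero>" if "a \<in> carrier A"
    using left_distr[OF that M.zero_closed M.zero_closed] left_closed[OF that M.zero_closed]
    by (metis M.add.r_cancel_one' M.l_zero M.zero_closed)
  show "\<zero>\<^bsub>A\<^esub> \<odot> m = \<zero>" if "m \<in> carrier M"
  proof -
    have z: "\<zero>\<^bsub>A\<^esub> \<in> carrier A" "\<zero>\<^bsub>A\<^esub> \<oplus>\<^bsub>A\<^esub> \<zero>\<^bsub>A\<^esub> = \<zero>\<^bsub>A\<^esub>"
      by (simp_all add: ring.ring_simprules[OF ring_axioms])
    show ?thesis using left_add[OF z(1) z(1) that] left_closed[OF z(1) that]
      unfolding z(2) by (metis M.add.r_cancel_one')
  qed
qed

lemma right_zero [simp]: "a \<in> carrier A \<Longrightarrow> \<zero> \<odot>r a = \<zero>" "m \<in> carrier M \<Longrightarrow> m \<odot>r \<zero>\<^bsub>A\<^esub> = \<zero>"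
proof -
  show "\<zero> \<odot>r a = \<zero>" if "a \<in> carrier A"
    using right_distr[OF that M.zero_closed M.zero_closed] right_closed[OF that M.zero_closed]
    by (metis M.add.r_cancel_one' M.l_zero M.zero_closed)
  show "m \<odot>r \<zero>\<^bsub>A\<^esub> = \<zero>" if "m \<in> carrier M"
  proof -
    have z: "\<zero>\<^bsub>A\<^esub> \<in> carrier A" "\<zero>\<^bsub>A\<^esub> \<oplus>\<^bsub>A\<^esub> \<zero>\<^bsub>A\<^esub> = \<zero>\<^bsub>A\<^esub>"
      by (simp_all add: ring.ring_simprules[OF ring_axioms])
    show ?thesis using right_add[OF z(1) z(1) that] right_closed[OF z(1) that]
      unfolding z(2) by (metis M.add.r_cancel_one')
  qed
qed

lemma left_minus: "a \<in> carrier A \<Longrightarrow> m \<in> carrier M \<Longrightarrow> a \<odot> (\<ominus> m) = \<ominus> (a \<odot> m)"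
  using left_distr[of a "\<ominus> m" m] left_closed[of a m] left_closed[of a "\<ominus> m"]
  by (metis M.a_inv_closed M.l_neg M.minus_equality left_zero(1))

lemma right_minus: "a \<in> carrier A \<Longrightarrow> m \<in> carrier M \<Longrightarrow> (\<ominus> m) \<odot>r a = \<ominus> (m \<odot>r a)"
  using right_distr[of a "\<ominus> m" m] right_closed[of a m] right_closed[of a "\<ominus> m"]
  by (metis M.a_inv_closed M.l_neg M.minus_equality right_zero(1))

end

text \<open>The symmetry over R is what lets a scalar pass from the right action to the left one, so
  that R becomes central in the extension.\<close>

lemma assoc_algebra_square_zero:
  assumes "assoc_algebra R A" "bimodule A M" and sym: "symmetric_over R A M"
  shows "assoc_algebra R (square_zero_extension A M)"
proof -
  interpret A: assoc_algebra R A by fact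
  interpret B: bimodule A M by fact
  let ?E = "square_zero_extension A M"
  note Bs = B.left_closed B.left_add B.left_distr B.left_assoc B.left_one B.right_closed B.right_add
    B.right_distr B.right_assoc B.right_one B.left_right
  have e: "r \<odot>\<^bsub>A\<^esub> \<one>\<^bsub>A\<^esub> \<in> carrier A" if "r \<in> carrier R" for r using that by simp
  have ea: "r \<odot>\<^bsub>A\<^esub> a = (r \<odot>\<^bsub>A\<^esub> \<one>\<^bsub>A\<^esub>) \<otimes>\<^bsub>A\<^esub> a" "r \<odot>\<^bsub>A\<^esub> a = a \<otimes>\<^bsub>A\<^esub> (r \<odot>\<^bsub>A\<^esub> \<one>\<^bsub>A\<^esub>)"
    if "r \<in> carrier R" "a \<in> carrier A" for r a
    using that by (simp_all add: A.smult_mult_left A.smult_mult_right)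
  have sm: "m \<odot>r\<^bsub>M\<^esub> (r \<odot>\<^bsub>A\<^esub> \<one>\<^bsub>A\<^esub>) = (r \<odot>\<^bsub>A\<^esub> \<one>\<^bsub>A\<^esub>) \<odot>\<^bsub>M\<^esub> m" if "r \<in> carrier R" "m \<in> carrier M" for r m
    using sym that by (simp add: symmetric_over_def)
  have ag: "abelian_group ?E"
  proof (rule abelian_groupI)
    fix x assume "x \<in> carrier ?E"
    then obtain a m where "x = (a, m)" "a \<in> carrier A" "m \<in> carrier M" by auto
    then show "\<exists>y \<in> carrier ?E. y \<oplus>\<^bsub>?E\<^esub> x = \<zero>\<^bsub>?E\<^esub>"
      by (intro bexI[of _ "(\<ominus>\<^bsub>A\<^esub> a, \<ominus>\<^bsub>M\<^esub> m)"]) (simp_all add: A.l_neg B.M.l_neg)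
  qed (auto simp: A.a_ac B.M.a_ac)
  have mod: "module R ?E"
  proof (rule moduleI[OF A.R.is_cring ag])
    fix r s x assume rs: "r \<in> carrier R" "s \<in> carrier R" and "x \<in> carrier ?E"
    then obtain a m where x: "x = (a, m)" "a \<in> carrier A" "m \<in> carrier M" by auto
    show "(r \<oplus>\<^bsub>R\<^esub> s) \<odot>\<^bsub>?E\<^esub> x = r \<odot>\<^bsub>?E\<^esub> x \<oplus>\<^bsub>?E\<^esub> s \<odot>\<^bsub>?E\<^esub> x"
      using x rs by (simp add: A.smult_l_distr Bs)
    have "(r \<odot>\<^bsub>A\<^esub> \<one>\<^bsub>A\<^esub>) \<otimes>\<^bsub>A\<^esub> (s \<odot>\<^bsub>A\<^esub> \<one>\<^bsub>A\<^esub>) = (r \<otimes>\<^bsub>R\<^esub> s) \<odot>\<^bsub>A\<^esub> \<one>\<^bsub>A\<^esub>"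
      using rs by (simp add: A.smult_mult_left A.smult_assoc1)
    then show "(r \<otimes>\<^bsub>R\<^esub> s) \<odot>\<^bsub>?E\<^esub> x = r \<odot>\<^bsub>?E\<^esub> (s \<odot>\<^bsub>?E\<^esub> x)"
      using x rs by (simp add: A.smult_assoc1 Bs(4)[symmetric])
  qed (auto simp: A.smult_r_distr Bs)
  have rng: "ring ?E"
  proof (rule ringI[OF ag])
    show "monoid ?E"
      by (rule monoidI) (auto simp: A.m_assoc Bs B.M.a_ac)
  qed (auto simp: A.l_distr A.r_distr Bs B.M.a_ac)
  show ?thesis
  proof (rule assoc_algebra.intro[OF mod rng assoc_algebra_axioms.intro])
    fix r x y assume r: "r \<in> carrier R" and "x \<in> carrier ?E" "y \<in> carrier ?E"
    then obtain a m b n where x: "x = (a, m)" "a \<in> carrier A" "m \<in> carrier M"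
      and y: "y = (b, n)" "b \<in> carrier A" "n \<in> carrier M" by auto
    let ?e = "r \<odot>\<^bsub>A\<^esub> \<one>\<^bsub>A\<^esub>"
    have 1: "(r \<odot>\<^bsub>A\<^esub> a) \<odot>\<^bsub>M\<^esub> n = ?e \<odot>\<^bsub>M\<^esub> (a \<odot>\<^bsub>M\<^esub> n)"
      by (subst ea(1)[OF r x(2)]) (simp add: r x y Bs(4))
    have 2: "a \<odot>\<^bsub>M\<^esub> (?e \<odot>\<^bsub>M\<^esub> n) = ?e \<odot>\<^bsub>M\<^esub> (a \<odot>\<^bsub>M\<^esub> n)"
      using ea[OF r x(2)] r x y by (simp add: Bs(4)[symmetric])
    have 3: "m \<odot>r\<^bsub>M\<^esub> (r \<odot>\<^bsub>A\<^esub> b) = ?e \<odot>\<^bsub>M\<^esub> (m \<odot>r\<^bsub>M\<^esub> b)"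
      by (subst ea(1)[OF r y(2)]) (simp add: r x y Bs(9,11) sm)
    show "(r \<odot>\<^bsub>?E\<^esub> x) \<otimes>\<^bsub>?E\<^esub> y = r \<odot>\<^bsub>?E\<^esub> (x \<otimes>\<^bsub>?E\<^esub> y)"
      using r x y by (simp add: A.smult_mult_left 1 Bs)
    show "x \<otimes>\<^bsub>?E\<^esub> (r \<odot>\<^bsub>?E\<^esub> y) = r \<odot>\<^bsub>?E\<^esub> (x \<otimes>\<^bsub>?E\<^esub> y)"
      using r x y by (simp add: A.smult_mult_right 2 3 Bs)
  qed
qed

section \<open>The associated graded module\<close>

locale self_centralizing_bimodule = self_centralizing R A C + B: bimodule A M
  for R :: "'r ring" and A :: "('r, 'a) module" (structure) and C :: "'a set" and M :: "('a, 'm) bimodule" +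
  assumes symmetric: "symmetric_over R A M"
begin

abbreviation "zM \<equiv> \<zero>\<^bsub>M\<^esub>"
abbreviation lact (infixl "\<bullet>" 70) where "a \<bullet> m \<equiv> a \<odot>\<^bsub>M\<^esub> m"
abbreviation "GM \<equiv> gr_module A C M"

definition N :: "'m set" where "N = filtration C M 0"

definition A' :: "('r, 'a \<times> 'm) module" where "A' = square_zero_extension A M"

lemma A'_simps [simp]:
  "carrier A' = carrier A \<times> carrier M"
  "monoid.mult A' (a, m) (b, n) = (a \<otimes> b, a \<bullet> n \<oplus>\<^bsub>M\<^esub> m \<odot>r\<^bsub>M\<^esub> b)"
  "one A' = (\<one>, zM)" "ring.zero A' = (\<zero>, zM)"
  "add A' (a, m) (b, n) = (a \<oplus> b, m \<oplus>\<^bsub>M\<^esub> n)"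
  "smult A' r (a, m) = (r \<odot>\<^bsub>A\<^esub> a, (r \<odot>\<^bsub>A\<^esub> \<one>) \<bullet> m)"
  by (simp_all add: A'_def)

lemma assoc_algebra_A': "assoc_algebra R A'"
  unfolding A'_def
  by (rule assoc_algebra_square_zero[OF assoc_algebra_axioms B.bimodule_axioms symmetric])

lemma N_iff: "n \<in> N \<longleftrightarrow> n \<in> carrier M \<and> (\<forall>c \<in> C. c \<bullet> n = n \<odot>r\<^bsub>M\<^esub> c)"
  by (auto simp: N_def filtration_def ad_def B.M.minus_eq_zero_iff B.left_closed B.right_closed)

lemma N_closed: "n \<in> N \<Longrightarrow> n \<in> carrier M" "zM \<in> N" "\<lbrakk>n \<in> N; m \<in> N\<rbrakk> \<Longrightarrow> n \<oplus>\<^bsub>M\<^esub> m \<in> N"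
  "n \<in> N \<Longrightarrow> \<ominus>\<^bsub>M\<^esub> n \<in> N" "\<lbrakk>c \<in> C; n \<in> N\<rbrakk> \<Longrightarrow> c \<bullet> n \<in> N" "\<lbrakk>c \<in> C; n \<in> N\<rbrakk> \<Longrightarrow> n \<odot>r\<^bsub>M\<^esub> c = c \<bullet> n"
proof -
  show "c \<bullet> n \<in> N" if c: "c \<in> C" and n: "n \<in> N"
    unfolding N_iff
  proof (intro conjI ballI)
    fix d assume d: "d \<in> C"
    have nM: "n \<in> carrier M" and dn: "d \<bullet> n = n \<odot>r\<^bsub>M\<^esub> d" using n d by (auto simp: N_iff)
    have "d \<bullet> (c \<bullet> n) = c \<bullet> (d \<bullet> n)"
      using C_comm[OF c d] c d nM by (simp add: B.left_assoc[symmetric])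
    also have "\<dots> = (c \<bullet> n) \<odot>r\<^bsub>M\<^esub> d" using c d nM by (simp add: dn B.left_right)
    finally show "d \<bullet> (c \<bullet> n) = (c \<bullet> n) \<odot>r\<^bsub>M\<^esub> d" .
  qed (use c n N_iff B.left_closed B.right_closed in auto)
qed (auto simp: N_iff B.left_distr B.right_distr B.left_minus B.right_minus)

lemma A'_inv: "\<lbrakk>a \<in> carrier A; m \<in> carrier M\<rbrakk> \<Longrightarrow> \<ominus>\<^bsub>A'\<^esub> (a, m) = (\<ominus> a, \<ominus>\<^bsub>M\<^esub> m)"
proof -
  interpret A': assoc_algebra R A' by (rule assoc_algebra_A')
  assume "a \<in> carrier A" "m \<in> carrier M"
  then show ?thesis by (intro A'.minus_equality) (simp_all add: l_neg B.M.l_neg)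
qed

text \<open>Commuting with all (c, 0) already forces the first component into the centralizer of C
  and the second into N. Conversely \<open>C \<times> N\<close> is commutative, as C acts on N alike
  from both sides and N has square zero.\<close>

lemma self_centralizing_A': "self_centralizing R A' (C \<times> N)"
proof -
  interpret A': assoc_algebra R A' by (rule assoc_algebra_A')
  show ?thesis
  proof (intro self_centralizing.intro assoc_algebra_A' self_centralizing_axioms.intro rationals)
    show "commutative_subalgebra R A' (C \<times> N)"
      unfolding commutative_subalgebra_def
    proof (intro conjI ballI subcringI A'.subringI A'.subcringI)
      show "C \<times> N \<subseteq> carrier A'" by (auto simp: N_closed)
      show "\<ominus>\<^bsub>A'\<^esub> h \<in> C \<times> N" if "h \<in> C \<times> N" for h
        using that by (auto simp: A'_inv N_closed)
      show "h1 \<otimes>\<^bsub>A'\<^esub> h2 = h2 \<otimes>\<^bsub>A'\<^esub> h1" if "h1 \<in> C \<times> N" "h2 \<in> C \<times> N" for h1 h2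
        using that by (auto simp: N_closed C_comm B.left_closed B.M.a_comm)
    qed (auto simp: N_closed)
    fix x assume "x \<in> carrier A'" and x: "\<And>y. y \<in> C \<times> N \<Longrightarrow> x \<otimes>\<^bsub>A'\<^esub> y = y \<otimes>\<^bsub>A'\<^esub> x"
    then obtain a m where am: "x = (a, m)" "a \<in> carrier A" "m \<in> carrier M" by auto
    have *: "a \<otimes> c = c \<otimes> a \<and> m \<odot>r\<^bsub>M\<^esub> c = c \<bullet> m" if c: "c \<in> C" for c
      using x[of "(c, zM)"] c am by (simp add: N_closed B.left_closed B.right_closed)
    then have "a \<in> C" using centralizer am by blast
    moreover have "m \<in> N" using * am by (simp add: N_iff)
    ultimately show "x \<in> C \<times> N" by (simp add: am)
  qed
qed

sublocale E: self_centralizing R A' "C \<times> N" by (rule self_centralizing_A')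

lemma E_comm:
  "\<lbrakk>a \<in> carrier A; b \<in> carrier A; m \<in> carrier M; n \<in> carrier M\<rbrakk> \<Longrightarrow>
    E.comm (a, m) (b, n) = (comm a b, (a \<bullet> n \<oplus>\<^bsub>M\<^esub> m \<odot>r\<^bsub>M\<^esub> b) \<ominus>\<^bsub>M\<^esub> (b \<bullet> m \<oplus>\<^bsub>M\<^esub> n \<odot>r\<^bsub>M\<^esub> a))"
  by (simp add: E.comm_def comm_def a_minus_def A'_inv B.left_closed B.right_closed)

lemma E_comm_M:
  "\<lbrakk>b \<in> carrier A; m \<in> carrier M; n \<in> carrier M\<rbrakk> \<Longrightarrow> E.comm (\<zero>, m) (b, n) = (\<zero>, m \<odot>r\<^bsub>M\<^esub> b \<ominus>\<^bsub>M\<^esub> b \<bullet> m)"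
  by (simp add: E_comm B.left_closed B.right_closed)

text \<open>An element of M commutes with N in the extension, as M has square zero. So its
  commutators with (c, n) and with (c, 0) agree, and the two filtrations of M coincide.\<close>

lemma F_module_iff: "m \<in> carrier M \<Longrightarrow> (\<zero>, m) \<in> E.F p \<longleftrightarrow> m \<in> filtration C M p"
proof (cases "p < 0")
  case False
  assume m: "m \<in> carrier M"
  have *: "(ad (self_bimodule A') (c, n) ^^ k) (\<zero>, m) = (\<zero>, (ad M c ^^ k) m) \<and> (ad M c ^^ k) m \<in> carrier M"
    if c: "c \<in> C" and n: "n \<in> N" for c n k
  proof (induction k)
    case (Suc k)
    then show ?case
      using c n by (simp add: E.ad_self E_comm ad_def[of M] N_closed B.left_closed B.right_closed)
  qed (simp add: m)
  have "(\<forall>x \<in> C \<times> N. (ad (self_bimodule A') x ^^ k) (\<zero>, m) = \<zero>\<^bsub>self_bimodule A'\<^esub>) \<longleftrightarrow> (\<forall>c \<in> C. (ad M c ^^ k) m = zM)" for k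
    using * N_closed(2) by (auto simp: self_bimodule_def)
  then show ?thesis using False m by (simp add: filtration_def del: funpow.simps add: self_bimodule_def)
qed (simp add: filtration_def self_bimodule_def)

lemma F_M_carrier: "m \<in> filtration C M p \<Longrightarrow> m \<in> carrier M"
  by (auto simp: filtration_def split: if_splits)

text \<open>The filtration of \<open>A'\<close> tests an element of A also against N, of which the
  hypothesis on a says nothing directly. As (0, n) commutes with \<open>C \<times> N\<close>, Jacobi
  passes further commutators on to a, lowering its degree until it lies in C, which commutes with
  n.\<close>

lemma comm_F_N:
  "\<lbrakk>a \<in> F p; n \<in> N\<rbrakk> \<Longrightarrow> E.comm (a, zM) (\<zero>, n) \<in> E.F (p - 1)"
proof (induction "nat (p + 1)" arbitrary: p a rule: less_induct)
  case less
  have a: "a \<in> carrier A" using F_carrier[OF less.prems(1)] .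
  note n = less.prems(2)
  have nM: "n \<in> carrier M" using n by (simp add: N_closed)
  have e: "E.comm (a, zM) (\<zero>, n) = (\<zero>, a \<bullet> n \<ominus>\<^bsub>M\<^esub> n \<odot>r\<^bsub>M\<^esub> a)"
    using a nM by (simp add: E_comm B.left_closed B.right_closed)
  show ?case
  proof (cases "p \<le> 0")
    case True
    then have "a \<in> C" using less.prems(1) F_0 by (cases "p = 0") (auto simp: F_neg)
    then have "E.comm (a, zM) (\<zero>, n) = \<zero>\<^bsub>A'\<^esub>"
      unfolding e using n by (simp add: N_closed a_minus_def B.M.r_neg)
    then show ?thesis using E.F_zero by simp
  next
    case False
    show ?thesis
    proof (rule E.F_intro)
      show "E.comm (E.comm (a, zM) (\<zero>, n)) x \<in> E.F (p - 1 - 1)" if "x \<in> C \<times> N" for x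
      proof -
        obtain c k where x: "x = (c, k)" "c \<in> C" "k \<in> N" using \<open>x \<in> C \<times> N\<close> by auto
        have kM: "k \<in> carrier M" using x by (simp add: N_closed)
        have nC: "(\<zero>, n) \<in> C \<times> N" using n by simp
        have cc: "comm a c \<in> carrier A" using a x by simp
        have "E.comm (E.comm (a, zM) (\<zero>, n)) x = E.comm (E.comm (a, zM) x) (\<zero>, n) \<oplus>\<^bsub>A'\<^esub> E.comm (a, zM) (E.comm (\<zero>, n) x)"
          using a nM x kM by (intro E.comm_comm) simp_all
        also have "E.comm (\<zero>, n) x = \<zero>\<^bsub>A'\<^esub>" by (rule E.comm_C[OF nC \<open>x \<in> C \<times> N\<close>])
        also have "E.comm (E.comm (a, zM) x) (\<zero>, n) = E.comm (comm a c, zM) (\<zero>, n)"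
          using a nM x kM cc by (simp add: E_comm B.left_closed B.right_closed)
        finally have "E.comm (E.comm (a, zM) (\<zero>, n)) x = E.comm (comm a c, zM) (\<zero>, n)"
          using a nM cc by (simp add: E_comm B.left_closed B.right_closed a_minus_def)
        then show ?thesis
          using less.hyps[OF _ F_der[OF less.prems(1) x(2)] n] False by simp
      qed
    qed (use False a nM in \<open>simp_all add: e B.left_closed B.right_closed\<close>)
  qed
qed

text \<open>The commutator of (a, 0) with (c, n) splits into [a, c], handled by induction, and the
  commutator with (0, n), which has lower degree by \<open>comm_F_N\<close>.\<close>

lemma F_algebra: "a \<in> F p \<Longrightarrow> (a, zM) \<in> E.F p"
proof (induction "nat (p + 1)" arbitrary: p a rule: less_induct)
  case less
  have a: "a \<in> carrier A" using F_carrier[OF less.prems(1)] .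
  show ?case
  proof (cases "p < 0")
    case True
    then show ?thesis using less.prems E.F_zero[of p] by (simp add: F_neg)
  next
    case False
    show ?thesis
    proof (rule E.F_intro)
      fix x assume "x \<in> C \<times> N"
      then obtain c n where x: "x = (c, n)" "c \<in> C" "n \<in> N" by auto
      have nM: "n \<in> carrier M" using x by (simp add: N_closed)
      have "E.comm (a, zM) x = (comm a c, zM) \<oplus>\<^bsub>A'\<^esub> E.comm (a, zM) (\<zero>, n)"
        using a x nM by (simp add: E_comm B.left_closed B.right_closed)
      then show "E.comm (a, zM) x \<in> E.F (p - 1)"
        using less.hyps[OF _ F_der[OF less.prems x(2)]] comm_F_N[OF less.prems x(3)] False
        by (simp add: E.F_add)
    qed (use False a in simp_all)
  qed
qed

section \<open>Symbols in the square-zero extension\<close>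

definition sigma :: "int \<Rightarrow> 'm \<Rightarrow> ('a \<times> 'm) list \<Rightarrow> 'a \<times> 'm" where "sigma p m = E.symbol p (\<zero>, m)"

text \<open>The class of a is sent to a form on \<open>C \<times> N\<close>, which also records the
  commutators of a with N. This form, not the one on C, lives in the same Poisson algebra as the
  symbols of elements of M.\<close>

definition kappa :: "int \<Rightarrow> 'a set \<Rightarrow> ('a \<times> 'm) list \<Rightarrow> 'a \<times> 'm" where
  "kappa p U = E.symbol p (SOME a. a \<in> U, zM)"

text \<open>Another representative differs by an element of the lower step of A, which by
  \<open>F_algebra\<close> lies in the lower step of \<open>A'\<close> and has zero symbol
  there.\<close>

lemma kappa_class:
  assumes a: "a \<in> F p" shows "kappa p (gr.cls p a) = E.symbol p (a, zM)"
proof -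
  define b where "b = (SOME a'. a' \<in> gr.cls p a)"
  have "a \<in> gr.cls p a" using a by (simp add: gr.class_eq)
  then have "b \<in> gr.cls p a" unfolding b_def by (rule someI)
  then have b: "b \<in> F p" "symbol p b = symbol p a" using gr.class_eq[OF a] by auto
  then have "gr.cls p b = gr.cls p a" using gr.class_eq_iff a by blast
  then obtain h where h: "h \<in> F (p - 1)" "b = h \<oplus> a"
    using \<open>b \<in> gr.cls p a\<close> unfolding gr_class_def a_r_coset_def' by auto
  have "(b, zM) = (h, zM) \<oplus>\<^bsub>A'\<^esub> (a, zM)" by (simp add: h)
  then have "E.symbol p (b, zM) = E.symbol p (h, zM) \<oplus>\<^bsub>E.S.Form p\<^esub> E.symbol p (a, zM)"
    using E.symbol_add[OF F_algebra F_algebra, of h p a] h F_mono a by auto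
  also have "E.symbol p (h, zM) = \<zero>\<^bsub>E.S.Form p\<^esub>"
    by (rule E.symbol_lower[OF F_algebra[OF h(1)]])
  also have "\<zero>\<^bsub>E.S.Form p\<^esub> \<oplus>\<^bsub>E.S.Form p\<^esub> E.symbol p (a, zM) = E.symbol p (a, zM)"
    using abelian_monoid.l_zero[OF abelian_group.axioms(1)[OF module.axioms(2)[OF E.S.module_sym_component]], of "E.symbol p (a, zM)" p]
      E.symbol_Der[OF F_algebra[OF a]] by simp
  finally show ?thesis unfolding kappa_def b_def .
qed

sublocale grM: filtered_symbol C M "\<lambda>p. component (sym_theta R E.S) p" sigma
proof (rule filtered_symbol.intro)
  note c = F_M_carrier
  show "abelian_group M" by (rule B.M.abelian_group_axioms)
  show "abelian_group (component (sym_theta R E.S) p)" for p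
    using E.S.sym_theta_graded_poisson_algebra by (rule graded_poisson_algebra.component_group)
  fix p
  show "filtration C M p \<subseteq> carrier M" using c by auto
  show "zM \<in> filtration C M p" using E.F_zero[of p] F_module_iff[of "zM" p] by simp
  show "filtration C M (p - 1) \<subseteq> filtration C M p"
    using E.F_mono[of p] F_module_iff c by blast
  fix m assume m: "m \<in> filtration C M p"
  then have m': "(\<zero>, m) \<in> E.F p" "m \<in> carrier M" using F_module_iff c by auto
  show "\<ominus>\<^bsub>M\<^esub> m \<in> filtration C M p"
    using E.F_minus[OF m'(1)] F_module_iff[of "\<ominus>\<^bsub>M\<^esub> m" p] m' by (simp add: A'_inv)
  show "sigma p m \<in> carrier (component (sym_theta R E.S) p)"
    using E.symbol_Der[OF m'(1)] by (simp add: sigma_def)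
  show "sigma p m = \<zero>\<^bsub>component (sym_theta R E.S) p\<^esub> \<longleftrightarrow> m \<in> filtration C M (p - 1)"
    using E.symbol_eq_zero[OF m'(1)] E.symbol_lower[of "(\<zero>, m)" p] F_module_iff[OF m'(2)]
    by (auto simp: sigma_def simp del: sym_component_simps)
  fix n assume n: "n \<in> filtration C M p"
  then have n': "(\<zero>, n) \<in> E.F p" "n \<in> carrier M" using F_module_iff c by auto
  show "m \<oplus>\<^bsub>M\<^esub> n \<in> filtration C M p"
    using E.F_add[OF m'(1) n'(1)] F_module_iff[of "m \<oplus>\<^bsub>M\<^esub> n" p] m' n' by simp
  show "sigma p (m \<oplus>\<^bsub>M\<^esub> n) = sigma p m \<oplus>\<^bsub>component (sym_theta R E.S) p\<^esub> sigma p n"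
    using E.symbol_add[OF m'(1) n'(1)] by (simp add: sigma_def del: sym_component_simps)
qed

text \<open>M is an ideal of \<open>A'\<close>, where m a and [m, a] are product and commutator of
  (0, m) and (a, 0); both are instances of \<open>symbol_hom\<close> for the extension.\<close>

lemma sigma_hom:
  assumes m: "m \<in> filtration C M p" and a: "a \<in> F q"
  shows "m \<odot>r\<^bsub>M\<^esub> a \<in> filtration C M (p + q)"
    and "sigma (p + q) (m \<odot>r\<^bsub>M\<^esub> a) = sym_mult E.S p q (sigma p m) (E.symbol q (a, zM))"
    and "m \<odot>r\<^bsub>M\<^esub> a \<ominus>\<^bsub>M\<^esub> a \<bullet> m \<in> filtration C M (p + q - 1)"
    and "sigma (p + q - 1) (m \<odot>r\<^bsub>M\<^esub> a \<ominus>\<^bsub>M\<^esub> a \<bullet> m) = sym_bracket E.S p q (sigma p m) (E.symbol q (a, zM))"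
proof -
  have mM: "m \<in> carrier M" and aA: "a \<in> carrier A" using F_M_carrier[OF m] F_carrier[OF a] .
  have m': "(\<zero>, m) \<in> E.F p" using F_module_iff[OF mM] m by simp
  have 1: "(\<zero>, m) \<otimes>\<^bsub>A'\<^esub> (a, zM) = (\<zero>, m \<odot>r\<^bsub>M\<^esub> a)" using mM aA by (simp add: B.right_closed)
  have 2: "E.comm (\<zero>, m) (a, zM) = (\<zero>, m \<odot>r\<^bsub>M\<^esub> a \<ominus>\<^bsub>M\<^esub> a \<bullet> m)" using mM aA by (simp add: E_comm_M)
  have cl: "m \<odot>r\<^bsub>M\<^esub> a \<in> carrier M" "m \<odot>r\<^bsub>M\<^esub> a \<ominus>\<^bsub>M\<^esub> a \<bullet> m \<in> carrier M"
    using mM aA by (simp_all add: B.left_closed B.right_closed)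
  note h = E.symbol_hom[OF m' F_algebra[OF a], unfolded 1 2]
  show "m \<odot>r\<^bsub>M\<^esub> a \<in> filtration C M (p + q)"
    and "sigma (p + q) (m \<odot>r\<^bsub>M\<^esub> a) = sym_mult E.S p q (sigma p m) (E.symbol q (a, zM))"
    and "m \<odot>r\<^bsub>M\<^esub> a \<ominus>\<^bsub>M\<^esub> a \<bullet> m \<in> filtration C M (p + q - 1)"
    and "sigma (p + q - 1) (m \<odot>r\<^bsub>M\<^esub> a \<ominus>\<^bsub>M\<^esub> a \<bullet> m) = sym_bracket E.S p q (sigma p m) (E.symbol q (a, zM))"
    using h unfolding sigma_def F_module_iff[OF cl(1)] F_module_iff[OF cl(2)] by blast+
qed

lemma gr_module_simps [simp]:
  "mcomponent GM p = restrict_scalars A (gr_component C M p)"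
  by (simp add: gr_module_def)

lemma mhomog_gr: "mhomog GM p = grM.cls p ` filtration C M p"
  by (simp add: grM.gr_carrier)

lemma gr_act:
  assumes m: "m \<in> filtration C M p" and a: "a \<in> F q"
  shows "mact GM p q (grM.cls p m) (gr.cls q a) = grM.cls (p + q) (m \<odot>r\<^bsub>M\<^esub> a)"
    and "mbracket GM p q (grM.cls p m) (gr.cls q a) = grM.cls (p + q - 1) (m \<odot>r\<^bsub>M\<^esub> a \<ominus>\<^bsub>M\<^esub> a \<bullet> m)"
proof -
  \<comment> \<open>Equal symbols on C mean equal classes in \<open>GA\<close>, and
    \<open>kappa\<close> sees only the class; so the symbols on \<open>C \<times> N\<close> agree as
    well.\<close>
  have k: "E.symbol q (x, zM) = E.symbol q (a, zM)" if "x \<in> F q" "symbol q x = symbol q a" for x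
    using kappa_class[OF that(1)] kappa_class[OF a] gr.class_eq_iff[OF that(1) a] that(2) by simp
  have "mact GM p q (grM.cls p m) (gr.cls q a) =
    (\<Union>x \<in> grM.cls p m. \<Union>y \<in> gr.cls q a. grM.cls (p + q) (x \<odot>r\<^bsub>M\<^esub> y))" by (simp add: gr_module_def)
  also have "\<dots> = (\<Union>x \<in> grM.cls p m. grM.cls (p + q) (x \<odot>r\<^bsub>M\<^esub> a))"
  proof (intro SUP_cong refl gr.UN_class[OF a])
    fix x y assume "x \<in> grM.cls p m" and y: "y \<in> F q" "symbol q y = symbol q a"
    then have x: "x \<in> filtration C M p" using grM.class_eq[OF m] by blast
    show "grM.cls (p + q) (x \<odot>r\<^bsub>M\<^esub> y) = grM.cls (p + q) (x \<odot>r\<^bsub>M\<^esub> a)"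
      unfolding grM.class_eq_iff[OF sigma_hom(1)[OF x y(1)] sigma_hom(1)[OF x a]] sigma_hom(2)[OF x y(1)] sigma_hom(2)[OF x a] k[OF y] ..
  qed
  also have "\<dots> = grM.cls (p + q) (m \<odot>r\<^bsub>M\<^esub> a)"
  proof (rule grM.UN_class[OF m])
    fix x assume x: "x \<in> filtration C M p" "sigma p x = sigma p m"
    show "grM.cls (p + q) (x \<odot>r\<^bsub>M\<^esub> a) = grM.cls (p + q) (m \<odot>r\<^bsub>M\<^esub> a)"
      unfolding grM.class_eq_iff[OF sigma_hom(1)[OF x(1) a] sigma_hom(1)[OF m a]] sigma_hom(2)[OF x(1) a] sigma_hom(2)[OF m a] x(2) ..
  qed
  finally show "mact GM p q (grM.cls p m) (gr.cls q a) = grM.cls (p + q) (m \<odot>r\<^bsub>M\<^esub> a)" .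
  have "mbracket GM p q (grM.cls p m) (gr.cls q a) =
    (\<Union>x \<in> grM.cls p m. \<Union>y \<in> gr.cls q a. grM.cls (p + q - 1) (x \<odot>r\<^bsub>M\<^esub> y \<ominus>\<^bsub>M\<^esub> y \<bullet> x))" by (simp add: gr_module_def)
  also have "\<dots> = (\<Union>x \<in> grM.cls p m. grM.cls (p + q - 1) (x \<odot>r\<^bsub>M\<^esub> a \<ominus>\<^bsub>M\<^esub> a \<bullet> x))"
  proof (intro SUP_cong refl gr.UN_class[OF a])
    fix x y assume "x \<in> grM.cls p m" and y: "y \<in> F q" "symbol q y = symbol q a"
    then have x: "x \<in> filtration C M p" using grM.class_eq[OF m] by blast
    show "grM.cls (p + q - 1) (x \<odot>r\<^bsub>M\<^esub> y \<ominus>\<^bsub>M\<^esub> y \<bullet> x) = grM.cls (p + q - 1) (x \<odot>r\<^bsub>M\<^esub> a \<ominus>\<^bsub>M\<^esub> a \<bullet> x)"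
      unfolding grM.class_eq_iff[OF sigma_hom(3)[OF x y(1)] sigma_hom(3)[OF x a]] sigma_hom(4)[OF x y(1)] sigma_hom(4)[OF x a] k[OF y] ..
  qed
  also have "\<dots> = grM.cls (p + q - 1) (m \<odot>r\<^bsub>M\<^esub> a \<ominus>\<^bsub>M\<^esub> a \<bullet> m)"
  proof (rule grM.UN_class[OF m])
    fix x assume x: "x \<in> filtration C M p" "sigma p x = sigma p m"
    show "grM.cls (p + q - 1) (x \<odot>r\<^bsub>M\<^esub> a \<ominus>\<^bsub>M\<^esub> a \<bullet> x) = grM.cls (p + q - 1) (m \<odot>r\<^bsub>M\<^esub> a \<ominus>\<^bsub>M\<^esub> a \<bullet> m)"
      unfolding grM.class_eq_iff[OF sigma_hom(3)[OF x(1) a] sigma_hom(3)[OF m a]] sigma_hom(4)[OF x(1) a] sigma_hom(4)[OF m a] x(2) ..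
  qed
  finally show "mbracket GM p q (grM.cls p m) (gr.cls q a) = grM.cls (p + q - 1) (m \<odot>r\<^bsub>M\<^esub> a \<ominus>\<^bsub>M\<^esub> a \<bullet> m)" .
qed

lemma gr_module_linear:
  "linear_injection R (mcomponent GM p) (component (sym_theta R E.S) p) (grM.gr_map p)"
  "module R (mcomponent GM p)"
proof -
  have "(r \<odot>\<^bsub>A\<^esub> \<one>) \<bullet> m \<in> filtration C M p \<and>
      sigma p ((r \<odot>\<^bsub>A\<^esub> \<one>) \<bullet> m) = r \<odot>\<^bsub>component (sym_theta R E.S) p\<^esub> sigma p m"
    if r: "r \<in> carrier R" and m: "m \<in> filtration C M p" for r m p
  proof -
    have mM: "m \<in> carrier M" using F_M_carrier[OF m] .
    have m': "(\<zero>, m) \<in> E.F p" using F_module_iff[OF mM] m by simp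
    have "(r \<odot>\<^bsub>A'\<^esub> \<one>\<^bsub>A'\<^esub>) \<otimes>\<^bsub>A'\<^esub> (\<zero>, m) = (\<zero>, (r \<odot>\<^bsub>A\<^esub> \<one>) \<bullet> m)"
      using r mM by (simp add: B.left_closed)
    then show ?thesis
      using E.F_smult[OF r m'] F_module_iff[of "(r \<odot>\<^bsub>A\<^esub> \<one>) \<bullet> m" p] r mM
      by (simp add: sigma_def B.left_closed del: sym_component_simps)
  qed
  note * = grM.gr_linear[OF graded_poisson_algebra.component_module[OF E.S.sym_theta_graded_poisson_algebra] this]
  show "linear_injection R (mcomponent GM p) (component (sym_theta R E.S) p) (grM.gr_map p)"
    "module R (mcomponent GM p)" using *[of p] by simp_all
qed

lemma kappa_hom:
  "x \<in> homog GA p \<Longrightarrow> kappa p x \<in> homog (sym_theta R E.S) p"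
  "\<lbrakk>x \<in> homog GA p; y \<in> homog GA p\<rbrakk> \<Longrightarrow>
    kappa p (x \<oplus>\<^bsub>component GA p\<^esub> y) = kappa p x \<oplus>\<^bsub>component (sym_theta R E.S) p\<^esub> kappa p y"
  "\<lbrakk>r \<in> carrier R; x \<in> homog GA p\<rbrakk> \<Longrightarrow>
    kappa p (r \<odot>\<^bsub>component GA p\<^esub> x) = r \<odot>\<^bsub>component (sym_theta R E.S) p\<^esub> kappa p x"
  "kappa 0 (gone GA) = gone (sym_theta R E.S)"
  "\<lbrakk>x \<in> homog GA p; y \<in> homog GA q\<rbrakk> \<Longrightarrow>
    kappa (p + q) (gmult GA p q x y) = gmult (sym_theta R E.S) p q (kappa p x) (kappa q y)"
  "\<lbrakk>x \<in> homog GA p; y \<in> homog GA q\<rbrakk> \<Longrightarrow>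
    kappa (p + q - 1) (gbracket GA p q x y) = gbracket (sym_theta R E.S) p q (kappa p x) (kappa q y)"
proof -
  have hm: "E.symbol (p + q) (a \<otimes> b, zM) = sym_mult E.S p q (E.symbol p (a, zM)) (E.symbol q (b, zM))"
    "E.symbol (p + q - 1) (comm a b, zM) = sym_bracket E.S p q (E.symbol p (a, zM)) (E.symbol q (b, zM))"
    if "a \<in> F p" "b \<in> F q" for a b p q
  proof -
    have e: "(a, zM) \<otimes>\<^bsub>A'\<^esub> (b, zM) = (a \<otimes> b, zM)" "E.comm (a, zM) (b, zM) = (comm a b, zM)"
      using F_carrier[OF that(1)] F_carrier[OF that(2)] by (simp_all add: E_comm a_minus_def)
    show "E.symbol (p + q) (a \<otimes> b, zM) = sym_mult E.S p q (E.symbol p (a, zM)) (E.symbol q (b, zM))"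
      "E.symbol (p + q - 1) (comm a b, zM) = sym_bracket E.S p q (E.symbol p (a, zM)) (E.symbol q (b, zM))"
      using E.symbol_hom[OF F_algebra[OF that(1)] F_algebra[OF that(2)], unfolded e] by simp_all
  qed
  show "kappa p x \<in> homog (sym_theta R E.S) p" if "x \<in> homog GA p"
    using that unfolding homog_gr by (auto simp: kappa_class E.symbol_Der F_algebra)
  show "kappa (p + q) (gmult GA p q x y) = gmult (sym_theta R E.S) p q (kappa p x) (kappa q y)"
    if "x \<in> homog GA p" "y \<in> homog GA q"
    using that symbol_hom unfolding homog_gr by (auto simp: gr_mult kappa_class hm)
  show "kappa (p + q - 1) (gbracket GA p q x y) = gbracket (sym_theta R E.S) p q (kappa p x) (kappa q y)"
    if "x \<in> homog GA p" "y \<in> homog GA q"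
    using that symbol_hom unfolding homog_gr by (auto simp: gr_bracket kappa_class hm)
  show "kappa 0 (gone GA) = gone (sym_theta R E.S)"
    using E.symbol_const[of "(\<one>, zM)"] by (simp add: kappa_class F_0 N_closed)
  show "kappa p (x \<oplus>\<^bsub>component GA p\<^esub> y) = kappa p x \<oplus>\<^bsub>component (sym_theta R E.S) p\<^esub> kappa p y"
    if xy: "x \<in> homog GA p" "y \<in> homog GA p"
  proof -
    obtain a b where ab: "x = gr.cls p a" "a \<in> F p" "y = gr.cls p b" "b \<in> F p" using xy unfolding homog_gr by auto
    then show ?thesis using E.symbol_add[OF F_algebra[OF ab(2)] F_algebra[OF ab(4)]]
      by (simp add: gr.gr_add kappa_class F_add del: sym_component_simps)
  qed
  show "kappa p (r \<odot>\<^bsub>component GA p\<^esub> x) = r \<odot>\<^bsub>component (sym_theta R E.S) p\<^esub> kappa p x"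
    if r: "r \<in> carrier R" and x: "x \<in> homog GA p"
  proof -
    obtain a where a: "x = gr.cls p a" "a \<in> F p" using x unfolding homog_gr by auto
    have aA: "a \<in> carrier A" using F_carrier[OF a(2)] .
    have 1: "r \<odot>\<^bsub>component GA p\<^esub> x = gr.cls p ((r \<odot>\<^bsub>A\<^esub> \<one>) \<otimes> a)"
    proof -
      have "r \<odot>\<^bsub>component GA p\<^esub> x \<in> homog GA p"
        by (rule module.smult_closed[OF gr_component_linear(2) r x])
      moreover have "\<iota> p (r \<odot>\<^bsub>component GA p\<^esub> x) = \<iota> p (gr.cls p ((r \<odot>\<^bsub>A\<^esub> \<one>) \<otimes> a))"
        using linear_injectionD(4)[OF gr_component_linear(1) r x] F_smult[OF r a(2)] r
        by (simp add: a iota_class del: gr_algebra_simps sym_component_simps)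
      moreover have "gr.cls p ((r \<odot>\<^bsub>A\<^esub> \<one>) \<otimes> a) \<in> homog GA p"
        unfolding homog_gr using F_smult[OF r a(2)] by blast
      ultimately show ?thesis using inj_onD[OF linear_injectionD(2)[OF gr_component_linear(1)]] by blast
    qed
    have e: "(r \<odot>\<^bsub>A'\<^esub> \<one>\<^bsub>A'\<^esub>) \<otimes>\<^bsub>A'\<^esub> (a, zM) = ((r \<odot>\<^bsub>A\<^esub> \<one>) \<otimes> a, zM)"
      using r aA by simp
    show ?thesis unfolding 1
      using E.F_smult(2)[OF r F_algebra[OF a(2)]] F_smult(1)[OF r a(2)] r
      unfolding e by (simp add: a kappa_class del: sym_component_simps)
  qed
qed

text \<open>Gr M sits inside the forms on \<open>C \<times> N\<close> by its symbols, and Gr A acts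
  there through \<open>kappa\<close>.\<close>

theorem gr_module_graded_poisson_module: "graded_poisson_module R GA GM"
proof (rule graded_poisson_module_pullback[OF gr_algebra_embedding(1) E.S.sym_theta_graded_poisson_algebra
      gr_module_linear(2) _ kappa_hom gr_module_linear(1)])
  show "\<exists>p0. \<forall>p<p0. mhomog GM p = {\<zero>\<^bsub>mcomponent GM p\<^esub>}"
    unfolding mhomog_gr by (rule exI[of _ 0]) (simp add: filtration_def grM.gr_zero)
  fix p q n x assume "n \<in> mhomog GM p" "x \<in> homog GA q"
  then obtain m a where m: "n = grM.cls p m" "m \<in> filtration C M p" and a: "x = gr.cls q a" "a \<in> F q"
    unfolding homog_gr mhomog_gr by auto
  note h = sigma_hom[OF m(2) a(2)]
  show "mact GM p q n x \<in> mhomog GM (p + q) \<and>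
      grM.gr_map (p + q) (mact GM p q n x) = gmult (sym_theta R E.S) p q (grM.gr_map p n) (kappa q x)"
    unfolding m(1) a(1) gr_act[OF m(2) a(2)] mhomog_gr using h m a by (simp add: grM.gr_map_class kappa_class)
  show "mbracket GM p q n x \<in> mhomog GM (p + q - 1) \<and>
      grM.gr_map (p + q - 1) (mbracket GM p q n x) = gbracket (sym_theta R E.S) p q (grM.gr_map p n) (kappa q x)"
    unfolding m(1) a(1) gr_act[OF m(2) a(2)] mhomog_gr using h m a by (simp add: grM.gr_map_class kappa_class)
qed

end


section \<open>Tensor products\<close>

locale tensor = N: module K N + V: module K V
  for K :: "('k, 'z) ring_scheme" and N :: "('k, 'n) module" and V :: "('k, 'v) module"
begin

abbreviation "pairs \<equiv> carrier N \<times> carrier V"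
abbreviation "rel \<equiv> tensor_relations (carrier K) N V"
abbreviation "coset \<equiv> tensor_coset (carrier K) N V"
abbreviation "T \<equiv> tensor_product (carrier K) N V"
abbreviation "pure \<equiv> pure_tensor (carrier K) N V"

lemma relation_in_pairs:
  "{frag_of (x \<oplus>\<^bsub>N\<^esub> y, v) - frag_of (x, v) - frag_of (y, v) | x y v.
         x \<in> carrier N \<and> y \<in> carrier N \<and> v \<in> carrier V} \<union>
      {frag_of (x, v \<oplus>\<^bsub>V\<^esub> w) - frag_of (x, v) - frag_of (x, w) | x v w.
         x \<in> carrier N \<and> v \<in> carrier V \<and> w \<in> carrier V} \<union>
      {frag_of (k \<odot>\<^bsub>N\<^esub> x, v) - frag_of (x, k \<odot>\<^bsub>V\<^esub> v) | k x v.
         k \<in> carrier K \<and> x \<in> carrier N \<and> v \<in> carrier V} \<subseteq> carrier (free_Abelian_group pairs)"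
proof -
  have "Poly_Mapping.keys (frag_of a - frag_of b) \<subseteq> pairs" if "a \<in> pairs" "b \<in> pairs" for a b :: "'n \<times> 'v"
    using keys_diff[of "frag_of a" "frag_of b"] that by auto
  moreover have "Poly_Mapping.keys (frag_of a - frag_of b - frag_of c) \<subseteq> pairs"
    if "a \<in> pairs" "b \<in> pairs" "c \<in> pairs" for a b c :: "'n \<times> 'v"
    using keys_diff[of "frag_of a - frag_of b" "frag_of c"] keys_diff[of "frag_of a" "frag_of b"] that by auto
  ultimately show ?thesis by auto
qed

lemma rel_subgroup: "subgroup rel (free_Abelian_group pairs)"
  unfolding tensor_relations_def
  by (rule group.generate_is_subgroup[OF group_free_Abelian_group relation_in_pairs])

lemma rel_keys: "r \<in> rel \<Longrightarrow> Poly_Mapping.keys r \<subseteq> pairs"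
  using subgroup.mem_carrier[OF rel_subgroup] by (simp only: carrier_free_Abelian_group_iff)

lemma rel_0: "0 \<in> rel" and rel_add: "\<lbrakk>r \<in> rel; s \<in> rel\<rbrakk> \<Longrightarrow> r + s \<in> rel" and rel_minus: "r \<in> rel \<Longrightarrow> - r \<in> rel"
  using subgroup.one_closed[OF rel_subgroup] subgroup.m_closed[OF rel_subgroup, of r s]
    subgroup.m_inv_closed[OF rel_subgroup, of r] rel_keys[of r] by simp_all

text \<open>Closure under differences accounts for both sums and inverses in the generated
  subgroup.\<close>

lemma rel_induct [consumes 1, case_names zero add left right balanced]:
  assumes "r \<in> rel" and "P 0" and "\<And>a b. \<lbrakk>P a; P b\<rbrakk> \<Longrightarrow> P (a - b)"
    and "\<And>x y v. \<lbrakk>x \<in> carrier N; y \<in> carrier N; v \<in> carrier V\<rbrakk> \<Longrightarrow> P (frag_of (x \<oplus>\<^bsub>N\<^esub> y, v) - frag_of (x, v) - frag_of (y, v))"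
    and "\<And>x v w. \<lbrakk>x \<in> carrier N; v \<in> carrier V; w \<in> carrier V\<rbrakk> \<Longrightarrow> P (frag_of (x, v \<oplus>\<^bsub>V\<^esub> w) - frag_of (x, v) - frag_of (x, w))"
    and "\<And>k x v. \<lbrakk>k \<in> carrier K; x \<in> carrier N; v \<in> carrier V\<rbrakk> \<Longrightarrow> P (frag_of (k \<odot>\<^bsub>N\<^esub> x, v) - frag_of (x, k \<odot>\<^bsub>V\<^esub> v))"
  shows "P r"
  using assms(1) unfolding tensor_relations_def
proof (induction r rule: generate.induct)
  case one
  then show ?case using assms(2) by simp
next
  case (incl h)
  then show ?case by (elim UnE CollectE exE conjE) (simp_all add: assms(4-6))
next
  case (inv h)
  from inv have "P h" by (elim UnE CollectE exE conjE) (simp_all add: assms(4-6))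
  then have "P (0 - h)" using assms(2,3) by blast
  moreover have "Poly_Mapping.keys h \<subseteq> pairs"
    using relation_in_pairs inv by (metis (no_types, lifting) carrier_free_Abelian_group_iff subsetD)
  ultimately show ?case by simp
next
  case (eng a b)
  have "P (a - (0 - b))" using eng assms(2,3) by blast
  then show ?case by simp
qed

lemma coset_def': "coset t = {r + t | r. r \<in> rel}"
  by (auto simp: tensor_coset_def r_coset_def)

lemma coset_eq_iff: "coset s = coset t \<longleftrightarrow> s - t \<in> rel"
proof
  assume "coset s = coset t"
  moreover have "s \<in> coset s" using rel_0 by (force simp: coset_def')
  ultimately show "s - t \<in> rel" by (auto simp: coset_def')
next
  assume st: "s - t \<in> rel"
  have "r + s \<in> coset t" if "r \<in> rel" for r
    using rel_add[OF that st] unfolding coset_def' by (auto intro!: exI[of _ "r + (s - t)"])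
  moreover have "r + t \<in> coset s" if "r \<in> rel" for r
    using rel_add[OF that rel_minus[OF st]] unfolding coset_def' by (auto intro!: exI[of _ "r + - (s - t)"])
  ultimately show "coset s = coset t" unfolding coset_def' by blast
qed

lemma T_carrier: "carrier T = coset ` {t. Poly_Mapping.keys t \<subseteq> pairs}"
  by (auto simp: tensor_product_def Let_def carrier_FactGroup tensor_coset_def free_Abelian_group_def)

lemma T_zero: "\<zero>\<^bsub>T\<^esub> = coset 0"
  by (auto simp: tensor_product_def Let_def coset_def')

lemma T_add: "coset s \<oplus>\<^bsub>T\<^esub> coset t = coset (s + t)"
proof -
  have "coset s \<oplus>\<^bsub>T\<^esub> coset t = {a + b | a b. a \<in> coset s \<and> b \<in> coset t}"
    by (auto simp: tensor_product_def Let_def set_mult_def)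
  also have "\<dots> = coset (s + t)"
  proof (intro equalityI subsetI)
    fix x assume "x \<in> {a + b | a b. a \<in> coset s \<and> b \<in> coset t}"
    then obtain r r' where "r \<in> rel" "r' \<in> rel" "x = (r + s) + (r' + t)" unfolding coset_def' by blast
    then have "x = (r + r') + (s + t)" "r + r' \<in> rel" by (simp_all add: rel_add algebra_simps)
    then show "x \<in> coset (s + t)" unfolding coset_def' by blast
  next
    fix x assume "x \<in> coset (s + t)"
    then obtain r where "r \<in> rel" "x = (r + s) + (0 + t)" unfolding coset_def' by (auto simp: algebra_simps)
    then show "x \<in> {a + b | a b. a \<in> coset s \<and> b \<in> coset t}" using rel_0 unfolding coset_def' by blast
  qed
  finally show ?thesis .
qed

lemma T_group: "abelian_group T"
proof (rule abelian_groupI)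
  fix x assume "x \<in> carrier T"
  then obtain t where t: "x = coset t" "Poly_Mapping.keys t \<subseteq> pairs" by (auto simp: T_carrier)
  show "\<exists>y \<in> carrier T. y \<oplus>\<^bsub>T\<^esub> x = \<zero>\<^bsub>T\<^esub>"
    by (rule bexI[of _ "coset (- t)"]) (use t in \<open>auto simp: T_add T_zero T_carrier\<close>)
next
  fix x y assume "x \<in> carrier T" "y \<in> carrier T"
  then obtain s t where st: "x = coset s" "Poly_Mapping.keys s \<subseteq> pairs" "y = coset t" "Poly_Mapping.keys t \<subseteq> pairs"
    by (auto simp: T_carrier)
  have "Poly_Mapping.keys (s + t) \<subseteq> pairs" using Poly_Mapping.keys_add[of s t] st by blast
  then show "x \<oplus>\<^bsub>T\<^esub> y \<in> carrier T" unfolding st T_add T_carrier by blast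
  show "x \<oplus>\<^bsub>T\<^esub> y = y \<oplus>\<^bsub>T\<^esub> x" unfolding st T_add by (simp add: add.commute)
  fix z assume "z \<in> carrier T"
  then obtain u where u: "z = coset u" by (auto simp: T_carrier)
  show "x \<oplus>\<^bsub>T\<^esub> y \<oplus>\<^bsub>T\<^esub> z = x \<oplus>\<^bsub>T\<^esub> (y \<oplus>\<^bsub>T\<^esub> z)" unfolding st u T_add by (simp add: add.assoc)
qed (auto simp: T_carrier T_zero T_add)

sublocale T: abelian_group T by (rule T_group)

lemma pure_closed: "\<lbrakk>x \<in> carrier N; v \<in> carrier V\<rbrakk> \<Longrightarrow> pure x v \<in> carrier T"
  by (auto simp: pure_tensor_def T_carrier)

lemma pure_add_left:
  assumes "x \<in> carrier N" "y \<in> carrier N" "v \<in> carrier V"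
  shows "pure (x \<oplus>\<^bsub>N\<^esub> y) v = pure x v \<oplus>\<^bsub>T\<^esub> pure y v"
proof -
  have "frag_of (x \<oplus>\<^bsub>N\<^esub> y, v) - frag_of (x, v) - frag_of (y, v) \<in> rel"
    unfolding tensor_relations_def by (rule generate.incl) (use assms in blast)
  then show ?thesis by (simp add: pure_tensor_def T_add coset_eq_iff algebra_simps)
qed

lemma pure_add_right:
  assumes "x \<in> carrier N" "v \<in> carrier V" "w \<in> carrier V"
  shows "pure x (v \<oplus>\<^bsub>V\<^esub> w) = pure x v \<oplus>\<^bsub>T\<^esub> pure x w"
proof -
  have "frag_of (x, v \<oplus>\<^bsub>V\<^esub> w) - frag_of (x, v) - frag_of (x, w) \<in> rel"
    unfolding tensor_relations_def by (rule generate.incl) (use assms in blast)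
  then show ?thesis by (simp add: pure_tensor_def T_add coset_eq_iff algebra_simps)
qed

lemma pure_balanced:
  assumes "k \<in> carrier K" "x \<in> carrier N" "v \<in> carrier V"
  shows "pure (k \<odot>\<^bsub>N\<^esub> x) v = pure x (k \<odot>\<^bsub>V\<^esub> v)"
proof -
  have "frag_of (k \<odot>\<^bsub>N\<^esub> x, v) - frag_of (x, k \<odot>\<^bsub>V\<^esub> v) \<in> rel"
    unfolding tensor_relations_def by (rule generate.incl) (use assms in blast)
  then show ?thesis by (simp add: pure_tensor_def coset_eq_iff)
qed

text \<open>Pure tensors generate the group, and closure under differences yields zero, negatives
  and sums.\<close>

lemma T_induct [consumes 1, case_names pure diff]:
  assumes "u \<in> carrier T" and pure: "\<And>x v. \<lbrakk>x \<in> carrier N; v \<in> carrier V\<rbrakk> \<Longrightarrow> P (pure x v)"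
    and diff: "\<And>u w. \<lbrakk>u \<in> carrier T; w \<in> carrier T; P u; P w\<rbrakk> \<Longrightarrow> P (u \<ominus>\<^bsub>T\<^esub> w)"
  shows "P u"
proof -
  obtain t where t: "u = coset t" "Poly_Mapping.keys t \<subseteq> pairs" using assms(1) by (auto simp: T_carrier)
  have dc: "coset (a - b) = coset a \<ominus>\<^bsub>T\<^esub> coset b"
    if "Poly_Mapping.keys a \<subseteq> pairs" "Poly_Mapping.keys b \<subseteq> pairs" for a b
  proof -
    have k: "Poly_Mapping.keys (a - b) \<subseteq> pairs" using keys_diff[of a b] that by blast
    have c: "coset a \<in> carrier T" "coset b \<in> carrier T" "coset (a - b) \<in> carrier T"
      using that k unfolding T_carrier by blast+
    have "coset (a - b) \<oplus>\<^bsub>T\<^esub> coset b = coset a" by (simp add: T_add)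
    then have "coset a \<ominus>\<^bsub>T\<^esub> coset b = coset (a - b) \<oplus>\<^bsub>T\<^esub> coset b \<oplus>\<^bsub>T\<^esub> \<ominus>\<^bsub>T\<^esub> coset b"
      by (simp add: a_minus_def)
    then show ?thesis using c by (simp add: T.a_assoc T.r_neg)
  qed
  have p0: "\<zero>\<^bsub>N\<^esub> \<in> carrier N" "\<zero>\<^bsub>V\<^esub> \<in> carrier V" by auto
  have "P (pure \<zero>\<^bsub>N\<^esub> \<zero>\<^bsub>V\<^esub> \<ominus>\<^bsub>T\<^esub> pure \<zero>\<^bsub>N\<^esub> \<zero>\<^bsub>V\<^esub>)"
    using pure_closed[OF p0] pure[OF p0] by (intro diff)
  then have z: "P (coset 0)" using pure_closed[OF p0] by (simp add: a_minus_def T.r_neg T_zero[symmetric])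
  have "Poly_Mapping.keys t \<subseteq> pairs \<and> P (coset t)"
    using t(2)
  proof (induction t rule: frag_induction)
    case (one x)
    then show ?case using pure[of "fst x" "snd x"] by (auto simp: pure_tensor_def)
  next
    case (diff a b)
    have "Poly_Mapping.keys (a - b) \<subseteq> pairs" using keys_diff[of a b] diff by blast
    moreover have "P (coset a \<ominus>\<^bsub>T\<^esub> coset b)" using diff by (intro assms(3)) (auto simp: T_carrier)
    ultimately show ?case using dc diff by simp
  qed (simp add: z)
  then show ?thesis by (simp add: t)
qed

text \<open>The universal property: extend \<beta> to the free abelian group, observe that the
  relations go to zero, and evaluate at any representative of a coset.\<close>

lemma T_lift:
  fixes W :: "('w, 'y) ring_scheme"
  assumes W: "abelian_group W"
    and cl: "\<And>x v. \<lbrakk>x \<in> carrier N; v \<in> carrier V\<rbrakk> \<Longrightarrow> \<beta> x v \<in> carrier W"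
    and left: "\<And>x y v. \<lbrakk>x \<in> carrier N; y \<in> carrier N; v \<in> carrier V\<rbrakk> \<Longrightarrow> \<beta> (x \<oplus>\<^bsub>N\<^esub> y) v = \<beta> x v \<oplus>\<^bsub>W\<^esub> \<beta> y v"
    and right: "\<And>x v w. \<lbrakk>x \<in> carrier N; v \<in> carrier V; w \<in> carrier V\<rbrakk> \<Longrightarrow> \<beta> x (v \<oplus>\<^bsub>V\<^esub> w) = \<beta> x v \<oplus>\<^bsub>W\<^esub> \<beta> x w"
    and bal: "\<And>k x v. \<lbrakk>k \<in> carrier K; x \<in> carrier N; v \<in> carrier V\<rbrakk> \<Longrightarrow> \<beta> (k \<odot>\<^bsub>N\<^esub> x) v = \<beta> x (k \<odot>\<^bsub>V\<^esub> v)"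
  obtains h where "\<And>u. u \<in> carrier T \<Longrightarrow> h u \<in> carrier W"
    "\<And>u w. \<lbrakk>u \<in> carrier T; w \<in> carrier T\<rbrakk> \<Longrightarrow> h (u \<oplus>\<^bsub>T\<^esub> w) = h u \<oplus>\<^bsub>W\<^esub> h w"
    "\<And>x v. \<lbrakk>x \<in> carrier N; v \<in> carrier V\<rbrakk> \<Longrightarrow> h (pure x v) = \<beta> x v"
proof -
  interpret W: abelian_group W by fact
  have "(\<lambda>(x, v). \<beta> x v) ` pairs \<subseteq> carrier (add_monoid W)" using cl by auto
  then obtain f where f: "f \<in> hom (free_Abelian_group pairs) (add_monoid W)"
    "\<And>x. x \<in> pairs \<Longrightarrow> f (frag_of x) = (case x of (x, v) \<Rightarrow> \<beta> x v)"
    using comm_group.free_Abelian_group_universal[OF W.a_comm_group] by blast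
  have fc: "f a \<in> carrier W" if "Poly_Mapping.keys a \<subseteq> pairs" for a
    using f(1) that by (auto simp: hom_def)
  have fadd: "f (a + b) = f a \<oplus>\<^bsub>W\<^esub> f b" if "Poly_Mapping.keys a \<subseteq> pairs" "Poly_Mapping.keys b \<subseteq> pairs" for a b
    using f(1) that by (auto simp: hom_def)
  have fdiff: "f (a - b) = f a \<ominus>\<^bsub>W\<^esub> f b" if "Poly_Mapping.keys a \<subseteq> pairs" "Poly_Mapping.keys b \<subseteq> pairs" for a b
  proof -
    have k: "Poly_Mapping.keys (a - b) \<subseteq> pairs" using keys_diff[of a b] that by blast
    have "f a = f (a - b) \<oplus>\<^bsub>W\<^esub> f b" using fadd[OF k that(2)] by simp
    then show ?thesis using fc[OF k] fc[OF that(2)] by (simp add: a_minus_def W.a_assoc W.r_neg)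
  qed
  have f1: "f (frag_of (x, v)) = \<beta> x v" if "x \<in> carrier N" "v \<in> carrier V" for x v
    using f(2)[of "(x, v)"] that by simp
  have k1: "Poly_Mapping.keys (frag_of (x, v)) \<subseteq> pairs" if "x \<in> carrier N" "v \<in> carrier V" for x v
    using that by simp
  have k2: "Poly_Mapping.keys (a - b) \<subseteq> pairs" if "Poly_Mapping.keys a \<subseteq> pairs" "Poly_Mapping.keys b \<subseteq> pairs" for a b :: "'n \<times> 'v \<Rightarrow>\<^sub>0 int"
    using keys_diff[of a b] that by blast
  have cancel: "(p \<oplus>\<^bsub>W\<^esub> q) \<ominus>\<^bsub>W\<^esub> p \<ominus>\<^bsub>W\<^esub> q = \<zero>\<^bsub>W\<^esub>" if "p \<in> carrier W" "q \<in> carrier W" for p q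
    using that by (simp add: a_minus_def W.a_comm[of p q] W.a_assoc W.r_neg)
  have "Poly_Mapping.keys r \<subseteq> pairs \<and> f r = \<zero>\<^bsub>W\<^esub>" if "r \<in> rel" for r
    using that
  proof (induction r rule: rel_induct)
    case zero
    have "f (0 + 0) = f 0 \<oplus>\<^bsub>W\<^esub> f 0" by (rule fadd) simp_all
    then show ?case using fc[of 0] by (metis W.add.r_cancel_one' add_0 empty_subsetI keys_zero)
  next
    case (add a b)
    then show ?case using k2[of a b] fdiff[of a b] by (simp add: a_minus_def)
  next
    case (left x y v)
    then have "f (frag_of (x \<oplus>\<^bsub>N\<^esub> y, v) - frag_of (x, v) - frag_of (y, v)) = \<zero>\<^bsub>W\<^esub>"
      by (simp add: fdiff k2 f1 assms(3) cancel cl k1)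
    with left show ?case by (simp add: k2 k1)
  next
    case (right x v w)
    then have "f (frag_of (x, v \<oplus>\<^bsub>V\<^esub> w) - frag_of (x, v) - frag_of (x, w)) = \<zero>\<^bsub>W\<^esub>"
      by (simp add: fdiff k2 f1 assms(4) cancel cl k1)
    with right show ?case by (simp add: k2 k1)
  next
    case (balanced k x v)
    then have "f (frag_of (k \<odot>\<^bsub>N\<^esub> x, v) - frag_of (x, k \<odot>\<^bsub>V\<^esub> v)) = \<zero>\<^bsub>W\<^esub>"
      by (simp add: fdiff k2 f1 bal cl a_minus_def W.r_neg k1)
    with balanced show ?case by (simp add: k2 k1)
  qed
  then have f0: "f r = \<zero>\<^bsub>W\<^esub>" if "r \<in> rel" for r using that by blast
  define h where "h u = f (SOME t. t \<in> u)" for u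
  have h: "h (coset t) = f t" if "Poly_Mapping.keys t \<subseteq> pairs" for t
  proof -
    have "t \<in> coset t" using rel_0 by (force simp: coset_def')
    then have "(SOME s. s \<in> coset t) \<in> coset t" by (rule someI)
    then obtain r where r: "r \<in> rel" "(SOME s. s \<in> coset t) = r + t" unfolding coset_def' by blast
    show ?thesis unfolding h_def r(2) using fadd[OF rel_keys[OF r(1)] that] f0[OF r(1)] fc[OF that] by simp
  qed
  show thesis
  proof (rule that[of h])
    show "h u \<in> carrier W" if "u \<in> carrier T" for u using that h fc by (auto simp: T_carrier)
    show "h (pure x v) = \<beta> x v" if "x \<in> carrier N" "v \<in> carrier V" for x v
      unfolding pure_tensor_def using h[OF k1[OF that]] f1[OF that] by simp
    fix u w assume "u \<in> carrier T" "w \<in> carrier T"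
    then obtain s t where st: "u = coset s" "Poly_Mapping.keys s \<subseteq> pairs" "w = coset t" "Poly_Mapping.keys t \<subseteq> pairs"
      by (auto simp: T_carrier)
    have "Poly_Mapping.keys (s + t) \<subseteq> pairs" using Poly_Mapping.keys_add[of s t] st by blast
    then show "h (u \<oplus>\<^bsub>T\<^esub> w) = h u \<oplus>\<^bsub>W\<^esub> h w" using st fadd by (simp add: T_add h)
  qed
qed

text \<open>Multiplying first components by k is an endomorphism of the free group that preserves
  the relations, so the union in the definition is a single coset.\<close>

lemma T_smult:
  assumes k: "k \<in> carrier K"
  shows "u \<in> carrier T \<Longrightarrow> k \<odot>\<^bsub>T\<^esub> u \<in> carrier T"
    and "\<lbrakk>u \<in> carrier T; w \<in> carrier T\<rbrakk> \<Longrightarrow> k \<odot>\<^bsub>T\<^esub> (u \<oplus>\<^bsub>T\<^esub> w) = k \<odot>\<^bsub>T\<^esub> u \<oplus>\<^bsub>T\<^esub> k \<odot>\<^bsub>T\<^esub> w"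
    and "\<lbrakk>x \<in> carrier N; v \<in> carrier V\<rbrakk> \<Longrightarrow> k \<odot>\<^bsub>T\<^esub> pure x v = pure (k \<odot>\<^bsub>N\<^esub> x) v"
proof -
  let ?f = "frag_extend (\<lambda>(x, v). frag_of (k \<odot>\<^bsub>N\<^esub> x, v))"
  have fr: "?f r \<in> rel" if "r \<in> rel" for r
    using that
  proof (induction r rule: rel_induct)
    case (add a b)
    then show ?case using rel_add[OF add(1) rel_minus[OF add(2)]] by (simp add: frag_extend_diff)
  next
    case (left x y v)
    have "frag_of (k \<odot>\<^bsub>N\<^esub> x \<oplus>\<^bsub>N\<^esub> k \<odot>\<^bsub>N\<^esub> y, v) - frag_of (k \<odot>\<^bsub>N\<^esub> x, v) - frag_of (k \<odot>\<^bsub>N\<^esub> y, v) \<in> rel"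
      unfolding tensor_relations_def by (rule generate.incl) (use left k N.smult_closed in blast)
    then show ?case using left k by (simp add: frag_extend_diff N.smult_r_distr)
  next
    case (right x v w)
    have "frag_of (k \<odot>\<^bsub>N\<^esub> x, v \<oplus>\<^bsub>V\<^esub> w) - frag_of (k \<odot>\<^bsub>N\<^esub> x, v) - frag_of (k \<odot>\<^bsub>N\<^esub> x, w) \<in> rel"
      unfolding tensor_relations_def by (rule generate.incl) (use right k N.smult_closed in blast)
    then show ?case by (simp add: frag_extend_diff)
  next
    case (balanced l x v)
    \<comment> \<open>Compatibility with the balancing relation for another scalar l rests on the
      commutativity of K.\<close>
    have "k \<odot>\<^bsub>N\<^esub> (l \<odot>\<^bsub>N\<^esub> x) = l \<odot>\<^bsub>N\<^esub> (k \<odot>\<^bsub>N\<^esub> x)"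
      using balanced k N.R.m_comm[of k l] by (simp add: N.smult_assoc1[symmetric])
    moreover have "frag_of (l \<odot>\<^bsub>N\<^esub> (k \<odot>\<^bsub>N\<^esub> x), v) - frag_of (k \<odot>\<^bsub>N\<^esub> x, l \<odot>\<^bsub>V\<^esub> v) \<in> rel"
      unfolding tensor_relations_def by (rule generate.incl) (use balanced k N.smult_closed in blast)
    ultimately show ?case by (simp add: frag_extend_diff)
  qed (simp add: rel_0)
  have sm: "k \<odot>\<^bsub>T\<^esub> coset t = coset (?f t)" for t
  proof -
    have "k \<odot>\<^bsub>T\<^esub> coset t = (\<Union>s \<in> coset t. coset (?f s))"
      by (simp add: tensor_product_def Let_def)
    moreover have "coset (?f s) = coset (?f t)" if s: "s \<in> coset t" for s
    proof -
      obtain r where "r \<in> rel" "s = r + t" using s unfolding coset_def' by blast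
      then show ?thesis using fr by (simp add: coset_eq_iff frag_extend_add)
    qed
    moreover have "t \<in> coset t" using rel_0 by (force simp: coset_def')
    ultimately show ?thesis by blast
  qed
  have fk: "Poly_Mapping.keys (?f t) \<subseteq> pairs" if "Poly_Mapping.keys t \<subseteq> pairs" for t
    using that
  proof (induction t rule: frag_induction)
    case (one x)
    then show ?case using k by auto
  next
    case (diff a b)
    then show ?case using keys_diff[of "?f a" "?f b"] by (auto simp: frag_extend_diff)
  qed simp
  show "k \<odot>\<^bsub>T\<^esub> u \<in> carrier T" if "u \<in> carrier T" using that fk sm unfolding T_carrier by auto
  show "k \<odot>\<^bsub>T\<^esub> (u \<oplus>\<^bsub>T\<^esub> w) = k \<odot>\<^bsub>T\<^esub> u \<oplus>\<^bsub>T\<^esub> k \<odot>\<^bsub>T\<^esub> w" if uw: "u \<in> carrier T" "w \<in> carrier T"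
  proof -
    obtain s t where "u = coset s" "w = coset t" using uw unfolding T_carrier by blast
    then show ?thesis by (simp add: T_add sm frag_extend_add)
  qed
  show "k \<odot>\<^bsub>T\<^esub> pure x v = pure (k \<odot>\<^bsub>N\<^esub> x) v" by (simp add: pure_tensor_def sm)
qed

end


section \<open>A dual basis for derivations of a smooth algebra\<close>

text \<open>Formal smoothness is tested on algebras with carrier in one fixed type; this copies an
  algebra of another type there along an injective map.\<close>

definition transport :: "('e \<Rightarrow> 't) \<Rightarrow> ('r, 'e) module \<Rightarrow> ('r, 't) module" where
  "transport c E = (let i = the_inv_into (carrier E) c in
     \<lparr>carrier = c ` carrier E, monoid.mult = (\<lambda>x y. c (i x \<otimes>\<^bsub>E\<^esub> i y)), one = c \<one>\<^bsub>E\<^esub>,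
      ring.zero = c \<zero>\<^bsub>E\<^esub>, add = (\<lambda>x y. c (i x \<oplus>\<^bsub>E\<^esub> i y)), smult = (\<lambda>r x. c (r \<odot>\<^bsub>E\<^esub> i x))\<rparr>)"

lemma algebra_transport:
  assumes E: "algebra R E" and c: "inj_on c (carrier E)"
  shows "algebra R (transport c E)"
proof -
  interpret algebra R E by fact
  let ?T = "transport c E"
  have i [simp]: "the_inv_into (carrier E) c (c x) = x" if "x \<in> carrier E" for x
    using the_inv_into_f_f[OF c that] .
  have T [simp]: "carrier ?T = c ` carrier E" "\<one>\<^bsub>?T\<^esub> = c \<one>\<^bsub>E\<^esub>" "\<zero>\<^bsub>?T\<^esub> = c \<zero>\<^bsub>E\<^esub>"
    by (simp_all add: transport_def Let_def)
  have ops [simp]: "c x \<otimes>\<^bsub>?T\<^esub> c y = c (x \<otimes>\<^bsub>E\<^esub> y)" "c x \<oplus>\<^bsub>?T\<^esub> c y = c (x \<oplus>\<^bsub>E\<^esub> y)"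
    if "x \<in> carrier E" "y \<in> carrier E" for x y
    using that by (simp_all add: transport_def Let_def)
  have sm [simp]: "r \<odot>\<^bsub>?T\<^esub> c x = c (r \<odot>\<^bsub>E\<^esub> x)" if "x \<in> carrier E" for r x
    using that by (simp add: transport_def Let_def)
  have ag: "abelian_group ?T"
  proof (rule abelian_groupI)
    fix x assume "x \<in> carrier ?T"
    then obtain a where a: "x = c a" "a \<in> carrier E" by auto
    show "\<exists>y \<in> carrier ?T. y \<oplus>\<^bsub>?T\<^esub> x = \<zero>\<^bsub>?T\<^esub>"
      by (rule bexI[of _ "c (\<ominus>\<^bsub>E\<^esub> a)"]) (use a in \<open>simp_all add: M.l_neg\<close>)
  qed (auto simp: M.a_ac)
  have cr: "cring ?T"
  proof (rule cringI[OF ag])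
    show "comm_monoid ?T" by (rule comm_monoidI) (auto simp: m_ac)
  qed (auto simp: l_distr)
  show ?thesis
    by (rule algebraI[OF R_cring cr])
      (auto simp: smult_l_distr smult_r_distr smult_assoc1 smult_assoc2)
qed

text \<open>Formal smoothness as the existence of sections: for a surjection p of E onto S with
  square-zero kernel, the inverse of the isomorphism from E / ker p to S is lifted to E.\<close>

lemma formally_smooth_lift:
  fixes E :: "('r, 'e) module" and c :: "'e \<Rightarrow> 't"
  assumes fs: "formally_smooth TYPE('t) R S" and S: "algebra R S" and E: "algebra R E"
    and c: "inj_on c (carrier E)" and p: "p \<in> ring_hom E S" and surj: "p ` carrier E = carrier S"
    and pR: "\<And>r. r \<in> carrier R \<Longrightarrow> p (r \<odot>\<^bsub>E\<^esub> \<one>\<^bsub>E\<^esub>) = r \<odot>\<^bsub>S\<^esub> \<one>\<^bsub>S\<^esub>"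
    and sq: "\<And>x y. \<lbrakk>x \<in> carrier E; y \<in> carrier E; p x = \<zero>\<^bsub>S\<^esub>; p y = \<zero>\<^bsub>S\<^esub>\<rbrakk> \<Longrightarrow> x \<otimes>\<^bsub>E\<^esub> y = \<zero>\<^bsub>E\<^esub>"
  obtains s where "s \<in> ring_hom S E" "\<And>r. r \<in> carrier R \<Longrightarrow> s (r \<odot>\<^bsub>S\<^esub> \<one>\<^bsub>S\<^esub>) = r \<odot>\<^bsub>E\<^esub> \<one>\<^bsub>E\<^esub>"
    "\<And>x. x \<in> carrier S \<Longrightarrow> p (s x) = x"
proof -
  interpret E: algebra R E by fact
  interpret S: algebra R S by fact
  let ?T = "transport c E"
  let ?i = "the_inv_into (carrier E) c"
  interpret T: algebra R ?T by (rule algebra_transport[OF E c])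
  have i [simp]: "?i (c x) = x" if "x \<in> carrier E" for x using the_inv_into_f_f[OF c that] .
  have T [simp]: "carrier ?T = c ` carrier E" "\<one>\<^bsub>?T\<^esub> = c \<one>\<^bsub>E\<^esub>" "\<zero>\<^bsub>?T\<^esub> = c \<zero>\<^bsub>E\<^esub>"
    by (simp_all add: transport_def Let_def)
  have ops: "c x \<otimes>\<^bsub>?T\<^esub> c y = c (x \<otimes>\<^bsub>E\<^esub> y)" "c x \<oplus>\<^bsub>?T\<^esub> c y = c (x \<oplus>\<^bsub>E\<^esub> y)"
    if "x \<in> carrier E" "y \<in> carrier E" for x y
    using that by (simp_all add: transport_def Let_def)
  have sm: "r \<odot>\<^bsub>?T\<^esub> c x = c (r \<odot>\<^bsub>E\<^esub> x)" if "x \<in> carrier E" for r x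
    using that by (simp add: transport_def Let_def)
  define q where "q x = p (?i x)" for x
  have ih: "?i \<in> ring_hom ?T E" by (rule ring_hom_memI) (auto simp: ops)
  have qh: "q \<in> ring_hom ?T S" using ring_hom_trans[OF ih p] by (simp add: q_def[abs_def] comp_def)
  interpret q: ring_hom_ring ?T S q
    using T.ring_axioms S.ring_axioms qh by (simp add: ring_hom_ring_def ring_hom_ring_axioms_def)
  have qs: "q ` carrier ?T = carrier S"
    using surj by (auto simp: q_def image_image)
  let ?I = "a_kernel ?T S q"
  let ?e = "\<lambda>Y. the_elem (q ` Y)"
  have idl: "ideal ?I ?T" by (rule q.kernel_is_ideal)
  have Q: "ring (?T Quot ?I)" by (rule ideal.quotient_is_ring[OF idl])
  have iso: "?e \<in> ring_iso (?T Quot ?I) S" by (rule q.FactRing_iso_set[OF qs])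
  define g where "g = inv_into (carrier (?T Quot ?I)) ?e"
  have gh: "g \<in> ring_hom S (?T Quot ?I)"
    using ring_iso_set_sym[OF Q iso] by (simp add: g_def ring_iso_def)
  have eI: "?e (?I +>\<^bsub>?T\<^esub> x) = q x" if "x \<in> carrier ?T" for x by (rule q.the_elem_simp[OF that])
  have inQ: "?I +>\<^bsub>?T\<^esub> x \<in> carrier (?T Quot ?I)" if "x \<in> carrier ?T" for x
    using that by (auto simp: FactRing_def A_RCOSETS_def')
  have inj: "inj_on ?e (carrier (?T Quot ?I))" using iso by (simp add: ring_iso_def bij_betw_def)
  have gq: "g (q x) = ?I +>\<^bsub>?T\<^esub> x" if "x \<in> carrier ?T" for x
    unfolding g_def eI[OF that, symmetric] by (rule inv_into_f_f[OF inj inQ[OF that]])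
  have sqI: "\<forall>x \<in> ?I. \<forall>y \<in> ?I. x \<otimes>\<^bsub>?T\<^esub> y = \<zero>\<^bsub>?T\<^esub>"
    using sq by (auto simp: a_kernel_def' q_def ops)
  have gR: "\<forall>r \<in> carrier R. g (r \<odot>\<^bsub>S\<^esub> \<one>\<^bsub>S\<^esub>) = ?I +>\<^bsub>?T\<^esub> (r \<odot>\<^bsub>?T\<^esub> \<one>\<^bsub>?T\<^esub>)"
  proof
    fix r assume r: "r \<in> carrier R"
    have "q (r \<odot>\<^bsub>?T\<^esub> \<one>\<^bsub>?T\<^esub>) = r \<odot>\<^bsub>S\<^esub> \<one>\<^bsub>S\<^esub>" using r by (simp add: sm q_def pR)
    then show "g (r \<odot>\<^bsub>S\<^esub> \<one>\<^bsub>S\<^esub>) = ?I +>\<^bsub>?T\<^esub> (r \<odot>\<^bsub>?T\<^esub> \<one>\<^bsub>?T\<^esub>)"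
      using gq[of "r \<odot>\<^bsub>?T\<^esub> \<one>\<^bsub>?T\<^esub>"] T.smult_closed[OF r T.one_closed] by simp
  qed
  obtain h where h: "h \<in> ring_hom S ?T" "\<And>r. r \<in> carrier R \<Longrightarrow> h (r \<odot>\<^bsub>S\<^esub> \<one>\<^bsub>S\<^esub>) = r \<odot>\<^bsub>?T\<^esub> \<one>\<^bsub>?T\<^esub>"
    "\<And>x. x \<in> carrier S \<Longrightarrow> ?I +>\<^bsub>?T\<^esub> h x = g x"
    using fs[unfolded formally_smooth_def, rule_format, of ?T ?I g] T.algebra_axioms idl sqI gh gR by blast
  show thesis
  proof (rule that[of "?i \<circ> h"])
    show "?i \<circ> h \<in> ring_hom S E" by (rule ring_hom_trans[OF h(1) ih])
    show "(?i \<circ> h) (r \<odot>\<^bsub>S\<^esub> \<one>\<^bsub>S\<^esub>) = r \<odot>\<^bsub>E\<^esub> \<one>\<^bsub>E\<^esub>" if "r \<in> carrier R" for r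
      using h(2)[OF that] that by (simp add: sm)
    fix x assume x: "x \<in> carrier S"
    have hx: "h x \<in> carrier ?T" by (rule ring_hom_closed[OF h(1) x])
    obtain y where y: "y \<in> carrier ?T" "q y = x" using qs x by (metis imageE)
    have "q (h x) = ?e (g x)" using eI[OF hx] h(3)[OF x] by simp
    also have "\<dots> = x" using gq[OF y(1)] eI[OF y(1)] y(2) by simp
    finally show "p ((?i \<circ> h) x) = x" by (simp add: q_def)
  qed
qed

section \<open>Finitely generated subalgebras\<close>

lemma commutative_subalgebraE:
  assumes "commutative_subalgebra R A D"
  shows "D \<subseteq> carrier A" "\<one>\<^bsub>A\<^esub> \<in> D" "\<zero>\<^bsub>A\<^esub> \<in> D" "\<lbrakk>x \<in> D; y \<in> D\<rbrakk> \<Longrightarrow> x \<oplus>\<^bsub>A\<^esub> y \<in> D"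
    "\<lbrakk>x \<in> D; y \<in> D\<rbrakk> \<Longrightarrow> x \<otimes>\<^bsub>A\<^esub> y \<in> D" "\<lbrakk>r \<in> carrier R; x \<in> D\<rbrakk> \<Longrightarrow> r \<odot>\<^bsub>A\<^esub> x \<in> D"
proof -
  have "subring D A" using assms by (auto simp: commutative_subalgebra_def intro: subcring.axioms)
  then interpret subring D A .
  have sg: "subgroup D (add_monoid A)" and sm: "submonoid D A" by unfold_locales
  show "D \<subseteq> carrier A" using submonoid.subset[OF sm] .
  show "\<one>\<^bsub>A\<^esub> \<in> D" using submonoid.one_closed[OF sm] .
  show "\<zero>\<^bsub>A\<^esub> \<in> D" using subgroup.one_closed[OF sg] by simp
  show "x \<oplus>\<^bsub>A\<^esub> y \<in> D" if "x \<in> D" "y \<in> D" using subgroup.m_closed[OF sg that] by simp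
  show "x \<otimes>\<^bsub>A\<^esub> y \<in> D" if "x \<in> D" "y \<in> D" using submonoid.m_closed[OF sm that] .
  show "r \<odot>\<^bsub>A\<^esub> x \<in> D" if "r \<in> carrier R" "x \<in> D" using assms that by (simp add: commutative_subalgebra_def)
qed

lemma algebra_subalgebra:
  fixes R :: "'r ring" and T :: "('r, 't) module"
  assumes T: "algebra R T" and E: "commutative_subalgebra R T E"
  shows "algebra R (T\<lparr>carrier := E\<rparr>)"
proof -
  interpret algebra R T by fact
  note E' = commutative_subalgebraE[OF E]
  have c: "x \<in> carrier T" if "x \<in> E" for x using E'(1) that by blast
  have "cring (T\<lparr>carrier := E\<rparr>)"
    using E subcring_iff[OF E'(1)] by (simp add: commutative_subalgebra_def)
  then show ?thesis
    by (rule algebraI[OF R_cring])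
      (simp_all add: c E' smult_l_distr smult_r_distr smult_assoc1 smult_assoc2)
qed

lemma (in algebra) commutative_subalgebraI:
  assumes sub: "D \<subseteq> carrier M" and one: "\<one>\<^bsub>M\<^esub> \<in> D" and add: "\<And>x y. \<lbrakk>x \<in> D; y \<in> D\<rbrakk> \<Longrightarrow> x \<oplus>\<^bsub>M\<^esub> y \<in> D"
    and mult: "\<And>x y. \<lbrakk>x \<in> D; y \<in> D\<rbrakk> \<Longrightarrow> x \<otimes>\<^bsub>M\<^esub> y \<in> D"
    and smult: "\<And>r x. \<lbrakk>r \<in> carrier R; x \<in> D\<rbrakk> \<Longrightarrow> r \<odot>\<^bsub>M\<^esub> x \<in> D"
  shows "subcring D M" "\<forall>r \<in> carrier R. \<forall>x \<in> D. r \<odot>\<^bsub>M\<^esub> x \<in> D"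
proof -
  show "subcring D M"
  proof (rule subcringI)
    show "subring D M"
    proof (rule subringI[OF sub one _ mult add])
      fix x assume x: "x \<in> D"
      have "(\<ominus> \<one>) \<odot>\<^bsub>M\<^esub> x = \<ominus>\<^bsub>M\<^esub> x" using x sub by (simp add: smult_l_minus subset_iff)
      then show "\<ominus>\<^bsub>M\<^esub> x \<in> D" using smult[of "\<ominus> \<one>" x] x by simp
    qed
    show "h1 \<otimes>\<^bsub>M\<^esub> h2 = h2 \<otimes>\<^bsub>M\<^esub> h1" if "h1 \<in> D" "h2 \<in> D" for h1 h2
      using that sub by (intro m_comm) auto
  qed
qed (use smult in blast)

text \<open>Elements of a subalgebra with \<open>n\<close> generators are named by the polynomials that represent them.\<close>

lemma finitely_generated_subalgebra:
  fixes R :: "'r ring" and T :: "('r, 't) module" and \<gamma> :: "nat \<Rightarrow> 't"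
  assumes T: "algebra R T" and \<gamma>: "\<And>i. i < n \<Longrightarrow> \<gamma> i \<in> carrier T"
  obtains E and c :: "'t \<Rightarrow> (nat multiset \<Rightarrow> 'r) set" where "commutative_subalgebra R T E"
    "\<And>i. i < n \<Longrightarrow> \<gamma> i \<in> E"
    "\<And>D. \<lbrakk>commutative_subalgebra R T D; \<And>i. i < n \<Longrightarrow> \<gamma> i \<in> D\<rbrakk> \<Longrightarrow> E \<subseteq> D" "inj_on c E"
proof -
  interpret algebra R T by fact
  \<comment> \<open>A multiset of indices stands for a monomial; indices from n on are ignored.
    \<open>Rep\<close> consists of the polynomials in countably many variables, and
    \<open>ev\<close> evaluates them at the generators.\<close>
  define mono where "mono \<alpha> = finprod T (\<lambda>i. \<gamma> i [^]\<^bsub>T\<^esub> count \<alpha> i) {..<n}" for \<alpha>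
  define Rep where "Rep = {f :: nat multiset \<Rightarrow> 'r. finite {\<alpha>. f \<alpha> \<noteq> \<zero>\<^bsub>R\<^esub>} \<and> (\<forall>\<alpha>. f \<alpha> \<in> carrier R)}"
  define ev where "ev f = finsum T (\<lambda>\<alpha>. f \<alpha> \<odot>\<^bsub>T\<^esub> mono \<alpha>) {\<alpha>. f \<alpha> \<noteq> \<zero>\<^bsub>R\<^esub>}" for f
  define E where "E = ev ` Rep"
  have pc: "(\<lambda>i. \<gamma> i [^]\<^bsub>T\<^esub> count \<alpha> i) \<in> {..<n} \<rightarrow> carrier T" for \<alpha> using \<gamma> by auto
  have mc [simp]: "mono \<alpha> \<in> carrier T" for \<alpha> unfolding mono_def by (rule finprod_closed[OF pc])
  have madd: "mono (\<alpha> + \<beta>) = mono \<alpha> \<otimes>\<^bsub>T\<^esub> mono \<beta>" for \<alpha> \<beta>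
  proof -
    have "mono (\<alpha> + \<beta>) = finprod T (\<lambda>i. \<gamma> i [^]\<^bsub>T\<^esub> count \<alpha> i \<otimes>\<^bsub>T\<^esub> \<gamma> i [^]\<^bsub>T\<^esub> count \<beta> i) {..<n}"
      unfolding mono_def using \<gamma> by (intro finprod_cong') (auto simp: nat_pow_mult)
    then show ?thesis unfolding mono_def by (simp add: finprod_multf[OF pc pc])
  qed
  have m0: "mono {#} = \<one>\<^bsub>T\<^esub>" unfolding mono_def by (rule finprod_one_eqI) simp
  have m1: "mono {#j#} = \<gamma> j" if j: "j < n" for j
  proof -
    have "mono {#j#} = finprod T (\<lambda>i. if j = i then \<gamma> i else \<one>\<^bsub>T\<^esub>) {..<n}"
      unfolding mono_def using \<gamma> by (intro finprod_cong') auto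
    also have "\<dots> = \<gamma> j" using j \<gamma> by (intro finprod_singleton) auto
    finally show ?thesis .
  qed
  have evB: "ev f = finsum T (\<lambda>\<alpha>. f \<alpha> \<odot>\<^bsub>T\<^esub> mono \<alpha>) B" if "f \<in> Rep" "finite B" "{\<alpha>. f \<alpha> \<noteq> \<zero>\<^bsub>R\<^esub>} \<subseteq> B" for f B
    unfolding ev_def using that
    by (intro M.add.finprod_mono_neutral_cong_left) (auto simp: Rep_def)
  have evc: "ev f \<in> carrier T" if "f \<in> Rep" for f
    unfolding ev_def using that by (intro M.finsum_closed) (auto simp: Rep_def)
  have Eadd: "x \<oplus>\<^bsub>T\<^esub> y \<in> E" if xy: "x \<in> E" "y \<in> E" for x y
  proof -
    obtain f h where f: "f \<in> Rep" "x = ev f" and h: "h \<in> Rep" "y = ev h" using xy by (auto simp: E_def)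
    let ?B = "{\<alpha>. f \<alpha> \<noteq> \<zero>\<^bsub>R\<^esub>} \<union> {\<alpha>. h \<alpha> \<noteq> \<zero>\<^bsub>R\<^esub>}"
    let ?k = "\<lambda>\<alpha>. f \<alpha> \<oplus>\<^bsub>R\<^esub> h \<alpha>"
    have fin: "finite ?B" using f h by (auto simp: Rep_def)
    have sub: "{\<alpha>. ?k \<alpha> \<noteq> \<zero>\<^bsub>R\<^esub>} \<subseteq> ?B" by auto
    have k: "?k \<in> Rep" using f h finite_subset[OF sub fin] by (auto simp: Rep_def)
    have "x \<oplus>\<^bsub>T\<^esub> y = finsum T (\<lambda>\<alpha>. f \<alpha> \<odot>\<^bsub>T\<^esub> mono \<alpha> \<oplus>\<^bsub>T\<^esub> h \<alpha> \<odot>\<^bsub>T\<^esub> mono \<alpha>) ?B"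
      unfolding f(2) h(2) evB[OF f(1) fin Un_upper1] evB[OF h(1) fin Un_upper2]
      using f h by (intro M.finsum_addf[symmetric]) (auto simp: Rep_def)
    also have "\<dots> = finsum T (\<lambda>\<alpha>. ?k \<alpha> \<odot>\<^bsub>T\<^esub> mono \<alpha>) ?B"
      using f h by (intro M.add.finprod_cong') (auto simp: Rep_def smult_l_distr)
    also have "\<dots> = ev ?k" by (rule evB[OF k fin sub, symmetric])
    finally show ?thesis using k by (auto simp: E_def)
  qed
  have Em: "r \<odot>\<^bsub>T\<^esub> mono \<alpha> \<in> E" if r: "r \<in> carrier R" for r \<alpha>
  proof -
    let ?f = "\<lambda>\<beta>. if \<beta> = \<alpha> then r else \<zero>\<^bsub>R\<^esub>"
    have f: "?f \<in> Rep" using r by (auto simp: Rep_def)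
    have "ev ?f = finsum T (\<lambda>\<beta>. ?f \<beta> \<odot>\<^bsub>T\<^esub> mono \<beta>) {\<alpha>}" by (rule evB[OF f]) auto
    also have "\<dots> = r \<odot>\<^bsub>T\<^esub> mono \<alpha>" using r by simp
    finally show ?thesis using f unfolding E_def by (metis imageI)
  qed
  have E0: "\<zero>\<^bsub>T\<^esub> \<in> E" using Em[of "\<zero>\<^bsub>R\<^esub>" "{#}"] by simp
  have sumin: "finsum T f B \<in> D" if "finite B" "\<And>b. b \<in> B \<Longrightarrow> f b \<in> D" "\<zero>\<^bsub>T\<^esub> \<in> D" "D \<subseteq> carrier T"
      "\<And>x y. \<lbrakk>x \<in> D; y \<in> D\<rbrakk> \<Longrightarrow> x \<oplus>\<^bsub>T\<^esub> y \<in> D" for f and B :: "nat multiset set" and D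
    using that(1,2)
  proof (induction B rule: finite_induct)
    case (insert b B)
    have "finsum T f (insert b B) = f b \<oplus>\<^bsub>T\<^esub> finsum T f B"
      using insert that(4) by (intro M.finsum_insert) auto
    then show ?case using insert that(5) by auto
  qed (simp add: that(3))
  have EC: "E \<subseteq> carrier T" using evc by (auto simp: E_def)
  have Emult1: "x \<otimes>\<^bsub>T\<^esub> (r \<odot>\<^bsub>T\<^esub> mono \<alpha>) \<in> E" if x: "x \<in> E" and r: "r \<in> carrier R" for x r \<alpha>
  proof -
    obtain f where f: "f \<in> Rep" "x = ev f" using x by (auto simp: E_def)
    have "x \<otimes>\<^bsub>T\<^esub> (r \<odot>\<^bsub>T\<^esub> mono \<alpha>) = finsum T (\<lambda>\<beta>. (f \<beta> \<odot>\<^bsub>T\<^esub> mono \<beta>) \<otimes>\<^bsub>T\<^esub> (r \<odot>\<^bsub>T\<^esub> mono \<alpha>)) {\<alpha>. f \<alpha> \<noteq> \<zero>\<^bsub>R\<^esub>}"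
      unfolding f(2) ev_def using f(1) r by (intro finsum_ldistr) (auto simp: Rep_def)
    also have "\<dots> \<in> E"
    proof (rule sumin[OF _ _ E0 EC Eadd])
      show "finite {\<alpha>. f \<alpha> \<noteq> \<zero>\<^bsub>R\<^esub>}" using f by (simp add: Rep_def)
      fix \<beta>
      have fb: "f \<beta> \<in> carrier R" using f by (simp add: Rep_def)
      have "(f \<beta> \<odot>\<^bsub>T\<^esub> mono \<beta>) \<otimes>\<^bsub>T\<^esub> (r \<odot>\<^bsub>T\<^esub> mono \<alpha>) = (f \<beta> \<otimes>\<^bsub>R\<^esub> r) \<odot>\<^bsub>T\<^esub> (mono \<alpha> \<otimes>\<^bsub>T\<^esub> mono \<beta>)"
        using fb r by (simp add: smult_assoc1 smult_assoc2 m_comm[of "mono \<beta>"])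
      then show "(f \<beta> \<odot>\<^bsub>T\<^esub> mono \<beta>) \<otimes>\<^bsub>T\<^esub> (r \<odot>\<^bsub>T\<^esub> mono \<alpha>) \<in> E"
        using Em[of "f \<beta> \<otimes>\<^bsub>R\<^esub> r" "\<alpha> + \<beta>"] fb r by (simp add: madd)
    qed
    finally show ?thesis .
  qed
  have Emult: "x \<otimes>\<^bsub>T\<^esub> y \<in> E" if x: "x \<in> E" and y: "y \<in> E" for x y
  proof -
    obtain f where f: "f \<in> Rep" "y = ev f" using y by (auto simp: E_def)
    have "x \<otimes>\<^bsub>T\<^esub> y = finsum T (\<lambda>\<beta>. x \<otimes>\<^bsub>T\<^esub> (f \<beta> \<odot>\<^bsub>T\<^esub> mono \<beta>)) {\<alpha>. f \<alpha> \<noteq> \<zero>\<^bsub>R\<^esub>}"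
      unfolding f(2) ev_def using f(1) x EC by (intro finsum_rdistr) (auto simp: Rep_def)
    also have "\<dots> \<in> E"
      by (rule sumin[OF _ _ E0 EC Eadd]) (use f x in \<open>auto simp: Rep_def intro!: Emult1\<close>)
    finally show ?thesis .
  qed
  have Er: "r \<odot>\<^bsub>T\<^esub> \<one>\<^bsub>T\<^esub> \<in> E" if "r \<in> carrier R" for r using Em[OF that, of "{#}"] by (simp add: m0)
  have E1: "\<one>\<^bsub>T\<^esub> \<in> E" using Er[of "\<one>\<^bsub>R\<^esub>"] by simp
  have Esm: "r \<odot>\<^bsub>T\<^esub> x \<in> E" if "r \<in> carrier R" "x \<in> E" for r x
  proof -
    have "r \<odot>\<^bsub>T\<^esub> x = (r \<odot>\<^bsub>T\<^esub> \<one>\<^bsub>T\<^esub>) \<otimes>\<^bsub>T\<^esub> x" using that EC by (auto simp: smult_assoc2)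
    then show ?thesis using Emult[OF Er[OF that(1)] that(2)] by simp
  qed
  \<comment> \<open>An element is named by the set of all polynomials that represent it. These
    fibres of \<open>ev\<close> are nonempty and disjoint for different elements of E, hence the
    injectivity.\<close>
  define c where "c e = {f \<in> Rep. ev f = e}" for e
  show thesis
  proof (rule that[of E c])
    show "commutative_subalgebra R T E"
      unfolding commutative_subalgebra_def using commutative_subalgebraI[OF EC E1 Eadd Emult Esm] by blast
    show "\<gamma> i \<in> E" if "i < n" for i using Em[of "\<one>\<^bsub>R\<^esub>" "{#i#}"] that \<gamma>[OF that] by (simp add: m1)
    show "inj_on c E"
    proof (rule inj_onI)
      fix x y assume x: "x \<in> E" and eq: "c x = c y"
      obtain f where "f \<in> Rep" "x = ev f" using x by (auto simp: E_def)
      then have "f \<in> c x" by (simp add: c_def)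
      then have "f \<in> c y" using eq by simp
      then show "x = y" using \<open>x = ev f\<close> by (simp add: c_def)
    qed
    fix D assume D: "commutative_subalgebra R T D" and gD: "\<And>i. i < n \<Longrightarrow> \<gamma> i \<in> D"
    note D' = commutative_subalgebraE[OF D]
    have pw: "x [^]\<^bsub>T\<^esub> (k::nat) \<in> D" if "x \<in> D" for x k
      using that by (induction k) (auto simp: D')
    have "finprod T (\<lambda>i. \<gamma> i [^]\<^bsub>T\<^esub> count \<alpha> i) {..<m} \<in> D" if "m \<le> n" for \<alpha> m
      using that
    proof (induction m)
      case (Suc m)
      have "finprod T (\<lambda>i. \<gamma> i [^]\<^bsub>T\<^esub> count \<alpha> i) {..<Suc m} =
        \<gamma> m [^]\<^bsub>T\<^esub> count \<alpha> m \<otimes>\<^bsub>T\<^esub> finprod T (\<lambda>i. \<gamma> i [^]\<^bsub>T\<^esub> count \<alpha> i) {..<m}"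
        using Suc.prems \<gamma> unfolding lessThan_Suc by (intro finprod_insert) auto
      then show ?case using Suc pw[OF gD[of m]] D'(5) by simp
    qed (simp add: D'(2))
    then have mD: "mono \<alpha> \<in> D" for \<alpha> unfolding mono_def by simp
    show "E \<subseteq> D"
    proof
      fix x assume "x \<in> E"
      then obtain f where f: "f \<in> Rep" "x = ev f" by (auto simp: E_def)
      show "x \<in> D" unfolding f(2) ev_def
        by (rule sumin[OF _ _ D'(3) D'(1) D'(4)]) (use f mD D'(6) in \<open>auto simp: Rep_def\<close>)
    qed
  qed
qed

text \<open>The free module S^U with both actions equal. A map c \<mapsto> (c, (d_u c)_u) into its
  square-zero extension is multiplicative exactly when every d_u satisfies the product rule.\<close>

definition free_bimodule :: "('r, 'c) module \<Rightarrow> 'c set \<Rightarrow> ('c, 'c \<Rightarrow> 'c) bimodule" where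
  "free_bimodule S U =
     \<lparr>carrier = U \<rightarrow>\<^sub>E carrier S, monoid.mult = undefined, one = undefined,
      ring.zero = (\<lambda>u \<in> U. \<zero>\<^bsub>S\<^esub>), add = (\<lambda>f g. \<lambda>u \<in> U. f u \<oplus>\<^bsub>S\<^esub> g u),
      smult = (\<lambda>c f. \<lambda>u \<in> U. c \<otimes>\<^bsub>S\<^esub> f u), rsmult = (\<lambda>f c. \<lambda>u \<in> U. c \<otimes>\<^bsub>S\<^esub> f u)\<rparr>"

lemma free_bimodule_simps [simp]:
  "carrier (free_bimodule S U) = U \<rightarrow>\<^sub>E carrier S" "ring.zero (free_bimodule S U) = (\<lambda>u \<in> U. \<zero>\<^bsub>S\<^esub>)"
  "add (free_bimodule S U) f g = (\<lambda>u \<in> U. f u \<oplus>\<^bsub>S\<^esub> g u)"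
  "smult (free_bimodule S U) c f = (\<lambda>u \<in> U. c \<otimes>\<^bsub>S\<^esub> f u)"
  "rsmult (free_bimodule S U) f c = (\<lambda>u \<in> U. c \<otimes>\<^bsub>S\<^esub> f u)"
  by (simp_all add: free_bimodule_def)

lemma algebra_free_extension:
  fixes R :: "'r ring" and S :: "('r, 'c) module"
  assumes S: "algebra R S"
  shows "algebra R (square_zero_extension S (free_bimodule S U))"
proof -
  interpret S: algebra R S by fact
  let ?F = "free_bimodule S U"
  let ?T = "square_zero_extension S ?F"
  have A: "assoc_algebra R S"
  proof (intro assoc_algebra.intro S.module S.ring_axioms assoc_algebra_axioms.intro)
    show "x \<otimes>\<^bsub>S\<^esub> (r \<odot>\<^bsub>S\<^esub> y) = r \<odot>\<^bsub>S\<^esub> (x \<otimes>\<^bsub>S\<^esub> y)"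
      if "r \<in> carrier R" "x \<in> carrier S" "y \<in> carrier S" for r x y
      using that by (metis S.m_comm S.smult_assoc2 S.smult_closed)
  qed (rule S.smult_assoc2)
  have fv: "f u \<in> carrier S" if "f \<in> U \<rightarrow>\<^sub>E carrier S" "u \<in> U" for f u using that by auto
  have ext: "(\<lambda>u \<in> U. h u) = f" if "f \<in> U \<rightarrow>\<^sub>E carrier S" "\<And>u. u \<in> U \<Longrightarrow> h u = f u" for f h
    using that by (auto simp: fun_eq_iff PiE_def extensional_def)
  have ag: "abelian_group ?F"
  proof (rule abelian_groupI)
    fix f assume f: "f \<in> carrier ?F"
    show "\<exists>g \<in> carrier ?F. g \<oplus>\<^bsub>?F\<^esub> f = \<zero>\<^bsub>?F\<^esub>"
      by (rule bexI[of _ "\<lambda>u \<in> U. \<ominus>\<^bsub>S\<^esub> f u"]) (use f fv in \<open>auto simp: S.M.l_neg intro!: restrict_ext\<close>)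
    show "\<zero>\<^bsub>?F\<^esub> \<oplus>\<^bsub>?F\<^esub> f = f" using f fv by (auto intro!: ext)
  qed (use fv in \<open>auto simp: S.M.a_ac intro!: restrict_ext\<close>)
  have B: "bimodule S ?F"
  proof (intro bimodule.intro S.ring_axioms ag bimodule_axioms.intro)
    show "\<one>\<^bsub>S\<^esub> \<odot>\<^bsub>?F\<^esub> m = m" "m \<odot>r\<^bsub>?F\<^esub> \<one>\<^bsub>S\<^esub> = m" if "m \<in> carrier ?F" for m
      using that fv by (auto intro!: ext)
  qed (use fv in \<open>auto simp: S.l_distr S.r_distr S.m_ac intro!: restrict_ext\<close>)
  have sym: "symmetric_over R S ?F" by (simp add: symmetric_over_def)
  interpret T: assoc_algebra R ?T by (rule assoc_algebra_square_zero[OF A B sym])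
  have "comm_monoid ?T"
  proof (rule T.monoid_comm_monoidI)
    fix x y assume "x \<in> carrier ?T" "y \<in> carrier ?T"
    then obtain a f b g where "x = (a, f)" "a \<in> carrier S" "f \<in> U \<rightarrow>\<^sub>E carrier S"
      "y = (b, g)" "b \<in> carrier S" "g \<in> U \<rightarrow>\<^sub>E carrier S" by auto
    then show "x \<otimes>\<^bsub>?T\<^esub> y = y \<otimes>\<^bsub>?T\<^esub> x"
      using fv by (auto simp: S.m_comm S.M.a_comm intro!: restrict_ext)
  qed
  then have "cring ?T" by (intro cring.intro T.ring_axioms)
  then show ?thesis
    by (intro algebra.intro T.module_axioms algebra_axioms.intro) (simp_all add: T.smult_mult_left)
qed

text \<open>\<open>d\<close> is a lift of the identity of \<open>S\<close> to the subalgebra of \<open>S \<oplus> S\<^sup>U\<close> generated by the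
  elements \<open>(u, e\<^sub>u)\<close>, an extension of \<open>S\<close> with square-zero kernel.\<close>

lemma smooth_dual_basis:
  fixes R :: "'r ring" and S :: "('r, 'c) module" (structure)
  assumes smooth: "smooth_algebra R S"
  obtains U d where "finite U" "U \<subseteq> carrier S" "\<And>u. u \<in> U \<Longrightarrow> derivation_on R S (d u)"
    "\<And>D c. \<lbrakk>commutative_subalgebra R (square_zero_extension S (free_bimodule S U)) D;
       \<And>u. u \<in> U \<Longrightarrow> (u, \<lambda>v \<in> U. if v = u then \<one> else \<zero>) \<in> D; c \<in> carrier S\<rbrakk>
       \<Longrightarrow> (c, \<lambda>u \<in> U. d u c) \<in> D"
proof -
  have S: "algebra R S" and ft: "finite_type R S" and fs: "formally_smooth TYPE((nat multiset \<Rightarrow> 'r) set) R S"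
    using smooth by (auto simp: smooth_algebra_def)
  interpret S: algebra R S by fact
  obtain U where U: "finite U" "U \<subseteq> carrier S"
    "\<And>D. \<lbrakk>commutative_subalgebra R S D; U \<subseteq> D\<rbrakk> \<Longrightarrow> D = carrier S"
    using ft unfolding finite_type_def by blast
  obtain us where us: "set us = U" using U(1) finite_list by blast
  let ?T = "square_zero_extension S (free_bimodule S U)"
  interpret T: algebra R ?T by (rule algebra_free_extension[OF S])
  let ?e = "\<lambda>u. (u, \<lambda>v \<in> U. if v = u then \<one> else \<zero>)"
  have eT: "?e u \<in> carrier ?T" if "u \<in> U" for u using that U(2) by auto
  have "?e (us ! i) \<in> carrier ?T" if "i < length us" for i using that us eT by (metis nth_mem)
  \<comment> \<open>On the whole of S \<oplus> S^U the section c \<mapsto> (c, 0) exists and says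
    nothing. What matters is a section with values in the subalgebra E generated by the (u, e_u):
    this forces its second component to express derivations through their values on U.\<close>
  then obtain E and c :: "_ \<Rightarrow> (nat multiset \<Rightarrow> 'r) set" where E: "commutative_subalgebra R ?T E"
    "\<And>i. i < length us \<Longrightarrow> ?e (us ! i) \<in> E"
    "\<And>D. \<lbrakk>commutative_subalgebra R ?T D; \<And>i. i < length us \<Longrightarrow> ?e (us ! i) \<in> D\<rbrakk> \<Longrightarrow> E \<subseteq> D" "inj_on c E"
    using finitely_generated_subalgebra[OF T.algebra_axioms, of "length us" "\<lambda>i. ?e (us ! i)"] by blast
  note E' = commutative_subalgebraE[OF E(1)]
  have eE: "?e u \<in> E" if "u \<in> U" for u using that E(2) us by (metis in_set_conv_nth)
  let ?E = "?T\<lparr>carrier := E\<rparr>"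
  have algE: "algebra R ?E" by (rule algebra_subalgebra[OF T.algebra_axioms E(1)])
  have fE: "fst x \<in> carrier S \<and> snd x \<in> U \<rightarrow>\<^sub>E carrier S" if "x \<in> E" for x
  proof -
    have "x \<in> carrier ?T" using that E'(1) by blast
    then show ?thesis by (cases x) simp
  qed
  have mul: "x \<otimes>\<^bsub>?T\<^esub> y = (fst x \<otimes> fst y, \<lambda>u \<in> U. fst x \<otimes> snd y u \<oplus> fst y \<otimes> snd x u)" for x y
    by (cases x; cases y) (simp cong: restrict_cong)
  have ad: "x \<oplus>\<^bsub>?T\<^esub> y = (fst x \<oplus> fst y, \<lambda>u \<in> U. snd x u \<oplus> snd y u)" for x y
    by (cases x; cases y) simp
  have smu: "r \<odot>\<^bsub>?T\<^esub> x = (r \<odot> fst x, \<lambda>u \<in> U. (r \<odot> \<one>) \<otimes> snd x u)" for r x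
    by (cases x) simp
  have p: "fst \<in> ring_hom ?E S" by (rule ring_hom_memI) (auto simp: fE mul ad)
  have "commutative_subalgebra R S (fst ` E)"
  proof -
    have 1: "fst ` E \<subseteq> carrier S" using fE by auto
    have 2: "\<one> \<in> fst ` E" using E'(2) by force
    have "x \<oplus> y \<in> fst ` E \<and> x \<otimes> y \<in> fst ` E" if "x \<in> fst ` E" "y \<in> fst ` E" for x y
    proof -
      from that obtain a b where ab: "a \<in> E" "x = fst a" "b \<in> E" "y = fst b" by blast
      show ?thesis
        using imageI[OF E'(4)[OF ab(1,3)], of fst] imageI[OF E'(5)[OF ab(1,3)], of fst] unfolding ad mul ab(2,4) by simp
    qed
    then have 3: "\<And>x y. \<lbrakk>x \<in> fst ` E; y \<in> fst ` E\<rbrakk> \<Longrightarrow> x \<oplus> y \<in> fst ` E"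
      and 4: "\<And>x y. \<lbrakk>x \<in> fst ` E; y \<in> fst ` E\<rbrakk> \<Longrightarrow> x \<otimes> y \<in> fst ` E" by blast+
    have sm: "r \<odot> x \<in> fst ` E" if r: "r \<in> carrier R" and x: "x \<in> fst ` E" for r x
    proof -
      obtain a where a: "a \<in> E" "x = fst a" using x by blast
      have "fst (r \<odot>\<^bsub>?T\<^esub> a) \<in> fst ` E" using E'(6)[OF r a(1)] by (rule imageI)
      then show ?thesis unfolding smu a(2) by simp
    qed
    show ?thesis unfolding commutative_subalgebra_def using S.commutative_subalgebraI[OF 1 2 3 4 sm] by blast
  qed
  moreover have "U \<subseteq> fst ` E" using eE by force
  ultimately have surj: "fst ` carrier ?E = carrier S" using U(3) by simp
  have pR: "fst (r \<odot>\<^bsub>?E\<^esub> \<one>\<^bsub>?E\<^esub>) = r \<odot> \<one>" for r by simp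
  have sq: "x \<otimes>\<^bsub>?E\<^esub> y = \<zero>\<^bsub>?E\<^esub>"
    if "x \<in> carrier ?E" "y \<in> carrier ?E" "fst x = \<zero>" "fst y = \<zero>" for x y
  proof -
    have "snd x u \<in> carrier S \<and> snd y u \<in> carrier S" if "u \<in> U" for u
      using fE[of x] fE[of y] \<open>x \<in> carrier ?E\<close> \<open>y \<in> carrier ?E\<close> that by auto
    then show ?thesis using that by (auto simp: mul intro!: restrict_ext)
  qed
  have cinj: "inj_on c (carrier ?E)" using E(4) by simp
  obtain s where s: "s \<in> ring_hom S ?E" "\<And>r. r \<in> carrier R \<Longrightarrow> s (r \<odot> \<one>) = r \<odot>\<^bsub>?E\<^esub> \<one>\<^bsub>?E\<^esub>"
    "\<And>x. x \<in> carrier S \<Longrightarrow> fst (s x) = x"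
    using formally_smooth_lift[OF fs S algE cinj p surj pR sq] by blast
  have sE: "s x \<in> E" if "x \<in> carrier S" for x using ring_hom_closed[OF s(1) that] by simp
  have sv: "snd (s x) \<in> U \<rightarrow>\<^sub>E carrier S" if "x \<in> carrier S" for x using fE[OF sE[OF that]] by simp
  \<comment> \<open>The components of the section: multiplicativity of s is the product rule for
    each d_u, and constants from R are killed because s respects R.\<close>
  define d where "d u x = snd (s x) u" for u x
  have dc: "d u x \<in> carrier S" if "u \<in> U" "x \<in> carrier S" for u x
    using sv[OF that(2)] that(1) by (auto simp: d_def)
  have dadd: "d u (x \<oplus> y) = d u x \<oplus> d u y" if "u \<in> U" "x \<in> carrier S" "y \<in> carrier S" for u x y
    using ring_hom_add[OF s(1) that(2,3)] that by (simp add: d_def ad)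
  have dmul: "d u (x \<otimes> y) = x \<otimes> d u y \<oplus> y \<otimes> d u x" if "u \<in> U" "x \<in> carrier S" "y \<in> carrier S" for u x y
    using ring_hom_mult[OF s(1) that(2,3)] that by (simp add: d_def mul s(3))
  have dconst: "d u (r \<odot> \<one>) = \<zero>" if "u \<in> U" "r \<in> carrier R" for u r
    using s(2)[OF that(2)] that by (simp add: d_def smu)
  show thesis
  proof (rule that[OF U(1,2), of d])
    fix u assume u: "u \<in> U"
    show "derivation_on R S (d u)"
      unfolding derivation_on_def
    proof (intro ballI conjI)
      fix x assume x: "x \<in> carrier S"
      show "d u x \<in> carrier S" using dc u x .
      show "d u (r \<odot> x) = r \<odot> d u x" if r: "r \<in> carrier R" for r
      proof -
        have "r \<odot> x = (r \<odot> \<one>) \<otimes> x" using r x by (simp add: S.smult_assoc2)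
        then have "d u (r \<odot> x) = (r \<odot> \<one>) \<otimes> d u x"
          using dmul[OF u _ x, of "r \<odot> \<one>"] dconst[OF u r] dc[OF u x] r x by simp
        then show ?thesis using dc[OF u x] r by (simp add: S.smult_assoc2)
      qed
    qed (use dadd dmul u in auto)
  next
    fix D x assume D: "commutative_subalgebra R ?T D" "\<And>u. u \<in> U \<Longrightarrow> ?e u \<in> D" and x: "x \<in> carrier S"
    have "?e (us ! i) \<in> D" if "i < length us" for i using D(2) that us by (metis nth_mem)
    then have "E \<subseteq> D" by (rule E(3)[OF D(1)])
    moreover have "s x = (x, \<lambda>u \<in> U. d u x)"
    proof -
      have "(\<lambda>u \<in> U. d u x) = snd (s x)" using sv[OF x] by (auto simp: d_def fun_eq_iff PiE_def extensional_def)
      then show ?thesis using s(3)[OF x] by (metis prod.collapse)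
    qed
    ultimately show "(x, \<lambda>u \<in> U. d u x) \<in> D" using sE[OF x] by auto
  qed
qed


section \<open>Expansion in a dual basis\<close>

definition derivation_into ::
    "'r ring \<Rightarrow> ('r, 'c) module \<Rightarrow> ('c, 'v) module \<Rightarrow> ('c \<Rightarrow> 'v) \<Rightarrow> bool" where
  "derivation_into R S V \<delta> \<longleftrightarrow> (\<forall>x \<in> carrier S. \<delta> x \<in> carrier V \<and>
     (\<forall>r \<in> carrier R. \<delta> (r \<odot>\<^bsub>S\<^esub> x) = (r \<odot>\<^bsub>S\<^esub> \<one>\<^bsub>S\<^esub>) \<odot>\<^bsub>V\<^esub> \<delta> x) \<and>
     (\<forall>y \<in> carrier S. \<delta> (x \<oplus>\<^bsub>S\<^esub> y) = \<delta> x \<oplus>\<^bsub>V\<^esub> \<delta> y \<and>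
        \<delta> (x \<otimes>\<^bsub>S\<^esub> y) = x \<odot>\<^bsub>V\<^esub> \<delta> y \<oplus>\<^bsub>V\<^esub> y \<odot>\<^bsub>V\<^esub> \<delta> x))"

lemma derivation_intoD:
  assumes "derivation_into R S V \<delta>" "x \<in> carrier S"
  shows "\<delta> x \<in> carrier V" "r \<in> carrier R \<Longrightarrow> \<delta> (r \<odot>\<^bsub>S\<^esub> x) = (r \<odot>\<^bsub>S\<^esub> \<one>\<^bsub>S\<^esub>) \<odot>\<^bsub>V\<^esub> \<delta> x"
    "y \<in> carrier S \<Longrightarrow> \<delta> (x \<oplus>\<^bsub>S\<^esub> y) = \<delta> x \<oplus>\<^bsub>V\<^esub> \<delta> y"
    "y \<in> carrier S \<Longrightarrow> \<delta> (x \<otimes>\<^bsub>S\<^esub> y) = x \<odot>\<^bsub>V\<^esub> \<delta> y \<oplus>\<^bsub>V\<^esub> y \<odot>\<^bsub>V\<^esub> \<delta> x"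
  using assms unfolding derivation_into_def by blast+

text \<open>The sum over U^p written as an iterated sum, so that an induction on p follows the
  expansion of one argument after the other.\<close>

fun nested_sum :: "('b, 'y) ring_scheme \<Rightarrow> 'c set \<Rightarrow> nat \<Rightarrow> ('c list \<Rightarrow> 'b) \<Rightarrow> 'b" where
  "nested_sum G U 0 g = g []"
| "nested_sum G U (Suc p) g = (\<Oplus>\<^bsub>G\<^esub>u\<in>U. nested_sum G U p (\<lambda>I. g (u # I)))"

definition index :: "'c set \<Rightarrow> nat \<Rightarrow> 'c list set" where
  "index U p = {I. length I = p \<and> set I \<subseteq> U}"

lemma index_simps [simp]: "[] \<in> index U 0" "u # I \<in> index U (Suc p) \<longleftrightarrow> u \<in> U \<and> I \<in> index U p"
  by (auto simp: index_def)

lemma nested_sum_closed: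
  assumes "abelian_group G"
  shows "(\<And>I. I \<in> index U p \<Longrightarrow> g I \<in> carrier G) \<Longrightarrow> nested_sum G U p g \<in> carrier G"
proof (induction p arbitrary: g)
  interpret abelian_group G by fact
  case (Suc p)
  then show ?case by (auto intro!: finsum_closed)
qed simp

lemma nested_sum_cong:
  assumes "abelian_group G"
  shows "(\<And>I. I \<in> index U p \<Longrightarrow> g I = h I \<and> h I \<in> carrier G) \<Longrightarrow> nested_sum G U p g = nested_sum G U p h"
proof (induction p arbitrary: g h)
  interpret abelian_group G by fact
  case (Suc p)
  have "nested_sum G U p (\<lambda>I. g (u # I)) = nested_sum G U p (\<lambda>I. h (u # I))" if "u \<in> U" for u
    using that Suc.prems by (intro Suc.IH) simp
  moreover have "nested_sum G U p (\<lambda>I. h (u # I)) \<in> carrier G" if "u \<in> U" for u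
    using that Suc.prems by (intro nested_sum_closed[OF assms]) simp
  ultimately show ?case by (auto intro!: finsum_cong')
qed simp

lemma nested_sum_add:
  assumes "abelian_group G"
  shows "\<lbrakk>\<And>I. I \<in> index U p \<Longrightarrow> g I \<in> carrier G; \<And>I. I \<in> index U p \<Longrightarrow> h I \<in> carrier G\<rbrakk> \<Longrightarrow>
    nested_sum G U p (\<lambda>I. g I \<oplus>\<^bsub>G\<^esub> h I) = nested_sum G U p g \<oplus>\<^bsub>G\<^esub> nested_sum G U p h"
proof (induction p arbitrary: g h)
  interpret abelian_group G by fact
  case (Suc p)
  have cl: "nested_sum G U p (\<lambda>I. g (u # I)) \<in> carrier G \<and> nested_sum G U p (\<lambda>I. h (u # I)) \<in> carrier G" if "u \<in> U" for u
    using that Suc.prems by (intro conjI nested_sum_closed[OF assms]) simp_all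
  have "nested_sum G U p (\<lambda>I. g (u # I) \<oplus>\<^bsub>G\<^esub> h (u # I)) =
      nested_sum G U p (\<lambda>I. g (u # I)) \<oplus>\<^bsub>G\<^esub> nested_sum G U p (\<lambda>I. h (u # I))" if "u \<in> U" for u
    using that Suc.prems by (intro Suc.IH) simp_all
  then have "nested_sum G U (Suc p) (\<lambda>I. g I \<oplus>\<^bsub>G\<^esub> h I) =
      (\<Oplus>\<^bsub>G\<^esub>u\<in>U. nested_sum G U p (\<lambda>I. g (u # I)) \<oplus>\<^bsub>G\<^esub> nested_sum G U p (\<lambda>I. h (u # I)))"
    unfolding nested_sum.simps using cl by (intro finsum_cong'[OF refl] funcsetI) blast+
  then show ?case using cl by (simp add: finsum_addf Pi_def)
qed simp

lemma finsum_hom: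
  assumes "abelian_group G" "abelian_group H" and f: "\<And>x. x \<in> carrier G \<Longrightarrow> f x \<in> carrier H"
    and add: "\<And>x y. \<lbrakk>x \<in> carrier G; y \<in> carrier G\<rbrakk> \<Longrightarrow> f (x \<oplus>\<^bsub>G\<^esub> y) = f x \<oplus>\<^bsub>H\<^esub> f y"
    and "finite U" and g: "\<And>u. u \<in> U \<Longrightarrow> g u \<in> carrier G"
  shows "f (finsum G g U) = (\<Oplus>\<^bsub>H\<^esub>u\<in>U. f (g u))"
proof -
  interpret G: abelian_group G by fact
  interpret H: abelian_group H by fact
  have z: "f \<zero>\<^bsub>G\<^esub> = \<zero>\<^bsub>H\<^esub>" by (rule additive_zero_minus(1)[OF assms(1-4)])
  from \<open>finite U\<close> g show ?thesis
  proof (induction U)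
    case (insert u U)
    have "finsum G g (insert u U) = g u \<oplus>\<^bsub>G\<^esub> finsum G g U"
      using insert by (intro G.finsum_insert) auto
    moreover have "(\<Oplus>\<^bsub>H\<^esub>v\<in>insert u U. f (g v)) = f (g u) \<oplus>\<^bsub>H\<^esub> (\<Oplus>\<^bsub>H\<^esub>v\<in>U. f (g v))"
      using insert f by (intro H.finsum_insert) auto
    moreover have "finsum G g U \<in> carrier G" using insert by (intro G.finsum_closed) auto
    ultimately show ?case using insert add by simp
  qed (simp add: z)
qed

lemma nested_sum_hom:
  assumes "abelian_group G" "abelian_group H" and f: "\<And>x. x \<in> carrier G \<Longrightarrow> f x \<in> carrier H"
    and add: "\<And>x y. \<lbrakk>x \<in> carrier G; y \<in> carrier G\<rbrakk> \<Longrightarrow> f (x \<oplus>\<^bsub>G\<^esub> y) = f x \<oplus>\<^bsub>H\<^esub> f y"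
    and "finite U"
  shows "(\<And>I. I \<in> index U p \<Longrightarrow> g I \<in> carrier G) \<Longrightarrow> f (nested_sum G U p g) = nested_sum H U p (\<lambda>I. f (g I))"
proof (induction p arbitrary: g)
  interpret H: abelian_group H by fact
  case (Suc p)
  have cl: "nested_sum G U p (\<lambda>I. g (u # I)) \<in> carrier G" if "u \<in> U" for u
    using that Suc.prems by (intro nested_sum_closed[OF assms(1)]) simp_all
  have "f (nested_sum G U (Suc p) g) = (\<Oplus>\<^bsub>H\<^esub>u\<in>U. f (nested_sum G U p (\<lambda>I. g (u # I))))"
    using cl finsum_hom[OF assms, of "\<lambda>u. nested_sum G U p (\<lambda>I. g (u # I))"] by simp
  also have "\<dots> = (\<Oplus>\<^bsub>H\<^esub>u\<in>U. nested_sum H U p (\<lambda>I. f (g (u # I))))"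
  proof (rule H.finsum_cong'[OF refl])
    show "(\<lambda>u. nested_sum H U p (\<lambda>I. f (g (u # I)))) \<in> U \<rightarrow> carrier H"
      using Suc.prems f by (auto intro!: nested_sum_closed[OF assms(2)])
    show "f (nested_sum G U p (\<lambda>I. g (u # I))) = nested_sum H U p (\<lambda>I. f (g (u # I)))" if "u \<in> U" for u
      using that Suc.prems by (intro Suc.IH) simp
  qed
  finally show ?case by simp
qed simp

lemma (in tensor) T_ext:
  assumes W: "abelian_group W" and f: "\<And>u. u \<in> carrier T \<Longrightarrow> f u \<in> carrier W"
    "\<And>u w. \<lbrakk>u \<in> carrier T; w \<in> carrier T\<rbrakk> \<Longrightarrow> f (u \<oplus>\<^bsub>T\<^esub> w) = f u \<oplus>\<^bsub>W\<^esub> f w"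
    and g: "\<And>u. u \<in> carrier T \<Longrightarrow> g u \<in> carrier W"
    "\<And>u w. \<lbrakk>u \<in> carrier T; w \<in> carrier T\<rbrakk> \<Longrightarrow> g (u \<oplus>\<^bsub>T\<^esub> w) = g u \<oplus>\<^bsub>W\<^esub> g w"
    and eq: "\<And>x v. \<lbrakk>x \<in> carrier N; v \<in> carrier V\<rbrakk> \<Longrightarrow> f (pure x v) = g (pure x v)"
    and "u \<in> carrier T"
  shows "f u = g u"
  using \<open>u \<in> carrier T\<close>
proof (induction u rule: T_induct)
  case (diff u w)
  have "f (u \<ominus>\<^bsub>T\<^esub> w) = f u \<ominus>\<^bsub>W\<^esub> f w" by (rule additive_zero_minus(3)[OF T_group W f diff(1,2)])
  moreover have "g (u \<ominus>\<^bsub>T\<^esub> w) = g u \<ominus>\<^bsub>W\<^esub> g w" by (rule additive_zero_minus(3)[OF T_group W g diff(1,2)])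
  ultimately show ?case using diff by simp
qed (rule eq)

text \<open>Instead of symmetry, the derivation property is asked in every slot; so the notion is
  stable under fixing the first argument, and it makes sense for values in any S-module.\<close>

definition form_into :: "'r ring \<Rightarrow> ('r, 'c) module \<Rightarrow> ('c, 'v) module \<Rightarrow> nat \<Rightarrow> ('c list \<Rightarrow> 'v) \<Rightarrow> bool" where
  "form_into R S V p h \<longleftrightarrow> (\<forall>xs \<in> tuples S p. h xs \<in> carrier V) \<and>
     (\<forall>m xs ys. p = Suc m \<longrightarrow> xs @ ys \<in> tuples S m \<longrightarrow> derivation_into R S V (\<lambda>x. h (xs @ x # ys)))"

lemma form_into_Cons:
  assumes h: "form_into R S V (Suc p) h" and u: "u \<in> carrier S"
  shows "form_into R S V p (\<lambda>xs. h (u # xs))"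
  unfolding form_into_def
proof (intro conjI allI impI ballI)
  show "h (u # xs) \<in> carrier V" if "xs \<in> tuples S p" for xs
    using h u that unfolding form_into_def by simp
  fix m xs ys assume "p = Suc m" "xs @ ys \<in> tuples S m"
  then have "(u # xs) @ ys \<in> tuples S p" using u by simp
  then have "derivation_into R S V (\<lambda>x. h ((u # xs) @ x # ys))" using h unfolding form_into_def by blast
  then show "derivation_into R S V (\<lambda>x. h (u # xs @ x # ys))" by simp
qed

lemma (in rational_algebra) Der_derivation_at:
  assumes f: "f \<in> Der (int p)" and p: "p = Suc m" and xs: "xs @ ys \<in> tuples S m"
  shows "derivation_on R S (\<lambda>x. f (xs @ x # ys))"
proof -
  have d: "derivation_on R S (\<lambda>x. f (x # xs @ ys))" using Der_derivation[OF f _ xs] p by simp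
  have "f (xs @ x # ys) = f (x # xs @ ys)" if "x \<in> carrier S" for x
    using that xs p by (intro symmetric_formD[OF Der_symmetric[OF f]]) (auto simp: tuples_def)
  then show ?thesis using derivation_on_cong[of "\<lambda>x. f (xs @ x # ys)" "\<lambda>x. f (x # xs @ ys)"] d by blast
qed

text \<open>The last assumption speaks of subalgebras of S \<oplus> S^U instead of derivations into
  modules, because an assumption of a locale cannot range over modules of all types. The universal
  property is recovered in \<open>derivation_expansion\<close>.\<close>

locale dual_basis = rational_algebra R S
  for R :: "'r ring" and S :: "('r, 'c) module" (structure) +
  fixes U :: "'c set" and d :: "'c \<Rightarrow> 'c \<Rightarrow> 'c"
  assumes finite_U: "finite U" and U_sub: "U \<subseteq> carrier S"
    and d_derivation: "u \<in> U \<Longrightarrow> derivation_on R S (d u)"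
    and generated: "\<lbrakk>commutative_subalgebra R (square_zero_extension S (free_bimodule S U)) D;
       \<And>u. u \<in> U \<Longrightarrow> (u, \<lambda>v \<in> U. if v = u then \<one> else \<zero>) \<in> D; c \<in> carrier S\<rbrakk>
       \<Longrightarrow> (c, \<lambda>u \<in> U. d u c) \<in> D"
begin

lemma d_closed: "\<lbrakk>u \<in> U; c \<in> cS\<rbrakk> \<Longrightarrow> d u c \<in> cS"
  by (rule derivation_onD(1)[OF d_derivation])

text \<open>The pairs (a, f) with \<delta>(a) = \<Sum> f_u \<delta>(u) form a subalgebra of S
  \<oplus> S^U, by the product rule for \<delta>. It contains the generators (u, e_u), hence also
  (c, (d_u c)_u).\<close>

lemma derivation_expansion:
  assumes "module S V" and \<delta>: "derivation_into R S V \<delta>" and c: "c \<in> cS"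
  shows "\<delta> c = (\<Oplus>\<^bsub>V\<^esub>u\<in>U. d u c \<odot>\<^bsub>V\<^esub> \<delta> u)"
proof -
  interpret V: module S V by fact
  let ?T = "square_zero_extension S (free_bimodule S U)"
  interpret T: algebra R ?T by (rule algebra_free_extension[OF algebra_axioms])
  define s where "s f = (\<Oplus>\<^bsub>V\<^esub>u\<in>U. f u \<odot>\<^bsub>V\<^esub> \<delta> u)" for f :: "'c \<Rightarrow> 'c"
  define D where "D = {x \<in> carrier ?T. \<delta> (fst x) = s (snd x)}"
  note dl = derivation_intoD[OF \<delta>]
  have dU: "\<delta> u \<in> carrier V" if "u \<in> U" for u using dl(1) U_sub that by blast
  have s_add: "s (\<lambda>u \<in> U. f u \<oplus> g u) = s f \<oplus>\<^bsub>V\<^esub> s g"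
    if f: "\<And>u. u \<in> U \<Longrightarrow> f u \<in> cS" and g: "\<And>u. u \<in> U \<Longrightarrow> g u \<in> cS" for f g
  proof -
    have "s (\<lambda>u \<in> U. f u \<oplus> g u) = (\<Oplus>\<^bsub>V\<^esub>u\<in>U. f u \<odot>\<^bsub>V\<^esub> \<delta> u \<oplus>\<^bsub>V\<^esub> g u \<odot>\<^bsub>V\<^esub> \<delta> u)"
      unfolding s_def using f g dU by (intro V.finsum_cong') (auto simp: V.smult_l_distr)
    also have "\<dots> = s f \<oplus>\<^bsub>V\<^esub> s g" unfolding s_def using f g dU by (intro V.finsum_addf) auto
    finally show ?thesis .
  qed
  have s_scale: "s (\<lambda>u \<in> U. k \<otimes> f u) = k \<odot>\<^bsub>V\<^esub> s f"
    if k: "k \<in> cS" and f: "\<And>u. u \<in> U \<Longrightarrow> f u \<in> cS" for k f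
  proof -
    have "k \<odot>\<^bsub>V\<^esub> s f = (\<Oplus>\<^bsub>V\<^esub>u\<in>U. k \<odot>\<^bsub>V\<^esub> (f u \<odot>\<^bsub>V\<^esub> \<delta> u))"
      unfolding s_def using k f dU
      by (intro finsum_hom[OF V.M.abelian_group_axioms V.M.abelian_group_axioms]) (auto simp: V.smult_r_distr finite_U)
    also have "\<dots> = s (\<lambda>u \<in> U. k \<otimes> f u)"
      unfolding s_def using k f dU by (intro V.finsum_cong') (auto simp: V.smult_assoc1)
    finally show ?thesis ..
  qed
  have DE: "\<exists>a f. x = (a, f) \<and> a \<in> cS \<and> f \<in> U \<rightarrow>\<^sub>E cS \<and> \<delta> a = s f" if "x \<in> D" for x
    using that unfolding D_def by (cases x) simp
  have DI: "(a, f) \<in> D" if "a \<in> cS" "f \<in> U \<rightarrow>\<^sub>E cS" "\<delta> a = s f" for a f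
    using that unfolding D_def by simp
  have 1: "D \<subseteq> carrier ?T" unfolding D_def by blast
  have z: "s (\<lambda>u \<in> U. \<zero>) = \<zero>\<^bsub>V\<^esub>"
  proof -
    have "s (\<lambda>u \<in> U. \<zero>) = (\<Oplus>\<^bsub>V\<^esub>u\<in>U. \<zero>\<^bsub>V\<^esub>)" unfolding s_def using dU by (intro V.finsum_cong') auto
    then show ?thesis by simp
  qed
  have "\<delta> \<one> = \<delta> \<one> \<oplus>\<^bsub>V\<^esub> \<delta> \<one>" using dl(4)[of "\<one>" "\<one>"] dl(1)[of "\<one>"] by simp
  then have d1: "\<delta> \<one> = \<zero>\<^bsub>V\<^esub>" using dl(1)[of "\<one>"] by (metis V.M.add.r_cancel_one' one_closed)
  have 2: "\<one>\<^bsub>?T\<^esub> \<in> D" unfolding D_def using z d1 by simp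
  have 3: "x \<oplus>\<^bsub>?T\<^esub> y \<in> D" if "x \<in> D" "y \<in> D" for x y
  proof -
    obtain a f b g where x: "x = (a, f)" "a \<in> cS" "f \<in> U \<rightarrow>\<^sub>E cS" "\<delta> a = s f"
      and y: "y = (b, g)" "b \<in> cS" "g \<in> U \<rightarrow>\<^sub>E cS" "\<delta> b = s g" using DE \<open>x \<in> D\<close> \<open>y \<in> D\<close> by metis
    have "\<And>u. u \<in> U \<Longrightarrow> f u \<in> cS" "\<And>u. u \<in> U \<Longrightarrow> g u \<in> cS" using x(3) y(3) by auto
    from this s_add[OF this] show ?thesis unfolding x(1) y(1) by (auto intro!: DI simp: x y dl(3))
  qed
  have 4: "x \<otimes>\<^bsub>?T\<^esub> y \<in> D" if "x \<in> D" "y \<in> D" for x y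
  proof -
    obtain a f b g where x: "x = (a, f)" "a \<in> cS" "f \<in> U \<rightarrow>\<^sub>E cS" "\<delta> a = s f"
      and y: "y = (b, g)" "b \<in> cS" "g \<in> U \<rightarrow>\<^sub>E cS" "\<delta> b = s g" using DE \<open>x \<in> D\<close> \<open>y \<in> D\<close> by metis
    have fg: "\<And>u. u \<in> U \<Longrightarrow> f u \<in> cS" "\<And>u. u \<in> U \<Longrightarrow> g u \<in> cS" using x(3) y(3) by auto
    let ?f = "\<lambda>u \<in> U. b \<otimes> f u" and ?g = "\<lambda>u \<in> U. a \<otimes> g u"
    have fgc: "\<And>u. u \<in> U \<Longrightarrow> ?g u \<in> cS" "\<And>u. u \<in> U \<Longrightarrow> ?f u \<in> cS" using x y fg by auto
    have "\<delta> (a \<otimes> b) = s (\<lambda>u \<in> U. ?g u \<oplus> ?f u)"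
    proof -
      have "s (\<lambda>u \<in> U. ?g u \<oplus> ?f u) = s ?g \<oplus>\<^bsub>V\<^esub> s ?f" by (rule s_add; rule fgc)
      also have "s ?g = a \<odot>\<^bsub>V\<^esub> s g" by (rule s_scale[OF x(2)]) (rule fg)
      also have "s ?f = b \<odot>\<^bsub>V\<^esub> s f" by (rule s_scale[OF y(2)]) (rule fg)
      finally show ?thesis using dl(4)[OF x(2) y(2)] x(4) y(4) by argo
    qed
    moreover have "(\<lambda>u \<in> U. ?g u \<oplus> ?f u) \<in> U \<rightarrow>\<^sub>E cS" using fgc by auto
    moreover have "x \<otimes>\<^bsub>?T\<^esub> y = (a \<otimes> b, \<lambda>u \<in> U. ?g u \<oplus> ?f u)" unfolding x(1) y(1) by simp
    ultimately show ?thesis using DI x(2) y(2) by simp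
  qed
  have 5: "r \<odot>\<^bsub>?T\<^esub> x \<in> D" if r: "r \<in> carrier R" and "x \<in> D" for r x
  proof -
    obtain a f where x: "x = (a, f)" "a \<in> cS" "f \<in> U \<rightarrow>\<^sub>E cS" "\<delta> a = s f" using DE \<open>x \<in> D\<close> by metis
    have f: "\<And>u. u \<in> U \<Longrightarrow> f u \<in> cS" using x(3) by auto
    have k: "r \<odot> \<one> \<in> cS" using r by simp
    show ?thesis unfolding x(1) using x r f k s_scale[OF k f] by (auto intro!: DI simp: dl(2))
  qed
  have "(c, \<lambda>u \<in> U. d u c) \<in> D"
  proof (rule generated[OF _ _ c])
    show "commutative_subalgebra R ?T D"
      unfolding commutative_subalgebra_def using T.commutative_subalgebraI[OF 1 2 3 4 5] by blast
    fix u assume u: "u \<in> U"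
    then have uS: "u \<in> cS" using U_sub by blast
    have "s (\<lambda>v \<in> U. if v = u then \<one> else \<zero>) = (\<Oplus>\<^bsub>V\<^esub>v\<in>U. if u = v then \<delta> v else \<zero>\<^bsub>V\<^esub>)"
      unfolding s_def using dU by (intro V.finsum_cong') auto
    also have "\<dots> = \<delta> u" using u dU finite_U by (intro V.M.add.finprod_singleton) auto
    finally show "(u, \<lambda>v \<in> U. if v = u then \<one> else \<zero>) \<in> D" using uS by (auto intro!: DI)
  qed
  then have "\<delta> c = s (\<lambda>u \<in> U. d u c)" unfolding D_def by simp
  also have "\<dots> = (\<Oplus>\<^bsub>V\<^esub>u\<in>U. d u c \<odot>\<^bsub>V\<^esub> \<delta> u)"
    unfolding s_def using dU d_closed c by (intro V.finsum_cong') auto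
  finally show ?thesis .
qed

definition dprod_value :: "'c list \<Rightarrow> 'c \<Rightarrow> 'c" where
  "dprod_value I c = foldr (\<lambda>u a. d u c \<otimes> a) I \<one>"

lemma dprod_value_closed: "\<lbrakk>I \<in> index U p; c \<in> cS\<rbrakk> \<Longrightarrow> dprod_value I c \<in> cS"
  by (induction I arbitrary: p) (auto simp: dprod_value_def index_def d_closed)

text \<open>The first argument is expanded by \<open>derivation_expansion\<close>; the induction
  hypothesis applies to the form with u inserted there.\<close>

lemma form_expansion:
  assumes "module S V" and c: "c \<in> cS"
  shows "form_into R S V p h \<Longrightarrow>
    h (replicate p c) = nested_sum V U p (\<lambda>I. dprod_value I c \<odot>\<^bsub>V\<^esub> h I)"
proof (induction p arbitrary: h)
  interpret V: module S V by fact
  case 0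
  then show ?case by (simp add: dprod_value_def form_into_def)
next
  interpret V: module S V by fact
  case (Suc p)
  have cl: "h I \<in> carrier V" if "I \<in> index U (Suc p)" for I
    using Suc.prems that U_sub unfolding form_into_def by (auto simp: tuples_def index_def)
  have rp: "[] @ replicate p c \<in> tuples S p" using c by simp
  then have "derivation_into R S V (\<lambda>x. h ([] @ x # replicate p c))"
    using Suc.prems unfolding form_into_def by blast
  from derivation_expansion[OF assms(1) this c]
  have "h (replicate (Suc p) c) = (\<Oplus>\<^bsub>V\<^esub>u\<in>U. d u c \<odot>\<^bsub>V\<^esub> h (u # replicate p c))" by simp
  also have "\<dots> = (\<Oplus>\<^bsub>V\<^esub>u\<in>U. nested_sum V U p (\<lambda>I. dprod_value (u # I) c \<odot>\<^bsub>V\<^esub> h (u # I)))"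
  proof (rule V.finsum_cong'[OF refl])
    show "(\<lambda>u. nested_sum V U p (\<lambda>I. dprod_value (u # I) c \<odot>\<^bsub>V\<^esub> h (u # I))) \<in> U \<rightarrow> carrier V"
    proof (intro funcsetI nested_sum_closed[OF V.M.abelian_group_axioms])
      show "dprod_value (u # I) c \<odot>\<^bsub>V\<^esub> h (u # I) \<in> carrier V" if "u \<in> U" "I \<in> index U p" for u I
        using dprod_value_closed[of "u # I" "Suc p" c] cl[of "u # I"] that c by simp
    qed
    fix u assume u: "u \<in> U"
    then have uS: "u \<in> cS" using U_sub by blast
    have "d u c \<odot>\<^bsub>V\<^esub> h (u # replicate p c) = d u c \<odot>\<^bsub>V\<^esub> nested_sum V U p (\<lambda>I. dprod_value I c \<odot>\<^bsub>V\<^esub> h (u # I))"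
      using Suc.IH[OF form_into_Cons[OF Suc.prems uS]] by simp
    also have "\<dots> = nested_sum V U p (\<lambda>I. d u c \<odot>\<^bsub>V\<^esub> (dprod_value I c \<odot>\<^bsub>V\<^esub> h (u # I)))"
      using u c cl dprod_value_closed d_closed finite_U
      by (intro nested_sum_hom[OF V.M.abelian_group_axioms V.M.abelian_group_axioms]) (simp_all add: V.smult_r_distr)
    also have "\<dots> = nested_sum V U p (\<lambda>I. dprod_value (u # I) c \<odot>\<^bsub>V\<^esub> h (u # I))"
    proof (rule nested_sum_cong[OF V.M.abelian_group_axioms])
      fix I assume I: "I \<in> index U p"
      have hI: "h (u # I) \<in> carrier V" using cl[of "u # I"] u I by simp
      note k = d_closed[OF u c] dprod_value_closed[OF I c]
      show "d u c \<odot>\<^bsub>V\<^esub> (dprod_value I c \<odot>\<^bsub>V\<^esub> h (u # I)) = dprod_value (u # I) c \<odot>\<^bsub>V\<^esub> h (u # I) \<and>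
          dprod_value (u # I) c \<odot>\<^bsub>V\<^esub> h (u # I) \<in> carrier V"
        using k hI by (simp add: dprod_value_def V.smult_assoc1)
    qed
    finally show "d u c \<odot>\<^bsub>V\<^esub> h (u # replicate p c) = nested_sum V U p (\<lambda>I. dprod_value (u # I) c \<odot>\<^bsub>V\<^esub> h (u # I))" .
  qed
  finally show ?case by simp
qed

section \<open>Products of the dual derivations in Sym \<Theta>\<close>

definition dform :: "'c \<Rightarrow> 'c list \<Rightarrow> 'c" where
  "dform u = (\<lambda>xs \<in> args S 1. d u (hd xs))"

fun dprod :: "'c list \<Rightarrow> 'c list \<Rightarrow> 'c" where
  "dprod [] = sym_const S \<one>"
| "dprod (u # I) = sym_mult S 1 (int (length I)) (dform u) (dprod I)"

lemma dform_Der: "u \<in> U \<Longrightarrow> dform u \<in> Der 1"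
  unfolding dform_def
proof (rule restricted_form_Der)
  assume u: "u \<in> U"
  show "symmetric_form S n (\<lambda>xs. d u (hd xs))" if "1 = int n" for n
  proof -
    have "n = 1" using that by simp
    then show ?thesis unfolding symmetric_form_def by (auto simp: tuples_def length_Suc_conv)
  qed
  show "derivation_on R S (\<lambda>x. d u (hd (x # zs)))" for zs :: "'c list" using d_derivation[OF u] by simp
qed simp

lemma dprod_facts:
  assumes "I \<in> index U p"
  shows "dprod I \<in> Der (int p)" "c \<in> cS \<Longrightarrow> diag S (int p) (dprod I) c = dprod_value I c"
proof -
  have "dprod I \<in> Der (int p) \<and> (\<forall>c \<in> carrier S. diag S (int p) (dprod I) c = dprod_value I c)"
    using assms
  proof (induction I arbitrary: p)
    case Nil
    then show ?case by (simp add: index_def const_form_Der dprod_value_def diag_sym_const)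
  next
    case (Cons u I)
    then have u: "u \<in> U" and p: "p = Suc (length I)" and I: "I \<in> index U (length I)" by (auto simp: index_def)
    note IH = Cons.IH[OF I]
    have 1: "diag S 1 (dform u) c = d u c" if "c \<in> cS" for c
      using that by (simp add: diag_def dform_def args_def)
    have e: "int p = 1 + int (length I)" using p by simp
    show ?case
      using sym_mult_facts[OF dform_Der[OF u] _ e, of "dprod I"] IH by (simp add: 1 dprod_value_def)
  qed
  then show "dprod I \<in> Der (int p)" "c \<in> cS \<Longrightarrow> diag S (int p) (dprod I) c = dprod_value I c" by blast+
qed

lemma regular_module: "module S (with_smult (\<otimes>) S)"
proof (rule moduleI)
  show "abelian_group (with_smult (\<otimes>) S)"
    by (rule abelian_group_cong[OF M.abelian_group_axioms]) (simp_all add: with_smult_def)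
qed (simp_all add: with_smult_def M_cring l_distr r_distr m_assoc)

text \<open>On the diagonal the right side becomes the expansion of f as a form with values in S
  regarded as a module over itself. The coefficients are the values of f at tuples from U.\<close>

lemma Der_expansion:
  assumes f: "f \<in> Der (int p)"
  shows "f = nested_sum (Form (int p)) U p (\<lambda>I. f I \<odot>\<^bsub>Form (int p)\<^esub> dprod I)"
proof (rule diag_eqI[OF f])
  interpret W: module S "Form (int p)" by (rule module_sym_component)
  have fI: "f I \<in> cS" if "I \<in> index U p" for I
    using Der_value_closed[OF f, of I] that U_sub by (auto simp: index_def tuples_def)
  have cl: "f I \<odot>\<^bsub>Form (int p)\<^esub> dprod I \<in> carrier (Form (int p))" if "I \<in> index U p" for I
    using fI[OF that] dprod_facts(1)[OF that] by (intro W.smult_closed) simp_all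
  have W: "abelian_group (Form (int p))" by (rule W.M.abelian_group_axioms)
  show "nested_sum (Form (int p)) U p (\<lambda>I. f I \<odot>\<^bsub>Form (int p)\<^esub> dprod I) \<in> Der (int p)"
    using nested_sum_closed[OF W cl] by simp
  fix c assume c: "c \<in> cS"
  have "diag S (int p) (nested_sum (Form (int p)) U p (\<lambda>I. f I \<odot>\<^bsub>Form (int p)\<^esub> dprod I)) c =
      nested_sum S U p (\<lambda>I. diag S (int p) (f I \<odot>\<^bsub>Form (int p)\<^esub> dprod I) c)"
    by (rule nested_sum_hom[OF W M.abelian_group_axioms _ _ finite_U cl])
      (simp_all add: diag_closed diag_add c del: sym_component_simps(2-4))
  also have "\<dots> = nested_sum S U p (\<lambda>I. dprod_value I c \<otimes> f I)"
  proof (rule nested_sum_cong[OF M.abelian_group_axioms])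
    show "diag S (int p) (f I \<odot>\<^bsub>Form (int p)\<^esub> dprod I) c = dprod_value I c \<otimes> f I \<and>
        dprod_value I c \<otimes> f I \<in> cS" if I: "I \<in> index U p" for I
      using fI[OF I] dprod_facts[OF I] dprod_value_closed[OF I c] c
      by (simp add: diag_scale m_comm del: sym_component_simps(2-4))
  qed
  also have "\<dots> = nested_sum (with_smult (\<otimes>) S) U p (\<lambda>I. dprod_value I c \<odot>\<^bsub>with_smult (\<otimes>) S\<^esub> f I)"
  proof -
    have "finsum (with_smult (\<otimes>) S) g U = finsum S g U" for g
      by (simp add: finsum_def finprod_def with_smult_def)
    then have "nested_sum (with_smult (\<otimes>) S) U k g = nested_sum S U k g" for k g
      by (induction k arbitrary: g) simp_all
    then show ?thesis by (simp add: with_smult_def)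
  qed
  also have "\<dots> = f (replicate p c)"
  proof (rule form_expansion[OF regular_module c, symmetric])
    show "form_into R S (with_smult (\<otimes>) S) p f"
      unfolding form_into_def
    proof (intro conjI ballI allI impI)
      show "f xs \<in> carrier (with_smult (\<otimes>) S)" if "xs \<in> tuples S p" for xs
        using Der_value_closed[OF f, of xs] that by (simp add: with_smult_def)
      fix m xs ys assume "p = Suc m" "xs @ ys \<in> tuples S m"
      from Der_derivation_at[OF f this]
      have *: "derivation_on R S (\<lambda>x. f (xs @ x # ys))" .
      then show "derivation_into R S (with_smult (\<otimes>) S) (\<lambda>x. f (xs @ x # ys))"
        unfolding derivation_into_def by (simp add: derivation_onD[OF *] with_smult_def smult_assoc2)
    qed
  qed
  finally show "diag S (int p) f c = diag S (int p)
      (nested_sum (Form (int p)) U p (\<lambda>I. f I \<odot>\<^bsub>Form (int p)\<^esub> dprod I)) c"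
    by (simp add: diag_def)
qed

end


section \<open>Forms with values in the module\<close>

context self_centralizing_bimodule
begin

text \<open>The forms on \<^term>\<open>C \<times> N\<close> which come from symmetric \<open>N\<close>-valued multiderivations of \<^term>\<open>C\<close>.\<close>

definition module_forms :: "int \<Rightarrow> (('a \<times> 'm) list \<Rightarrow> 'a \<times> 'm) set" where
  "module_forms p = {\<phi> \<in> E.S.Der p. \<forall>c \<in> C. \<forall>n \<in> N.
     fst (diag E.S p \<phi> (c, n)) = \<zero> \<and> diag E.S p \<phi> (c, n) = diag E.S p \<phi> (c, zM)}"

abbreviation retract :: "'a \<times> 'm \<Rightarrow> 'a \<times> 'm" where "retract x \<equiv> (fst x, zM)"

lemma module_forms_Der: "\<phi> \<in> module_forms p \<Longrightarrow> \<phi> \<in> E.S.Der p"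
  by (simp add: module_forms_def)

lemma fst_nat_multiple: "x \<in> carrier A' \<Longrightarrow> fst ([(k::nat)] \<cdot>\<^bsub>A'\<^esub> x) = [k] \<cdot> fst x"
proof (induction k)
  case (Suc k)
  have "[k] \<cdot>\<^bsub>A'\<^esub> x \<in> carrier A'" using Suc.prems by (rule E.add.nat_pow_closed)
  then have "fst ([k] \<cdot>\<^bsub>A'\<^esub> x \<oplus>\<^bsub>A'\<^esub> x) = fst ([k] \<cdot>\<^bsub>A'\<^esub> x) \<oplus> fst x" by (simp add: A'_def square_zero_extension_def)
  then show ?case using Suc by simp
qed simp

lemma E_add: "x \<oplus>\<^bsub>A'\<^esub> y = (fst x \<oplus> fst y, snd x \<oplus>\<^bsub>M\<^esub> snd y)"
  by (simp add: A'_def square_zero_extension_def)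

text \<open>The definition of \<open>module_forms\<close> restricts the diagonal only. Polarization,
  applied to the first component of \<phi> and to \<phi> composed with \<open>retract\<close>,
  extends both conditions to all arguments.\<close>

lemma module_forms_value:
  assumes \<phi>: "\<phi> \<in> module_forms (int k)" and xs: "xs \<in> tuples E.S k"
  shows "fst (\<phi> xs) = \<zero>" and "\<phi> xs = \<phi> (map retract xs)"
proof -
  have D: "\<phi> \<in> E.S.Der (int k)" by (rule module_forms_Der[OF \<phi>])
  note m = multiderivationD(2,3)[OF D]
  have cl: "\<phi> ys \<in> C \<times> N" if "ys \<in> tuples E.S k" for ys using multiadditive_closed[OF m(1) that] by simp
  have dg: "diag E.S (int k) \<phi> x = \<phi> (replicate k x)" for x by (simp add: diag_def)
  have mem: "xs @ z # ys \<in> tuples E.S k" if "xs @ x # ys \<in> tuples E.S k" "z \<in> C \<times> N" for xs ys x z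
    using that by (auto simp: tuples_def)
  have "(fst (\<phi> xs), zM) = \<zero>\<^bsub>E.S\<^esub>"
  proof (rule E.S.diagonal_zero[OF _ _ _ xs])
    show "multiadditive E.S E.S k (\<lambda>xs. (fst (\<phi> xs), zM))"
      unfolding multiadditive_def
    proof (intro conjI ballI allI impI)
      fix xs assume "xs \<in> tuples E.S k"
      then show "(fst (\<phi> xs), zM) \<in> carrier E.S" using cl[of xs] by (simp add: mem_Times_iff N_closed)
    next
      fix xs ys x y assume "x \<in> carrier E.S" "y \<in> carrier E.S" "xs @ x # ys \<in> tuples E.S k"
      then have "\<phi> (xs @ (x \<oplus>\<^bsub>E.S\<^esub> y) # ys) = \<phi> (xs @ x # ys) \<oplus>\<^bsub>E.S\<^esub> \<phi> (xs @ y # ys)" by (rule multiadditive_add[OF m(1)])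
      then show "(fst (\<phi> (xs @ (x \<oplus>\<^bsub>E.S\<^esub> y) # ys)), zM) =
          (fst (\<phi> (xs @ x # ys)), zM) \<oplus>\<^bsub>E.S\<^esub> (fst (\<phi> (xs @ y # ys)), zM)"
        by (simp add: E_add)
    qed
    show "symmetric_form E.S k (\<lambda>xs. (fst (\<phi> xs), zM))"
      using m(2) unfolding symmetric_form_def by metis
    show "(fst (\<phi> (replicate k c)), zM) = \<zero>\<^bsub>E.S\<^esub>" if "c \<in> carrier E.S" for c
    proof -
      have "fst (diag E.S (int k) \<phi> (fst c, snd c)) = \<zero>" using that \<phi> unfolding module_forms_def by auto
      then show ?thesis by (simp add: dg)
    qed
  qed
  then show "fst (\<phi> xs) = \<zero>" by simp
  have mapt: "map retract ys \<in> tuples E.S k" if "ys \<in> tuples E.S k" for ys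
    using that N_closed(2) by (auto simp: tuples_def)
  show "\<phi> xs = \<phi> (map retract xs)"
  proof (rule E.S.diagonal_determines[OF m _ _ _ xs])
    show "multiadditive E.S E.S k (\<lambda>xs. \<phi> (map retract xs))"
      unfolding multiadditive_def
    proof (intro conjI ballI allI impI)
      fix xs assume "xs \<in> tuples E.S k"
      then show "\<phi> (map retract xs) \<in> carrier E.S" by (intro multiadditive_closed[OF m(1)] mapt)
    next
      fix xs ys x y assume x: "x \<in> carrier E.S" and y: "y \<in> carrier E.S" and t: "xs @ x # ys \<in> tuples E.S k"
      have "map retract xs @ retract x # map retract ys \<in> tuples E.S k" using mapt[OF t] by simp
      moreover have "retract x \<in> carrier E.S" "retract y \<in> carrier E.S" using x y N_closed(2) by auto
      ultimately show "\<phi> (map retract (xs @ (x \<oplus>\<^bsub>E.S\<^esub> y) # ys)) =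
          \<phi> (map retract (xs @ x # ys)) \<oplus>\<^bsub>E.S\<^esub> \<phi> (map retract (xs @ y # ys))"
        using multiadditive_add[OF m(1), of "retract x" "retract y" "map retract xs" "map retract ys"] x y
        by (simp add: E_add N_closed)
    qed
    show "symmetric_form E.S k (\<lambda>xs. \<phi> (map retract xs))"
      unfolding symmetric_form_def
    proof (intro ballI impI)
      fix xs ys assume "xs \<in> tuples E.S k" "ys \<in> tuples E.S k" and e: "mset xs = mset ys"
      from e have "image_mset retract (mset xs) = image_mset retract (mset ys)" by (rule arg_cong)
      then have "mset (map retract xs) = mset (map retract ys)" unfolding mset_map .
      then show "\<phi> (map retract xs) = \<phi> (map retract ys)"
        by (rule symmetric_formD[OF m(2) mapt[OF \<open>xs \<in> tuples E.S k\<close>]])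
    qed
    show "\<phi> (replicate k c) = \<phi> (map retract (replicate k c))" if "c \<in> carrier E.S" for c
    proof (cases c)
      case (Pair a n)
      then have "a \<in> C" "n \<in> N" using that by auto
      then have "diag E.S (int k) \<phi> (a, n) = diag E.S (int k) \<phi> (a, zM)" using \<phi> unfolding module_forms_def by blast
      then show ?thesis unfolding dg by (simp add: Pair)
    qed
  qed
qed

lemma module_forms_deriv:
  assumes \<phi>: "\<phi> \<in> module_forms p" and x: "x \<in> C \<times> N" and y: "y \<in> C \<times> N"
  shows "fst (diag_deriv E.S p \<phi> x y) = \<zero>"
    and "diag_deriv E.S p \<phi> x y = diag_deriv E.S p \<phi> (retract x) (retract y)"
proof -
  have "fst (diag_deriv E.S p \<phi> x y) = \<zero> \<and> diag_deriv E.S p \<phi> x y = diag_deriv E.S p \<phi> (retract x) (retract y)"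
  proof (cases "p < 1")
    case False
    define k where "k = nat p - 1"
    have p: "p = int (Suc k)" using False by (simp add: k_def)
    have t: "y # replicate k x \<in> tuples E.S (Suc k)" using x y by simp
    note v = module_forms_value[OF \<phi>[unfolded p] t]
    have c: "\<phi> (y # replicate k x) \<in> carrier A'"
      using E.S.Der_value_closed[OF module_forms_Der[OF \<phi>], of "y # replicate k x"] t E.C_closed(1)
      unfolding p args_int by simp
    have "fst ([(Suc k)] \<cdot>\<^bsub>A'\<^esub> \<phi> (y # replicate k x)) = \<zero>"
      unfolding fst_nat_multiple[OF c] v(1) by (rule add.nat_pow_one)
    moreover have "nat p = Suc k" using p by simp
    ultimately show ?thesis using v(2) False by (simp add: diag_deriv_def del: E.add.nat_pow_Suc)
  qed (simp add: diag_deriv_def)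
  then show "fst (diag_deriv E.S p \<phi> x y) = \<zero>"
    "diag_deriv E.S p \<phi> x y = diag_deriv E.S p \<phi> (retract x) (retract y)" by blast+
qed

section \<open>Symbols over the extension, and closure of the module forms\<close>

lemma fst_inverse_fact: "fst (E.inverse_fact k) = inverse_fact k"
proof (rule SA.torsion_free_cancel)
  have c: "E.inverse_fact k \<in> C \<times> N" by (rule E.inverse_fact_C)
  have "[(fact k :: nat)] \<cdot> fst (E.inverse_fact k) = fst ([(fact k :: nat)] \<cdot>\<^bsub>A'\<^esub> E.inverse_fact k)"
    using E.C_closed(1)[OF c] by (rule fst_nat_multiple[symmetric])
  also have "\<dots> = \<one>" by (simp only: E.fact_inverse_fact A'_simps fst_conv)
  finally show "[(fact k :: nat)] \<cdot> fst (E.inverse_fact k) = [(fact k :: nat)] \<cdot> inverse_fact k"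
    by (simp only: fact_inverse_fact)
  show "fst (E.inverse_fact k) \<in> carrier A" using c by (auto simp: mem_Times_iff)
qed simp_all

lemma ders_algebra:
  "\<lbrakk>set xs \<subseteq> C \<times> N; x \<in> carrier A'\<rbrakk> \<Longrightarrow> E.ders xs x \<in> carrier A' \<and> fst (E.ders xs x) = ders (map fst xs) (fst x)"
proof (induction xs)
  case (Cons y ys)
  then obtain a m where e: "E.ders ys x = (a, m)" "a \<in> carrier A" "m \<in> carrier M" by (cases "E.ders ys x") auto
  obtain c n where y: "y = (c, n)" "c \<in> C" "n \<in> N" using Cons.prems by (cases y) auto
  then have nM: "n \<in> carrier M" by (simp add: N_closed)
  have "E.comm (a, m) (c, n) \<in> carrier A'" using e y nM by (intro E.comm_closed) simp_all
  then show ?case using Cons e y nM by (simp add: E_comm)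
qed simp

text \<open>Commutators of M with N vanish in \<open>A'\<close>, so only the C-components of the
  arguments count.\<close>

lemma ders_module:
  assumes m: "m \<in> carrier M" and xs: "set xs \<subseteq> C \<times> N"
  shows "fst (E.ders xs (\<zero>, m)) = \<zero>" and "E.ders xs (\<zero>, m) = E.ders (map retract xs) (\<zero>, m)"
proof -
  have *: "fst (E.ders ys (\<zero>, m)) = \<zero>" if "set ys \<subseteq> C \<times> N" for ys
  proof -
    have "ders zs \<zero> = \<zero>" if "set zs \<subseteq> C" for zs using that by (induction zs) simp_all
    moreover have "set (map fst ys) \<subseteq> C" using that by auto
    ultimately show ?thesis using ders_algebra[OF that, of "(\<zero>, m)"] m by simp
  qed
  then show "fst (E.ders xs (\<zero>, m)) = \<zero>" using xs .
  show "E.ders xs (\<zero>, m) = E.ders (map retract xs) (\<zero>, m)" using xs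
  proof (induction xs)
    case (Cons y ys)
    obtain c n where y: "y = (c, n)" "c \<in> C" "n \<in> N" using Cons.prems by (cases y) auto
    then have nM: "n \<in> carrier M" by (simp add: N_closed)
    have ys: "set ys \<subseteq> C \<times> N" using Cons.prems by simp
    obtain m' where e: "E.ders ys (\<zero>, m) = (\<zero>, m')" "m' \<in> carrier M"
      using ders_algebra[OF ys, of "(\<zero>, m)"] *[OF ys] m by (cases "E.ders ys (\<zero>, m)") auto
    then show ?case using Cons.IH[OF ys] y nM by (simp add: E_comm_M)
  qed simp
qed

text \<open>The projection from \<open>A'\<close> to A respects commutators and 1/q!, so the first
  component of the symbol over \<open>C \<times> N\<close> is the symbol over C.\<close>

lemma symbol_algebra_diag:
  assumes "b \<in> F q" and x: "x \<in> C \<times> N"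
  shows "fst (diag E.S q (E.symbol q (b, zM)) x) = diag S q (symbol q b) (fst x)"
proof (cases "q < 0")
  case False
  have bA: "b \<in> carrier A" using F_carrier[OF assms(1)] .
  have xC: "fst x \<in> C" using x by auto
  have s: "set (replicate (nat q) x) \<subseteq> C \<times> N" using x by (auto dest: in_set_replicate[THEN iffD1])
  have d: "E.ders (replicate (nat q) x) (b, zM) \<in> carrier A'"
    "fst (E.ders (replicate (nat q) x) (b, zM)) = ders (replicate (nat q) (fst x)) b"
    using ders_algebra[OF s, of "(b, zM)"] bA by simp_all
  have "fst (u \<otimes>\<^bsub>A'\<^esub> v) = fst u \<otimes> fst v" for u v by (simp add: A'_def square_zero_extension_def)
  then show ?thesis
    using False x xC d(2) by (simp add: diag_def symbol_def E.symbol_def args_nonneg fst_inverse_fact)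
qed (simp add: diag_def)

lemma symbol_module_form:
  assumes m: "(\<zero>, m) \<in> E.F p" and mM: "m \<in> carrier M"
  shows "E.symbol p (\<zero>, m) \<in> module_forms p"
  unfolding module_forms_def
proof (intro CollectI conjI ballI E.symbol_Der[OF m])
  fix c n assume c: "c \<in> C" and n: "n \<in> N"
  have v: "E.symbol p (\<zero>, m) (replicate (nat p) x) = E.inverse_fact (nat p) \<otimes>\<^bsub>A'\<^esub> E.ders (replicate (nat p) x) (\<zero>, m)"
    if "0 \<le> p" "x \<in> C \<times> N" for x
    using that by (simp add: E.symbol_def args_nonneg)
  have s: "set (replicate (nat p) x) \<subseteq> C \<times> N" if "x \<in> C \<times> N" for x
    using that by (auto dest: in_set_replicate[THEN iffD1])
  have x: "(c, n) \<in> C \<times> N" "(c, zM) \<in> C \<times> N" using c n by (simp_all add: N_closed)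
  note dm = ders_module[OF mM s[OF x(1)]]
  have f: "fst (u \<otimes>\<^bsub>A'\<^esub> w) = fst u \<otimes> fst w" for u w by (simp add: A'_def square_zero_extension_def)
  have i: "fst (E.inverse_fact (nat p)) \<in> carrier A" by (simp add: fst_inverse_fact)
  show "fst (diag E.S p (E.symbol p (\<zero>, m)) (c, n)) = \<zero>"
    using v[OF _ x(1)] dm(1) i by (simp add: diag_def f)
  show "diag E.S p (E.symbol p (\<zero>, m)) (c, n) = diag E.S p (E.symbol p (\<zero>, m)) (c, zM)"
    using v[OF _ x(1)] v[OF _ x(2)] dm(2) by (simp add: diag_def)
qed

lemma sigma_module_form: "m \<in> filtration C M p \<Longrightarrow> sigma p m \<in> module_forms p"
  unfolding sigma_def using F_M_carrier F_module_iff by (intro symbol_module_form) auto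

text \<open>A product (0, m) (a, k) = (0, m a) sees only the first component of the symbol of b,
  which does not depend on n by \<open>symbol_algebra_diag\<close>.\<close>

lemma module_forms_mult:
  assumes \<phi>: "\<phi> \<in> module_forms p" and b: "b \<in> F q"
  shows "sym_mult E.S p q \<phi> (E.symbol q (b, zM)) \<in> module_forms (p + q)"
proof -
  let ?g = "E.symbol q (b, zM)"
  have g: "?g \<in> E.S.Der q" by (rule E.symbol_Der[OF F_algebra[OF b]])
  note h = E.S.sym_mult_facts[OF module_forms_Der[OF \<phi>] g refl]
  have p: "(\<zero>, m) \<otimes>\<^bsub>A'\<^esub> u = (\<zero>, m \<odot>r\<^bsub>M\<^esub> fst u)" if "m \<in> carrier M" "fst u \<in> carrier A" "snd u \<in> carrier M" for m u
    using that by (cases u) (simp add: B.right_closed)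
  show ?thesis
    unfolding module_forms_def
  proof (intro CollectI conjI ballI h(1))
    fix c n assume c: "c \<in> C" and n: "n \<in> N"
    have x: "(c, n) \<in> C \<times> N" "(c, zM) \<in> C \<times> N" using c n by (simp_all add: N_closed)
    have \<phi>c: "fst (diag E.S p \<phi> (c, n)) = \<zero>" "diag E.S p \<phi> (c, n) = diag E.S p \<phi> (c, zM)"
      using \<phi> c n unfolding module_forms_def by blast+
    have "diag E.S p \<phi> (c, n) \<in> carrier E.S" using E.S.diag_closed[OF module_forms_Der[OF \<phi>]] x(1) by simp
    then obtain m where m: "diag E.S p \<phi> (c, n) = (\<zero>, m)" "m \<in> carrier M"
      using \<phi>c(1) N_closed(1) by (cases "diag E.S p \<phi> (c, n)") auto
    have gx: "fst (diag E.S q ?g x) \<in> carrier A" "snd (diag E.S q ?g x) \<in> carrier M" if "x \<in> C \<times> N" for x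
      using E.S.diag_closed[OF g, of x] that N_closed(1) by (cases "diag E.S q ?g x"; simp)+
    have v: "diag E.S (p + q) (sym_mult E.S p q \<phi> ?g) x = (\<zero>, m \<odot>r\<^bsub>M\<^esub> fst (diag E.S q ?g x))"
      if x: "x \<in> C \<times> N" and e: "diag E.S p \<phi> x = (\<zero>, m)" for x
      using h(2)[of x] p[OF m(2) gx[OF x]] x e by simp
    show "fst (diag E.S (p + q) (sym_mult E.S p q \<phi> ?g) (c, n)) = \<zero>"
      unfolding v[OF x(1) m(1)] by simp
    show "diag E.S (p + q) (sym_mult E.S p q \<phi> ?g) (c, n) = diag E.S (p + q) (sym_mult E.S p q \<phi> ?g) (c, zM)"
      unfolding v[OF x(1) m(1)] v[OF x(2) m(1)[unfolded \<phi>c(2)]] symbol_algebra_diag[OF b x(1)] symbol_algebra_diag[OF b x(2)]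
      by simp
  qed
qed

text \<open>Differentiation in the direction (0, m) is bracketing with a constant, so it yields the
  symbol of the commutator of b with m. That commutator lies in M, and its symbol is a module
  form.\<close>

lemma symbol_algebra_deriv:
  assumes b: "b \<in> F q" and m: "m \<in> N" and c: "c \<in> C" and n: "n \<in> N"
  shows "fst (diag_deriv E.S q (E.symbol q (b, zM)) (c, n) (\<zero>, m)) = \<zero>"
    and "diag_deriv E.S q (E.symbol q (b, zM)) (c, n) (\<zero>, m) =
      diag_deriv E.S q (E.symbol q (b, zM)) (c, zM) (\<zero>, m)"
proof -
  let ?g = "E.symbol q (b, zM)" and ?h = "E.symbol (q - 1) (E.comm (b, zM) (\<zero>, m))"
  have g: "?g \<in> E.S.Der q" by (rule E.symbol_Der[OF F_algebra[OF b]])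
  have mN: "(\<zero>, m) \<in> C \<times> N" and mM: "m \<in> carrier M" using m by (simp_all add: N_closed)
  have bA: "b \<in> carrier A" using F_carrier[OF b] .
  have k: "sym_const E.S (\<zero>, m) \<in> E.S.Der 0" using mN by (intro E.S.const_form_Der) simp
  have e: "E.comm (b, zM) (\<zero>, m) = (\<zero>, b \<bullet> m \<ominus>\<^bsub>M\<^esub> m \<odot>r\<^bsub>M\<^esub> b)"
    using bA mM by (simp add: E_comm B.left_closed B.right_closed)
  have h: "?h \<in> module_forms (q - 1)"
    using comm_F_N[OF b m] bA mM unfolding e by (intro symbol_module_form) (simp_all add: B.left_closed B.right_closed)
  have *: "diag_deriv E.S q ?g x (\<zero>, m) = diag E.S (q - 1) ?h x" if "x \<in> C \<times> N" for x
  proof -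
    have xS: "x \<in> carrier E.S" using that by simp
    have D: "diag_deriv E.S q ?g x (\<zero>, m) \<in> carrier E.S"
      using derivation_onD(1)[OF E.S.diag_deriv_derivation[OF g xS]] mN by simp
    have "diag E.S (q - 1) (sym_bracket E.S q 0 ?g (sym_const E.S (\<zero>, m))) x =
        diag_deriv E.S q ?g x (\<zero>, m) \<ominus>\<^bsub>E.S\<^esub> \<zero>\<^bsub>E.S\<^esub>"
      using E.S.sym_bracket_facts(2)[OF g k _ xS, of "q - 1"] xS
      by (simp add: E.S.diag_sym_const diag_deriv_def[of _ 0])
    also have "\<dots> = diag_deriv E.S q ?g x (\<zero>, m)" 
      unfolding a_minus_def E.S.M.minus_equality[OF E.S.M.l_zero[OF E.S.M.zero_closed] E.S.M.zero_closed E.S.M.zero_closed]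
      by (rule E.S.M.r_zero[OF D])
    finally show ?thesis using E.symbol_bracket_const[OF F_algebra[OF b] mN] by simp
  qed
  have x: "(c, n) \<in> C \<times> N" "(c, zM) \<in> C \<times> N" using c n by (simp_all add: N_closed)
  show "fst (diag_deriv E.S q ?g (c, n) (\<zero>, m)) = \<zero>"
    "diag_deriv E.S q ?g (c, n) (\<zero>, m) = diag_deriv E.S q ?g (c, zM) (\<zero>, m)"
    unfolding *[OF x(1)] *[OF x(2)] using h c n unfolding module_forms_def by blast+
qed

lemma E_S_minus:
  "\<lbrakk>a \<in> C; a' \<in> C; m \<in> N; m' \<in> N\<rbrakk> \<Longrightarrow> (a, m) \<ominus>\<^bsub>E.S\<^esub> (a', m') = (a \<ominus> a', m \<ominus>\<^bsub>M\<^esub> m')"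
proof -
  assume am: "a \<in> C" "a' \<in> C" "m \<in> N" "m' \<in> N"
  have "\<ominus>\<^bsub>E.S\<^esub> (a', m') = (\<ominus> a', \<ominus>\<^bsub>M\<^esub> m')"
    using am N_closed by (intro E.S.M.minus_equality) (simp_all add: l_neg B.M.l_neg)
  then show ?thesis by (simp add: a_minus_def)
qed

text \<open>On the diagonal the bracket is \<phi>'(x)(g(x)) - g'(x)(\<phi>(x)). The first term
  depends only on the C-components of x and g(x); in the second, \<phi>(x) is a direction in N and
  \<open>symbol_algebra_deriv\<close> applies. This closure yields a bracket on all of N \<otimes>
  Sym \<Theta>, not only on symbols of elements of M.\<close>

lemma module_forms_bracket:
  assumes \<phi>: "\<phi> \<in> module_forms p" and b: "b \<in> F q"
  shows "sym_bracket E.S p q \<phi> (E.symbol q (b, zM)) \<in> module_forms (p + q - 1)"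
proof -
  let ?g = "E.symbol q (b, zM)"
  have g: "?g \<in> E.S.Der q" by (rule E.symbol_Der[OF F_algebra[OF b]])
  note h = E.S.sym_bracket_facts[OF module_forms_Der[OF \<phi>] g refl]
  show ?thesis
    unfolding module_forms_def
  proof (intro CollectI conjI ballI h(1))
    fix c n assume c: "c \<in> C" and n: "n \<in> N"
    have x: "(c, n) \<in> C \<times> N" "(c, zM) \<in> C \<times> N" using c n by (simp_all add: N_closed)
    have \<phi>c: "fst (diag E.S p \<phi> (c, n)) = \<zero>" "diag E.S p \<phi> (c, n) = diag E.S p \<phi> (c, zM)"
      using \<phi> c n unfolding module_forms_def by blast+
    have "diag E.S p \<phi> (c, n) \<in> carrier E.S" using E.S.diag_closed[OF module_forms_Der[OF \<phi>]] x(1) by simp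
    then obtain m where m: "diag E.S p \<phi> (c, n) = (\<zero>, m)" "m \<in> N"
      using \<phi>c(1) by (cases "diag E.S p \<phi> (c, n)") auto
    have gc: "diag E.S q ?g y \<in> C \<times> N" if "y \<in> C \<times> N" for y using E.S.diag_closed[OF g, of y] that by simp
    have gr: "retract (diag E.S q ?g (c, n)) = retract (diag E.S q ?g (c, zM))"
      using symbol_algebra_diag[OF b x(1)] symbol_algebra_diag[OF b x(2)] by simp
    note d1 = module_forms_deriv[OF \<phi> x(1) gc[OF x(1)]] and d2 = module_forms_deriv(2)[OF \<phi> x(2) gc[OF x(2)]]
    note e = symbol_algebra_deriv[OF b m(2) c n]
    have v: "diag E.S (p + q - 1) (sym_bracket E.S p q \<phi> ?g) y =
        diag_deriv E.S p \<phi> y (diag E.S q ?g y) \<ominus>\<^bsub>E.S\<^esub> diag_deriv E.S q ?g y (diag E.S p \<phi> y)" if "y \<in> C \<times> N" for y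
      using h(2)[of y] that by simp
    have "diag_deriv E.S p \<phi> (c, n) (diag E.S q ?g (c, n)) = diag_deriv E.S p \<phi> (c, zM) (diag E.S q ?g (c, zM))"
      using d1(2) d2 gr by simp
    then show "diag E.S (p + q - 1) (sym_bracket E.S p q \<phi> ?g) (c, n) =
        diag E.S (p + q - 1) (sym_bracket E.S p q \<phi> ?g) (c, zM)"
      unfolding v[OF x(1)] v[OF x(2)] \<phi>c(2)[symmetric] m(1) e(2) by (rule arg_cong)
    have D: "diag_deriv E.S p \<phi> (c, n) (diag E.S q ?g (c, n)) \<in> C \<times> N" "diag_deriv E.S q ?g (c, n) (\<zero>, m) \<in> C \<times> N"
      using derivation_onD(1)[OF E.S.diag_deriv_derivation[OF module_forms_Der[OF \<phi>]], of "(c, n)"]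
        derivation_onD(1)[OF E.S.diag_deriv_derivation[OF g], of "(c, n)" "(\<zero>, m)"] x gc[OF x(1)] m(2) by simp_all
    obtain m1 m2 where "diag_deriv E.S p \<phi> (c, n) (diag E.S q ?g (c, n)) = (\<zero>, m1)" "m1 \<in> N"
        "diag_deriv E.S q ?g (c, n) (\<zero>, m) = (\<zero>, m2)" "m2 \<in> N"
      using D d1(1) e(1) by (metis mem_Times_iff prod.collapse)
    moreover have zz: "\<zero> \<ominus> \<zero> = \<zero>" by (simp add: a_minus_def)
    ultimately show "fst (diag E.S (p + q - 1) (sym_bracket E.S p q \<phi> ?g) (c, n)) = \<zero>"
      unfolding v[OF x(1)] m(1) by (simp add: E_S_minus zz)
  qed
qed

end


section \<open>The tensor product as a module of forms\<close>

context self_centralizing_bimodule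
begin

text \<open>The elements are classes in degree 0, as the notion of a flat connection demands;
  \<open>Nmod\<close> is the same module on N itself, and \<open>nval\<close> translates.\<close>

definition N0 :: "('a, 'm set) module" where
  "N0 = degree_zero_module S GA \<iota> GM"

definition Nmod :: "('a, 'm) module" where
  "Nmod = \<lparr>carrier = N, monoid.mult = undefined, one = undefined, ring.zero = zM, add = add M, smult = smult M\<rparr>"

lemma Nmod_simps [simp]:
  "carrier Nmod = N" "ring.zero Nmod = zM" "add Nmod = add M" "smult Nmod = smult M"
  by (simp_all add: Nmod_def)

lemma module_Nmod: "module S Nmod"
proof (rule moduleI)
  show "cring S" by (rule S.M_cring)
  show "abelian_group Nmod"
  proof (rule abelian_groupI)
    show "\<exists>y \<in> carrier Nmod. y \<oplus>\<^bsub>Nmod\<^esub> x = \<zero>\<^bsub>Nmod\<^esub>" if "x \<in> carrier Nmod" for x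
      using that by (intro bexI[of _ "\<ominus>\<^bsub>M\<^esub> x"]) (simp_all add: N_closed B.M.l_neg)
  qed (simp_all add: N_closed B.M.a_ac)
qed (simp_all add: N_closed B.left_add B.left_distr B.left_assoc B.left_one)

lemma N_filtration: "n \<in> N \<Longrightarrow> n \<in> filtration C M 0"
  by (simp add: N_def)

text \<open>A symbol of degree 0 is the constant (0, n), so its value at the empty list recovers n
  from the class.\<close>

definition nval :: "'m set \<Rightarrow> 'm" where "nval U = snd (grM.gr_map 0 U [])"

lemma nval_class: "n \<in> N \<Longrightarrow> nval (grM.cls 0 n) = n"
proof -
  assume n: "n \<in> N"
  then have "grM.gr_map 0 (grM.cls 0 n) = sym_const E.S (\<zero>, n)"
    using E.symbol_const[of "(\<zero>, n)"] by (simp add: grM.gr_map_class[OF N_filtration] sigma_def)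
  then show ?thesis by (simp add: nval_def sym_const_def args_def)
qed

lemma N0_simps:
  "carrier N0 = grM.cls 0 ` N" "\<zero>\<^bsub>N0\<^esub> = grM.cls 0 zM"
  "\<lbrakk>n \<in> N; m \<in> N\<rbrakk> \<Longrightarrow> grM.cls 0 n \<oplus>\<^bsub>N0\<^esub> grM.cls 0 m = grM.cls 0 (n \<oplus>\<^bsub>M\<^esub> m)"
  "\<lbrakk>c \<in> C; n \<in> N\<rbrakk> \<Longrightarrow> c \<odot>\<^bsub>N0\<^esub> grM.cls 0 n = grM.cls 0 (c \<bullet> n)"
proof -
  show "carrier N0 = grM.cls 0 ` N"
    by (simp add: N0_def degree_zero_module_def with_smult_def grM.gr_carrier N_def)
  show "\<zero>\<^bsub>N0\<^esub> = grM.cls 0 zM"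
    by (simp add: N0_def degree_zero_module_def with_smult_def grM.gr_zero)
  show "grM.cls 0 n \<oplus>\<^bsub>N0\<^esub> grM.cls 0 m = grM.cls 0 (n \<oplus>\<^bsub>M\<^esub> m)" if "n \<in> N" "m \<in> N"
    using grM.gr_add[OF N_filtration[OF that(1)] N_filtration[OF that(2)]]
    by (simp add: N0_def degree_zero_module_def with_smult_def)
  show "c \<odot>\<^bsub>N0\<^esub> grM.cls 0 n = grM.cls 0 (c \<bullet> n)" if c: "c \<in> C" and n: "n \<in> N"
  proof -
    have cF: "c \<in> F 0" using c by (simp add: F_0)
    have h: "gr.cls 0 c \<in> homog GA 0" using cF by (simp add: gr.gr_carrier)
    have "the_inv_into (homog GA 0) (\<iota> 0) (\<iota> 0 (gr.cls 0 c)) = gr.cls 0 c"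
      by (rule the_inv_into_f_f[OF linear_injectionD(2)[OF gr_component_linear(1)] h])
    then have "the_inv_into (homog GA 0) (\<iota> 0) (sym_const S c) = gr.cls 0 c"
      by (simp only: gr_algebra_embedding(3)[OF c])
    then have "c \<odot>\<^bsub>N0\<^esub> grM.cls 0 n = mact GM 0 0 (grM.cls 0 n) (gr.cls 0 c)"
      by (simp add: N0_def degree_zero_module_def with_smult_def)
    also have "\<dots> = grM.cls 0 (n \<odot>r\<^bsub>M\<^esub> c)" using gr_act(1)[OF N_filtration[OF n] cF] by simp
    finally show ?thesis using N_closed(6)[OF c n] by simp
  qed
qed

lemma module_N0: "module S N0"
proof (rule module_pullback[OF module_Nmod, of nval])
  show "inj_on nval (carrier N0)" unfolding N0_simps by (auto intro!: inj_onI simp: nval_class)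
qed (auto simp: N0_simps nval_class N_closed)

text \<open>The form belonging to n \<otimes> f: an N-valued multiderivation of C, pulled back along
  the projection from \<open>C \<times> N\<close>.\<close>

definition tensor_form :: "int \<Rightarrow> 'm \<Rightarrow> ('a list \<Rightarrow> 'a) \<Rightarrow> ('a \<times> 'm) list \<Rightarrow> 'a \<times> 'm" where
  "tensor_form p n f = (\<lambda>xs \<in> args E.S p. (\<zero>, f (map fst xs) \<bullet> n))"

lemma map_fst_tuples: "xs \<in> tuples E.S k \<Longrightarrow> map fst xs \<in> tuples S k"
  by (auto simp: tuples_def)

lemma tensor_form_Der:
  assumes n: "n \<in> N" and f: "f \<in> S.Der p"
  shows "tensor_form p n f \<in> E.S.Der p"
  unfolding tensor_form_def
proof (rule E.S.restricted_form_Der)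
  show "symmetric_form E.S k (\<lambda>xs. (\<zero>, f (map fst xs) \<bullet> n))" if k: "p = int k" for k
    unfolding symmetric_form_def
  proof (intro ballI impI)
    fix xs ys assume xs: "xs \<in> tuples E.S k" and "ys \<in> tuples E.S k" "mset xs = mset ys"
    from this(3) have "image_mset fst (mset xs) = image_mset fst (mset ys)" by (rule arg_cong)
    then have "mset (map fst xs) = mset (map fst ys)" unfolding mset_map .
    then show "(\<zero>, f (map fst xs) \<bullet> n) = (\<zero>, f (map fst ys) \<bullet> n)"
      using symmetric_formD[OF S.Der_symmetric map_fst_tuples[OF xs]] f k by metis
  qed
  show "(\<zero>, f (map fst []) \<bullet> n) \<in> carrier E.S" if "p = 0"
    using S.Der_value_closed[OF f, of "[]"] that n by (simp add: args_def N_closed)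
  fix m zs assume p: "p = int (Suc m)" and "zs \<in> tuples E.S m"
  then have d: "derivation_on R S (\<lambda>x. f (x # map fst zs))"
    by (intro S.Der_derivation[OF f p] map_fst_tuples)
  note dd = derivation_onD[OF d, unfolded S_simps]
  have nM: "n \<in> carrier M" using n by (simp add: N_closed)
  show "derivation_on R E.S (\<lambda>x. (\<zero>, f (map fst (x # zs)) \<bullet> n))"
    unfolding derivation_on_def
  proof (intro ballI conjI)
    fix x assume "x \<in> carrier E.S"
    then obtain a k where x: "x = (a, k)" "a \<in> C" "k \<in> N" by auto
    have fa: "f (a # map fst zs) \<in> C" using dd(1)[of a] x by simp
    show "(\<zero>, f (map fst (x # zs)) \<bullet> n) \<in> carrier E.S" using fa n by (simp add: x N_closed)
    show "(\<zero>, f (map fst ((r \<odot>\<^bsub>E.S\<^esub> x) # zs)) \<bullet> n) = r \<odot>\<^bsub>E.S\<^esub> (\<zero>, f (map fst (x # zs)) \<bullet> n)"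
      if r: "r \<in> carrier R" for r
    proof -
      have "(r \<odot>\<^bsub>A\<^esub> f (a # map fst zs)) \<bullet> n = (r \<odot>\<^bsub>A\<^esub> \<one>) \<bullet> (f (a # map fst zs) \<bullet> n)"
        using r fa nM by (simp add: B.left_assoc[symmetric] smult_mult_left)
      then show ?thesis using dd(2)[of a r] x r by simp
    qed
    fix y assume "y \<in> carrier E.S"
    then obtain b l where y: "y = (b, l)" "b \<in> C" "l \<in> N" by auto
    have fb: "f (b # map fst zs) \<in> C" using dd(1)[of b] y by simp
    have kl: "k \<in> carrier M" "l \<in> carrier M" using x y by (simp_all add: N_closed)
    show "(\<zero>, f (map fst ((x \<oplus>\<^bsub>E.S\<^esub> y) # zs)) \<bullet> n) =
        (\<zero>, f (map fst (x # zs)) \<bullet> n) \<oplus>\<^bsub>E.S\<^esub> (\<zero>, f (map fst (y # zs)) \<bullet> n)"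
      using dd(3)[of a b] x y fa fb nM by (simp add: B.left_add)
    show "(\<zero>, f (map fst ((x \<otimes>\<^bsub>E.S\<^esub> y) # zs)) \<bullet> n) =
        x \<otimes>\<^bsub>E.S\<^esub> (\<zero>, f (map fst (y # zs)) \<bullet> n) \<oplus>\<^bsub>E.S\<^esub> y \<otimes>\<^bsub>E.S\<^esub> (\<zero>, f (map fst (x # zs)) \<bullet> n)"
      using dd(4)[of a b] x y fa fb nM kl by (simp add: B.left_add B.left_assoc B.left_closed)
  qed
qed

lemma diag_tensor_form:
  assumes "n \<in> N" "x \<in> C \<times> N"
  shows "diag E.S p (tensor_form p n f) x = (\<zero>, diag S p f (fst x) \<bullet> n)"
  using assms by (auto simp: diag_def tensor_form_def args_nonneg N_closed)

lemma tensor_form_module_form: "\<lbrakk>n \<in> N; f \<in> S.Der p\<rbrakk> \<Longrightarrow> tensor_form p n f \<in> module_forms p"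
  unfolding module_forms_def by (simp add: tensor_form_Der diag_tensor_form N_closed)

text \<open>Needed for the induction over the tensor product, which proceeds through
  differences.\<close>

lemma module_forms_diff:
  assumes \<phi>: "\<phi> \<in> module_forms p" and \<psi>: "\<psi> \<in> module_forms p"
  shows "\<phi> \<ominus>\<^bsub>restrict_scalars E.S (E.S.Form p)\<^esub> \<psi> \<in> module_forms p"
proof -
  note D = module_forms_Der[OF \<phi>] module_forms_Der[OF \<psi>]
  note u = E.S.diag_uminus[OF D(2)]
  have v: "diag E.S p (\<phi> \<ominus>\<^bsub>restrict_scalars E.S (E.S.Form p)\<^esub> \<psi>) x = diag E.S p \<phi> x \<ominus>\<^bsub>E.S\<^esub> diag E.S p \<psi> x"
    if "x \<in> C \<times> N" for x
    using E.S.diag_add[OF D(1) u(1), of x] u(2)[of x] that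
    by (simp add: a_minus_def del: sym_component_simps)
  have sub: "\<phi> \<ominus>\<^bsub>restrict_scalars E.S (E.S.Form p)\<^esub> \<psi> \<in> E.S.Der p"
    using E.S.add_form_Der[OF D(1) u(1)[OF E.S.M.zero_closed]] by (simp add: a_minus_def)
  have z: "\<zero> \<ominus> \<zero> = \<zero>" by (simp add: a_minus_def)
  show ?thesis
    unfolding module_forms_def
  proof (intro CollectI conjI ballI sub)
    fix c n assume c: "c \<in> C" and n: "n \<in> N"
    have x: "(c, n) \<in> C \<times> N" "(c, zM) \<in> C \<times> N" using c n by (simp_all add: N_closed)
    have e: "fst (diag E.S p \<chi> (c, n)) = \<zero>" "diag E.S p \<chi> (c, n) = diag E.S p \<chi> (c, zM)" if "\<chi> \<in> module_forms p" for \<chi>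
      using that c n unfolding module_forms_def by blast+
    have "\<exists>m \<in> N. diag E.S p \<chi> (c, n) = (\<zero>, m)" if "\<chi> \<in> module_forms p" for \<chi>
    proof -
      have "diag E.S p \<chi> (c, n) \<in> C \<times> N" using E.S.diag_closed[OF module_forms_Der[OF that], of "(c, n)"] x(1) by simp
      then show ?thesis using e(1)[OF that] by (cases "diag E.S p \<chi> (c, n)") auto
    qed
    from this[OF \<phi>] this[OF \<psi>] obtain m k where m: "m \<in> N" "diag E.S p \<phi> (c, n) = (\<zero>, m)"
      and k: "k \<in> N" "diag E.S p \<psi> (c, n) = (\<zero>, k)" by blast
    show "fst (diag E.S p (\<phi> \<ominus>\<^bsub>restrict_scalars E.S (E.S.Form p)\<^esub> \<psi>) (c, n)) = \<zero>"
      unfolding v[OF x(1)] m k using m k by (simp add: E_S_minus z)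
    show "diag E.S p (\<phi> \<ominus>\<^bsub>restrict_scalars E.S (E.S.Form p)\<^esub> \<psi>) (c, n) =
        diag E.S p (\<phi> \<ominus>\<^bsub>restrict_scalars E.S (E.S.Form p)\<^esub> \<psi>) (c, zM)"
      unfolding v[OF x(1)] v[OF x(2)] using e(2)[OF \<phi>] e(2)[OF \<psi>] by simp
  qed
qed

section \<open>The comparison map from the tensor product to forms\<close>

abbreviation "NT p \<equiv> tensor_product C N0 (S.Form p)"
abbreviation "npure p \<equiv> pure_tensor C N0 (S.Form p)"

lemma tensor_NT: "tensor S N0 (S.Form p)"
  by (rule tensor.intro[OF module_N0 S.module_sym_component])

lemma NT_facts:
  "abelian_group (NT p)"
  "\<lbrakk>n \<in> N; f \<in> S.Der p\<rbrakk> \<Longrightarrow> npure p (grM.cls 0 n) f \<in> carrier (NT p)"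
  "\<lbrakk>k \<in> C; u \<in> carrier (NT p)\<rbrakk> \<Longrightarrow> k \<odot>\<^bsub>NT p\<^esub> u \<in> carrier (NT p)"
  "\<lbrakk>k \<in> C; u \<in> carrier (NT p); w \<in> carrier (NT p)\<rbrakk> \<Longrightarrow> k \<odot>\<^bsub>NT p\<^esub> (u \<oplus>\<^bsub>NT p\<^esub> w) = k \<odot>\<^bsub>NT p\<^esub> u \<oplus>\<^bsub>NT p\<^esub> k \<odot>\<^bsub>NT p\<^esub> w"
  "\<lbrakk>k \<in> C; n \<in> N; f \<in> S.Der p\<rbrakk> \<Longrightarrow> k \<odot>\<^bsub>NT p\<^esub> npure p (grM.cls 0 n) f = npure p (grM.cls 0 (k \<bullet> n)) f"
  "\<lbrakk>k \<in> C; n \<in> N; f \<in> S.Der p\<rbrakk> \<Longrightarrow>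
    npure p (grM.cls 0 (k \<bullet> n)) f = npure p (grM.cls 0 n) (k \<odot>\<^bsub>S.Form p\<^esub> f)"
  "\<lbrakk>n \<in> N; m \<in> N; f \<in> S.Der p\<rbrakk> \<Longrightarrow>
    npure p (grM.cls 0 (n \<oplus>\<^bsub>M\<^esub> m)) f = npure p (grM.cls 0 n) f \<oplus>\<^bsub>NT p\<^esub> npure p (grM.cls 0 m) f"
  "\<lbrakk>n \<in> N; f \<in> S.Der p; g \<in> S.Der p\<rbrakk> \<Longrightarrow>
    npure p (grM.cls 0 n) (f \<oplus>\<^bsub>S.Form p\<^esub> g) = npure p (grM.cls 0 n) f \<oplus>\<^bsub>NT p\<^esub> npure p (grM.cls 0 n) g"
proof -
  interpret T: tensor S N0 "S.Form p" by (rule tensor_NT)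
  note t = T.T_group T.pure_closed T.T_smult T.pure_balanced T.pure_add_left T.pure_add_right
  note t' = t[unfolded S_simps(1) sym_component_simps(1)]
  have c: "grM.cls 0 n \<in> carrier N0" if "n \<in> N" for n using that by (simp add: N0_simps)
  show "abelian_group (NT p)" by (rule t'(1))
  show "\<lbrakk>n \<in> N; f \<in> S.Der p\<rbrakk> \<Longrightarrow> npure p (grM.cls 0 n) f \<in> carrier (NT p)" by (intro t'(2) c)
  show "\<lbrakk>k \<in> C; u \<in> carrier (NT p)\<rbrakk> \<Longrightarrow> k \<odot>\<^bsub>NT p\<^esub> u \<in> carrier (NT p)" by (rule t'(3))
  show "\<lbrakk>k \<in> C; u \<in> carrier (NT p); w \<in> carrier (NT p)\<rbrakk> \<Longrightarrow> k \<odot>\<^bsub>NT p\<^esub> (u \<oplus>\<^bsub>NT p\<^esub> w) = k \<odot>\<^bsub>NT p\<^esub> u \<oplus>\<^bsub>NT p\<^esub> k \<odot>\<^bsub>NT p\<^esub> w"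
    by (rule t'(4))
  show "\<lbrakk>k \<in> C; n \<in> N; f \<in> S.Der p\<rbrakk> \<Longrightarrow> k \<odot>\<^bsub>NT p\<^esub> npure p (grM.cls 0 n) f = npure p (grM.cls 0 (k \<bullet> n)) f"
    using t'(5)[of k "grM.cls 0 n" f] c by (simp only: N0_simps(4))
  show "\<lbrakk>k \<in> C; n \<in> N; f \<in> S.Der p\<rbrakk> \<Longrightarrow>
    npure p (grM.cls 0 (k \<bullet> n)) f = npure p (grM.cls 0 n) (k \<odot>\<^bsub>S.Form p\<^esub> f)"
    using t'(6)[of k "grM.cls 0 n" f] c by (simp only: N0_simps(4))
  show "\<lbrakk>n \<in> N; m \<in> N; f \<in> S.Der p\<rbrakk> \<Longrightarrow>
    npure p (grM.cls 0 (n \<oplus>\<^bsub>M\<^esub> m)) f = npure p (grM.cls 0 n) f \<oplus>\<^bsub>NT p\<^esub> npure p (grM.cls 0 m) f"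
    using t'(7)[of "grM.cls 0 n" "grM.cls 0 m" f] c by (simp only: N0_simps(3))
  show "\<lbrakk>n \<in> N; f \<in> S.Der p; g \<in> S.Der p\<rbrakk> \<Longrightarrow>
    npure p (grM.cls 0 n) (f \<oplus>\<^bsub>S.Form p\<^esub> g) = npure p (grM.cls 0 n) f \<oplus>\<^bsub>NT p\<^esub> npure p (grM.cls 0 n) g"
    using t'(8)[of "grM.cls 0 n" f g] c by simp
qed

lemma NT_ext:
  assumes W: "abelian_group W" and f: "\<And>u. u \<in> carrier (NT p) \<Longrightarrow> f u \<in> carrier W"
    "\<And>u w. \<lbrakk>u \<in> carrier (NT p); w \<in> carrier (NT p)\<rbrakk> \<Longrightarrow> f (u \<oplus>\<^bsub>NT p\<^esub> w) = f u \<oplus>\<^bsub>W\<^esub> f w"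
    and g: "\<And>u. u \<in> carrier (NT p) \<Longrightarrow> g u \<in> carrier W"
    "\<And>u w. \<lbrakk>u \<in> carrier (NT p); w \<in> carrier (NT p)\<rbrakk> \<Longrightarrow> g (u \<oplus>\<^bsub>NT p\<^esub> w) = g u \<oplus>\<^bsub>W\<^esub> g w"
    and eq: "\<And>n v. \<lbrakk>n \<in> N; v \<in> S.Der p\<rbrakk> \<Longrightarrow> f (npure p (grM.cls 0 n) v) = g (npure p (grM.cls 0 n) v)"
    and u: "u \<in> carrier (NT p)"
  shows "f u = g u"
proof -
  interpret T: tensor S N0 "S.Form p" by (rule tensor_NT)
  show ?thesis
  proof (rule T.T_ext[unfolded S_simps(1) sym_component_simps(1), OF W f g _ u])
    fix x v assume "x \<in> carrier N0" "v \<in> S.Der p"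
    then show "f (npure p x v) = g (npure p x v)" using eq unfolding N0_simps by blast
  qed
qed

text \<open>The universal property applied to \<open>tensor_form\<close>, whose bilinearity is
  checked on diagonals. The values are module forms because those of pure tensors are.\<close>

lemma tensor_form_lift:
  obtains h where "\<And>u. u \<in> carrier (NT p) \<Longrightarrow> h u \<in> module_forms p"
    "\<And>u w. \<lbrakk>u \<in> carrier (NT p); w \<in> carrier (NT p)\<rbrakk> \<Longrightarrow> h (u \<oplus>\<^bsub>NT p\<^esub> w) = h u \<oplus>\<^bsub>E.S.Form p\<^esub> h w"
    "\<And>k u. \<lbrakk>k \<in> C; u \<in> carrier (NT p)\<rbrakk> \<Longrightarrow> h (k \<odot>\<^bsub>NT p\<^esub> u) = (k, zM) \<odot>\<^bsub>E.S.Form p\<^esub> h u"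
    "\<And>n f. \<lbrakk>n \<in> N; f \<in> S.Der p\<rbrakk> \<Longrightarrow> h (npure p (grM.cls 0 n) f) = tensor_form p n f"
proof -
  interpret T: tensor S N0 "S.Form p" by (rule tensor_NT)
  let ?W = "restrict_scalars E.S (E.S.Form p)"
  interpret W: module R ?W by (rule E.S.module_sym_theta)
  interpret W': module E.S "E.S.Form p" by (rule E.S.module_sym_component)
  note [simp del] = sym_component_simps(2-4)
  note tl = T.T_lift[OF W.M.abelian_group_axioms, of "\<lambda>x v. tensor_form p (nval x) v", unfolded S_simps(1) sym_component_simps(1)]
  obtain h where h: "\<And>u. u \<in> carrier (NT p) \<Longrightarrow> h u \<in> carrier ?W"
    "\<And>u w. \<lbrakk>u \<in> carrier (NT p); w \<in> carrier (NT p)\<rbrakk> \<Longrightarrow> h (u \<oplus>\<^bsub>NT p\<^esub> w) = h u \<oplus>\<^bsub>?W\<^esub> h w"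
    "\<And>x v. \<lbrakk>x \<in> carrier N0; v \<in> S.Der p\<rbrakk> \<Longrightarrow> h (npure p x v) = tensor_form p (nval x) v"
  proof (rule tl)
    show "tensor_form p (nval x) v \<in> carrier ?W" if "x \<in> carrier N0" "v \<in> S.Der p" for x v
      using that by (auto simp: N0_simps nval_class tensor_form_Der)
    show "tensor_form p (nval (x \<oplus>\<^bsub>N0\<^esub> y)) v = tensor_form p (nval x) v \<oplus>\<^bsub>?W\<^esub> tensor_form p (nval y) v"
      if xy: "x \<in> carrier N0" "y \<in> carrier N0" and v: "v \<in> S.Der p" for x y v
    proof -
      obtain n m where n: "x = grM.cls 0 n" "n \<in> N" and m: "y = grM.cls 0 m" "m \<in> N" using xy by (auto simp: N0_simps)
      have "tensor_form p (n \<oplus>\<^bsub>M\<^esub> m) v = tensor_form p n v \<oplus>\<^bsub>E.S.Form p\<^esub> tensor_form p m v"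
      proof (rule E.S.diag_eqI[of _ p])
        show "tensor_form p n v \<oplus>\<^bsub>E.S.Form p\<^esub> tensor_form p m v \<in> E.S.Der p"
          using W'.M.a_closed[of "tensor_form p n v" "tensor_form p m v"] tensor_form_Der n m v by simp
        fix c assume c: "c \<in> carrier E.S"
        then have "diag S p v (fst c) \<in> C" using S.diag_closed[OF v, of "fst c"] by auto
        then show "diag E.S p (tensor_form p (n \<oplus>\<^bsub>M\<^esub> m) v) c =
            diag E.S p (tensor_form p n v \<oplus>\<^bsub>E.S.Form p\<^esub> tensor_form p m v) c"
          using n m c by (simp add: E.S.diag_add tensor_form_Der v diag_tensor_form N_closed B.left_distr)
      qed (use n m v in \<open>simp add: tensor_form_Der N_closed\<close>)
      then show ?thesis using n m by (simp add: N0_simps nval_class N_closed)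
    qed
    show "tensor_form p (nval x) (v \<oplus>\<^bsub>S.Form p\<^esub> w) = tensor_form p (nval x) v \<oplus>\<^bsub>?W\<^esub> tensor_form p (nval x) w"
      if x: "x \<in> carrier N0" and v: "v \<in> S.Der p" and w: "w \<in> S.Der p" for x v w
    proof -
      obtain n where n: "x = grM.cls 0 n" "n \<in> N" using x by (auto simp: N0_simps)
      have vw: "v \<oplus>\<^bsub>S.Form p\<^esub> w \<in> S.Der p"
        using abelian_monoid.a_closed[OF abelian_group.axioms(1)[OF module.axioms(2)[OF S.module_sym_component]], of v p w] v w by simp
      have "tensor_form p n (v \<oplus>\<^bsub>S.Form p\<^esub> w) = tensor_form p n v \<oplus>\<^bsub>E.S.Form p\<^esub> tensor_form p n w"
      proof (rule E.S.diag_eqI[of _ p])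
        show "tensor_form p n v \<oplus>\<^bsub>E.S.Form p\<^esub> tensor_form p n w \<in> E.S.Der p"
          using W'.M.a_closed[of "tensor_form p n v" "tensor_form p n w"] tensor_form_Der n v w by simp
        fix c assume c: "c \<in> carrier E.S"
        then have "diag S p v (fst c) \<in> C" "diag S p w (fst c) \<in> C" 
          using S.diag_closed[OF v, of "fst c"] S.diag_closed[OF w, of "fst c"] by auto
        then show "diag E.S p (tensor_form p n (v \<oplus>\<^bsub>S.Form p\<^esub> w)) c =
            diag E.S p (tensor_form p n v \<oplus>\<^bsub>E.S.Form p\<^esub> tensor_form p n w) c"
          using n c S.diag_add[OF v w, of "fst c"]
          by (auto simp: E.S.diag_add tensor_form_Der v w diag_tensor_form N_closed B.left_add)
      qed (use n vw in \<open>simp add: tensor_form_Der N_closed\<close>)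
      then show ?thesis using n by (simp add: nval_class)
    qed
    show "tensor_form p (nval (k \<odot>\<^bsub>N0\<^esub> x)) v = tensor_form p (nval x) (k \<odot>\<^bsub>S.Form p\<^esub> v)"
      if k: "k \<in> C" and x: "x \<in> carrier N0" and v: "v \<in> S.Der p" for k x v
    proof -
      obtain n where n: "x = grM.cls 0 n" "n \<in> N" using x by (auto simp: N0_simps)
      have kv: "k \<odot>\<^bsub>S.Form p\<^esub> v \<in> S.Der p"
        using module.smult_closed[OF S.module_sym_component, of k v p] k v by simp
      have "tensor_form p (k \<bullet> n) v = tensor_form p n (k \<odot>\<^bsub>S.Form p\<^esub> v)"
      proof (rule E.S.diag_eqI[of _ p])
        fix c assume c: "c \<in> carrier E.S"
        then have d: "diag S p v (fst c) \<in> C" using S.diag_closed[OF v, of "fst c"] by auto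
        have "diag S p v (fst c) \<bullet> (k \<bullet> n) = (k \<otimes> diag S p v (fst c)) \<bullet> n"
          using d k n C_comm[OF d k] by (simp add: B.left_assoc[symmetric] N_closed)
        then show "diag E.S p (tensor_form p (k \<bullet> n) v) c = diag E.S p (tensor_form p n (k \<odot>\<^bsub>S.Form p\<^esub> v)) c"
          using n c k S.diag_scale[OF v, of k "fst c"] by (auto simp: diag_tensor_form N_closed)
      qed (use n k v kv in \<open>simp_all add: tensor_form_Der N_closed\<close>)
      then show ?thesis using n k by (simp add: N0_simps nval_class N_closed)
    qed
  qed (rule that)
  have hp: "h (npure p (grM.cls 0 n) f) = tensor_form p n f" if "n \<in> N" "f \<in> S.Der p" for n f
    using h(3)[of "grM.cls 0 n" f] that by (simp add: N0_simps nval_class)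
  have "h u \<in> module_forms p" if "u \<in> carrier (NT p)" for u
    using that
  proof (induction u rule: T.T_induct[unfolded S_simps(1), consumes 1, case_names pure diff])
    case (pure x v)
    then show ?case using hp by (auto simp: N0_simps tensor_form_module_form)
  next
    case (diff u w)
    have "h (u \<ominus>\<^bsub>NT p\<^esub> w) = h u \<ominus>\<^bsub>?W\<^esub> h w"
      by (rule additive_zero_minus(3)[OF NT_facts(1) W.M.abelian_group_axioms h(1,2) diff(1,2)])
    then show ?case using module_forms_diff diff by simp
  qed
  moreover have "h (k \<odot>\<^bsub>NT p\<^esub> u) = (k, zM) \<odot>\<^bsub>E.S.Form p\<^esub> h u" if k: "k \<in> C" and u: "u \<in> carrier (NT p)" for k u
  proof (rule NT_ext[where f = "\<lambda>u. h (k \<odot>\<^bsub>NT p\<^esub> u)" and g = "\<lambda>u. (k, zM) \<odot>\<^bsub>E.S.Form p\<^esub> h u", OF W.M.abelian_group_axioms _ _ _ _ _ u])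
    have kk: "(k, zM) \<in> carrier E.S" using k by (simp add: N_closed)
    show "h (k \<odot>\<^bsub>NT p\<^esub> u) \<in> carrier ?W" if "u \<in> carrier (NT p)" for u by (rule h(1)[OF NT_facts(3)[OF k that]])
    show "(k, zM) \<odot>\<^bsub>E.S.Form p\<^esub> h u \<in> carrier ?W" if "u \<in> carrier (NT p)" for u
      using W'.smult_closed[OF kk, of "h u"] h(1)[OF that] by simp
    fix u w assume u: "u \<in> carrier (NT p)" and w: "w \<in> carrier (NT p)"
    show "h (k \<odot>\<^bsub>NT p\<^esub> (u \<oplus>\<^bsub>NT p\<^esub> w)) = h (k \<odot>\<^bsub>NT p\<^esub> u) \<oplus>\<^bsub>?W\<^esub> h (k \<odot>\<^bsub>NT p\<^esub> w)"
      unfolding NT_facts(4)[OF k u w] by (rule h(2)[OF NT_facts(3)[OF k u] NT_facts(3)[OF k w]])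
    show "(k, zM) \<odot>\<^bsub>E.S.Form p\<^esub> h (u \<oplus>\<^bsub>NT p\<^esub> w) =
        ((k, zM) \<odot>\<^bsub>E.S.Form p\<^esub> h u) \<oplus>\<^bsub>?W\<^esub> ((k, zM) \<odot>\<^bsub>E.S.Form p\<^esub> h w)"
      using W'.smult_r_distr[OF kk, of "h u" "h w"] h(1)[OF u] h(1)[OF w] by (simp add: h(2)[OF u w])
  next
    fix n v assume n: "n \<in> N" and v: "v \<in> S.Der p"
    have kk: "(k, zM) \<in> carrier E.S" using k by (simp add: N_closed)
    have "tensor_form p (k \<bullet> n) v = (k, zM) \<odot>\<^bsub>E.S.Form p\<^esub> tensor_form p n v"
    proof (rule E.S.diag_eqI[of _ p])
      show "(k, zM) \<odot>\<^bsub>E.S.Form p\<^esub> tensor_form p n v \<in> E.S.Der p"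
        using W'.smult_closed[OF kk, of "tensor_form p n v"] tensor_form_Der[OF n v] by simp
      fix c assume c: "c \<in> carrier E.S"
      then have d: "diag S p v (fst c) \<in> C" using S.diag_closed[OF v, of "fst c"] by auto
      have "diag S p v (fst c) \<bullet> (k \<bullet> n) = k \<bullet> (diag S p v (fst c) \<bullet> n)"
        using d k n C_comm[OF d k] by (simp add: B.left_assoc[symmetric] N_closed)
      then show "diag E.S p (tensor_form p (k \<bullet> n) v) c = diag E.S p ((k, zM) \<odot>\<^bsub>E.S.Form p\<^esub> tensor_form p n v) c"
        using n c k d E.S.diag_scale[OF tensor_form_Der[OF n v] kk c]
        by (simp add: diag_tensor_form N_closed B.left_closed)
    qed (use n k v in \<open>simp add: tensor_form_Der N_closed\<close>)
    then show "h (k \<odot>\<^bsub>NT p\<^esub> npure p (grM.cls 0 n) v) = (k, zM) \<odot>\<^bsub>E.S.Form p\<^esub> h (npure p (grM.cls 0 n) v)"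
      using n k v by (simp add: NT_facts(5) hp N_closed)
  qed
  ultimately show ?thesis using that[of h] h(2) hp by simp
qed

end


context self_centralizing_bimodule
begin

section \<open>Bijectivity of the comparison map, and the flat connection\<close>

lemma value_form_into:
  assumes \<phi>: "\<phi> \<in> module_forms (int k)"
  shows "form_into R S Nmod k (\<lambda>cs. snd (\<phi> (map (\<lambda>c. (c, zM)) cs)))"
proof -
  let ?i = "\<lambda>c. (c, zM)"
  note D = module_forms_Der[OF \<phi>]
  have t: "map ?i cs \<in> tuples E.S j" if "cs \<in> tuples S j" for cs j using that by (auto simp: tuples_def N_closed)
  show ?thesis
    unfolding form_into_def
  proof (intro conjI ballI allI impI)
    show "snd (\<phi> (map ?i cs)) \<in> carrier Nmod" if "cs \<in> tuples S k" for cs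
      using E.S.Der_value_closed[OF D, of "map ?i cs"] t[OF that] by (auto simp: mem_Times_iff)
    fix m xs ys assume k: "k = Suc m" and "xs @ ys \<in> tuples S m"
    then have "map ?i xs @ map ?i ys \<in> tuples E.S m" using t by fastforce
    from E.S.Der_derivation_at[OF D k this]
    have d: "derivation_on R E.S (\<lambda>x. \<phi> (map ?i xs @ x # map ?i ys))" .
    show "derivation_into R S Nmod (\<lambda>x. snd (\<phi> (map ?i (xs @ x # ys))))"
      unfolding derivation_into_def
    proof (intro ballI conjI)
      let ?f = "\<lambda>x. \<phi> (map ?i xs @ (x, zM) # map ?i ys)"
      have cl: "?f x \<in> C \<times> N" if "x \<in> C" for x
        using derivation_onD(1)[OF d, of "?i x"] that by (simp add: N_closed)
      have ex: "\<exists>a m. ?f x = (a, m) \<and> a \<in> C \<and> m \<in> N \<and> m \<in> carrier M" if "x \<in> C" for x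
        using cl[OF that] N_closed(1) by (cases "?f x") auto
      fix x assume x: "x \<in> carrier S"
      then have xC: "x \<in> C" by simp
      obtain a m where a: "?f x = (a, m)" "a \<in> C" "m \<in> N" "m \<in> carrier M" using ex[OF xC] by blast
      show "snd (\<phi> (map ?i (xs @ x # ys))) \<in> carrier Nmod" using a by simp
      show "snd (\<phi> (map ?i (xs @ (r \<odot>\<^bsub>S\<^esub> x) # ys))) = (r \<odot>\<^bsub>S\<^esub> \<one>\<^bsub>S\<^esub>) \<odot>\<^bsub>Nmod\<^esub> snd (\<phi> (map ?i (xs @ x # ys)))"
        if r: "r \<in> carrier R" for r
        using derivation_onD(2)[OF d, of "?i x" r] xC r a by (simp add: N_closed)
      fix y assume y: "y \<in> carrier S"
      then have yC: "y \<in> C" by simp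
      obtain b n where b: "?f y = (b, n)" "b \<in> C" "n \<in> N" "n \<in> carrier M" using ex[OF yC] by blast
      show "snd (\<phi> (map ?i (xs @ (x \<oplus>\<^bsub>S\<^esub> y) # ys))) = snd (\<phi> (map ?i (xs @ x # ys))) \<oplus>\<^bsub>Nmod\<^esub> snd (\<phi> (map ?i (xs @ y # ys)))"
        using derivation_onD(3)[OF d, of "?i x" "?i y"] xC yC a b by (simp add: N_closed)
      show "snd (\<phi> (map ?i (xs @ (x \<otimes>\<^bsub>S\<^esub> y) # ys))) =
          x \<odot>\<^bsub>Nmod\<^esub> snd (\<phi> (map ?i (xs @ y # ys))) \<oplus>\<^bsub>Nmod\<^esub> y \<odot>\<^bsub>Nmod\<^esub> snd (\<phi> (map ?i (xs @ x # ys)))"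
        using derivation_onD(4)[OF d, of "?i x" "?i y"] xC yC a b by (simp add: N_closed B.left_closed)
    qed
  qed
qed

text \<open>The inverse sends \<phi> to the sum of \<phi>(I) \<otimes> d_I over tuples I from U. One
  composite is the identity by \<open>Der_expansion\<close>, used on pure tensors, the other by
  \<open>form_expansion\<close>, used on the diagonal.\<close>

lemma tensor_form_bij:
  assumes db: "dual_basis R S U d"
  obtains h where "bij_betw h (carrier (NT p)) (module_forms p)"
    "\<And>u w. \<lbrakk>u \<in> carrier (NT p); w \<in> carrier (NT p)\<rbrakk> \<Longrightarrow> h (u \<oplus>\<^bsub>NT p\<^esub> w) = h u \<oplus>\<^bsub>E.S.Form p\<^esub> h w"
    "\<And>k u. \<lbrakk>k \<in> C; u \<in> carrier (NT p)\<rbrakk> \<Longrightarrow> h (k \<odot>\<^bsub>NT p\<^esub> u) = (k, zM) \<odot>\<^bsub>E.S.Form p\<^esub> h u"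
    "\<And>n f. \<lbrakk>n \<in> N; f \<in> S.Der p\<rbrakk> \<Longrightarrow> h (npure p (grM.cls 0 n) f) = tensor_form p n f"
proof -
  interpret D: dual_basis R S U d by fact
  obtain h where h: "\<And>u. u \<in> carrier (NT p) \<Longrightarrow> h u \<in> module_forms p"
    "\<And>u w. \<lbrakk>u \<in> carrier (NT p); w \<in> carrier (NT p)\<rbrakk> \<Longrightarrow> h (u \<oplus>\<^bsub>NT p\<^esub> w) = h u \<oplus>\<^bsub>E.S.Form p\<^esub> h w"
    "\<And>k u. \<lbrakk>k \<in> C; u \<in> carrier (NT p)\<rbrakk> \<Longrightarrow> h (k \<odot>\<^bsub>NT p\<^esub> u) = (k, zM) \<odot>\<^bsub>E.S.Form p\<^esub> h u"
    "\<And>n f. \<lbrakk>n \<in> N; f \<in> S.Der p\<rbrakk> \<Longrightarrow> h (npure p (grM.cls 0 n) f) = tensor_form p n f"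
    using tensor_form_lift[of p] by blast
  interpret W: module E.S "E.S.Form p" by (rule E.S.module_sym_component)
  interpret T: abelian_group "NT p" by (rule NT_facts(1))
  have WG: "abelian_group (E.S.Form p)" by (rule W.M.abelian_group_axioms)
  have hW: "h u \<in> carrier (E.S.Form p)" if "u \<in> carrier (NT p)" for u
    using module_forms_Der[OF h(1)[OF that]] by simp
  have "bij_betw h (carrier (NT p)) (module_forms p)"
  proof (cases "p < 0")
    case True
    \<comment> \<open>In negative degree there is only one form, so f + f = f; every pure tensor
      equals its double and vanishes.\<close>
    have z: "f = g" if "f \<in> S.Der p" "g \<in> S.Der p" for f g using that by (simp add: S.Der_negative[OF True])
    have "u = \<zero>\<^bsub>NT p\<^esub>" if "u \<in> carrier (NT p)" for u
    proof (rule NT_ext[where f = "\<lambda>u. u" and g = "\<lambda>_. \<zero>\<^bsub>NT p\<^esub>", OF NT_facts(1) _ _ _ _ _ that])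
      fix n f assume n: "n \<in> N" and f: "f \<in> S.Der p"
      have "f \<oplus>\<^bsub>S.Form p\<^esub> f \<in> S.Der p" using S.add_form_Der[OF f f] by simp
      then have "npure p (grM.cls 0 n) f \<oplus>\<^bsub>NT p\<^esub> npure p (grM.cls 0 n) f = npure p (grM.cls 0 n) f"
        using NT_facts(8)[OF n f f] z[OF _ f] by metis
      then show "npure p (grM.cls 0 n) f = \<zero>\<^bsub>NT p\<^esub>" using NT_facts(2)[OF n f] by simp
    qed (assumption | rule refl T.zero_closed T.l_zero[OF T.zero_closed, symmetric])+
    then have c: "carrier (NT p) = {\<zero>\<^bsub>NT p\<^esub>}" by blast
    have "module_forms p \<subseteq> {h \<zero>\<^bsub>NT p\<^esub>}"
      using module_forms_Der[of _ p] module_forms_Der[OF h(1)[OF T.zero_closed]] E.S.Der_negative[OF True] by auto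
    then have "module_forms p = {h \<zero>\<^bsub>NT p\<^esub>}" using h(1)[OF T.zero_closed] by blast
    then show ?thesis by (simp add: c bij_betw_def)
  next
    case False
    define k where "k = nat p"
    have p: "p = int k" using False by (simp add: k_def)
    let ?i = "\<lambda>c. (c, zM)"
    define co where "co \<phi> I = snd (\<phi> (map ?i I))" for \<phi> :: "('a \<times> 'm) list \<Rightarrow> 'a \<times> 'm" and I
    define \<Theta> where "\<Theta> \<phi> = nested_sum (NT p) U k (\<lambda>I. npure p (grM.cls 0 (co \<phi> I)) (D.dprod I))" for \<phi>
    have IS: "I \<in> tuples S k" if "I \<in> index U k" for I using that D.U_sub by (auto simp: index_def tuples_def)
    have It: "map ?i I \<in> tuples E.S k" if "I \<in> index U k" for I using IS[OF that] by (auto simp: tuples_def N_closed)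
    have dp: "D.dprod I \<in> S.Der p" if "I \<in> index U k" for I using D.dprod_facts(1)[OF that] by (simp add: p)
    have coN: "co \<phi> I \<in> N" if "\<phi> \<in> module_forms p" "I \<in> index U k" for \<phi> I
      using E.S.Der_value_closed[OF module_forms_Der[OF that(1)], of "map ?i I"] It[OF that(2)]
      by (auto simp: co_def p mem_Times_iff)
    have summand: "npure p (grM.cls 0 (co \<phi> I)) (D.dprod I) \<in> carrier (NT p)" if "\<phi> \<in> module_forms p" "I \<in> index U k" for \<phi> I
      by (rule NT_facts(2)[OF coN[OF that] dp[OF that(2)]])
    have \<Theta>c: "\<Theta> \<phi> \<in> carrier (NT p)" if "\<phi> \<in> module_forms p" for \<phi>
      unfolding \<Theta>_def by (rule nested_sum_closed[OF NT_facts(1) summand[OF that]])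
    have left: "\<Theta> (h u) = u" if "u \<in> carrier (NT p)" for u
    proof (rule NT_ext[where f = "\<lambda>u. \<Theta> (h u)" and g = "\<lambda>u. u", OF NT_facts(1) _ _ _ _ _ that])
      fix u w assume u: "u \<in> carrier (NT p)" and w: "w \<in> carrier (NT p)"
      have "co (h (u \<oplus>\<^bsub>NT p\<^esub> w)) I = co (h u) I \<oplus>\<^bsub>M\<^esub> co (h w) I" if "I \<in> index U k" for I
        unfolding h(2)[OF u w] co_def using It[OF that] by (simp add: p E_add)
      then have "\<Theta> (h (u \<oplus>\<^bsub>NT p\<^esub> w)) = nested_sum (NT p) U k (\<lambda>I.
          npure p (grM.cls 0 (co (h u) I)) (D.dprod I) \<oplus>\<^bsub>NT p\<^esub> npure p (grM.cls 0 (co (h w) I)) (D.dprod I))"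
        unfolding \<Theta>_def using summand[OF h(1)[OF u]] summand[OF h(1)[OF w]]
        by (intro nested_sum_cong[OF NT_facts(1)]) (simp add: NT_facts(7) coN h(1)[OF u] h(1)[OF w] dp)
      also have "\<dots> = \<Theta> (h u) \<oplus>\<^bsub>NT p\<^esub> \<Theta> (h w)"
        unfolding \<Theta>_def using summand[OF h(1)[OF u]] summand[OF h(1)[OF w]] by (rule nested_sum_add[OF NT_facts(1)])
      finally show "\<Theta> (h (u \<oplus>\<^bsub>NT p\<^esub> w)) = \<Theta> (h u) \<oplus>\<^bsub>NT p\<^esub> \<Theta> (h w)" .
    next
      fix n f assume n: "n \<in> N" and f: "f \<in> S.Der p"
      let ?V = "S.Form p"
      interpret V: module S ?V by (rule S.module_sym_component)
      have fI: "f I \<in> C" if "I \<in> index U k" for I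
        using S.Der_value_closed[OF f, of I] IS[OF that] by (simp add: p)
      have fd: "f I \<odot>\<^bsub>?V\<^esub> D.dprod I \<in> S.Der p" if "I \<in> index U k" for I
        using V.smult_closed[of "f I" "D.dprod I"] fI[OF that] dp[OF that] by simp
      \<comment> \<open>The scalar f(I) moves from n to d_I across the tensor product; the sum is
        then collected in the second factor, where it equals f.\<close>
      have "\<Theta> (h (npure p (grM.cls 0 n) f)) = nested_sum (NT p) U k (\<lambda>I. npure p (grM.cls 0 n) (f I \<odot>\<^bsub>?V\<^esub> D.dprod I))"
        unfolding \<Theta>_def
      proof (rule nested_sum_cong[OF NT_facts(1)])
        fix I assume I: "I \<in> index U k"
        have "map fst (map ?i I) = I" by (simp add: comp_def)
        then have "co (h (npure p (grM.cls 0 n) f)) I = f I \<bullet> n"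
          using It[OF I] unfolding co_def h(4)[OF n f] tensor_form_def unfolding p args_int by (simp only: restrict_apply' snd_conv)
        then show "npure p (grM.cls 0 (co (h (npure p (grM.cls 0 n) f)) I)) (D.dprod I) =
            npure p (grM.cls 0 n) (f I \<odot>\<^bsub>?V\<^esub> D.dprod I) \<and>
            npure p (grM.cls 0 n) (f I \<odot>\<^bsub>?V\<^esub> D.dprod I) \<in> carrier (NT p)"
          using NT_facts(6)[OF fI[OF I] n dp[OF I]] NT_facts(2)[OF n fd[OF I]] by (simp only: simp_thms)
      qed
      also have "\<dots> = npure p (grM.cls 0 n) (nested_sum ?V U k (\<lambda>I. f I \<odot>\<^bsub>?V\<^esub> D.dprod I))"
        by (rule nested_sum_hom[OF V.M.abelian_group_axioms NT_facts(1) _ _ D.finite_U, symmetric])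
          (simp_all add: NT_facts(2,8) n fd del: sym_component_simps(2-4))
      also have "nested_sum ?V U k (\<lambda>I. f I \<odot>\<^bsub>?V\<^esub> D.dprod I) = f"
        using D.Der_expansion[OF f[unfolded p]] by (simp only: p)
      finally show "\<Theta> (h (npure p (grM.cls 0 n) f)) = npure p (grM.cls 0 n) f" .
    qed (use \<Theta>c h(1) in simp_all)
    have right: "h (\<Theta> \<phi>) = \<phi>" if \<phi>: "\<phi> \<in> module_forms p" for \<phi>
    proof (rule E.S.diag_eqI[OF module_forms_Der[OF h(1)[OF \<Theta>c[OF \<phi>]]] module_forms_Der[OF \<phi>]])
      interpret Nm: module S Nmod by (rule module_Nmod)
      fix x assume xS: "x \<in> carrier E.S"
      then obtain c n where x: "x = (c, n)" and c: "c \<in> C" and n: "n \<in> N" by auto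
      have tf: "tensor_form p (co \<phi> I) (D.dprod I) \<in> E.S.Der p" if "I \<in> index U k" for I
        by (rule tensor_form_Der[OF coN[OF \<phi> that] dp[OF that]])
      have dN: "D.dprod_value I c \<bullet> co \<phi> I \<in> N" if "I \<in> index U k" for I
        using D.dprod_value_closed[OF that, of c] c coN[OF \<phi> that] by (simp add: N_closed)
      have "h (\<Theta> \<phi>) = nested_sum (E.S.Form p) U k (\<lambda>I. h (npure p (grM.cls 0 (co \<phi> I)) (D.dprod I)))"
        unfolding \<Theta>_def by (rule nested_sum_hom[OF NT_facts(1) WG hW h(2) D.finite_U summand[OF \<phi>]])
      also have "\<dots> = nested_sum (E.S.Form p) U k (\<lambda>I. tensor_form p (co \<phi> I) (D.dprod I))"
        by (rule nested_sum_cong[OF WG]) (simp add: h(4) coN[OF \<phi>] dp tf)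
      finally have "diag E.S p (h (\<Theta> \<phi>)) x = diag E.S p (nested_sum (E.S.Form p) U k (\<lambda>I. tensor_form p (co \<phi> I) (D.dprod I))) x"
        by simp
      also have "\<dots> = nested_sum E.S U k (\<lambda>I. diag E.S p (tensor_form p (co \<phi> I) (D.dprod I)) x)"
      proof (rule nested_sum_hom[OF WG E.S.M.abelian_group_axioms _ _ D.finite_U])
        show "diag E.S p f x \<in> carrier E.S" if "f \<in> carrier (E.S.Form p)" for f
          using E.S.diag_closed[of f p x] that xS by simp
        show "diag E.S p (f \<oplus>\<^bsub>E.S.Form p\<^esub> g) x = diag E.S p f x \<oplus>\<^bsub>E.S\<^esub> diag E.S p g x"
          if "f \<in> carrier (E.S.Form p)" "g \<in> carrier (E.S.Form p)" for f g
          using that xS by (intro E.S.diag_add) simp_all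
      qed (use tf in simp)
      also have "\<dots> = nested_sum E.S U k (\<lambda>I. (\<zero>, D.dprod_value I c \<odot>\<^bsub>Nmod\<^esub> co \<phi> I))"
      proof (rule nested_sum_cong[OF E.S.M.abelian_group_axioms])
        fix I assume I: "I \<in> index U k"
        have "diag S p (D.dprod I) c = D.dprod_value I c" using D.dprod_facts(2)[OF I] c by (simp add: p)
        then show "diag E.S p (tensor_form p (co \<phi> I) (D.dprod I)) x = (\<zero>, D.dprod_value I c \<odot>\<^bsub>Nmod\<^esub> co \<phi> I) \<and>
            (\<zero>, D.dprod_value I c \<odot>\<^bsub>Nmod\<^esub> co \<phi> I) \<in> carrier E.S"
          using xS dN[OF I] by (simp add: diag_tensor_form[OF coN[OF \<phi> I]] x)
      qed
      also have "\<dots> = (\<zero>, nested_sum Nmod U k (\<lambda>I. D.dprod_value I c \<odot>\<^bsub>Nmod\<^esub> co \<phi> I))"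
        by (rule nested_sum_hom[OF Nm.M.abelian_group_axioms E.S.M.abelian_group_axioms _ _ D.finite_U, symmetric])
          (simp_all add: dN)
      \<comment> \<open>The values of \<phi> at arguments (c, 0) make up an N-valued multiderivation
        of C, to which the expansion applies.\<close>
      also have "nested_sum Nmod U k (\<lambda>I. D.dprod_value I c \<odot>\<^bsub>Nmod\<^esub> co \<phi> I) = co \<phi> (replicate k c)"
        unfolding co_def using D.form_expansion[OF module_Nmod _ value_form_into[OF \<phi>[unfolded p]], of c] c by simp
      also have "(\<zero>, co \<phi> (replicate k c)) = diag E.S p \<phi> (c, zM)"
      proof -
        have "fst (diag E.S p \<phi> (c, zM)) = \<zero>" using \<phi> c N_closed(2) unfolding module_forms_def by blast
        moreover have "co \<phi> (replicate k c) = snd (diag E.S p \<phi> (c, zM))" by (simp add: co_def diag_def p)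
        ultimately show ?thesis by (simp add: prod_eq_iff)
      qed
      also have "\<dots> = diag E.S p \<phi> x" unfolding x using \<phi> c n unfolding module_forms_def by simp
      finally show "diag E.S p (h (\<Theta> \<phi>)) x = diag E.S p \<phi> x" .
    qed
    show ?thesis
      by (rule bij_betw_byWitness[where f' = \<Theta>]) (use left right h(1) \<Theta>c in auto)
  qed
  with h that show ?thesis by blast
qed

text \<open>The structure on N \<otimes> Sym \<Theta> is transported from the module forms, on which
  Gr A acts by product and bracket with \<open>kappa\<close>; the embedding j is the symbol followed
  by the inverse of the comparison map.\<close>

theorem gr_module_flat_connection:
  assumes db: "dual_basis R S U d"
  shows "\<exists>L j. sheaf_with_flat_connection R S GA \<iota> GM L j"
proof -
  let ?B = "GA" and ?W = "\<lambda>p. E.S.Form p"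
  have "\<exists>h. bij_betw h (carrier (NT p)) (module_forms p) \<and>
      (\<forall>u \<in> carrier (NT p). \<forall>w \<in> carrier (NT p). h (u \<oplus>\<^bsub>NT p\<^esub> w) = h u \<oplus>\<^bsub>?W p\<^esub> h w) \<and>
      (\<forall>k \<in> C. \<forall>u \<in> carrier (NT p). h (k \<odot>\<^bsub>NT p\<^esub> u) = (k, zM) \<odot>\<^bsub>?W p\<^esub> h u) \<and>
      (\<forall>n \<in> N. \<forall>f \<in> S.Der p. h (npure p (grM.cls 0 n) f) = tensor_form p n f)" for p
    by (rule tensor_form_bij[OF db, of p]) blast
  then obtain \<Psi> where \<Psi>: "\<And>p. bij_betw (\<Psi> p) (carrier (NT p)) (module_forms p)"
    "\<And>p u w. \<lbrakk>u \<in> carrier (NT p); w \<in> carrier (NT p)\<rbrakk> \<Longrightarrow> \<Psi> p (u \<oplus>\<^bsub>NT p\<^esub> w) = \<Psi> p u \<oplus>\<^bsub>?W p\<^esub> \<Psi> p w"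
    "\<And>p k u. \<lbrakk>k \<in> C; u \<in> carrier (NT p)\<rbrakk> \<Longrightarrow> \<Psi> p (k \<odot>\<^bsub>NT p\<^esub> u) = (k, zM) \<odot>\<^bsub>?W p\<^esub> \<Psi> p u"
    "\<And>p n f. \<lbrakk>n \<in> N; f \<in> S.Der p\<rbrakk> \<Longrightarrow> \<Psi> p (npure p (grM.cls 0 n) f) = tensor_form p n f"
    by metis
  define \<Psi>i where "\<Psi>i p = the_inv_into (carrier (NT p)) (\<Psi> p)" for p
  have inj: "inj_on (\<Psi> p) (carrier (NT p))" for p using \<Psi>(1) by (rule bij_betw_imp_inj_on)
  have im: "\<Psi> p ` carrier (NT p) = module_forms p" for p using \<Psi>(1) by (rule bij_betw_imp_surj_on)
  have \<Psi>c: "\<Psi> p u \<in> module_forms p" if "u \<in> carrier (NT p)" for p u using im that by blast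
  have \<Psi>i: "\<Psi>i p \<phi> \<in> carrier (NT p) \<and> \<Psi> p (\<Psi>i p \<phi>) = \<phi>" if "\<phi> \<in> module_forms p" for p \<phi>
    unfolding \<Psi>i_def using that im[of p] the_inv_into_into[OF inj, of \<phi> p "carrier (NT p)"] f_the_inv_into_f[OF inj, of \<phi> p] by auto
  have \<Psi>i_eq: "\<Psi>i p (\<Psi> p u) = u" if "u \<in> carrier (NT p)" for p u
    unfolding \<Psi>i_def by (rule the_inv_into_f_f[OF inj that])
  define L :: "('r, 'a set, ('m set \<times> ('a list \<Rightarrow> 'a) \<Rightarrow>\<^sub>0 int) set) graded_poisson_mod" where
    "L = \<lparr>mcomponent = (\<lambda>p. restrict_scalars S (NT p)),
      mact = (\<lambda>p q u b. \<Psi>i (p + q) (sym_mult E.S p q (\<Psi> p u) (kappa q b))),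
      mbracket = (\<lambda>p q u b. \<Psi>i (p + q - 1) (sym_bracket E.S p q (\<Psi> p u) (kappa q b)))\<rparr>"
  define j where "j p V = \<Psi>i p (grM.gr_map p V)" for p V
  have Ls: "mcomponent L p = restrict_scalars S (NT p)"
    "mact L p q u b = \<Psi>i (p + q) (sym_mult E.S p q (\<Psi> p u) (kappa q b))"
    "mbracket L p q u b = \<Psi>i (p + q - 1) (sym_bracket E.S p q (\<Psi> p u) (kappa q b))" for p q u b
    by (simp_all add: L_def)
  have Bk: "\<exists>b \<in> F q. x = gr.cls q b \<and> kappa q x = E.symbol q (b, zM)" if "x \<in> homog ?B q" for q x
    using that unfolding homog_gr by (auto simp: kappa_class)
  have act: "sym_mult E.S p q \<phi> (kappa q x) \<in> module_forms (p + q)"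
    and bra: "sym_bracket E.S p q \<phi> (kappa q x) \<in> module_forms (p + q - 1)"
    if "\<phi> \<in> module_forms p" "x \<in> homog ?B q" for \<phi> p q x
    using Bk[OF that(2)] module_forms_mult[OF that(1)] module_forms_bracket[OF that(1)] by auto
  have lin: "linear_injection R (mcomponent L p) (component (sym_theta R E.S) p) (\<Psi> p)" for p
    unfolding linear_injection_def
  proof (intro conjI ballI)
    show "\<Psi> p \<in> carrier (mcomponent L p) \<rightarrow> carrier (component (sym_theta R E.S) p)"
      using module_forms_Der[OF \<Psi>c] by (simp add: Ls)
    show "inj_on (\<Psi> p) (carrier (mcomponent L p))" using inj by (simp add: Ls)
    show "\<Psi> p (x \<oplus>\<^bsub>mcomponent L p\<^esub> y) = \<Psi> p x \<oplus>\<^bsub>component (sym_theta R E.S) p\<^esub> \<Psi> p y"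
      if "x \<in> carrier (mcomponent L p)" "y \<in> carrier (mcomponent L p)" for x y
      using that \<Psi>(2) by (simp add: Ls del: sym_component_simps)
    show "\<Psi> p (r \<odot>\<^bsub>mcomponent L p\<^esub> x) = r \<odot>\<^bsub>component (sym_theta R E.S) p\<^esub> \<Psi> p x"
      if "r \<in> carrier R" "x \<in> carrier (mcomponent L p)" for r x
      using that \<Psi>(3)[of "r \<odot>\<^bsub>A\<^esub> \<one>" x p] by (simp add: Ls del: sym_component_simps)
  qed
  have modL: "module R (mcomponent L p)" for p
  proof (rule module_pullback[OF graded_poisson_algebra.component_module[OF E.S.sym_theta_graded_poisson_algebra]])
    interpret T: abelian_group "NT p" by (rule NT_facts(1))
    note l = linear_injectionD[OF lin]
    show "\<Psi> p \<in> carrier (mcomponent L p) \<rightarrow> carrier (component (sym_theta R E.S) p)" using l(1) by blast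
    show "inj_on (\<Psi> p) (carrier (mcomponent L p))" by (rule l(2))
    show "\<zero>\<^bsub>mcomponent L p\<^esub> \<in> carrier (mcomponent L p)" by (simp add: Ls)
    have "abelian_group (mcomponent L p)"
      by (rule abelian_group_cong[OF NT_facts(1)]) (simp_all add: Ls)
    then show "\<Psi> p \<zero>\<^bsub>mcomponent L p\<^esub> = \<zero>\<^bsub>component (sym_theta R E.S) p\<^esub>"
      using graded_poisson_algebra.component_group[OF E.S.sym_theta_graded_poisson_algebra] l(1) l(3)
      by (rule additive_zero_minus(1))
    show "x \<oplus>\<^bsub>mcomponent L p\<^esub> y \<in> carrier (mcomponent L p) \<and>
        \<Psi> p (x \<oplus>\<^bsub>mcomponent L p\<^esub> y) = \<Psi> p x \<oplus>\<^bsub>component (sym_theta R E.S) p\<^esub> \<Psi> p y"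
      if "x \<in> carrier (mcomponent L p)" "y \<in> carrier (mcomponent L p)" for x y
      using l(3)[OF that] that by (simp add: Ls del: sym_component_simps sym_theta_simps)
    show "r \<odot>\<^bsub>mcomponent L p\<^esub> x \<in> carrier (mcomponent L p) \<and>
        \<Psi> p (r \<odot>\<^bsub>mcomponent L p\<^esub> x) = r \<odot>\<^bsub>component (sym_theta R E.S) p\<^esub> \<Psi> p x"
      if "r \<in> carrier R" "x \<in> carrier (mcomponent L p)" for r x
      using l(4)[OF that] that NT_facts(3)[of "r \<odot>\<^bsub>A\<^esub> \<one>" x p] by (simp add: Ls del: sym_component_simps sym_theta_simps)
  qed
  have GL: "graded_poisson_module R ?B L"
  proof (rule graded_poisson_module_pullback[OF gr_algebra_embedding(1) E.S.sym_theta_graded_poisson_algebra modL _ kappa_hom lin])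
    show "\<exists>p0. \<forall>p<p0. mhomog L p = {\<zero>\<^bsub>mcomponent L p\<^esub>}"
    proof (intro exI[of _ 0] allI impI)
      fix p :: int assume p: "p < 0"
      interpret T: abelian_group "NT p" by (rule NT_facts(1))
      have "u = \<zero>\<^bsub>NT p\<^esub>" if "u \<in> carrier (NT p)" for u
        using module_forms_Der[OF \<Psi>c[OF that]] module_forms_Der[OF \<Psi>c[OF T.zero_closed]]
          E.S.Der_negative[OF p] inj_onD[OF inj _ that T.zero_closed] by simp
      then show "mhomog L p = {\<zero>\<^bsub>mcomponent L p\<^esub>}" by (auto simp: Ls)
    qed
    fix p q n x assume n: "n \<in> mhomog L p" and x: "x \<in> homog ?B q"
    have n': "\<Psi> p n \<in> module_forms p" using n by (intro \<Psi>c) (simp add: Ls)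
    show "mact L p q n x \<in> mhomog L (p + q) \<and> \<Psi> (p + q) (mact L p q n x) = gmult (sym_theta R E.S) p q (\<Psi> p n) (kappa q x)"
      using \<Psi>i[OF act[OF n' x]] by (simp add: Ls)
    show "mbracket L p q n x \<in> mhomog L (p + q - 1) \<and>
        \<Psi> (p + q - 1) (mbracket L p q n x) = gbracket (sym_theta R E.S) p q (\<Psi> p n) (kappa q x)"
      using \<Psi>i[OF bra[OF n' x]] by (simp add: Ls)
  qed
  \<comment> \<open>The prescribed action on pure tensors: in the product of (0, e n) with a value
    of the symbol of (a, 0) only the first component of the latter counts, and that is a value of
    the symbol of a on C.\<close>
  have pure: "mact L p q (npure p V f) b = npure (p + q) V (sym_mult S p q f (\<iota> q b))"
    if V0: "V \<in> mhomog GM 0" and f: "f \<in> S.Der p" and b: "b \<in> homog ?B q" for p q V f b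
  proof -
    obtain n where V: "V = grM.cls 0 n" and n: "n \<in> N" using V0 unfolding mhomog_gr N_def by blast
    obtain a where a: "a \<in> F q" "b = gr.cls q a" "kappa q b = E.symbol q (a, zM)" using Bk[OF b] by blast
    let ?g = "E.symbol q (a, zM)"
    have g: "?g \<in> E.S.Der q" by (rule E.symbol_Der[OF F_algebra[OF a(1)]])
    have s: "symbol q a \<in> S.Der q" by (rule symbol_Der[OF a(1)])
    note m = S.sym_mult_facts[OF f s refl]
    have "sym_mult E.S p q (tensor_form p n f) ?g = tensor_form (p + q) n (sym_mult S p q f (symbol q a))"
    proof (rule E.S.diag_eqI)
      show "sym_mult E.S p q (tensor_form p n f) ?g \<in> E.S.Der (p + q)"
        by (rule E.S.sym_mult_facts(1)[OF tensor_form_Der[OF n f] g refl])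
      show "tensor_form (p + q) n (sym_mult S p q f (symbol q a)) \<in> E.S.Der (p + q)"
        by (rule tensor_form_Der[OF n m(1)])
      fix x assume xS: "x \<in> carrier E.S"
      then have xCN: "x \<in> C \<times> N" and xC: "fst x \<in> carrier S" by auto
      define y where "y = diag E.S q ?g x"
      have y: "fst y = diag S q (symbol q a) (fst x)" unfolding y_def by (rule symbol_algebra_diag[OF a(1) xCN])
      have yS: "y \<in> C \<times> N" unfolding y_def using E.S.diag_closed[OF g xS] by simp
      define e where "e = diag S p f (fst x)"
      have e: "e \<in> C" using S.diag_closed[OF f xC] by (simp add: e_def)
      have fy: "fst y \<in> C" "snd y \<in> carrier M" using yS N_closed(1) by (auto simp: mem_Times_iff)
      have nM: "n \<in> carrier M" "e \<bullet> n \<in> N" "e \<bullet> n \<in> carrier M" using n e by (simp_all add: N_closed)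
      have "diag E.S (p + q) (sym_mult E.S p q (tensor_form p n f) ?g) x = (\<zero>, e \<bullet> n) \<otimes>\<^bsub>A'\<^esub> (fst y, snd y)"
        using E.S.sym_mult_facts(2)[OF tensor_form_Der[OF n f] g refl xS]
        by (simp add: diag_tensor_form[OF n xCN] y_def e_def)
      also have "\<dots> = (\<zero>, (e \<bullet> n) \<odot>r\<^bsub>M\<^esub> fst y)" unfolding A'_simps(2) using fy nM by (simp add: B.right_closed)
      also have "(e \<bullet> n) \<odot>r\<^bsub>M\<^esub> fst y = fst y \<bullet> (e \<bullet> n)" by (rule N_closed(6)[OF fy(1) nM(2)])
      also have "\<dots> = (e \<otimes> fst y) \<bullet> n"
        using C_comm[OF e fy(1)] e fy nM by (simp add: B.left_assoc[symmetric])
      also have "(\<zero>, (e \<otimes> fst y) \<bullet> n) = diag E.S (p + q) (tensor_form (p + q) n (sym_mult S p q f (symbol q a))) x"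
        using m(2)[OF xC] by (simp add: diag_tensor_form[OF n xCN] e_def y)
      finally show "diag E.S (p + q) (sym_mult E.S p q (tensor_form p n f) ?g) x =
        diag E.S (p + q) (tensor_form (p + q) n (sym_mult S p q f (symbol q a))) x" .
    qed
    also have "\<dots> = \<Psi> (p + q) (npure (p + q) V (sym_mult S p q f (symbol q a)))"
      unfolding V by (rule \<Psi>(4)[OF n m(1), symmetric])
    finally have "mact L p q (npure p V f) b = \<Psi>i (p + q) (\<Psi> (p + q) (npure (p + q) V (sym_mult S p q f (symbol q a))))"
      unfolding Ls a(3) V \<Psi>(4)[OF n f] by (rule arg_cong)
    also have "\<dots> = npure (p + q) V (sym_mult S p q f (symbol q a))"
      unfolding V by (rule \<Psi>i_eq[OF NT_facts(2)[OF n m(1)]])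
    finally show ?thesis unfolding a(2) iota_class[OF a(1)] .
  qed
  have gm: "grM.gr_map p V \<in> module_forms p" if "V \<in> mhomog GM p" for p V
    using that unfolding mhomog_gr by (auto simp: grM.gr_map_class sigma_module_form)
  have jc: "j p V \<in> carrier (NT p) \<and> \<Psi> p (j p V) = grM.gr_map p V" if "V \<in> mhomog GM p" for p V
    unfolding j_def by (rule \<Psi>i[OF gm[OF that]])
  have emb: "graded_poisson_module_embedding R ?B GM L j"
    unfolding graded_poisson_module_embedding_def
  proof (intro conjI allI ballI gr_module_graded_poisson_module GL)
    note G = graded_poisson_module.mcomponent_module[OF gr_module_graded_poisson_module]
    fix p
    interpret G: module R "mcomponent GM p" by (rule G)
    interpret Lm: module R "mcomponent L p" by (rule modL)
    note l = linear_injectionD[OF gr_module_linear(1)[of p]] and l' = linear_injectionD[OF lin[of p]]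
    have jL: "j p V \<in> carrier (mcomponent L p)" if "V \<in> mhomog GM p" for V using jc[OF that] by (simp add: Ls)
    show "linear_injection R (mcomponent GM p) (mcomponent L p) (j p)"
      unfolding linear_injection_def
    proof (intro conjI ballI)
      show "j p \<in> mhomog GM p \<rightarrow> carrier (mcomponent L p)" using jL by blast
      show "inj_on (j p) (mhomog GM p)"
        using jc by (intro inj_onI inj_onD[OF l(2)]) metis+
      fix x assume x: "x \<in> mhomog GM p"
      show "j p (x \<oplus>\<^bsub>mcomponent GM p\<^esub> y) = j p x \<oplus>\<^bsub>mcomponent L p\<^esub> j p y"
        if y: "y \<in> mhomog GM p" for y
      proof (rule inj_onD[OF l'(2)])
        note xy = G.M.a_closed[OF x y]
        have "\<Psi> p (j p (x \<oplus>\<^bsub>mcomponent GM p\<^esub> y)) = grM.gr_map p x \<oplus>\<^bsub>component (sym_theta R E.S) p\<^esub> grM.gr_map p y"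
          using jc[OF xy] l(3)[OF x y] by argo
        also have "\<dots> = \<Psi> p (j p x \<oplus>\<^bsub>mcomponent L p\<^esub> j p y)"
          using l'(3)[OF jL[OF x] jL[OF y]] jc[OF x] jc[OF y] by argo
        finally show "\<Psi> p (j p (x \<oplus>\<^bsub>mcomponent GM p\<^esub> y)) = \<Psi> p (j p x \<oplus>\<^bsub>mcomponent L p\<^esub> j p y)" .
      qed (use x y in \<open>simp_all add: jL del: gr_module_simps\<close>)
      show "j p (r \<odot>\<^bsub>mcomponent GM p\<^esub> x) = r \<odot>\<^bsub>mcomponent L p\<^esub> j p x" if r: "r \<in> carrier R" for r
      proof (rule inj_onD[OF l'(2)])
        note rx = G.smult_closed[OF r x]
        have "\<Psi> p (j p (r \<odot>\<^bsub>mcomponent GM p\<^esub> x)) = r \<odot>\<^bsub>component (sym_theta R E.S) p\<^esub> grM.gr_map p x"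
          using jc[OF rx] l(4)[OF r x] by argo
        also have "\<dots> = \<Psi> p (r \<odot>\<^bsub>mcomponent L p\<^esub> j p x)"
          using l'(4)[OF r jL[OF x]] jc[OF x] by argo
        finally show "\<Psi> p (j p (r \<odot>\<^bsub>mcomponent GM p\<^esub> x)) = \<Psi> p (r \<odot>\<^bsub>mcomponent L p\<^esub> j p x)" .
      qed (use r x in \<open>simp_all add: jL del: gr_module_simps\<close>)
    qed
    fix q n x assume n: "n \<in> mhomog GM p" and x: "x \<in> homog ?B q"
    obtain m a where m: "n = grM.cls p m" "m \<in> filtration C M p" and a: "a \<in> F q" "x = gr.cls q a" "kappa q x = E.symbol q (a, zM)"
      using n Bk[OF x] unfolding mhomog_gr by auto
    note h = sigma_hom[OF m(2) a(1)]
    show "j (p + q) (mact GM p q n x) = mact L p q (j p n) x"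
      using jc[OF n] h by (simp add: Ls j_def m(1) a gr_act[OF m(2) a(1)] grM.gr_map_class m(2) kappa_class[OF a(1)])
    show "j (p + q - 1) (mbracket GM p q n x) = mbracket L p q (j p n) x"
      using jc[OF n] h by (simp add: Ls j_def m(1) a gr_act[OF m(2) a(1)] grM.gr_map_class m(2) kappa_class[OF a(1)])
  qed
  have "sheaf_with_flat_connection R S ?B \<iota> GM L j"
    unfolding sheaf_with_flat_connection_def Let_def N0_def[symmetric] S_simps(1)
    using gr_module_graded_poisson_module GL Ls(1) pure emb by simp
  then show ?thesis by blast
qed

end

theorem theorem3:
  fixes R :: "'r ring" and A :: "('r, 'a) module" and C :: "'a set"
    and M :: "('a, 'm) bimodule"
  assumes "cring R" and "noetherian_ring R" and "contains_rationals R"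
    and "assoc_algebra R A"
    and "maximal_commutative_subalgebra R A C"
    and "smooth_algebra R (A\<lparr>carrier := C\<rparr>)"
    and "bimodule A M" and "symmetric_over R A M"
  shows "\<exists>\<iota>. graded_poisson_embedding R (gr_algebra A C) (sym_theta R (A\<lparr>carrier := C\<rparr>)) \<iota> \<and>
           (\<forall>c \<in> C. \<iota> 0 (gr_class C (self_bimodule A) 0 c) = sym_const (A\<lparr>carrier := C\<rparr>) c) \<and>
           nonlinear_involutive_distribution R (A\<lparr>carrier := C\<rparr>)
             (\<lambda>p. \<iota> p ` homog (gr_algebra A C) p) \<and>
           (\<exists>L j. sheaf_with_flat_connection R (A\<lparr>carrier := C\<rparr>)
             (gr_algebra A C) \<iota> (gr_module A C M) L j)"
proof -
  have sc: "self_centralizing R A C"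
  proof (rule self_centralizing.intro[OF assms(4) self_centralizing_axioms.intro])
    show "commutative_subalgebra R A C" using assms(5) by (simp add: maximal_commutative_subalgebra_def)
    show "a \<in> C" if "a \<in> carrier A" "\<And>c. c \<in> C \<Longrightarrow> a \<otimes>\<^bsub>A\<^esub> c = c \<otimes>\<^bsub>A\<^esub> a" for a
      using maximal_commutative_centralizer[OF assms(4,5) that] .
  qed (rule assms(3))
  interpret self_centralizing_bimodule R A C M
    by (rule self_centralizing_bimodule.intro[OF sc assms(7) self_centralizing_bimodule_axioms.intro[OF assms(8)]])
  have "\<exists>U d. dual_basis R S U d"
  proof (rule smooth_dual_basis[OF assms(6)[folded S_def]])
    fix U d
    assume db: "finite U" "U \<subseteq> carrier S" "\<And>u. u \<in> U \<Longrightarrow> derivation_on R S (d u)"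
      "\<And>D c. \<lbrakk>commutative_subalgebra R (square_zero_extension S (free_bimodule S U)) D;
         \<And>u. u \<in> U \<Longrightarrow> (u, \<lambda>v \<in> U. if v = u then \<one>\<^bsub>S\<^esub> else \<zero>\<^bsub>S\<^esub>) \<in> D; c \<in> carrier S\<rbrakk>
         \<Longrightarrow> (c, \<lambda>u \<in> U. d u c) \<in> D"
    have "dual_basis R S U d"
    proof (rule dual_basis.intro[OF S.rational_algebra_axioms], rule dual_basis_axioms.intro[OF db(1,2)])
      show "derivation_on R S (d u)" if "u \<in> U" for u using that by (rule db(3))
      fix D c
      assume "commutative_subalgebra R (square_zero_extension S (free_bimodule S U)) D"
        "\<And>u. u \<in> U \<Longrightarrow> (u, \<lambda>v \<in> U. if v = u then \<one>\<^bsub>S\<^esub> else \<zero>\<^bsub>S\<^esub>) \<in> D" "c \<in> carrier S"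
      then show "(c, \<lambda>u \<in> U. d u c) \<in> D" by (rule db(4))
    qed
    then show "\<exists>U d. dual_basis R S U d" by blast
  qed
  then obtain U d where "dual_basis R S U d" by blast
  from gr_algebra_embedding(2-4) gr_module_flat_connection[OF this] show ?thesis
    unfolding S_def by blast
qed
end
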